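(* Let $Q$ be a finite acyclic quiver with vertex set $\mathbb I$ and generalized Cartan matrix $C=(c_{ij})$, let $\tau$ be a permutation of $\mathbb I$ with $\tau^2=\mathrm{Id}$ and $c_{\tau i,\tau j}=c_{ij}$ for all $i,j$, and let $\varsigma=(\varsigma_i)\in(\mathbb Q(v)^\times)^{\mathbb I}$ be such that $\varsigma_i=\varsigma_{\tau i}$ for each $i\in\mathbb I$ with $c_{i,\tau i}=0$. Then: (1) The algebra ${\bf U}^\imath={\bf U}^\imath_\varsigma$ is isomorphic to the quotient of $\widetilde{\bf U}^\imath$ by the ideal generated by $$\widetilde k_i-\varsigma_i\ (\text{for }i=\tau i),\qquad\widetilde k_i\widetilde k_{\tau i}-\varsigma_i\varsigma_{\tau i}\ (\text{for }i\ne\tau i).$$ The isomorphism is given by sending $B_i\mapsto B_i$, $k_j\mapsto\varsigma_j^{-1}\widetilde k_j$, $k_j^{-1}\mapsto\varsigma_{\tau j}^{-1}\widetilde k_{\tau j}$, for all $i\in\mathbb I$, $j\in\mathbb I\setminus\mathbb I_\tau$. (2) The algebra $\widetilde{\bf U}^\imath$ is a right coideal subalgebra of $\widetilde{\bf U}$, i.e. $\Delta(\widetilde{\bf U}^\imath)\subseteq\widetilde{\bf U}^\imath\otimes\widetilde{\bf U}$; that is, $(\widetilde{\bf U},\widetilde{\bf U}^\imath)$ forms a quantum symmetric pair.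
   Context: Let $n_{ij}$ be the number of edges between $i$ and $j$ in $Q$; $c_{ij}=2\delta_{ij}-n_{ij}$. $\widetilde{\bf U}$ is the $\mathbb Q(v)$-algebra generated by $E_i,F_i$ and invertible $\widetilde K_i,\widetilde K_i'$ ($i\in\mathbb I$), subject to: $E_iF_j-F_jE_i=\delta_{ij}\frac{\widetilde K_i-\widetilde K_i'}{v-v^{-1}}$; all $\widetilde K_i,\widetilde K_j'$ commute; $\widetilde K_iE_j=v^{c_{ij}}E_j\widetilde K_i$, $\widetilde K_iF_j=v^{-c_{ij}}F_j\widetilde K_i$, $\widetilde K_i'E_j=v^{-c_{ij}}E_j\widetilde K_i'$, $\widetilde K_i'F_j=v^{c_{ij}}F_j\widetilde K_i'$; and the quantum Serre relations $\sum_{r=0}^{1-c_{ij}}(-1)^r\left[{1-c_{ij}\atop r}\right]X_i^rX_jX_i^{1-c_{ij}-r}=0$ for $i\ne j$ and $X=E,F$, where $\left[{m\atop r}\right]$ are the quantum binomials built from $[n]=\frac{v^n-v^{-n}}{v-v^{-1}}$. Comultiplication: $\Delta(E_i)=E_i\otimes1+\widetilde K_i\otimes E_i$, $\Delta(F_i)=1\otimes F_i+F_i\otimes\widetilde K_i'$, $\Delta(\widetilde K_i)=\widetilde K_i\otimes\widetilde K_i$, $\Delta(\widetilde K_i')=\widetilde K_i'\otimes\widetilde K_i'$. The quantum group ${\bf U}$ is defined by the same presentation with $\widetilde K_i,\widetilde K_i'$ replaced by $K_i,K_i^{-1}$. $\mathbb I_\tau\subseteq\mathbb I$ is a chosen set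 of representatives of the $\tau$-orbits. $\widetilde{\bf U}^\imath$ is the $\mathbb Q(v)$-subalgebra of $\widetilde{\bf U}$ generated by $B_i=F_i+E_{\tau i}\widetilde K_i'$ and $\widetilde k_i^{\pm1}$, where $\widetilde k_i=\widetilde K_i\widetilde K_{\tau i}'$ ($i\in\mathbb I$). ${\bf U}^\imath_\varsigma$ is the $\mathbb Q(v)$-subalgebra of ${\bf U}$ generated by $B_i=F_i+\varsigma_iE_{\tau i}K_i^{-1}$ ($i\in\mathbb I$) and $k_j^{\pm1}$, where $k_j=K_jK_{\tau j}^{-1}$ ($j\in\mathbb I\setminus\mathbb I_\tau$).
   Formalization: In (1) the isomorphism sends k_j to ς_{τj}^{-1} k̃_j and k_j^{-1} to ς_j^{-1} k̃_{τj}; the printed indices agree when ς_j = ς_{τj} but fail otherwise, e.g. for the quiver 1→2 with τ swapping the vertices and ς_1 ≠ ς_2. *)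

theory Defs
  imports
    "HOL-Algebra.QuotRing"
    "HOL-Algebra.Module"
    "HOL-Algebra.Subrings"
    "HOL-Library.Poly_Mapping"
    "HOL-Computational_Algebra.Polynomial"
    "HOL-Computational_Algebra.Fraction_Field"
    "HOL-Combinatorics.Permutations"
    "Graph_Theory.Digraph"
begin

section \<open>Associative unital algebras over a field\<close>

text \<open>
  An algebra over a field type \<open>'k\<close> is a \<^type>\<open>module_scheme\<close> record, whose \<^const>\<open>module.smult\<close> field is the
  scalar action. (The library locale \<^locale>\<open>algebra\<close> only covers commutative algebras.)
\<close>

definition alg_hom ::
    "('k, 'a, 'c) module_scheme \<Rightarrow> ('k, 'b, 'd) module_scheme \<Rightarrow> ('a \<Rightarrow> 'b) set" where
  "alg_hom A B = {h \<in> ring_hom A B. \<forall>c. \<forall>x\<in>carrier A. h (c \<odot>\<^bsub>A\<^esub> x) = c \<odot>\<^bsub>B\<^esub> h x}"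

definition alg_iso ::
    "('k, 'a, 'c) module_scheme \<Rightarrow> ('k, 'b, 'd) module_scheme \<Rightarrow> ('a \<Rightarrow> 'b) set" where
  "alg_iso A B = {h \<in> alg_hom A B. bij_betw h (carrier A) (carrier B)}"

definition subalg :: "'a set \<Rightarrow> ('k, 'a, 'c) module_scheme \<Rightarrow> bool" where
  "subalg S A \<longleftrightarrow> subring S A \<and> (\<forall>c. \<forall>x\<in>S. c \<odot>\<^bsub>A\<^esub> x \<in> S)"

definition generated_subalg :: "('k, 'a, 'c) module_scheme \<Rightarrow> 'a set \<Rightarrow> ('k, 'a, 'c) module_scheme" where
  "generated_subalg A S = A\<lparr>carrier := \<Inter>{T. subalg T A \<and> S \<subseteq> T}\<rparr>"

definition quot_alg :: "('k, 'a, 'c) module_scheme \<Rightarrow> 'a set \<Rightarrow> ('k, 'a set) module" where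
  "quot_alg A I = ring.extend (A Quot I) (module.fields (\<lambda>c X. \<Union>x\<in>X. I +>\<^bsub>A\<^esub> (c \<odot>\<^bsub>A\<^esub> x)))"

definition monoid_algebra :: "('m, 'c) monoid_scheme \<Rightarrow> ('k::field, 'm \<Rightarrow>\<^sub>0 'k) module" where
  "monoid_algebra M =
    \<lparr>carrier = {f. Poly_Mapping.keys f \<subseteq> carrier M},
     monoid.mult = (\<lambda>f g. \<Sum>x\<in>Poly_Mapping.keys f. \<Sum>y\<in>Poly_Mapping.keys g.
        Poly_Mapping.single (x \<otimes>\<^bsub>M\<^esub> y) (Poly_Mapping.lookup f x * Poly_Mapping.lookup g y)),
     one = Poly_Mapping.single \<one>\<^bsub>M\<^esub> 1,
     zero = 0,
     add = (+),
     module.smult = (\<lambda>c. Poly_Mapping.map (\<lambda>a. c * a))\<rparr>"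


subsection \<open>Presentations by generators and relations\<close>

definition free_algebra :: "'g set \<Rightarrow> ('k::field, 'g list \<Rightarrow>\<^sub>0 'k) module" where
  "free_algebra X = monoid_algebra \<lparr>carrier = lists X, monoid.mult = (@), one = []\<rparr>"

definition free_gen :: "'g \<Rightarrow> 'g list \<Rightarrow>\<^sub>0 'k::field" where
  "free_gen g = Poly_Mapping.single [g] 1"

text \<open>A relation \<open>l = r\<close> is given as the pair \<open>(l, r)\<close>.\<close>

definition relation_ideal ::
    "'g set \<Rightarrow> (('g list \<Rightarrow>\<^sub>0 'k) \<times> ('g list \<Rightarrow>\<^sub>0 'k)) set \<Rightarrow> ('g list \<Rightarrow>\<^sub>0 'k::field) set" where
  "relation_ideal X R = Idl\<^bsub>free_algebra X\<^esub> {l \<ominus>\<^bsub>free_algebra X\<^esub> r | l r. (l, r) \<in> R}"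

definition presented_algebra ::
    "'g set \<Rightarrow> (('g list \<Rightarrow>\<^sub>0 'k) \<times> ('g list \<Rightarrow>\<^sub>0 'k)) set \<Rightarrow> ('k::field, ('g list \<Rightarrow>\<^sub>0 'k) set) module" where
  "presented_algebra X R = quot_alg (free_algebra X) (relation_ideal X R)"

definition presented_gen ::
    "'g set \<Rightarrow> (('g list \<Rightarrow>\<^sub>0 'k) \<times> ('g list \<Rightarrow>\<^sub>0 'k)) set \<Rightarrow> 'g \<Rightarrow> ('g list \<Rightarrow>\<^sub>0 'k::field) set" where
  "presented_gen X R g = relation_ideal X R +>\<^bsub>free_algebra X\<^esub> free_gen g"


subsection \<open>Tensor products of algebras\<close>

text \<open>
  The monoid algebra of \<open>A \<times>\<times> B\<close> is the vector space with basis all pairs \<open>(x, y)\<close> and multiplication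
  \<open>(x, y) (x', y') = (x x', y y')\<close>; dividing by the bilinearity relations gives \<open>A \<otimes> B\<close>.
  The linear span of these relations is already a two-sided ideal.
\<close>

definition bilinear_relations ::
    "('k::field, 'a, 'c) module_scheme \<Rightarrow> ('k, 'b, 'd) module_scheme \<Rightarrow> ('a \<times> 'b \<Rightarrow>\<^sub>0 'k) set" where
  "bilinear_relations A B =
    {Poly_Mapping.single (x \<oplus>\<^bsub>A\<^esub> x', y) 1 - Poly_Mapping.single (x, y) 1 - Poly_Mapping.single (x', y) 1
       | x x' y. x \<in> carrier A \<and> x' \<in> carrier A \<and> y \<in> carrier B} \<union>
    {Poly_Mapping.single (x, y \<oplus>\<^bsub>B\<^esub> y') 1 - Poly_Mapping.single (x, y) 1 - Poly_Mapping.single (x, y') 1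
       | x y y'. x \<in> carrier A \<and> y \<in> carrier B \<and> y' \<in> carrier B} \<union>
    {Poly_Mapping.single (c \<odot>\<^bsub>A\<^esub> x, y) 1 - Poly_Mapping.single (x, y) c
       | c x y. x \<in> carrier A \<and> y \<in> carrier B} \<union>
    {Poly_Mapping.single (x, c \<odot>\<^bsub>B\<^esub> y) 1 - Poly_Mapping.single (x, y) c
       | c x y. x \<in> carrier A \<and> y \<in> carrier B}"

definition tensor_ideal ::
    "('k::field, 'a, 'c) module_scheme \<Rightarrow> ('k, 'b, 'd) module_scheme \<Rightarrow> ('a \<times> 'b \<Rightarrow>\<^sub>0 'k) set" where
  "tensor_ideal A B = Idl\<^bsub>monoid_algebra (A \<times>\<times> B)\<^esub> (bilinear_relations A B)"

definition tensor_alg ::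
    "('k::field, 'a, 'c) module_scheme \<Rightarrow> ('k, 'b, 'd) module_scheme \<Rightarrow> ('k, ('a \<times> 'b \<Rightarrow>\<^sub>0 'k) set) module" where
  "tensor_alg A B = quot_alg (monoid_algebra (A \<times>\<times> B)) (tensor_ideal A B)"

definition pure_tensor ::
    "('k::field, 'a, 'c) module_scheme \<Rightarrow> ('k, 'b, 'd) module_scheme \<Rightarrow> 'a \<Rightarrow> 'b \<Rightarrow> ('a \<times> 'b \<Rightarrow>\<^sub>0 'k) set" where
  "pure_tensor A B x y = tensor_ideal A B +>\<^bsub>monoid_algebra (A \<times>\<times> B)\<^esub> Poly_Mapping.single (x, y) 1"

text \<open>For linear subspaces \<open>S\<close> of \<open>A\<close> and \<open>T\<close> of \<open>B\<close>: the subspace \<open>S \<otimes> T\<close> of \<open>A \<otimes> B\<close>.\<close>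

definition tensor_subspace ::
    "('k::field, 'a, 'c) module_scheme \<Rightarrow> ('k, 'b, 'd) module_scheme \<Rightarrow> 'a set \<Rightarrow> 'b set
      \<Rightarrow> ('a \<times> 'b \<Rightarrow>\<^sub>0 'k) set set" where
  "tensor_subspace A B S T =
    {\<Oplus>\<^bsub>tensor_alg A B\<^esub>k\<in>{..<n}. pure_tensor A B (s k) (t k)
       | (n::nat) s t. s ` {..<n} \<subseteq> S \<and> t ` {..<n} \<subseteq> T}"

definition right_coideal_subalgebra ::
    "('k::field, 'a, 'c) module_scheme \<Rightarrow> ('a \<Rightarrow> ('a \<times> 'a \<Rightarrow>\<^sub>0 'k) set) \<Rightarrow> 'a set \<Rightarrow> bool" where
  "right_coideal_subalgebra A \<Delta> S \<longleftrightarrow>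
    subalg S A \<and> \<Delta> ` S \<subseteq> tensor_subspace A A S (carrier A)"


section \<open>Quantum integers and binomials in the field of rational functions\<close>

definition qv :: "rat poly fract" where
  "qv = Fract [:0, 1:] 1"

definition qint :: "nat \<Rightarrow> rat poly fract" where
  "qint n = (qv ^ n - inverse qv ^ n) / (qv - inverse qv)"

definition qfact :: "nat \<Rightarrow> rat poly fract" where
  "qfact n = (\<Prod>k=1..n. qint k)"

definition qbinom :: "nat \<Rightarrow> nat \<Rightarrow> rat poly fract" where
  "qbinom m r = qfact m / (qfact r * qfact (m - r))"


section \<open>The quantum groups of a quiver\<close>

definition num_edges :: "('i, 'a) pre_digraph \<Rightarrow> 'i \<Rightarrow> 'i \<Rightarrow> nat" where
  "num_edges Q i j = card {e \<in> arcs Q.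
     tail Q e = i \<and> head Q e = j \<or> tail Q e = j \<and> head Q e = i}"

definition cartan :: "('i, 'a) pre_digraph \<Rightarrow> 'i \<Rightarrow> 'i \<Rightarrow> int" where
  "cartan Q i j = (if i = j then 2 else 0) - int (num_edges Q i j)"

definition serre_relations ::
    "('i, 'a) pre_digraph \<Rightarrow> (rat poly fract, 'b, 'c) module_scheme \<Rightarrow> ('i \<Rightarrow> 'b) \<Rightarrow> ('b \<times> 'b) set" where
  "serre_relations Q A x =
    {(\<Oplus>\<^bsub>A\<^esub>r\<in>{0..m}. ((-1) ^ r * qbinom m r) \<odot>\<^bsub>A\<^esub>
         (x i [^]\<^bsub>A\<^esub> r \<otimes>\<^bsub>A\<^esub> x j \<otimes>\<^bsub>A\<^esub> x i [^]\<^bsub>A\<^esub> (m - r)), \<zero>\<^bsub>A\<^esub>)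
       | m i j. i \<in> verts Q \<and> j \<in> verts Q \<and> i \<noteq> j \<and> m = nat (1 - cartan Q i j)}"

text \<open>
  The relations between elements \<open>e\<^sub>i\<close>, \<open>f\<^sub>i\<close>, \<open>k\<^sub>i\<close>, \<open>k'\<^sub>i\<close> common to both quantum groups below;
  invertibility of the Cartan generators is added separately.
\<close>

definition quantum_relations ::
    "('i, 'a) pre_digraph \<Rightarrow> (rat poly fract, 'b, 'c) module_scheme
      \<Rightarrow> ('i \<Rightarrow> 'b) \<Rightarrow> ('i \<Rightarrow> 'b) \<Rightarrow> ('i \<Rightarrow> 'b) \<Rightarrow> ('i \<Rightarrow> 'b) \<Rightarrow> ('b \<times> 'b) set" where
  "quantum_relations Q A e f k k' =
    (\<Union>i\<in>verts Q. \<Union>j\<in>verts Q.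
      {(e i \<otimes>\<^bsub>A\<^esub> f j \<ominus>\<^bsub>A\<^esub> f j \<otimes>\<^bsub>A\<^esub> e i,
        if i = j then (1 / (qv - inverse qv)) \<odot>\<^bsub>A\<^esub> (k i \<ominus>\<^bsub>A\<^esub> k' i) else \<zero>\<^bsub>A\<^esub>),
       (k i \<otimes>\<^bsub>A\<^esub> k j, k j \<otimes>\<^bsub>A\<^esub> k i),
       (k i \<otimes>\<^bsub>A\<^esub> k' j, k' j \<otimes>\<^bsub>A\<^esub> k i),
       (k' i \<otimes>\<^bsub>A\<^esub> k' j, k' j \<otimes>\<^bsub>A\<^esub> k' i),
       (k i \<otimes>\<^bsub>A\<^esub> e j, (qv powi cartan Q i j) \<odot>\<^bsub>A\<^esub> (e j \<otimes>\<^bsub>A\<^esub> k i)),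
       (k i \<otimes>\<^bsub>A\<^esub> f j, (qv powi (- cartan Q i j)) \<odot>\<^bsub>A\<^esub> (f j \<otimes>\<^bsub>A\<^esub> k i)),
       (k' i \<otimes>\<^bsub>A\<^esub> e j, (qv powi (- cartan Q i j)) \<odot>\<^bsub>A\<^esub> (e j \<otimes>\<^bsub>A\<^esub> k' i)),
       (k' i \<otimes>\<^bsub>A\<^esub> f j, (qv powi cartan Q i j) \<odot>\<^bsub>A\<^esub> (f j \<otimes>\<^bsub>A\<^esub> k' i))})
    \<union> serre_relations Q A e \<union> serre_relations Q A f"

definition inverse_relations ::
    "('i, 'a) pre_digraph \<Rightarrow> (rat poly fract, 'b, 'c) module_scheme
      \<Rightarrow> ('i \<Rightarrow> 'b) \<Rightarrow> ('i \<Rightarrow> 'b) \<Rightarrow> ('b \<times> 'b) set" where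
  "inverse_relations Q A x y =
    (\<Union>i\<in>verts Q. {(x i \<otimes>\<^bsub>A\<^esub> y i, \<one>\<^bsub>A\<^esub>), (y i \<otimes>\<^bsub>A\<^esub> x i, \<one>\<^bsub>A\<^esub>)})"


subsection \<open>The algebra with Cartan generators \<open>K\<^sub>i\<close> and \<open>K\<^sub>i'\<close>\<close>

datatype 'i tgen = tE 'i | tF 'i | tK 'i | tK' 'i | tKinv 'i | tK'inv 'i

definition Ut_gens :: "('i, 'a) pre_digraph \<Rightarrow> 'i tgen set" where
  "Ut_gens Q = {g. set_tgen g \<subseteq> verts Q}"

definition Ut_rels :: "('i, 'a) pre_digraph
    \<Rightarrow> (('i tgen list \<Rightarrow>\<^sub>0 rat poly fract) \<times> ('i tgen list \<Rightarrow>\<^sub>0 rat poly fract)) set" where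
  "Ut_rels Q = (let A = free_algebra (Ut_gens Q) in
     quantum_relations Q A (free_gen \<circ> tE) (free_gen \<circ> tF) (free_gen \<circ> tK) (free_gen \<circ> tK') \<union>
     inverse_relations Q A (free_gen \<circ> tK) (free_gen \<circ> tKinv) \<union>
     inverse_relations Q A (free_gen \<circ> tK') (free_gen \<circ> tK'inv))"

definition Ut :: "('i, 'a) pre_digraph
    \<Rightarrow> (rat poly fract, ('i tgen list \<Rightarrow>\<^sub>0 rat poly fract) set) module" where
  "Ut Q = presented_algebra (Ut_gens Q) (Ut_rels Q)"

definition Ut_gen :: "('i, 'a) pre_digraph \<Rightarrow> 'i tgen \<Rightarrow> ('i tgen list \<Rightarrow>\<^sub>0 rat poly fract) set" where
  "Ut_gen Q = presented_gen (Ut_gens Q) (Ut_rels Q)"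

text \<open>These conditions determine \<open>\<Delta>\<close> on the carrier of \<open>Ut Q\<close>.\<close>

definition is_comultiplication :: "('i, 'a) pre_digraph
    \<Rightarrow> (('i tgen list \<Rightarrow>\<^sub>0 rat poly fract) set
        \<Rightarrow> (('i tgen list \<Rightarrow>\<^sub>0 rat poly fract) set \<times> ('i tgen list \<Rightarrow>\<^sub>0 rat poly fract) set
             \<Rightarrow>\<^sub>0 rat poly fract) set) \<Rightarrow> bool" where
  "is_comultiplication Q \<Delta> \<longleftrightarrow>
    (let U = Ut Q; T = tensor_alg U U; t = pure_tensor U U; g = Ut_gen Q in
      \<Delta> \<in> alg_hom U T \<and>
      (\<forall>i\<in>verts Q.
        \<Delta> (g (tE i)) = t (g (tE i)) \<one>\<^bsub>U\<^esub> \<oplus>\<^bsub>T\<^esub> t (g (tK i)) (g (tE i)) \<and>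
        \<Delta> (g (tF i)) = t \<one>\<^bsub>U\<^esub> (g (tF i)) \<oplus>\<^bsub>T\<^esub> t (g (tF i)) (g (tK' i)) \<and>
        \<Delta> (g (tK i)) = t (g (tK i)) (g (tK i)) \<and>
        \<Delta> (g (tK' i)) = t (g (tK' i)) (g (tK' i))))"


subsection \<open>The quantum group\<close>

datatype 'i qgen = qE 'i | qF 'i | qK 'i | qKinv 'i

definition Uq_gens :: "('i, 'a) pre_digraph \<Rightarrow> 'i qgen set" where
  "Uq_gens Q = {g. set_qgen g \<subseteq> verts Q}"

definition Uq_rels :: "('i, 'a) pre_digraph
    \<Rightarrow> (('i qgen list \<Rightarrow>\<^sub>0 rat poly fract) \<times> ('i qgen list \<Rightarrow>\<^sub>0 rat poly fract)) set" where
  "Uq_rels Q = (let A = free_algebra (Uq_gens Q) in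
     quantum_relations Q A (free_gen \<circ> qE) (free_gen \<circ> qF) (free_gen \<circ> qK) (free_gen \<circ> qKinv) \<union>
     inverse_relations Q A (free_gen \<circ> qK) (free_gen \<circ> qKinv))"

definition Uq :: "('i, 'a) pre_digraph
    \<Rightarrow> (rat poly fract, ('i qgen list \<Rightarrow>\<^sub>0 rat poly fract) set) module" where
  "Uq Q = presented_algebra (Uq_gens Q) (Uq_rels Q)"

definition Uq_gen :: "('i, 'a) pre_digraph \<Rightarrow> 'i qgen \<Rightarrow> ('i qgen list \<Rightarrow>\<^sub>0 rat poly fract) set" where
  "Uq_gen Q = presented_gen (Uq_gens Q) (Uq_rels Q)"


section \<open>The i-quantum groups\<close>

definition orbit_representatives :: "('i \<Rightarrow> 'i) \<Rightarrow> 'i set \<Rightarrow> 'i set \<Rightarrow> bool" where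
  "orbit_representatives \<tau> I J \<longleftrightarrow> J \<subseteq> I \<and> (\<forall>i\<in>I. \<exists>!j. j \<in> J \<and> j \<in> {i, \<tau> i})"

definition Bti :: "('i, 'a) pre_digraph \<Rightarrow> ('i \<Rightarrow> 'i) \<Rightarrow> 'i \<Rightarrow> ('i tgen list \<Rightarrow>\<^sub>0 rat poly fract) set" where
  "Bti Q \<tau> i = Ut_gen Q (tF i) \<oplus>\<^bsub>Ut Q\<^esub> Ut_gen Q (tE (\<tau> i)) \<otimes>\<^bsub>Ut Q\<^esub> Ut_gen Q (tK' i)"

definition kti :: "('i, 'a) pre_digraph \<Rightarrow> ('i \<Rightarrow> 'i) \<Rightarrow> 'i \<Rightarrow> ('i tgen list \<Rightarrow>\<^sub>0 rat poly fract) set" where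
  "kti Q \<tau> i = Ut_gen Q (tK i) \<otimes>\<^bsub>Ut Q\<^esub> Ut_gen Q (tK' (\<tau> i))"

definition Uit :: "('i, 'a) pre_digraph \<Rightarrow> ('i \<Rightarrow> 'i)
    \<Rightarrow> (rat poly fract, ('i tgen list \<Rightarrow>\<^sub>0 rat poly fract) set) module" where
  "Uit Q \<tau> = generated_subalg (Ut Q)
     (\<Union>i\<in>verts Q. {Bti Q \<tau> i, kti Q \<tau> i, inv\<^bsub>Ut Q\<^esub> (kti Q \<tau> i)})"

definition Bi :: "('i, 'a) pre_digraph \<Rightarrow> ('i \<Rightarrow> 'i) \<Rightarrow> ('i \<Rightarrow> rat poly fract) \<Rightarrow> 'i
    \<Rightarrow> ('i qgen list \<Rightarrow>\<^sub>0 rat poly fract) set" where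
  "Bi Q \<tau> \<sigma> i = Uq_gen Q (qF i) \<oplus>\<^bsub>Uq Q\<^esub> \<sigma> i \<odot>\<^bsub>Uq Q\<^esub> (Uq_gen Q (qE (\<tau> i)) \<otimes>\<^bsub>Uq Q\<^esub> Uq_gen Q (qKinv i))"

definition ki :: "('i, 'a) pre_digraph \<Rightarrow> ('i \<Rightarrow> 'i) \<Rightarrow> 'i \<Rightarrow> ('i qgen list \<Rightarrow>\<^sub>0 rat poly fract) set" where
  "ki Q \<tau> j = Uq_gen Q (qK j) \<otimes>\<^bsub>Uq Q\<^esub> Uq_gen Q (qKinv (\<tau> j))"

text \<open>The argument \<open>J\<close> is the chosen set of representatives of the \<open>\<tau>\<close>-orbits.\<close>

definition Uiq :: "('i, 'a) pre_digraph \<Rightarrow> ('i \<Rightarrow> 'i) \<Rightarrow> 'i set \<Rightarrow> ('i \<Rightarrow> rat poly fract)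
    \<Rightarrow> (rat poly fract, ('i qgen list \<Rightarrow>\<^sub>0 rat poly fract) set) module" where
  "Uiq Q \<tau> J \<sigma> = generated_subalg (Uq Q)
     ((\<Union>i\<in>verts Q. {Bi Q \<tau> \<sigma> i}) \<union> (\<Union>j\<in>verts Q - J. {ki Q \<tau> j, inv\<^bsub>Uq Q\<^esub> (ki Q \<tau> j)}))"

text \<open>
  The element \<open>\<sigma> (\<tau> i) k\<^sub>i\<close> of \<open>Uq Q\<close> plays the role of the element \<open>kti Q \<tau> i\<close> of \<open>Ut Q\<close>: a
  \<open>K\<^sub>i\<close> arises from pairing \<open>F\<^sub>i\<close> in \<open>B\<^sub>i\<close> with the summand \<open>\<sigma> (\<tau> i) E\<^sub>i K\<^sub>\<tau>\<^sub>i\<inverse>\<close> of \<open>B\<^sub>\<tau>\<^sub>i\<close>.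
  If \<open>\<sigma> i = \<sigma> (\<tau> i)\<close> the index does not matter, but that is only required when
  \<open>cartan Q i (\<tau> i) = 0\<close>.
\<close>

definition specialisation_ideal :: "('i, 'a) pre_digraph \<Rightarrow> ('i \<Rightarrow> 'i) \<Rightarrow> ('i \<Rightarrow> rat poly fract)
    \<Rightarrow> ('i tgen list \<Rightarrow>\<^sub>0 rat poly fract) set set" where
  "specialisation_ideal Q \<tau> \<sigma> = (let A = Uit Q \<tau> in
    Idl\<^bsub>A\<^esub> ({kti Q \<tau> i \<ominus>\<^bsub>A\<^esub> \<sigma> i \<odot>\<^bsub>A\<^esub> \<one>\<^bsub>A\<^esub> | i. i \<in> verts Q \<and> i = \<tau> i} \<union>
            {kti Q \<tau> i \<otimes>\<^bsub>A\<^esub> kti Q \<tau> (\<tau> i) \<ominus>\<^bsub>A\<^esub> (\<sigma> i * \<sigma> (\<tau> i)) \<odot>\<^bsub>A\<^esub> \<one>\<^bsub>A\<^esub>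
               | i. i \<in> verts Q \<and> i \<noteq> \<tau> i}))"

end

theory Submission
  imports Defs "HOL-Algebra.Free_Abelian_Groups"
begin

text \<open>
  Both i-quantum groups are described by generators and relations in a uniform way, and the two
  descriptions are compared.

  In either algebra let \<open>t\<^sub>n\<close>, for an integral exponent vector \<open>n\<close>, be the Laurent monomials in the
  elements \<open>k\<^sub>i\<close> (multiplied by \<open>\<sigma> (\<tau> i)\<close> in the quantum group). The i-quantum group is spanned by
  the products \<open>B\<^sub>J t\<^sub>n\<close> for words \<open>J\<close>, so it is a quotient of the space with the pairs \<open>(J, n)\<close> as a
  basis, and the rule for multiplying such pairs does not depend on the algebra. The point is to find
  the kernel of the evaluation map.

  For each pair \<open>i \<noteq> j\<close> there is a relation whose terms of maximal length form the Serre combination of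
  \<open>B\<^sub>i\<close> and \<open>B\<^sub>j\<close>. There are four cases: if \<open>\<tau> i\<close> is neither \<open>i\<close> nor \<open>j\<close>, the Serre relation itself
  holds (\<open>serre_B_generic\<close>); if \<open>\<tau> i = i\<close>, the relation is given by a continuant
  (\<open>continuant_B_fixed\<close>); if \<open>\<tau> i = j\<close>, the Serre combination equals a combination of
  \<open>B\<^sub>i\<^sup>m\<^sup>-\<^sup>1 k\<^sub>i\<close> and \<open>B\<^sub>i\<^sup>m\<^sup>-\<^sup>1 k\<^sub>j\<close> (\<open>serre_B_swapped\<close>, and \<open>commutator_B\<close> when
  \<open>c\<^sub>i\<^sub>j = 0\<close>). They rest on a calculation of iterated twisted commutators of a sum
  \<open>a + b\<close> with an element \<open>w\<close> (\<open>continuant_eq_zs\<close>, \<open>qprod_x_top\<close>). All coefficients are independent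
  of \<open>\<sigma>\<close>, provided that the \<open>k\<^sub>i\<close> are scaled as above; so these relations are the same in both algebras.

  That there are no further relations among words is seen on a quotient of a Verma module, the free
  module on words in the \<open>F\<^sub>i\<close> modulo the Serre relations. There \<open>B\<^sub>i\<close> acts as \<open>F\<^sub>i\<close> up to shorter
  words, so the longest words of a combination that evaluates to zero lie in the Serre ideal
  (\<open>leading_term\<close>), and can be replaced by shorter words by means of the relations. Hence the kernel is
  spanned by the relations above and by those among the \<open>t\<^sub>n\<close> (\<open>evA_kernel\<close>). In \<open>Ut\<close> the monomials
  \<open>t\<^sub>n\<close> are independent. In \<open>Uq\<close> one has \<open>k\<^sub>i = 1\<close> if \<open>\<tau> i = i\<close> and \<open>k\<^sub>i k\<^sub>\<tau>\<^sub>i = 1\<close> otherwise,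
  and these additional relations are those that the specialisation ideal imposes. So sending a word to
  the class of the same word is the isomorphism (\<open>specialisation_iso\<close>).

  The comultiplication exists because the images of the generators in the tensor product satisfy the
  defining relations (\<open>quantum_system_coproduct\<close>), where the Serre relations follow again from the
  calculation with \<open>a + b\<close>. The formula for \<open>\<Delta> (B\<^sub>i)\<close> shows the coideal property
  (\<open>Uit_right_coideal\<close>).

  For the calculations all algebras are embedded into rings of endomorphisms of vector spaces
  (\<open>kalg_faithful_rep\<close>), since these are types.
\<close>

section \<open>Linear algebra of finitely supported functions\<close>

definition pscale :: "'k::field \<Rightarrow> ('b \<Rightarrow>\<^sub>0 'k) \<Rightarrow> ('b \<Rightarrow>\<^sub>0 'k)" where
  "pscale c = Poly_Mapping.map (\<lambda>a. c * a)"

lemma lookup_pscale [simp]: "Poly_Mapping.lookup (pscale c f) x = c * Poly_Mapping.lookup f x"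
  by (simp add: pscale_def Poly_Mapping.map.rep_eq when_def)

lemma pscale_single [simp]: "pscale c (Poly_Mapping.single x d) = Poly_Mapping.single x (c * d)"
  by (rule poly_mapping_eqI) (simp add: lookup_single when_def)

lemma vector_space_pscale: "vector_space pscale"
  by unfold_locales (auto intro!: poly_mapping_eqI simp: lookup_add algebra_simps)

lemma keys_pscale: "Poly_Mapping.keys (pscale c f) \<subseteq> Poly_Mapping.keys f"
  by (auto simp: in_keys_iff)

locale vec = vector_space scale for scale :: "'k::field \<Rightarrow> 'v::ab_group_add \<Rightarrow> 'v"
begin

definition lin :: "('c \<Rightarrow> 'v) \<Rightarrow> ('c \<Rightarrow>\<^sub>0 'k) \<Rightarrow> 'v" where
  "lin \<phi> f = (\<Sum>x\<in>Poly_Mapping.keys f. scale (Poly_Mapping.lookup f x) (\<phi> x))"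

lemma lin_superset:
    assumes "finite A" "Poly_Mapping.keys f \<subseteq> A"
  shows "lin \<phi> f = (\<Sum>x\<in>A. scale (Poly_Mapping.lookup f x) (\<phi> x))"
  unfolding lin_def by (rule sum.mono_neutral_left) (use assms in \<open>auto simp: in_keys_iff\<close>)

lemma lin_add: "lin \<phi> (f + g) = lin \<phi> f + lin \<phi> g"
proof -
  let ?A = "Poly_Mapping.keys f \<union> Poly_Mapping.keys g"
  show ?thesis
    using Poly_Mapping.keys_add[of f g]
    by (simp add: lin_superset[of ?A] lookup_add scale_left_distrib sum.distrib)
qed

lemma lin_scale: "lin \<phi> (pscale c f) = scale c (lin \<phi> f)"
  using keys_pscale[of c f]
  by (simp add: lin_superset[of "Poly_Mapping.keys f"] scale_sum_right)

lemma linear_lin: "Vector_Spaces.linear pscale scale (lin \<phi>)"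
proof -
  interpret p: vector_space pscale by (rule vector_space_pscale)
  show ?thesis by unfold_locales (simp_all add: lin_add lin_scale)
qed

lemma lin_single [simp]: "lin \<phi> (Poly_Mapping.single x c) = scale c (\<phi> x)"
  by (simp add: lin_def)

lemma lin_zero [simp]: "lin \<phi> 0 = 0"
  by (simp add: lin_def)

lemma lin_minus: "lin \<phi> (- f) = - lin \<phi> f"
  using lin_add[of \<phi> f "- f"] by (simp add: eq_neg_iff_add_eq_0 add.commute)

lemma lin_diff: "lin \<phi> (f - g) = lin \<phi> f - lin \<phi> g"
  using lin_add[of \<phi> f "- g"] by (simp add: lin_minus)

lemma linear_eq_lin:
  assumes "Vector_Spaces.linear pscale scale F"
  shows "F f = lin (\<lambda>x. F (Poly_Mapping.single x 1)) f"
proof -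
  interpret Vector_Spaces.linear pscale scale F by fact
  have "f = (\<Sum>x\<in>Poly_Mapping.keys f. pscale (Poly_Mapping.lookup f x) (Poly_Mapping.single x 1))"
    by (rule poly_mapping_eqI)
       (auto simp: lookup_sum lookup_single when_def in_keys_iff)
  then have "F f = (\<Sum>x\<in>Poly_Mapping.keys f. F (pscale (Poly_Mapping.lookup f x) (Poly_Mapping.single x 1)))"
    by (metis (no_types, lifting) sum sum.cong)
  then show ?thesis
    by (simp only: lin_def scale)
qed

lemma lin_cong: "(\<And>x. x \<in> Poly_Mapping.keys f \<Longrightarrow> \<phi> x = \<psi> x) \<Longrightarrow> lin \<phi> f = lin \<psi> f"
  by (simp add: lin_def)

lemma linear_ext_on_keys:
  assumes "Vector_Spaces.linear pscale scale F" "Vector_Spaces.linear pscale scale G"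
    and "\<And>x. x \<in> Poly_Mapping.keys f \<Longrightarrow> F (Poly_Mapping.single x 1) = G (Poly_Mapping.single x 1)"
  shows "F f = G f"
  unfolding linear_eq_lin[OF assms(1), of f] linear_eq_lin[OF assms(2), of f]
  by (rule lin_cong) (rule assms(3))

lemma lin_fun_add: "lin (\<lambda>x. \<phi> x + \<psi> x) f = lin \<phi> f + lin \<psi> f"
  by (simp add: lin_def scale_right_distrib sum.distrib)

lemma lin_fun_scale: "lin (\<lambda>x. scale c (\<phi> x)) f = scale c (lin \<phi> f)"
  by (simp add: lin_def scale_sum_right mult.commute)

lemma lin_fun_zero [simp]: "lin (\<lambda>x. 0) f = 0"
  by (simp add: lin_def)

end

interpretation pm: vec pscale
  unfolding vec_def by (rule vector_space_pscale)

lemma poly_mapping_sum_singles: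
  fixes f :: "'b \<Rightarrow>\<^sub>0 'k::field"
  shows "pm.lin (\<lambda>x. Poly_Mapping.single x 1) f = f"
  using pm.linear_eq_lin[OF pm.linear_id, of f] by (simp add: id_def)

lemma linear_lin_comp:
  assumes "Vector_Spaces.linear pscale s F" shows "F (pm.lin \<phi> f) = vec.lin s (\<lambda>x. F (\<phi> x)) f"
proof -
  interpret F: Vector_Spaces.linear pscale s F by fact
  interpret S: vec s by (simp add: vec_def F.vs2.vector_space_axioms)
  show ?thesis by (simp add: pm.lin_def S.lin_def F.sum F.scale)
qed

lemma keys_lin:
  assumes "\<And>x. x \<in> Poly_Mapping.keys f \<Longrightarrow> Poly_Mapping.keys (\<phi> x) \<subseteq> S"
  shows "Poly_Mapping.keys (pm.lin \<phi> f) \<subseteq> S"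
proof -
  have "Poly_Mapping.keys (pm.lin \<phi> f) \<subseteq> (\<Union>x\<in>Poly_Mapping.keys f. Poly_Mapping.keys (pscale (Poly_Mapping.lookup f x) (\<phi> x)))"
    unfolding pm.lin_def by (rule Poly_Mapping.keys_sum)
  also have "\<dots> \<subseteq> S" using assms keys_pscale by fastforce
  finally show ?thesis .
qed

subsection \<open>The ring of linear endomorphisms\<close>

text \<open>
  Every algebra given as a record embeds into a ring of this kind. Noncommutative calculations then
  take place in a ring type, where they need no side conditions about carriers.
\<close>

typedef (overloaded) ('b, 'k) lend = "{T :: ('b \<Rightarrow>\<^sub>0 'k::field) \<Rightarrow> ('b \<Rightarrow>\<^sub>0 'k). Vector_Spaces.linear pscale pscale T}"
  morphisms app Lend
  using pm.linear_id by blast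

setup_lifting type_definition_lend

lemma linear_app: "Vector_Spaces.linear pscale pscale (app T)"
  using app by blast

lemma app_add: "app T (x + y) = app T x + app T y"
  and app_pscale: "app T (pscale c x) = pscale c (app T x)"
  and app_zero [simp]: "app T 0 = 0"
  and app_diff: "app T (x - y) = app T x - app T y"
  and app_sum: "app T (sum g A) = (\<Sum>x\<in>A. app T (g x))"
proof -
  interpret Vector_Spaces.linear pscale pscale "app T" by (rule linear_app)
  show "app T (x + y) = app T x + app T y" "app T (pscale c x) = pscale c (app T x)" "app T 0 = 0"
    "app T (x - y) = app T x - app T y" "app T (sum g A) = (\<Sum>x\<in>A. app T (g x))"
    by (rule add scale zero diff sum)+
qed

lemma lend_eqI: "(\<And>x. app S x = app T x) \<Longrightarrow> S = T"
  by (simp add: app_inject[symmetric] ext)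

lemma linear_pscaleI:
  "(\<And>x y. T (x + y) = T x + T y) \<Longrightarrow> (\<And>c x. T (pscale c x) = pscale c (T x)) \<Longrightarrow>
   Vector_Spaces.linear pscale pscale T"
  by (simp add: Vector_Spaces.linear_iff vector_space_pscale)

lemma linear_pscale_iff:
  "Vector_Spaces.linear pscale pscale T \<longleftrightarrow>
    (\<forall>x y. T (x + y) = T x + T y) \<and> (\<forall>c x. T (pscale c x) = pscale c (T x))"
  by (simp add: Vector_Spaces.linear_iff vector_space_pscale)

instantiation lend :: (type, field) ring_1
begin

lift_definition zero_lend :: "('a, 'b) lend" is "\<lambda>x. 0" by (rule linear_pscaleI) auto
lift_definition one_lend :: "('a, 'b) lend" is "\<lambda>x. x" by (rule linear_pscaleI) auto
lift_definition plus_lend :: "('a, 'b) lend \<Rightarrow> ('a, 'b) lend \<Rightarrow> ('a, 'b) lend" is "\<lambda>S T x. S x + T x"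
  by (rule linear_pscaleI) (auto simp: linear_pscale_iff algebra_simps pm.scale_right_distrib)
lift_definition minus_lend :: "('a, 'b) lend \<Rightarrow> ('a, 'b) lend \<Rightarrow> ('a, 'b) lend" is "\<lambda>S T x. S x - T x"
  by (rule linear_pscaleI) (auto simp: linear_pscale_iff algebra_simps pm.scale_right_diff_distrib)
lift_definition uminus_lend :: "('a, 'b) lend \<Rightarrow> ('a, 'b) lend" is "\<lambda>S x. - S x"
  by (rule linear_pscaleI) (auto simp: linear_pscale_iff algebra_simps)
lift_definition times_lend :: "('a, 'b) lend \<Rightarrow> ('a, 'b) lend \<Rightarrow> ('a, 'b) lend" is "\<lambda>S T x. S (T x)"
  by (rule linear_pscaleI) (auto simp: linear_pscale_iff)

instance
proof
  show "(0::('a,'b) lend) \<noteq> 1"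
  proof
    assume "(0::('a,'b) lend) = 1"
    then have "app (0::('a,'b) lend) (Poly_Mapping.single undefined 1) = app 1 (Poly_Mapping.single undefined 1)" by simp
    then have "(0 :: 'a \<Rightarrow>\<^sub>0 'b) = Poly_Mapping.single undefined 1"
      by (simp only: zero_lend.rep_eq one_lend.rep_eq)
    then have "Poly_Mapping.lookup (0 :: 'a \<Rightarrow>\<^sub>0 'b) undefined = Poly_Mapping.lookup (Poly_Mapping.single (undefined :: 'a) 1) undefined"
      by (rule arg_cong[where f="\<lambda>f. Poly_Mapping.lookup f undefined"])
    then show False by simp
  qed
qed (transfer; auto simp: linear_pscale_iff)+

end

lift_definition lscale :: "'k::field \<Rightarrow> ('b, 'k) lend \<Rightarrow> ('b, 'k) lend" is "\<lambda>c T x. pscale c (T x)"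
  by (rule linear_pscaleI) (auto simp: linear_pscale_iff pm.scale_right_distrib mult.commute)

lemmas app_simps = zero_lend.rep_eq one_lend.rep_eq plus_lend.rep_eq minus_lend.rep_eq
  uminus_lend.rep_eq times_lend.rep_eq lscale.rep_eq

lemma app_sum_lend: "app (sum g A) x = (\<Sum>y\<in>A. app (g y) x)"
  by (induction A rule: infinite_finite_induct) (auto simp: app_simps)

locale scalar_ring = vec scl
  for scl :: "'k::field \<Rightarrow> 'r::ring_1 \<Rightarrow> 'r" (infixr \<open>\<cdot>\<close> 75) +
  assumes scl_mult_left: "(c \<cdot> x) * y = c \<cdot> (x * y)"
    and scl_mult_right: "x * (c \<cdot> y) = c \<cdot> (x * y)"
begin

lemmas scl_nf = mult.assoc scl_mult_left scl_mult_right scale_scale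
  distrib_left distrib_right left_diff_distrib right_diff_distrib
  scale_right_distrib scale_right_diff_distrib

lemma linear_times_left: "Vector_Spaces.linear scl scl (\<lambda>y. x * y)"
  by unfold_locales (simp_all add: distrib_left scl_mult_right)

lemma linear_times_right: "Vector_Spaces.linear scl scl (\<lambda>y. y * x)"
  by unfold_locales (simp_all add: distrib_right scl_mult_left)

end

interpretation lend: scalar_ring "lscale :: 'k::field \<Rightarrow> ('b, 'k) lend \<Rightarrow> ('b, 'k) lend"
  by unfold_locales
    (transfer; auto simp: linear_pscale_iff fun_eq_iff pm.scale_left_distrib pm.scale_right_distrib)+

section \<open>Gaussian binomial coefficients\<close>

definition gint :: "'k::field \<Rightarrow> nat \<Rightarrow> 'k" where
  "gint A n = (\<Sum>i<n. A ^ i)"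

definition gfact :: "'k::field \<Rightarrow> nat \<Rightarrow> 'k" where
  "gfact A n = (\<Prod>k=1..n. gint A k)"

definition gbinom :: "'k::field \<Rightarrow> nat \<Rightarrow> nat \<Rightarrow> 'k" where
  "gbinom A n r = (if r \<le> n then gfact A n / (gfact A r * gfact A (n - r)) else 0)"

lemma gint_0 [simp]: "gint A 0 = 0" by (simp add: gint_def)
lemma gint_Suc_0 [simp]: "gint A (Suc 0) = 1" by (simp add: gint_def)

lemma gint_Suc: "gint A (Suc n) = gint A n + A ^ n" by (simp add: gint_def)
lemma gint_eq: "gint A n * (1 - A) = 1 - A ^ n"
  unfolding gint_def by (simp add: one_diff_power_eq mult.commute)

lemma gfact_0 [simp]: "gfact A 0 = 1" by (simp add: gfact_def)
lemma gfact_Suc [simp]: "gfact A (Suc n) = gint A (Suc n) * gfact A n" by (simp add: gfact_def mult.commute)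

locale not_root_of_unity =
  fixes A :: "'k::field"
  assumes A0 [simp]: "A \<noteq> 0" and no_root: "n > 0 \<Longrightarrow> A ^ n \<noteq> 1"
begin

lemma A_neq_1 [simp]: "A \<noteq> 1" using no_root[of 1] by simp

lemma gint_nz [simp]: "n > 0 \<Longrightarrow> gint A n \<noteq> 0"
  using gint_eq[of A n] no_root[of n] by auto

lemma gfact_nz [simp]: "gfact A n \<noteq> 0"
  by (simp add: gfact_def)

lemma gbinom_0 [simp]: "gbinom A n 0 = 1"
  and gbinom_n [simp]: "gbinom A n n = 1"
  by (simp_all add: gbinom_def)

lemma gbinom_step:
  "r \<le> n \<Longrightarrow> gbinom A (Suc n) r * gint A (Suc n - r) = gint A (Suc n) * gbinom A n r"
  "r \<le> n \<Longrightarrow> gbinom A n r * gint A (n - r) = gint A (Suc r) * gbinom A n (Suc r)"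
proof -
  assume r: "r \<le> n"
  then have s: "Suc n - r = Suc (n - r)" by simp
  show "gbinom A (Suc n) r * gint A (Suc n - r) = gint A (Suc n) * gbinom A n r"
    using r by (simp add: gbinom_def s del: One_nat_def)
  show "gbinom A n r * gint A (n - r) = gint A (Suc r) * gbinom A n (Suc r)"
  proof (cases "r = n")
    case False
    then have "n - r = Suc (n - Suc r)" using r by simp
    then show ?thesis using False r by (simp add: gbinom_def)
  qed (simp add: gbinom_def)
qed

lemma gbinom_Pascal:
  assumes "Suc r \<le> n"
  shows "gbinom A (Suc n) (Suc r) = gbinom A n (Suc r) + A ^ (n - r) * gbinom A n r"
proof -
  have nz: "gint A (n - r) \<noteq> 0" using assms by simp
  have 1: "gbinom A (Suc n) (Suc r) * gint A (n - r) = gint A (Suc n) * gbinom A n (Suc r)"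
    using gbinom_step(1)[of "Suc r" n] assms by simp
  have 2: "gbinom A n r * gint A (n - r) = gint A (Suc r) * gbinom A n (Suc r)"
    using gbinom_step(2)[of r n] assms by simp
  have 3: "gint A (Suc n) = gint A (n - r) + A ^ (n - r) * gint A (Suc r)"
  proof -
    have "gint A (Suc n) * (1 - A) = (gint A (n - r) + A ^ (n - r) * gint A (Suc r)) * (1 - A)"
    proof -
      have "A ^ Suc n = A ^ (n - r) * A ^ Suc r" unfolding power_add[symmetric] using assms by (simp del: power_Suc)
      then show ?thesis
        unfolding distrib_right mult.assoc gint_eq by (simp add: algebra_simps)
    qed
    then show ?thesis by simp
  qed
  have "gbinom A (Suc n) (Suc r) * gint A (n - r) =
      (gbinom A n (Suc r) + A ^ (n - r) * gbinom A n r) * gint A (n - r)"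
    unfolding 1 distrib_right mult.assoc 2 3 by (simp add: algebra_simps)
  then show ?thesis using nz by simp
qed

end

subsection \<open>Continuants\<close>

text \<open>
  The three-term recursion of Euler's continuants, with operators as entries. The relations of an
  i-quantum group between \<open>B\<^sub>i\<close> and \<open>B\<^sub>j\<close> with \<open>\<tau> i = i\<close> are of this form, whereas the
  Serre relation is the special case with \<open>\<gamma> = 0\<close>.
\<close>

fun continuant :: "(nat \<Rightarrow> 'v \<Rightarrow> 'v) \<Rightarrow> (nat \<Rightarrow> 'v \<Rightarrow> 'v) \<Rightarrow> 'v::ab_group_add \<Rightarrow> nat \<Rightarrow> 'v" where
  "continuant \<alpha> \<gamma> w 0 = w"
| "continuant \<alpha> \<gamma> w (Suc 0) = \<alpha> 0 w"
| "continuant \<alpha> \<gamma> w (Suc (Suc n)) =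
     \<alpha> (Suc n) (continuant \<alpha> \<gamma> w (Suc n)) + \<gamma> (Suc n) (continuant \<alpha> \<gamma> w n)"

lemma continuant_from_left:
  assumes "\<And>i x y. \<alpha> i (x + y) = \<alpha> i x + \<alpha> i y" "\<And>i x y. \<gamma> i (x + y) = \<gamma> i x + \<gamma> i y"
  shows "continuant \<alpha> \<gamma> w (Suc (Suc n)) =
    continuant (\<lambda>i. \<alpha> (Suc i)) (\<lambda>i. \<gamma> (Suc i)) (\<alpha> 0 w) (Suc n) +
    continuant (\<lambda>i. \<alpha> (Suc (Suc i))) (\<lambda>i. \<gamma> (Suc (Suc i))) (\<gamma> 1 w) n"
proof (induction n rule: less_induct)
  case (less n)
  consider "n = 0" | "n = 1" | k where "n = Suc (Suc k)"
    by (metis One_nat_def nat.exhaust)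
  then show ?case
  proof cases
    case 3
    let ?X = "continuant (\<lambda>i. \<alpha> (Suc i)) (\<lambda>i. \<gamma> (Suc i)) (\<alpha> 0 w)"
    let ?Y = "continuant (\<lambda>i. \<alpha> (Suc (Suc i))) (\<lambda>i. \<gamma> (Suc (Suc i))) (\<gamma> 1 w)"
    have "continuant \<alpha> \<gamma> w (Suc (Suc (Suc k))) = ?X (Suc (Suc k)) + ?Y (Suc k)"
      by (rule less) (simp add: 3)
    moreover have "continuant \<alpha> \<gamma> w (Suc (Suc k)) = ?X (Suc k) + ?Y k"
      by (rule less) (simp add: 3)
    ultimately have "continuant \<alpha> \<gamma> w (Suc (Suc n)) =
        \<alpha> (Suc n) (?X (Suc (Suc k)) + ?Y (Suc k)) + \<gamma> (Suc n) (?X (Suc k) + ?Y k)"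
      unfolding 3 continuant.simps(3)[of \<alpha> \<gamma> w "Suc (Suc k)"] by (simp only:)
    then show ?thesis by (simp add: assms 3)
  qed (auto simp: assms algebra_simps)
qed

lemma continuant_apply:
  assumes "\<And>i x y. \<alpha> i (x + y) = \<alpha> i x + \<alpha> i y" "\<And>i x y. \<gamma> i (x + y) = \<gamma> i x + \<gamma> i y"
    "\<And>x y. f (x + y) = f x + f y" "\<And>i x. f (\<alpha> i x) = \<alpha>' i (f x)" "\<And>i x. f (\<gamma> i x) = \<gamma>' i (f x)"
  shows "f (continuant \<alpha> \<gamma> w n) = continuant \<alpha>' \<gamma>' (f w) n"
  by (induction n rule: induct_nat_012) (simp_all add: assms)

lemma continuant_cong:
  "(\<And>i x. i < n \<Longrightarrow> \<alpha> i x = \<alpha>' i x) \<Longrightarrow> (\<And>i x. 0 < i \<Longrightarrow> i < n \<Longrightarrow> \<gamma> i x = \<gamma>' i x) \<Longrightarrow>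
   continuant \<alpha> \<gamma> w n = continuant \<alpha>' \<gamma>' w n"
  by (induction \<alpha> \<gamma> w n rule: continuant.induct) auto

text \<open>
  Continuants of commuting entries are symmetric: the recursion may be run from either end. By this
  symmetry the computations for \<open>w = F\<^sub>j\<close> and \<open>w = E\<^sub>\<tau>\<^sub>j K'\<^sub>j\<close>, in which the parameters are
  inverse to each other, lead to the same polynomial in \<open>B\<^sub>i\<close>.
\<close>

lemma continuant_rev:
  assumes "\<And>i x y. \<alpha> i (x + y) = \<alpha> i x + \<alpha> i y" "\<And>i x y. \<gamma> i (x + y) = \<gamma> i x + \<gamma> i y"
    and "\<And>i j x. \<alpha> i (\<alpha> j x) = \<alpha> j (\<alpha> i x)" "\<And>i j x. \<alpha> i (\<gamma> j x) = \<gamma> j (\<alpha> i x)"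
      "\<And>i j x. \<gamma> i (\<gamma> j x) = \<gamma> j (\<gamma> i x)"
  shows "continuant \<alpha> \<gamma> w n = continuant (\<lambda>i. \<alpha> (n - 1 - i)) (\<lambda>i. \<gamma> (n - i)) w n"
  using assms
proof (induction n arbitrary: \<alpha> \<gamma> rule: less_induct)
  case (less n)
  consider "n = 0" | "n = 1" | k where "n = Suc (Suc k)"
    by (metis One_nat_def nat.exhaust)
  then show ?case
  proof cases
    case 3
    let ?a1 = "\<lambda>i. \<alpha> (Suc i)" and ?g1 = "\<lambda>i. \<gamma> (Suc i)"
    let ?a2 = "\<lambda>i. \<alpha> (Suc (Suc i))" and ?g2 = "\<lambda>i. \<gamma> (Suc (Suc i))"
    have "continuant \<alpha> \<gamma> w n = \<alpha> 0 (continuant ?a1 ?g1 w (Suc k)) + \<gamma> 1 (continuant ?a2 ?g2 w k)"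
    proof -
      have "\<alpha> 0 (continuant ?a1 ?g1 w (Suc k)) = continuant ?a1 ?g1 (\<alpha> 0 w) (Suc k)"
        by (rule continuant_apply) (simp_all add: less.prems)
      moreover have "\<gamma> 1 (continuant ?a2 ?g2 w k) = continuant ?a2 ?g2 (\<gamma> 1 w) k"
        by (rule continuant_apply) (simp_all add: less.prems)
      ultimately show ?thesis
        unfolding 3 continuant_from_left[OF less.prems(1,2)] by (simp only:)
    qed
    also have "continuant ?a1 ?g1 w (Suc k) =
        continuant (\<lambda>i. ?a1 (Suc k - 1 - i)) (\<lambda>i. ?g1 (Suc k - i)) w (Suc k)"
      by (rule less.IH) (simp_all add: 3 less.prems)
    also have "\<dots> = continuant (\<lambda>i. \<alpha> (n - 1 - i)) (\<lambda>i. \<gamma> (n - i)) w (Suc k)"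
      by (rule continuant_cong) (simp_all add: 3 Suc_diff_le)
    also have "continuant ?a2 ?g2 w k =
        continuant (\<lambda>i. ?a2 (k - 1 - i)) (\<lambda>i. ?g2 (k - i)) w k"
      by (rule less.IH) (simp_all add: 3 less.prems)
    also have "\<dots> = continuant (\<lambda>i. \<alpha> (n - 1 - i)) (\<lambda>i. \<gamma> (n - i)) w k"
    proof (rule continuant_cong)
      fix i x assume "i < k"
      then have "Suc (Suc (k - 1 - i)) = n - 1 - i" using 3 by simp
      then show "\<alpha> (Suc (Suc (k - 1 - i))) x = \<alpha> (n - 1 - i) x" by simp
    qed (simp_all add: 3 Suc_diff_le)
    finally show ?thesis unfolding 3 by simp
  qed auto
qed

subsection \<open>Expansion of products of commuting operators\<close>

context vec
begin

primrec qprod :: "'k \<Rightarrow> 'k \<Rightarrow> ('v \<Rightarrow> 'v) \<Rightarrow> ('v \<Rightarrow> 'v) \<Rightarrow> 'v \<Rightarrow> nat \<Rightarrow> 'v" where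
  "qprod t A L R w 0 = w"
| "qprod t A L R w (Suc n) = L (qprod t A L R w n) - scale (t * A ^ n) (R (qprod t A L R w n))"

text \<open>
  The \<open>q\<close>-binomial theorem. It turns the iterated twisted commutator into the alternating sum that
  occurs in the Serre relations.
\<close>

lemma qprod_expand:
  assumes A: "not_root_of_unity A"
    and L: "Vector_Spaces.linear scale scale L" and R: "Vector_Spaces.linear scale scale R"
    and comm: "\<And>x. L (R x) = R (L x)"
  shows "qprod t A L R w n =
    (\<Sum>r\<le>n. scale ((- t) ^ r * A ^ (r * (r - 1) div 2) * gbinom A n r) ((L ^^ (n - r)) ((R ^^ r) w)))"
proof (induction n)
  case 0
  interpret not_root_of_unity A by fact
  show ?case by simp
next
  case (Suc n)
  interpret not_root_of_unity A by fact
  interpret L: Vector_Spaces.linear scale scale L by fact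
  interpret R: Vector_Spaces.linear scale scale R by fact
  have RL: "R ((L ^^ k) x) = (L ^^ k) (R x)" for k x
    by (induction k) (auto simp: comm[symmetric])
  let ?C = "\<lambda>n r. (- t) ^ r * A ^ (r * (r - 1) div 2) * gbinom A n r"
  let ?T = "\<lambda>n r. (L ^^ (n - r)) ((R ^^ r) w)"
  have c: "?C (Suc n) (Suc r) = ?C n (Suc r) - t * A ^ n * ?C n r" if "r < n" for r
  proof -
    have "Suc r * (Suc r - 1) div 2 = r * (r - 1) div 2 + r"
    proof -
      have "Suc r * (Suc r - 1) = r * (r - 1) + r * 2" by (cases r) auto
      then show ?thesis by simp
    qed
    moreover have "A ^ n = A ^ r * A ^ (n - r)" unfolding power_add[symmetric] using that by simp
    ultimately show ?thesis
      using gbinom_Pascal[of r n] that by (simp add: power_add algebra_simps)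
  qed
  have c': "?C (Suc n) (Suc n) = - (t * A ^ n * ?C n n)"
  proof -
    have "Suc n * (Suc n - 1) = n * (n - 1) + n * 2" by (cases n) auto
    then have "Suc n * (Suc n - 1) div 2 = n * (n - 1) div 2 + n" by simp
    then show ?thesis by (simp add: power_add)
  qed
  have "qprod t A L R w (Suc n) =
      (\<Sum>r\<le>n. scale (?C n r) (L (?T n r))) - scale (t * A ^ n) (\<Sum>r\<le>n. scale (?C n r) (R (?T n r)))"
    by (simp add: Suc.IH L.sum L.scale R.sum R.scale)
  also have "(\<Sum>r\<le>n. scale (?C n r) (L (?T n r))) = (\<Sum>r\<le>n. scale (?C n r) (?T (Suc n) r))"
    by (rule sum.cong) (auto simp: Suc_diff_le)
  also have "\<dots> = scale (?C n 0) (?T (Suc n) 0) + (\<Sum>r<n. scale (?C n (Suc r)) (?T (Suc n) (Suc r)))"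
    unfolding lessThan_Suc_atMost[symmetric] by (rule sum.lessThan_Suc_shift)
  also have "scale (t * A ^ n) (\<Sum>r\<le>n. scale (?C n r) (R (?T n r))) =
      (\<Sum>r\<le>n. scale (t * A ^ n * ?C n r) (?T (Suc n) (Suc r)))"
    by (simp add: scale_sum_right RL)
  also have "\<dots> = (\<Sum>r<n. scale (t * A ^ n * ?C n r) (?T (Suc n) (Suc r)))
      + scale (t * A ^ n * ?C n n) (?T (Suc n) (Suc n))"
    by (simp add: lessThan_Suc_atMost[symmetric])
  finally have "qprod t A L R w (Suc n) = scale (?C n 0) (?T (Suc n) 0)
      + (\<Sum>r<n. scale (?C (Suc n) (Suc r)) (?T (Suc n) (Suc r))) + scale (?C (Suc n) (Suc n)) (?T (Suc n) (Suc n))"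
    unfolding c' using c by (simp add: scale_left_diff_distrib sum_subtractf scale_minus_left)
  also have "\<dots> = (\<Sum>r<Suc (Suc n). scale (?C (Suc n) r) (?T (Suc n) r))"
    unfolding sum.lessThan_Suc_shift[of _ "Suc n"] by simp
  finally show ?case unfolding lessThan_Suc_atMost .
qed

end

section \<open>Serre relations for sums of q-commuting elements\<close>

locale serre_coeffs = not_root_of_unity A for A :: "'k::field" +
  fixes p :: 'k and m :: nat
  assumes p0 [simp]: "p \<noteq> 0" and m0: "m > 0" and pA: "p * p = A ^ (m - 1)"
begin

definition \<mu> :: "nat \<Rightarrow> 'k" where "\<mu> l = 1 - A ^ l / (p * p)"

text \<open>
  The coefficient of \<open>b\<^sup>k\<^sup>-\<^sup>n z\<^sub>n\<close> in the iterated twisted commutator of \<open>a + b\<close> with \<open>w\<close>, when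
  \<open>b\<close> \<open>q\<close>-commutes with \<open>a\<close> and \<open>w\<close>. Since \<open>\<mu>\<close> vanishes at \<open>m - 1\<close>, only \<open>z\<^sub>m\<close> survives for \<open>k = m\<close>.
\<close>

definition cf :: "nat \<Rightarrow> nat \<Rightarrow> 'k" where "cf k n = gbinom A k n * (\<Prod>l\<in>{n..<k}. \<mu> l)"

lemma \<mu>_top [simp]: "\<mu> (m - 1) = 0"
  by (simp add: \<mu>_def pA)

lemma cf_diag [simp]: "cf k k = 1" by (simp add: cf_def)

lemma cf_top: "n < m \<Longrightarrow> cf m n = 0"
  unfolding cf_def using m0 \<mu>_top by (intro mult_eq_0_iff[THEN iffD2] disjI2 prod_zero bexI[of _ "m - 1"]) auto

lemma cf_step_0: "cf (Suc k) 0 = \<mu> k * cf k 0"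
  by (simp add: cf_def)

lemma cf_step_right:
  assumes "n < k" shows "cf k n * gint A (k - n) = cf k (Suc n) * gint A (Suc n) * \<mu> n"
  using gbinom_step(2)[of n k] assms by (simp add: cf_def prod.atLeast_Suc_lessThan[of n k])

lemma cf_step_down:
  assumes "n \<le> k" shows "cf (Suc k) n * gint A (Suc k - n) = gint A (Suc k) * \<mu> k * cf k n"
  using gbinom_step(1)[of n k] assms by (simp add: cf_def)

lemma cf_step:
  assumes "n < k"
  shows "cf (Suc k) (Suc n) = A ^ (k - n) * cf k n + (1 - A ^ (k + Suc n) / (p * p)) * cf k (Suc n)"
proof -
  have nz: "gint A (k - n) \<noteq> 0" using assms by simp
  have key: "gint A (Suc k) * \<mu> k =
      A ^ (k - n) * (gint A (Suc n) * \<mu> n) + (1 - A ^ (k + Suc n) / (p * p)) * gint A (k - n)"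
    (is "?l = ?r")
  proof -
    define \<beta> \<delta> D where "\<beta> = A ^ Suc n" and "\<delta> = A ^ (k - n)" and "D = 1 / (A * (p * p))"
    have 1: "A ^ Suc k = \<beta> * \<delta>" unfolding \<beta>_def \<delta>_def power_add[symmetric] using assms by simp
    have 2: "\<mu> k = 1 - D * (\<beta> * \<delta>)" unfolding \<mu>_def 1[symmetric] D_def by simp
    have 3: "\<mu> n = 1 - D * \<beta>" unfolding \<mu>_def \<beta>_def D_def by simp
    have "A ^ (k + Suc n) = A ^ Suc k * A ^ n" unfolding power_add[symmetric] by simp
    then have "A ^ (k + Suc n) / (p * p) = A ^ Suc k * (A ^ Suc n / (A * (p * p)))" by simp
    also have "\<dots> = \<beta> * \<delta> * (D * \<beta>)" unfolding 1 by (simp add: \<beta>_def D_def)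
    finally have 4: "A ^ (k + Suc n) / (p * p) = \<beta> * \<delta> * (D * \<beta>)" .
    have "?l * (1 - A) = (gint A (Suc k) * (1 - A)) * \<mu> k" by (simp only: mult_ac)
    also have "\<dots> = (1 - \<beta> * \<delta>) * (1 - D * (\<beta> * \<delta>))" unfolding gint_eq 1 2 ..
    also have "\<dots> = \<delta> * ((1 - \<beta>) * (1 - D * \<beta>)) + (1 - \<beta> * \<delta> * (D * \<beta>)) * (1 - \<delta>)"
      by (simp add: algebra_simps)
    also have "\<dots> = \<delta> * ((gint A (Suc n) * (1 - A)) * \<mu> n) + (1 - \<beta> * \<delta> * (D * \<beta>)) * (gint A (k - n) * (1 - A))"
      unfolding gint_eq 3 by (simp add: \<beta>_def \<delta>_def)
    also have "\<dots> = ?r * (1 - A)" unfolding 4 \<delta>_def[symmetric] by (simp add: algebra_simps)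
    finally show ?thesis by simp
  qed
  have "cf (Suc k) (Suc n) * gint A (k - n) = gint A (Suc k) * \<mu> k * cf k (Suc n)"
    using cf_step_down[of "Suc n" k] assms by simp
  also have "\<dots> = A ^ (k - n) * (cf k (Suc n) * gint A (Suc n) * \<mu> n)
      + (1 - A ^ (k + Suc n) / (p * p)) * cf k (Suc n) * gint A (k - n)"
    unfolding key by (simp only: distrib_left distrib_right mult_ac)
  also have "\<dots> = (A ^ (k - n) * cf k n + (1 - A ^ (k + Suc n) / (p * p)) * cf k (Suc n)) * gint A (k - n)"
    unfolding cf_step_right[OF assms, symmetric] by (simp only: distrib_right distrib_left mult_ac)
  finally show ?thesis using nz by simp
qed

lemma cf_sum_shift:
  "cf (Suc k) n = (if n = 0 then 0 else A ^ (Suc k - n) * cf k (n - 1)) +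
     (if n \<le> k then (1 - A ^ (k + n) / (p * p)) * cf k n else 0)" if "n \<le> Suc k"
proof (cases n)
  case 0 then show ?thesis by (simp add: cf_step_0 \<mu>_def)
next
  case (Suc j)
  then have "j < k \<or> j = k" using that by auto
  then show ?thesis
    using cf_step[of j k] by (elim disjE) (simp_all add: Suc)
qed

end

text \<open>
  The elements \<open>z\<^sub>n\<close> are the iterated twisted commutators of \<open>a\<close> with \<open>w\<close>, and \<open>z\<^sub>m = 0\<close> is
  the Serre relation. In the applications \<open>a\<close> and \<open>b\<close> are the two summands of \<open>B\<^sub>i\<close>, and the aim is
  to compute the same commutators for \<open>x = a + b\<close>.
\<close>

locale serre_pair = scalar_ring scl + serre_coeffs A p m
  for scl :: "'k::field \<Rightarrow> 'r::ring_1 \<Rightarrow> 'r" (infixr \<open>\<cdot>\<close> 75) and A p :: 'k and m :: nat +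
  fixes a b w :: 'r
begin

definition zs :: "nat \<Rightarrow> 'r" where
  "zs = qprod (inverse p) A (\<lambda>y. a * y) (\<lambda>y. y * a) w"

lemma zs_0 [simp]: "zs 0 = w" by (simp add: zs_def)
lemma zs_Suc: "zs (Suc n) = a * zs n - (A ^ n / p) \<cdot> (zs n * a)"
  by (simp add: zs_def divide_inverse mult.commute)

lemma a_zs: "a * zs n = zs (Suc n) + (A ^ n / p) \<cdot> (zs n * a)"
  by (simp add: zs_Suc)

definition x where "x = a + b"

end

text \<open>
  Here \<open>b\<close> \<open>q\<close>-commutes with \<open>w\<close>, but with \<open>a\<close> only up to a central element \<open>K\<close> and a multiple
  of \<open>y\<^sup>2\<close>. This is the situation of \<open>a = F\<^sub>i\<close>, \<open>b = E\<^sub>i K'\<^sub>i\<close>, \<open>y = K'\<^sub>i\<close>.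
\<close>

locale serre_pair_2 = serre_pair scl A p m a b w
  for scl :: "'k::field \<Rightarrow> 'r::ring_1 \<Rightarrow> 'r" (infixr \<open>\<cdot>\<close> 75) and A p :: 'k and m :: nat and a b w :: 'r +
  fixes K y :: 'r and e :: 'k
  assumes ba: "b * a = (inverse A) \<cdot> (a * b) + K - e \<cdot> (y * y)"
    and bw: "b * w = p \<cdot> (w * b)"
    and ya: "y * a = (inverse A) \<cdot> (a * y)" and yb: "y * b = A \<cdot> (b * y)" and yw: "y * w = p \<cdot> (w * y)"
    and Ka: "K * a = a * K" and Kb: "K * b = b * K" and Kw: "K * w = w * K" and Ky: "K * y = y * K"
begin

lemma ab: "a * b = A \<cdot> (b * a) - A \<cdot> K + (A * e) \<cdot> (y * y)"
  unfolding ba by (simp add: scl_nf)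

lemma ay: "a * y = A \<cdot> (y * a)"
  unfolding ya by (simp add: scl_nf)

lemma K_zs: "K * zs n = zs n * K"
proof (induction n)
  case (Suc n)
  have 1: "K * (zs n * X) = zs n * (K * X)" for X by (metis Suc mult.assoc)
  have 2: "K * (a * X) = a * (K * X)" for X by (metis Ka mult.assoc)
  show ?case by (simp add: zs_Suc scl_nf 1 2 Suc Ka)
qed (simp add: Kw)

lemma y_zs: "y * zs n = (p / A ^ n) \<cdot> (zs n * y)"
proof (induction n)
  case 0 show ?case by (simp add: yw)
next
  case (Suc n)
  have "y * zs (Suc n) = (y * a) * zs n - (A ^ n / p) \<cdot> ((y * zs n) * a)"
    by (simp add: zs_Suc scl_nf)
  also have "\<dots> = (p / A ^ Suc n) \<cdot> (zs (Suc n) * y)"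
    unfolding ya Suc by (simp add: zs_Suc scl_nf Suc ya field_simps)
  finally show ?case .
qed

text \<open>
  Moving \<open>b\<close> past \<open>z\<^sub>n\<close> creates the term \<open>e bt\<^sub>n y\<^sup>2 z\<^sub>n\<^sub>-\<^sub>1\<close>. As \<open>bt\<close> vanishes at \<open>m\<close>,
  the Serre element \<open>z\<^sub>m\<close> again \<open>q\<close>-commutes with \<open>b\<close>.
\<close>

definition bt :: "nat \<Rightarrow> 'k" where "bt n = - gint A n * \<mu> (n - 1)"

lemma bt_0 [simp]: "bt 0 = 0" by (simp add: bt_def)

lemma gint_Suc': "gint A (Suc n) = 1 + A * gint A n"
proof -
  have "gint A (Suc n) * (1 - A) = (1 + A * gint A n) * (1 - A)"
    unfolding distrib_right mult.assoc gint_eq by (simp add: algebra_simps)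
  then show ?thesis by simp
qed

lemma bt_Suc: "bt (Suc n) = A * bt n - 1 + A ^ n * A ^ n / (p * p)"
proof (cases n)
  case 0 then show ?thesis by (simp add: bt_def \<mu>_def)
next
  case (Suc j)
  have "A * bt n = - (A * gint A n) + A ^ n * gint A n / (p * p)"
    by (simp add: bt_def \<mu>_def Suc field_simps)
  moreover have "bt (Suc n) = - (1 + A * gint A n) + A ^ n * (gint A n + A ^ n) / (p * p)"
  proof -
    have "bt (Suc n) = - G + A ^ n * H / (p * p)" if "gint A (Suc n) = G" "gint A (Suc n) = H" for G H
      unfolding that(1)[symmetric] bt_def \<mu>_def using that by (simp add: right_diff_distrib)
    from this[OF gint_Suc' gint_Suc] show ?thesis .
  qed
  ultimately show ?thesis by (simp add: distrib_left add_divide_distrib)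
qed

lemma y_zs': "y * (zs n * X) = (p / A ^ n) \<cdot> (zs n * (y * X))"
  using arg_cong[OF y_zs[of n], of "\<lambda>z. z * X"] by (simp add: scl_nf)

lemma yy_a: "a * (y * (y * X)) = (A * A) \<cdot> (y * (y * (a * X)))"
  by (simp add: mult.assoc[symmetric] ay scl_mult_left) (simp add: scl_nf ay)

lemma b_zs: "b * zs n = (p / A ^ n) \<cdot> (zs n * b) + (e * bt n) \<cdot> (y * (y * zs (n - 1)))"
proof (induction n)
  case 0 show ?case by (simp add: bw)
next
  case (Suc n)
  have 1: "b * zs (Suc n) = (b * a) * zs n - (A ^ n / p) \<cdot> ((b * zs n) * a)"
    by (simp add: zs_Suc scl_nf)
  have 2: "(A ^ n / p) \<cdot> ((b * zs n) * a) = zs n * (b * a) + (e * bt n * (A ^ n / p)) \<cdot> (y * (y * (zs (n - 1) * a)))"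
    unfolding Suc by (simp add: scl_nf mult_ac)
  have 3: "(b * a) * zs n = (inverse A) \<cdot> (a * (b * zs n)) + K * zs n - e \<cdot> (y * (y * zs n))"
    unfolding ba by (simp add: scl_nf)
  have 4: "a * (b * zs n) = (p / A ^ n) \<cdot> (a * (zs n * b)) + (e * bt n * (A * A)) \<cdot> (y * (y * (a * zs (n - 1))))"
    unfolding Suc by (simp add: scl_nf yy_a mult_ac)
  have 5: "zs n * (b * a) = (inverse A) \<cdot> (zs n * (a * b)) + K * zs n - e \<cdot> (zs n * (y * y))"
    unfolding ba by (simp add: scl_nf K_zs)
  have 6: "zs n * (y * y) = (A ^ n * A ^ n / (p * p)) \<cdot> (y * (y * zs n))"
  proof -
    have "y * (y * zs n) = (p * p / (A ^ n * A ^ n)) \<cdot> (zs n * (y * y))"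
      by (simp add: y_zs y_zs' scl_nf)
    then show ?thesis by (simp add: scl_nf)
  qed
  have 7: "(e * bt n * A) \<cdot> (y * (y * (a * zs (n - 1)))) - (e * bt n * (A ^ n / p)) \<cdot> (y * (y * (zs (n - 1) * a)))
      = (e * bt n * A) \<cdot> (y * (y * zs n))"
  proof (cases n)
    case (Suc j)
    then show ?thesis by (simp add: a_zs scl_nf mult_ac)
  qed simp
  have 8: "(p / A ^ Suc n) \<cdot> (zs (Suc n) * b) = (inverse A * (p / A ^ n)) \<cdot> (a * (zs n * b)) - (inverse A) \<cdot> (zs n * (a * b))"
    by (simp add: zs_Suc scl_nf field_simps)
  have "b * zs (Suc n) = (inverse A * (p / A ^ n)) \<cdot> (a * (zs n * b)) - (inverse A) \<cdot> (zs n * (a * b))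
     + ((e * bt n * A) \<cdot> (y * (y * (a * zs (n - 1)))) - (e * bt n * (A ^ n / p)) \<cdot> (y * (y * (zs (n - 1) * a))))
     - e \<cdot> (y * (y * zs n)) + e \<cdot> (zs n * (y * y))"
    unfolding 1 2 3 4 5 by (simp add: scl_nf scale_left_distrib scale_left_diff_distrib algebra_simps)
  also have "\<dots> = (p / A ^ Suc n) \<cdot> (zs (Suc n) * b) + ((e * bt n * A) - e + (e * (A ^ n * A ^ n / (p * p)))) \<cdot> (y * (y * zs n))"
    unfolding 7 8 6 by (simp add: scl_nf scale_left_distrib scale_left_diff_distrib algebra_simps)
  also have "(e * bt n * A) - e + (e * (A ^ n * A ^ n / (p * p))) = (e * bt (Suc n))"
    unfolding bt_Suc by (simp add: algebra_simps)
  finally show ?case by simp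
qed

text \<open>
  These elements replace the powers of \<open>b\<close>: the correction terms are chosen such that moving \<open>a\<close> or
  \<open>b\<close> past them produces only such elements again, with \<open>y\<close> and \<open>K\<close> as further factors.
\<close>

fun PP :: "nat \<Rightarrow> 'r" where
  "PP 0 = 1"
| "PP (Suc 0) = b"
| "PP (Suc (Suc s)) = b * PP (Suc s) + (e * A * gint A (Suc s)) \<cdot> (y * PP s * y)"

lemma PP_Suc: "PP (Suc s) = b * PP s + (e * A * gint A s) \<cdot> (y * (PP (s - 1) * y))"
  by (cases s) (simp_all add: mult.assoc)

lemma b_PP: "b * PP s = PP (Suc s) - (e * A * gint A s) \<cdot> (y * (PP (s - 1) * y))"
  by (simp add: PP_Suc)

lemma b_PP': "b * (PP s * X) = PP (Suc s) * X - (e * A * gint A s) \<cdot> (y * (PP (s - 1) * (y * X)))"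
  using arg_cong[OF b_PP[of s], of "\<lambda>z. z * X"] by (simp add: scl_nf)

lemma yb': "y * (b * X) = A \<cdot> (b * (y * X))"
  using arg_cong[OF yb, of "\<lambda>z. z * X"] by (simp add: scl_nf)

lemma by': "b * (y * X) = (inverse A) \<cdot> (y * (b * X))"
  by (simp add: yb' scl_nf)

lemma y_PP: "y * PP s = (A ^ s) \<cdot> (PP s * y) +
    (e * A * (1 - A) * gint A s * gint A (s - 1)) \<cdot> (y * (PP (s - 2) * (y * y)))"
proof (induction s rule: induct_nat_012)
  case 0 show ?case by simp
next
  case 1 show ?case by (simp add: yb)
next
  case (ge2 n)
  show ?case
  proof (cases n)
    case 0
    have "gint A 2 = 1 + A" by (simp add: gint_def numeral_2_eq_2)
    then show ?thesis
      by (simp add: 0 scl_nf yb' yb scale_left_distrib scale_left_diff_distrib numeral_2_eq_2 algebra_simps)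
  next
    case (Suc t)
    let ?c = "e * A * (1 - A)"
    have IH1: "y * (PP (Suc n) * X) = (A ^ Suc n) \<cdot> (PP (Suc n) * (y * X)) +
        (?c * gint A (Suc n) * gint A n) \<cdot> (y * (PP t * (y * (y * X))))" for X
      using arg_cong[OF ge2.IH(2), of "\<lambda>z. z * X"] Suc by (simp add: scl_nf)
    have IH0: "y * (PP n * X) = (A ^ n) \<cdot> (PP n * (y * X)) +
        (?c * gint A n * gint A t) \<cdot> (y * (PP (t - 1) * (y * (y * X))))" for X
      using arg_cong[OF ge2.IH(1), of "\<lambda>z. z * X"] Suc by (simp add: scl_nf)
    have "y * PP (Suc (Suc n)) = A \<cdot> (b * (y * PP (Suc n))) + (e * A * gint A (Suc n)) \<cdot> (y * (y * (PP n * y)))"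
      by (simp add: PP_Suc[of "Suc n"] scl_nf yb')
    also have "A \<cdot> (b * (y * PP (Suc n))) = (A * A ^ Suc n) \<cdot> (b * (PP (Suc n) * y)) +
        (?c * gint A (Suc n) * gint A n) \<cdot> (A \<cdot> (b * (y * (PP t * (y * y)))))"
      using IH1[of 1] by (simp add: scl_nf mult_ac)
    also have "A \<cdot> (b * (y * (PP t * (y * y)))) = y * (PP n * (y * y)) - (e * A * gint A t) \<cdot> (y * (y * (PP (t - 1) * (y * (y * y)))))"
      unfolding yb'[symmetric] b_PP' by (simp add: Suc scl_nf)
    also have "b * (PP (Suc n) * y) = PP (Suc (Suc n)) * y - (e * A * gint A (Suc n)) \<cdot> (y * (PP n * (y * y)))"
      unfolding b_PP' by simp
    also have "y * (y * (PP n * y)) = (A ^ n) \<cdot> (y * (PP n * (y * y))) +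
        (?c * gint A n * gint A t) \<cdot> (y * (y * (PP (t - 1) * (y * (y * y)))))"
      by (simp add: IH0 scl_nf)
    finally have "y * PP (Suc (Suc n)) = (A ^ Suc (Suc n)) \<cdot> (PP (Suc (Suc n)) * y) +
       ((?c * gint A (Suc n) * gint A n) - (A ^ Suc (Suc n) * (e * A * gint A (Suc n)))
          + (e * A * gint A (Suc n) * A ^ n)) \<cdot> (y * (PP n * (y * y)))"
      by (simp add: scl_nf scale_left_distrib scale_left_diff_distrib algebra_simps)
    also have "(?c * gint A (Suc n) * gint A n) - (A ^ Suc (Suc n) * (e * A * gint A (Suc n)))
          + (e * A * gint A (Suc n) * A ^ n) = (?c * gint A (Suc (Suc n)) * gint A (Suc n))"
    proof -
      have "(1 - A) * gint A n - A ^ Suc (Suc n) + A ^ n = (1 - A) * gint A (Suc (Suc n))"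
        using gint_eq[of A n] gint_eq[of A "Suc (Suc n)"] by (simp add: algebra_simps)
      then have key: "(1 - A) * gint A (Suc (Suc n)) = (1 - A) * gint A n - A ^ Suc (Suc n) + A ^ n" ..
      have "?c * gint A (Suc (Suc n)) * gint A (Suc n) = e * A * gint A (Suc n) * ((1 - A) * gint A (Suc (Suc n)))"
        by (simp only: mult_ac)
      then show ?thesis unfolding key by (simp add: algebra_simps)
    qed
    finally show ?thesis by simp
  qed
qed

lemma PP_b: "PP s * b = PP (Suc s) - (e * A * gint A s) \<cdot> (PP (s - 1) * (y * y))"
proof (induction s rule: induct_nat_012)
  case 0 show ?case by simp
next
  case 1 show ?case by (simp add: scl_nf)
next
  case (ge2 n)
  have IH1: "PP (Suc n) * b = PP (Suc (Suc n)) - (e * A * gint A (Suc n)) \<cdot> (PP n * (y * y))"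
    using ge2.IH(2) by simp
  have IH0: "PP n * (b * X) = PP (Suc n) * X - (e * A * gint A n) \<cdot> (PP (n - 1) * (y * (y * X)))" for X
    using arg_cong[OF ge2.IH(1), of "\<lambda>z. z * X"] by (simp add: scl_nf)
  have "PP (Suc (Suc n)) * b = b * (PP (Suc n) * b) + (e * A * gint A (Suc n)) \<cdot> (y * (PP n * (y * b)))"
    by (simp add: PP_Suc[of "Suc n"] scl_nf)
  also have "b * (PP (Suc n) * b) = b * PP (Suc (Suc n)) - (e * A * gint A (Suc n)) \<cdot> (b * (PP n * (y * y)))"
    unfolding IH1 by (simp add: scl_nf)
  also have "b * PP (Suc (Suc n)) = PP (Suc (Suc (Suc n))) - (e * A * gint A (Suc (Suc n))) \<cdot> (y * (PP (Suc n) * y))"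
    unfolding b_PP by simp
  also have "b * (PP n * (y * y)) = PP (Suc n) * (y * y) - (e * A * gint A n) \<cdot> (y * (PP (n - 1) * (y * (y * y))))"
    by (rule b_PP')
  also have "y * (PP n * (y * b)) = A \<cdot> (y * (PP (Suc n) * y)) - (A * (e * A * gint A n)) \<cdot> (y * (PP (n - 1) * (y * (y * y))))"
    by (simp add: yb scl_nf IH0)
  finally have *: "PP (Suc (Suc n)) * b = PP (Suc (Suc (Suc n)))
     - ((e * A * gint A (Suc (Suc n))) - (e * A * gint A (Suc n) * A)) \<cdot> (y * (PP (Suc n) * y))
     - (e * A * gint A (Suc n)) \<cdot> (PP (Suc n) * (y * y))
     + (e * A * gint A (Suc n) * (e * A * gint A n) * (1 - A)) \<cdot> (y * (PP (n - 1) * (y * (y * y))))"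
    by (simp add: scl_nf scale_left_distrib scale_left_diff_distrib algebra_simps)
  have 1: "(e * A * gint A (Suc (Suc n))) - (e * A * gint A (Suc n) * A) = (e * A)"
    unfolding gint_Suc'[of "Suc n"] by (simp add: algebra_simps)
  have 2: "y * (PP (Suc n) * y) = (A ^ Suc n) \<cdot> (PP (Suc n) * (y * y)) +
     (e * A * (1 - A) * gint A (Suc n) * gint A n) \<cdot> (y * (PP (n - 1) * (y * (y * y))))"
    using arg_cong[OF y_PP[of "Suc n"], of "\<lambda>z. z * y"] by (simp add: scl_nf)
  have "PP (Suc (Suc n)) * b = PP (Suc (Suc (Suc n)))
     - ((e * A * A ^ Suc n) + (e * A * gint A (Suc n))) \<cdot> (PP (Suc n) * (y * y))"
    unfolding * 1 2 by (simp add: scl_nf scale_left_distrib scale_left_diff_distrib algebra_simps)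
  then show ?case
    unfolding gint_Suc[of A "Suc n"] by (simp add: algebra_simps)
qed

lemma a_PP: "a * PP s = (A ^ s) \<cdot> (PP s * a) + (e * A * gint A s) \<cdot> (y * (PP (s - 1) * y))
    - (A * gint A s) \<cdot> (K * PP (s - 1))"
proof (induction s rule: induct_nat_012)
  case 0 show ?case by simp
next
  case 1 show ?case by (simp add: ab scl_nf)
next
  case (ge2 n)
  have IH1: "a * PP (Suc n) = (A ^ Suc n) \<cdot> (PP (Suc n) * a) + (e * A * gint A (Suc n)) \<cdot> (y * (PP n * y))
    - (A * gint A (Suc n)) \<cdot> (K * PP n)"
    using ge2.IH(2) by simp
  have IH0: "a * (PP n * X) = (A ^ n) \<cdot> (PP n * (a * X)) + (e * A * gint A n) \<cdot> (y * (PP (n - 1) * (y * X)))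
    - (A * gint A n) \<cdot> (K * (PP (n - 1) * X))" for X
    using arg_cong[OF ge2.IH(1), of "\<lambda>z. z * X"] by (simp add: scl_nf)
  have K_out: "b * (K * X) = K * (b * X)" "y * (K * X) = K * (y * X)" for X
    by (metis Kb mult.assoc, metis Ky mult.assoc)
  have "a * PP (Suc (Suc n)) = (a * b) * PP (Suc n) + (e * A * gint A (Suc n)) \<cdot> ((a * y) * (PP n * y))"
    by (simp add: PP_Suc[of "Suc n"] scl_nf)
  also have "(a * b) * PP (Suc n) = A \<cdot> (b * (a * PP (Suc n))) - A \<cdot> (K * PP (Suc n)) + (A * e) \<cdot> (y * (y * PP (Suc n)))"
    unfolding ab by (simp add: scl_nf)
  also have "b * (a * PP (Suc n)) = (A ^ Suc n) \<cdot> (b * (PP (Suc n) * a)) + (e * gint A (Suc n)) \<cdot> (y * (b * (PP n * y)))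
    - (A * gint A (Suc n)) \<cdot> (K * (b * PP n))"
    unfolding IH1 by (simp add: scl_nf by' K_out mult_ac)
  also have "b * (PP (Suc n) * a) = PP (Suc (Suc n)) * a - (e * A * gint A (Suc n)) \<cdot> (y * (PP n * (y * a)))"
    unfolding b_PP' by simp
  also have "b * (PP n * y) = PP (Suc n) * y - (e * A * gint A n) \<cdot> (y * (PP (n - 1) * (y * y)))"
    by (rule b_PP')
  also have "b * PP n = PP (Suc n) - (e * A * gint A n) \<cdot> (y * (PP (n - 1) * y))"
    by (rule b_PP)
  also have "(a * y) * (PP n * y) = (A ^ Suc n * A) \<cdot> (y * (PP n * (y * a)))
     + (A * (e * A * gint A n)) \<cdot> (y * (y * (PP (n - 1) * (y * y))))
     - (A * (A * gint A n)) \<cdot> (K * (y * (PP (n - 1) * y)))"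
  proof -
    have "(a * y) * (PP n * y) = A \<cdot> (y * (a * (PP n * y)))" unfolding ay by (simp add: scl_nf)
    then show ?thesis unfolding IH0 by (simp add: ay scl_nf K_out mult_ac)
  qed
  finally have *: "a * PP (Suc (Suc n)) = (A ^ Suc (Suc n)) \<cdot> (PP (Suc (Suc n)) * a)
     + (e * A) \<cdot> (y * (y * PP (Suc n))) + (e * A * gint A (Suc n)) \<cdot> (y * (PP (Suc n) * y))
     - (e * A * (e * A * (1 - A) * gint A (Suc n) * gint A n)) \<cdot> (y * (y * (PP (n - 1) * (y * y))))
     - (A + (A * A * gint A (Suc n))) \<cdot> (K * PP (Suc n))"
    by (simp add: scl_nf scale_left_distrib scale_left_diff_distrib algebra_simps)
  have 1: "A + (A * A * gint A (Suc n)) = (A * gint A (Suc (Suc n)))"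
    unfolding gint_Suc'[of "Suc n"] by (simp add: algebra_simps)
  have 2: "y * (y * PP (Suc n)) = (A ^ Suc n) \<cdot> (y * (PP (Suc n) * y)) +
     (e * A * (1 - A) * gint A (Suc n) * gint A n) \<cdot> (y * (y * (PP (n - 1) * (y * y))))"
    using arg_cong[OF y_PP[of "Suc n"], of "\<lambda>z. y * z"] by (simp add: scl_nf)
  have "a * PP (Suc (Suc n)) = (A ^ Suc (Suc n)) \<cdot> (PP (Suc (Suc n)) * a)
     + ((e * A * A ^ Suc n) + (e * A * gint A (Suc n))) \<cdot> (y * (PP (Suc n) * y))
     - (A * gint A (Suc (Suc n))) \<cdot> (K * PP (Suc n))"
    unfolding * 1 2 by (simp add: scl_nf scale_left_distrib scale_left_diff_distrib algebra_simps)
  then show ?case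
    unfolding gint_Suc[of A "Suc n"] by (simp add: algebra_simps)
qed

definition Zs :: "nat \<Rightarrow> 'r" where
  "Zs k = (\<Sum>n\<le>k. cf k n \<cdot> (PP (k - n) * zs n))"

lemma x_step:
  "x * (PP s * zs n) - (A ^ (s + n) / p) \<cdot> (PP s * zs n * x) =
    (1 - A ^ (s + n + n) / (p * p)) \<cdot> (PP (Suc s) * zs n) + A ^ s \<cdot> (PP s * zs (Suc n))
    - (A * gint A s) \<cdot> (K * (PP (s - 1) * zs n))
    + (A ^ (s + n + n) / (p * p) * (e * A * gint A s)) \<cdot> (PP (s - 1) * (y * (y * zs n)))
    + (A ^ (s + n + n) / (p * p) * (e * bt n)) \<cdot> (PP s * (y * (y * zs (n - 1))))"
proof -
  have zb: "zs n * b = (A ^ n / p) \<cdot> (b * zs n) - (A ^ n / p * (e * bt n)) \<cdot> (y * (y * zs (n - 1)))"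
    unfolding b_zs by (simp add: scl_nf)
  have 1: "x * (PP s * zs n) = (b * PP s) * zs n + (a * PP s) * zs n"
    by (simp add: x_def scl_nf)
  have 2: "PP s * zs n * x = PP s * (zs n * a) + PP s * (zs n * b)"
    by (simp add: x_def scl_nf)
  have 3: "PP s * (zs n * b) = (A ^ n / p) \<cdot> ((PP s * b) * zs n) - (A ^ n / p * (e * bt n)) \<cdot> (PP s * (y * (y * zs (n - 1))))"
    unfolding zb by (simp add: scl_nf)
  show ?thesis
    unfolding 1 2 3 b_PP PP_b a_PP
    by (simp add: scl_nf scale_left_diff_distrib a_zs power_add mult_ac)
qed

lemma Zs_Suc:
  "Zs (Suc k) = (x * Zs k - (A ^ k / p) \<cdot> (Zs k * x)) + (A * gint A k * \<mu> (k - 1)) \<cdot> (K * Zs (k - 1))"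
proof -
  let ?\<phi> = "\<lambda>n. A ^ (k + n) / (p * p)"
  define S1 where "S1 = (\<Sum>n\<le>k. (cf k n * (1 - ?\<phi> n)) \<cdot> (PP (Suc k - n) * zs n))"
  define S2 where "S2 = (\<Sum>n\<le>k. (cf k n * A ^ (k - n)) \<cdot> (PP (k - n) * zs (Suc n)))"
  define S3 where "S3 = (\<Sum>n\<le>k. (cf k n * (A * gint A (k - n))) \<cdot> (K * (PP (k - n - 1) * zs n)))"
  define S4 where "S4 = (\<Sum>n\<le>k. (cf k n * (?\<phi> n * (e * A * gint A (k - n)))) \<cdot> (PP (k - n - 1) * (y * (y * zs n))))"
  define S5 where "S5 = (\<Sum>n\<le>k. (cf k n * (?\<phi> n * (e * bt n))) \<cdot> (PP (k - n) * (y * (y * zs (n - 1)))))"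
  have "x * Zs k - (A ^ k / p) \<cdot> (Zs k * x) =
     (\<Sum>n\<le>k. cf k n \<cdot> (x * (PP (k - n) * zs n) - (A ^ k / p) \<cdot> (PP (k - n) * zs n * x)))"
    by (simp add: Zs_def sum_distrib_left sum_distrib_right scl_mult_left scl_mult_right
        scale_sum_right scale_right_diff_distrib sum_subtractf mult_ac)
  also have "\<dots> = (\<Sum>n\<le>k. (cf k n * (1 - ?\<phi> n)) \<cdot> (PP (Suc k - n) * zs n)
     + (cf k n * A ^ (k - n)) \<cdot> (PP (k - n) * zs (Suc n))
     - (cf k n * (A * gint A (k - n))) \<cdot> (K * (PP (k - n - 1) * zs n))
     + (cf k n * (?\<phi> n * (e * A * gint A (k - n)))) \<cdot> (PP (k - n - 1) * (y * (y * zs n)))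
     + (cf k n * (?\<phi> n * (e * bt n))) \<cdot> (PP (k - n) * (y * (y * zs (n - 1)))))"
  proof (rule sum.cong)
    fix n assume "n \<in> {..k}"
    then have k: "k - n + n = k" "Suc (k - n) = Suc k - n" by auto
    show "cf k n \<cdot> (x * (PP (k - n) * zs n) - (A ^ k / p) \<cdot> (PP (k - n) * zs n * x)) =
       (cf k n * (1 - ?\<phi> n)) \<cdot> (PP (Suc k - n) * zs n)
     + (cf k n * A ^ (k - n)) \<cdot> (PP (k - n) * zs (Suc n))
     - (cf k n * (A * gint A (k - n))) \<cdot> (K * (PP (k - n - 1) * zs n))
     + (cf k n * (?\<phi> n * (e * A * gint A (k - n)))) \<cdot> (PP (k - n - 1) * (y * (y * zs n)))
     + (cf k n * (?\<phi> n * (e * bt n))) \<cdot> (PP (k - n) * (y * (y * zs (n - 1))))"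
      using x_step[of "k - n" n] unfolding k
      by (simp only: scale_right_distrib scale_right_diff_distrib scale_scale)
  qed simp
  also have "\<dots> = S1 + S2 - S3 + S4 + S5"
    by (simp add: S1_def S2_def S3_def S4_def S5_def sum.distrib sum_subtractf)
  finally have step: "x * Zs k - (A ^ k / p) \<cdot> (Zs k * x) = S1 + S2 - S3 + S4 + S5" .
  have "S3 = (A * gint A k * \<mu> (k - 1)) \<cdot> (K * Zs (k - 1))"
  proof (cases k)
    case 0 then show ?thesis by (simp add: S3_def)
  next
    case (Suc j)
    have "S3 = (\<Sum>n\<le>j. (cf k n * (A * gint A (k - n))) \<cdot> (K * (PP (k - n - 1) * zs n)))"
      by (simp add: S3_def Suc)
    also have "\<dots> = (\<Sum>n\<le>j. (A * gint A k * \<mu> j) \<cdot> (K * (cf j n \<cdot> (PP (j - n) * zs n))))"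
    proof (rule sum.cong)
      fix n assume n: "n \<in> {..j}"
      then have "cf k n * (A * gint A (k - n)) = A * gint A k * \<mu> j * cf j n"
        using cf_step_down[of n j] by (simp add: Suc mult_ac)
      then show "(cf k n * (A * gint A (k - n))) \<cdot> (K * (PP (k - n - 1) * zs n)) =
        (A * gint A k * \<mu> j) \<cdot> (K * (cf j n \<cdot> (PP (j - n) * zs n)))"
        using n by (simp add: Suc scl_mult_right)
    qed simp
    finally show ?thesis
      by (simp add: Suc Zs_def sum_distrib_left scale_sum_right)
  qed
  moreover have "S4 + S5 = 0"
  proof (cases k)
    case 0 then show ?thesis by (simp add: S4_def S5_def)
  next
    case (Suc j)
    have "S4 = (\<Sum>n\<le>j. (cf k n * (?\<phi> n * (e * A * gint A (k - n)))) \<cdot> (PP (k - n - 1) * (y * (y * zs n))))"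
      by (simp add: S4_def Suc)
    moreover have "S5 = (\<Sum>n\<le>j. (cf k (Suc n) * (?\<phi> (Suc n) * (e * bt (Suc n)))) \<cdot> (PP (k - Suc n) * (y * (y * zs n))))"
      unfolding S5_def Suc sum.atMost_Suc_shift by simp
    moreover have "cf k n * (?\<phi> n * (e * A * gint A (k - n))) + cf k (Suc n) * (?\<phi> (Suc n) * (e * bt (Suc n))) = 0"
      if "n \<le> j" for n
    proof -
      have "cf k n * (?\<phi> n * (e * A * gint A (k - n))) = ?\<phi> n * e * A * (cf k n * gint A (k - n))"
        by (simp only: mult_ac)
      also have "\<dots> = ?\<phi> n * e * A * (cf k (Suc n) * gint A (Suc n) * \<mu> n)"
        using cf_step_right[of n k] that Suc by simp
      finally show ?thesis by (simp add: bt_def)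
    qed
    ultimately show ?thesis
      by (simp add: sum.distrib[symmetric] scale_left_distrib[symmetric])
  qed
  moreover have "S1 + S2 = Zs (Suc k)"
  proof -
    have "Zs (Suc k) = (\<Sum>n\<le>Suc k. (if n = 0 then 0 else A ^ (Suc k - n) * cf k (n - 1)) \<cdot> (PP (Suc k - n) * zs n))
       + (\<Sum>n\<le>Suc k. (if n \<le> k then (1 - ?\<phi> n) * cf k n else 0) \<cdot> (PP (Suc k - n) * zs n))"
      unfolding Zs_def sum.distrib[symmetric]
      by (rule sum.cong) (simp_all add: cf_sum_shift scale_left_distrib)
    also have "(\<Sum>n\<le>Suc k. (if n \<le> k then (1 - ?\<phi> n) * cf k n else 0) \<cdot> (PP (Suc k - n) * zs n)) = S1"
      by (simp add: S1_def mult.commute)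
    also have "(\<Sum>n\<le>Suc k. (if n = 0 then 0 else A ^ (Suc k - n) * cf k (n - 1)) \<cdot> (PP (Suc k - n) * zs n)) = S2"
      unfolding sum.atMost_Suc_shift by (simp add: S2_def mult.commute)
    finally show ?thesis by simp
  qed
  ultimately show ?thesis
    unfolding step by (simp add: add.assoc)
qed

text \<open>
  Both sides of the recursion are evaluated on \<open>\<Sum>\<^sub>n cf k n PP (k - n) z\<^sub>n\<close>, which satisfies the
  three-term recursion of the continuant. All coefficients except the one of \<open>z\<^sub>m\<close> vanish for \<open>k = m\<close>.
\<close>

theorem continuant_eq_zs:
  "continuant (\<lambda>k z. x * z - (A ^ k / p) \<cdot> (z * x)) (\<lambda>k z. (A * gint A k * \<mu> (k - 1)) \<cdot> (K * z)) w m = zs m"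
proof -
  have "continuant (\<lambda>k z. x * z - (A ^ k / p) \<cdot> (z * x)) (\<lambda>k z. (A * gint A k * \<mu> (k - 1)) \<cdot> (K * z)) w k = Zs k" for k
  proof (induction k rule: induct_nat_012)
    case 0 show ?case by (simp add: Zs_def)
  next
    case 1 show ?case using Zs_Suc[of 0] by (simp add: Zs_def)
  next
    case (ge2 n) then show ?case using Zs_Suc[of "Suc n"] by simp
  qed
  moreover have "Zs m = zs m"
  proof -
    have "Zs m = (\<Sum>n\<in>{m}. cf m n \<cdot> (PP (m - n) * zs n))"
      unfolding Zs_def by (rule sum.mono_neutral_right) (auto simp: cf_top)
    then show ?thesis by simp
  qed
  ultimately show ?thesis by simp
qed

lemma bt_top [simp]: "bt m = 0"
  by (simp only: bt_def \<mu>_top mult_zero_right)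

lemma b_zs_top: "b * zs m = (p / A ^ m) \<cdot> (zs m * b)"
  by (simp add: b_zs)

end

text \<open>
  Here \<open>b\<close> \<open>q\<close>-commutes with \<open>a\<close>, but with \<open>w\<close> only up to \<open>K - \<kappa>\<close>. This is the situation of
  \<open>a = F\<^sub>i\<close>, \<open>b = E\<^sub>j K'\<^sub>i\<close>, \<open>w = F\<^sub>j\<close> for \<open>j = \<tau> i \<noteq> i\<close>.
\<close>

locale serre_pair_3 = serre_pair scl A p m a b w
  for scl :: "'k::field \<Rightarrow> 'r::ring_1 \<Rightarrow> 'r" (infixr \<open>\<cdot>\<close> 75) and A p :: 'k and m :: nat and a b w :: 'r +
  fixes K \<kappa> :: 'r
  assumes ba: "b * a = (inverse A) \<cdot> (a * b)"
    and bw: "b * w = p \<cdot> (w * b) + K - \<kappa>"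
    and Ka: "K * a = inverse (A * p) \<cdot> (a * K)" and Kb: "K * b = inverse (A * p) \<cdot> (b * K)"
    and ka: "\<kappa> * a = (p / A) \<cdot> (a * \<kappa>)" and kb: "\<kappa> * b = (A / p) \<cdot> (b * \<kappa>)"
begin

lemma ab: "a * b = A \<cdot> (b * a)"
  unfolding ba by (simp add: scl_nf)

lemma a_bpow: "a * b ^ n = A ^ n \<cdot> (b ^ n * a)"
proof (induction n)
  case (Suc n)
  have "a * b ^ Suc n = (a * b) * b ^ n" by (simp add: mult.assoc)
  also have "\<dots> = A \<cdot> (b * (a * b ^ n))" unfolding ab by (simp add: scl_nf)
  finally show ?case unfolding Suc by (simp add: scl_nf)
qed simp

definition dd :: "nat \<Rightarrow> 'k" where "dd n = (\<Prod>l<n. \<mu> l)"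

lemma b_zs: "b * zs n = (p / A ^ n) \<cdot> (zs n * b) + (dd n / A ^ n) \<cdot> (a ^ n * K) - (if n = 0 then \<kappa> else 0)"
proof (induction n)
  case 0 show ?case by (simp add: bw dd_def)
next
  case (Suc n)
  have 1: "b * zs (Suc n) = (b * a) * zs n - (A ^ n / p) \<cdot> ((b * zs n) * a)"
    by (simp add: zs_Suc scl_nf)
  have 2: "(b * a) * zs n = inverse A \<cdot> (a * (b * zs n))"
    unfolding ba by (simp add: scl_nf)
  have 3: "(p / A ^ Suc n) \<cdot> (zs (Suc n) * b) = (inverse A * (p / A ^ n)) \<cdot> (a * (zs n * b)) - inverse A \<cdot> (zs n * (a * b))"
    by (simp add: zs_Suc scl_nf field_simps)
  have a_pow': "a ^ j * (a * X) = a * (a ^ j * X)" for j X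
    by (simp add: mult.assoc[symmetric] power_commutes)
  have 6: "dd (Suc n) / A ^ Suc n = inverse A * (dd n / A ^ n) - A ^ n / p * (dd n / A ^ n * inverse (A * p))"
    by (simp add: dd_def \<mu>_def field_simps)
  have k: "inverse A \<cdot> (a * \<kappa>) - (1 / p) \<cdot> (\<kappa> * a) = 0"
    unfolding ka by (simp add: scl_nf field_simps)
  have "b * zs (Suc n) = (inverse A * (p / A ^ n)) \<cdot> (a * (zs n * b)) - inverse A \<cdot> (zs n * (a * b))
      + (inverse A * (dd n / A ^ n)) \<cdot> (a ^ Suc n * K) - (A ^ n / p * (dd n / A ^ n * inverse (A * p))) \<cdot> (a ^ Suc n * K)
      - (if n = 0 then inverse A \<cdot> (a * \<kappa>) - (1 / p) \<cdot> (\<kappa> * a) else 0)"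
    unfolding 1 2 Suc
    by (cases n) (simp_all add: scl_nf ba Ka[unfolded inverse_mult_distrib] a_pow')
  then show ?case
    unfolding k 6 3 by (simp add: scale_left_diff_distrib)
qed

definition Ws :: "nat \<Rightarrow> 'r" where
  "Ws k = (\<Sum>n\<le>k. cf k n \<cdot> (b ^ (k - n) * zs n))"

lemma x_pow: "x ^ k = (\<Sum>n\<le>k. gbinom A k n \<cdot> (b ^ (k - n) * a ^ n))"
proof (induction k)
  case 0 show ?case by simp
next
  case (Suc k)
  have 1: "x * (b ^ s * a ^ n) = b ^ Suc s * a ^ n + A ^ s \<cdot> (b ^ s * a ^ Suc n)" for s n
  proof -
    have "x * (b ^ s * a ^ n) = b ^ Suc s * a ^ n + (a * b ^ s) * a ^ n"
      by (simp add: x_def distrib_right mult.assoc)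
    then show ?thesis unfolding a_bpow by (simp add: scl_nf)
  qed
  have P: "gbinom A (Suc k) n = (if n \<le> k then gbinom A k n else 0) + (if n = 0 then 0 else A ^ (Suc k - n) * gbinom A k (n - 1))"
    if "n \<le> Suc k" for n
  proof (cases n)
    case (Suc j)
    then show ?thesis using that gbinom_Pascal[of j k] by (cases "j = k") auto
  qed simp
  have "x ^ Suc k = (\<Sum>n\<le>k. gbinom A k n \<cdot> (b ^ (Suc k - n) * a ^ n)) + (\<Sum>n\<le>k. (A ^ (k - n) * gbinom A k n) \<cdot> (b ^ (k - n) * a ^ Suc n))"
    unfolding power_Suc Suc.IH
    by (simp add: sum_distrib_left scl_mult_right 1 scale_right_distrib sum.distrib Suc_diff_le mult.commute)
  also have "(\<Sum>n\<le>k. gbinom A k n \<cdot> (b ^ (Suc k - n) * a ^ n)) =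
     (\<Sum>n\<le>Suc k. (if n \<le> k then gbinom A k n else 0) \<cdot> (b ^ (Suc k - n) * a ^ n))" by simp
  also have "(\<Sum>n\<le>k. (A ^ (k - n) * gbinom A k n) \<cdot> (b ^ (k - n) * a ^ Suc n)) =
     (\<Sum>n\<le>Suc k. (if n = 0 then 0 else A ^ (Suc k - n) * gbinom A k (n - 1)) \<cdot> (b ^ (Suc k - n) * a ^ n))"
    unfolding sum.atMost_Suc_shift by simp
  finally show ?case
    unfolding sum.distrib[symmetric] by (simp add: P scale_left_distrib)
qed

lemma x_step:
  "x * (b ^ s * zs n) - (A ^ (s + n) / p) \<cdot> (b ^ s * zs n * x) =
    (1 - A ^ (s + n + n) / (p * p)) \<cdot> (b ^ Suc s * zs n) + A ^ s \<cdot> (b ^ s * zs (Suc n))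
    + (A ^ (s + n) / (p * p) * dd n) \<cdot> (b ^ s * (a ^ n * K))
    - (if n = 0 then (A ^ s / (p * p)) \<cdot> (b ^ s * \<kappa>) else 0)"
proof -
  have zb: "zs n * b = (A ^ n / p) \<cdot> (b * zs n) - (dd n / p) \<cdot> (a ^ n * K) + (if n = 0 then (1 / p) \<cdot> \<kappa> else 0)"
    unfolding b_zs by (simp add: scl_nf)
  have 1: "x * (b ^ s * zs n) = b ^ Suc s * zs n + (a * b ^ s) * zs n"
    by (simp add: x_def scl_nf)
  have 2: "b ^ s * zs n * x = b ^ s * (zs n * a) + b ^ s * (zs n * b)"
    by (simp add: x_def scl_nf)
  have 3: "b ^ s * (b * zs n) = b ^ Suc s * zs n"
    by (simp add: power_commutes mult.assoc[symmetric])
  show ?thesis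
    unfolding 1 2 zb a_bpow
    by (simp add: scl_nf scale_left_diff_distrib a_zs power_add mult_ac 3[unfolded power_Suc mult.assoc])
qed

lemma cf_dd: "n \<le> k \<Longrightarrow> cf k n * dd n = gbinom A k n * dd k"
  using prod.atLeastLessThan_concat[of 0 n k \<mu>] by (simp add: cf_def dd_def lessThan_atLeast0 mult_ac)

lemma Ws_Suc:
  "x * Ws k - (A ^ k / p) \<cdot> (Ws k * x) = Ws (Suc k) + (A ^ k / (p * p) * dd k) \<cdot> (x ^ k * K - b ^ k * \<kappa>)"
proof -
  let ?\<phi> = "\<lambda>n. A ^ (k + n) / (p * p)"
  define S1 where "S1 = (\<Sum>n\<le>k. (cf k n * (1 - ?\<phi> n)) \<cdot> (b ^ (Suc k - n) * zs n))"
  define S2 where "S2 = (\<Sum>n\<le>k. (cf k n * A ^ (k - n)) \<cdot> (b ^ (k - n) * zs (Suc n)))"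
  define S3 where "S3 = (\<Sum>n\<le>k. (cf k n * (A ^ k / (p * p) * dd n)) \<cdot> (b ^ (k - n) * (a ^ n * K)))"
  define S4 where "S4 = (\<Sum>n\<le>k. (if n = 0 then (cf k n * (A ^ (k - n) / (p * p))) \<cdot> (b ^ (k - n) * \<kappa>) else 0))"
  have "x * Ws k - (A ^ k / p) \<cdot> (Ws k * x) =
     (\<Sum>n\<le>k. cf k n \<cdot> (x * (b ^ (k - n) * zs n) - (A ^ k / p) \<cdot> (b ^ (k - n) * zs n * x)))"
    by (simp add: Ws_def sum_distrib_left sum_distrib_right scl_mult_left scl_mult_right
        scale_sum_right scale_right_diff_distrib sum_subtractf mult_ac)
  also have "\<dots> = (\<Sum>n\<le>k. (cf k n * (1 - ?\<phi> n)) \<cdot> (b ^ (Suc k - n) * zs n)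
     + (cf k n * A ^ (k - n)) \<cdot> (b ^ (k - n) * zs (Suc n))
     + (cf k n * (A ^ k / (p * p) * dd n)) \<cdot> (b ^ (k - n) * (a ^ n * K))
     - (if n = 0 then (cf k n * (A ^ (k - n) / (p * p))) \<cdot> (b ^ (k - n) * \<kappa>) else 0))"
  proof (rule sum.cong)
    fix n assume "n \<in> {..k}"
    then have k: "k - n + n = k" "Suc (k - n) = Suc k - n" by auto
    show "cf k n \<cdot> (x * (b ^ (k - n) * zs n) - (A ^ k / p) \<cdot> (b ^ (k - n) * zs n * x)) =
       (cf k n * (1 - ?\<phi> n)) \<cdot> (b ^ (Suc k - n) * zs n)
     + (cf k n * A ^ (k - n)) \<cdot> (b ^ (k - n) * zs (Suc n))
     + (cf k n * (A ^ k / (p * p) * dd n)) \<cdot> (b ^ (k - n) * (a ^ n * K))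
     - (if n = 0 then (cf k n * (A ^ (k - n) / (p * p))) \<cdot> (b ^ (k - n) * \<kappa>) else 0)"
      using x_step[of "k - n" n] unfolding k
      by (simp only: scale_right_distrib scale_right_diff_distrib scale_scale if_distrib[of "(\<cdot>) (cf k n)"] scale_zero_right)
  qed simp
  also have "\<dots> = S1 + S2 + S3 - S4"
    by (simp add: S1_def S2_def S3_def S4_def sum.distrib sum_subtractf)
  finally have step: "x * Ws k - (A ^ k / p) \<cdot> (Ws k * x) = S1 + S2 + S3 - S4" .
  have "S3 = (A ^ k / (p * p) * dd k) \<cdot> (x ^ k * K)"
    unfolding S3_def x_pow sum_distrib_right scale_sum_right
  proof (rule sum.cong)
    fix n assume "n \<in> {..k}"
    then have "cf k n * (A ^ k / (p * p) * dd n) = A ^ k / (p * p) * dd k * gbinom A k n"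
      using cf_dd[of n k] by (simp add: mult_ac)
    then show "(cf k n * (A ^ k / (p * p) * dd n)) \<cdot> (b ^ (k - n) * (a ^ n * K)) =
      (A ^ k / (p * p) * dd k) \<cdot> (gbinom A k n \<cdot> (b ^ (k - n) * a ^ n) * K)"
      by (simp add: scl_nf)
  qed simp
  moreover have "S4 = (A ^ k / (p * p) * dd k) \<cdot> (b ^ k * \<kappa>)"
    using cf_dd[of 0 k] by (simp add: S4_def dd_def mult.commute)
  moreover have "S1 + S2 = Ws (Suc k)"
  proof -
    have "Ws (Suc k) = (\<Sum>n\<le>Suc k. (if n = 0 then 0 else A ^ (Suc k - n) * cf k (n - 1)) \<cdot> (b ^ (Suc k - n) * zs n))
       + (\<Sum>n\<le>Suc k. (if n \<le> k then (1 - ?\<phi> n) * cf k n else 0) \<cdot> (b ^ (Suc k - n) * zs n))"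
      unfolding Ws_def sum.distrib[symmetric]
      by (rule sum.cong) (simp_all add: cf_sum_shift scale_left_distrib del: power_Suc)
    also have "(\<Sum>n\<le>Suc k. (if n \<le> k then (1 - ?\<phi> n) * cf k n else 0) \<cdot> (b ^ (Suc k - n) * zs n)) = S1"
      by (simp add: S1_def mult.commute)
    also have "(\<Sum>n\<le>Suc k. (if n = 0 then 0 else A ^ (Suc k - n) * cf k (n - 1)) \<cdot> (b ^ (Suc k - n) * zs n)) = S2"
      unfolding sum.atMost_Suc_shift by (simp add: S2_def mult.commute)
    finally show ?thesis by simp
  qed
  ultimately show ?thesis
    unfolding step by (simp add: scale_right_diff_distrib)
qed

end

primrec (in serre_coeffs) \<xi> :: "nat \<Rightarrow> 'k" where
  "\<xi> 0 = 0"
| "\<xi> (Suc k) = \<mu> (k - 1) * \<xi> k + A ^ k / (p * p) * (\<Prod>l<k. \<mu> l)"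

context serre_pair_3
begin

lemma qprod_x:
  "qprod (inverse p) A (\<lambda>z. x * z) (\<lambda>z. z * x) w k = Ws k + \<xi> k \<cdot> (x ^ (k - 1) * K)
     - (gint A k / (p * p) * (\<Prod>l\<in>{1..<k}. \<mu> l)) \<cdot> (b ^ (k - 1) * \<kappa>)"
proof (induction k)
  case 0 show ?case by (simp add: Ws_def)
next
  case (Suc k)
  let ?\<alpha> = "\<lambda>z. x * z - (A ^ k / p) \<cdot> (z * x)"
  let ?\<zeta> = "\<lambda>k. gint A k / (p * p) * (\<Prod>l\<in>{1..<k}. \<mu> l)"
  have lin: "?\<alpha> (u + c \<cdot> v - d \<cdot> v') = ?\<alpha> u + c \<cdot> ?\<alpha> v - d \<cdot> ?\<alpha> v'" for u v v' c d
    by (simp add: scl_nf mult_ac)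
  have "qprod (inverse p) A (\<lambda>z. x * z) (\<lambda>z. z * x) w (Suc k) =
      ?\<alpha> (Ws k + \<xi> k \<cdot> (x ^ (k - 1) * K) - ?\<zeta> k \<cdot> (b ^ (k - 1) * \<kappa>))"
    by (simp add: Suc divide_inverse mult.commute)
  also have "\<dots> = ?\<alpha> (Ws k) + \<xi> k \<cdot> ?\<alpha> (x ^ (k - 1) * K) - ?\<zeta> k \<cdot> ?\<alpha> (b ^ (k - 1) * \<kappa>)"
    by (rule lin)
  also have "\<xi> k \<cdot> ?\<alpha> (x ^ (k - 1) * K) = (\<mu> (k - 1) * \<xi> k) \<cdot> (x ^ k * K)"
  proof (cases k)
    case (Suc j)
    have "K * x = inverse (A * p) \<cdot> (x * K)" unfolding x_def by (simp only: distrib_left distrib_right Ka Kb scale_right_distrib)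
    then have "x ^ j * K * x = inverse (A * p) \<cdot> (x ^ Suc j * K)"
      by (simp only: mult.assoc scl_mult_right power_Suc2)
    then have "?\<alpha> (x ^ j * K) = x ^ Suc j * K - (A ^ k / p * inverse (A * p)) \<cdot> (x ^ Suc j * K)"
      by (simp add: mult.assoc)
    also have "A ^ k / p * inverse (A * p) = A ^ j / (p * p)"
      by (simp add: Suc field_simps)
    also have "x ^ Suc j * K - (A ^ j / (p * p)) \<cdot> (x ^ Suc j * K) = \<mu> j \<cdot> (x ^ k * K)"
      by (simp add: Suc \<mu>_def scale_left_diff_distrib)
    finally show ?thesis by (simp add: Suc mult.commute)
  qed simp
  also have "?\<zeta> k \<cdot> ?\<alpha> (b ^ (k - 1) * \<kappa>) = (\<mu> (Suc k) * ?\<zeta> k) \<cdot> (b ^ k * \<kappa>)"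
  proof (cases k)
    case (Suc j)
    have "b ^ j * \<kappa> * x = (p / A) \<cdot> ((b ^ j * a) * \<kappa>) + (A / p) \<cdot> (b ^ Suc j * \<kappa>)"
      unfolding x_def by (simp add: scl_nf ka kb) (simp add: mult.assoc[symmetric] power_commutes)
    moreover have "x * (b ^ j * \<kappa>) = A ^ j \<cdot> ((b ^ j * a) * \<kappa>) + b ^ Suc j * \<kappa>"
      unfolding x_def by (simp add: distrib_right mult.assoc[symmetric] a_bpow scl_mult_left)
    ultimately have "?\<alpha> (b ^ j * \<kappa>) = b ^ Suc j * \<kappa> - (A ^ k / p * (A / p)) \<cdot> (b ^ Suc j * \<kappa>)"
      by (simp add: Suc scale_right_distrib)
    also have "A ^ k / p * (A / p) = A ^ Suc k / (p * p)"
      by simp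
    also have "b ^ Suc j * \<kappa> - (A ^ Suc k / (p * p)) \<cdot> (b ^ Suc j * \<kappa>) = \<mu> (Suc k) \<cdot> (b ^ k * \<kappa>)"
      by (simp add: Suc \<mu>_def scale_left_diff_distrib)
    finally show ?thesis by (simp add: Suc mult.commute)
  qed simp
  also have "?\<alpha> (Ws k) = Ws (Suc k) + (A ^ k / (p * p) * dd k) \<cdot> (x ^ k * K - b ^ k * \<kappa>)"
    by (rule Ws_Suc)
  finally have *: "qprod (inverse p) A (\<lambda>z. x * z) (\<lambda>z. z * x) w (Suc k) =
    Ws (Suc k) + (\<mu> (k - 1) * \<xi> k + A ^ k / (p * p) * dd k) \<cdot> (x ^ k * K)
      - (\<mu> (Suc k) * ?\<zeta> k + A ^ k / (p * p) * dd k) \<cdot> (b ^ k * \<kappa>)"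
    by (simp add: scale_left_distrib scale_right_diff_distrib)
  have "\<mu> (Suc k) * ?\<zeta> k + A ^ k / (p * p) * dd k = ?\<zeta> (Suc k)"
  proof (cases k)
    case 0 then show ?thesis by (simp add: dd_def)
  next
    case (Suc j)
    define M where "M = (\<Prod>l\<in>{1..<k}. \<mu> l)"
    have 1: "dd k = \<mu> 0 * M"
      using prod.atLeast_Suc_lessThan[of 0 k \<mu>] Suc by (simp only: dd_def M_def lessThan_atLeast0 One_nat_def)
    have 2: "(\<Prod>l\<in>{1..<Suc k}. \<mu> l) = M * \<mu> k" unfolding M_def Suc by simp
    have g: "gint A k + A ^ k = 1 + A * gint A k"
    proof -
      have "(gint A k + A ^ k) * (1 - A) = (1 + A * gint A k) * (1 - A)"
        unfolding distrib_right mult.assoc gint_eq by (simp add: algebra_simps)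
      then show ?thesis by simp
    qed
    have "(gint A k + A ^ k) * \<mu> k = \<mu> (Suc k) * gint A k + A ^ k * \<mu> 0"
    proof -
      have "(gint A k + A ^ k) * \<mu> k = gint A k + A ^ k - A ^ k / (p * p) * (gint A k + A ^ k)"
        by (simp add: \<mu>_def algebra_simps)
      also have "\<dots> = gint A k + A ^ k - A ^ k / (p * p) * (1 + A * gint A k)" unfolding g ..
      also have "\<dots> = \<mu> (Suc k) * gint A k + A ^ k * \<mu> 0"
        by (simp add: \<mu>_def algebra_simps add_divide_distrib)
      finally show ?thesis .
    qed
    then have "(gint A k + A ^ k) / (p * p) * (M * \<mu> k) = (\<mu> (Suc k) * gint A k + A ^ k * \<mu> 0) / (p * p) * M"
      by (simp add: field_simps)
    then show ?thesis unfolding 1 2 M_def[symmetric] gint_Suc by (simp add: add_divide_distrib algebra_simps)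
  qed
  then show ?case unfolding * by (simp add: dd_def)
qed

text \<open>
  The inhomogeneous term \<open>K\<close> contributes \<open>\<xi> m x\<^sup>m\<^sup>-\<^sup>1 K\<close>. The contribution of \<open>\<kappa>\<close> carries the
  factor \<open>\<mu> 1 \<dots> \<mu> (m - 1)\<close>, which contains \<open>\<mu> (m - 1) = 0\<close> as soon as \<open>m \<ge> 2\<close>.
\<close>

theorem qprod_x_top:
  assumes "m \<ge> 2"
  shows "qprod (inverse p) A (\<lambda>z. x * z) (\<lambda>z. z * x) w m = zs m + \<xi> m \<cdot> (x ^ (m - 1) * K)"
proof -
  have "(\<Prod>l\<in>{1..<m}. \<mu> l) = 0"
    by (rule prod_zero) (use assms \<mu>_top in auto)
  moreover have "Ws m = zs m"
  proof -
    have "Ws m = (\<Sum>n\<in>{m}. cf m n \<cdot> (b ^ (m - n) * zs n))"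
      unfolding Ws_def by (rule sum.mono_neutral_right) (auto simp: cf_top)
    then show ?thesis by simp
  qed
  ultimately show ?thesis by (simp add: qprod_x)
qed

end

section \<open>The field of rational functions and quantum binomials\<close>

lemma qv_power: "qv ^ n = Fract (monom 1 n) 1"
  by (induction n) (simp_all add: qv_def One_fract_def[symmetric] mult_monom monom_Suc)

lemma qv_nonzero [simp]: "qv \<noteq> 0"
  by (simp add: qv_def Zero_fract_def eq_fract)

lemma qv_power_neq_1: "n > 0 \<Longrightarrow> qv ^ n \<noteq> 1"
proof
  assume n: "n > 0" and "qv ^ n = 1"
  then have "monom (1::rat) n = 1" by (simp add: qv_power One_fract_def eq_fract)
  then have "degree (monom (1::rat) n) = 0" by simp
  then show False using n by (simp add: degree_monom_eq)
qed

text \<open>The two parameters \<open>v\<close> and \<open>v\<^sup>-\<^sup>1\<close> give the same quantum integers.\<close>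

definition qpar :: "rat poly fract \<Rightarrow> bool" where "qpar u \<longleftrightarrow> u = qv \<or> u = inverse qv"

lemma qpar_nonzero: "qpar u \<Longrightarrow> u \<noteq> 0"
  by (auto simp: qpar_def)

lemma qpar_power_neq_1: "qpar u \<Longrightarrow> n > 0 \<Longrightarrow> u ^ n \<noteq> 1"
  using qv_power_neq_1 by (auto simp: qpar_def power_inverse)

lemma qpar_not_root: assumes "qpar u" shows "not_root_of_unity (inverse (u ^ 2))"
proof
  show "inverse (u ^ 2) \<noteq> 0" using qpar_nonzero[OF assms] by simp
  fix n :: nat assume "n > 0"
  then show "inverse (u ^ 2) ^ n \<noteq> 1"
    using qpar_power_neq_1[OF assms, of "2 * n"] by (simp add: power_inverse power_mult)
qed

lemma qint_gint:
  assumes "qpar u" shows "qint (Suc n) = u ^ n * gint (inverse (u ^ 2)) (Suc n)"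
proof -
  interpret not_root_of_unity "inverse (u ^ 2)" by (rule qpar_not_root[OF assms])
  have u0: "u \<noteq> 0" by (rule qpar_nonzero[OF assms])
  have nz: "1 - inverse (u ^ 2) \<noteq> 0" using A_neq_1 by simp
  have nz': "u - inverse u \<noteq> 0"
  proof
    assume "u - inverse u = 0"
    then have "u ^ 2 = 1" using u0 by (simp add: field_simps power2_eq_square)
    then show False using qpar_power_neq_1[OF assms, of 2] by simp
  qed
  have sym: "qint (Suc n) = (u ^ Suc n - inverse u ^ Suc n) / (u - inverse u)"
  proof (cases "u = qv")
    case False
    then have u: "inverse qv = u" "qv = inverse u" using assms by (auto simp: qpar_def)
    have "qint (Suc n) = (inverse u ^ Suc n - u ^ Suc n) / (inverse u - u)"
      unfolding qint_def u(1) unfolding u(2) by simp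
    also have "\<dots> = (- (inverse u ^ Suc n - u ^ Suc n)) / (- (inverse u - u))" by (rule minus_divide_divide[symmetric])
    finally show ?thesis by simp
  qed (simp add: qint_def)
  have "gint (inverse (u ^ 2)) (Suc n) = (1 - inverse (u ^ 2) ^ Suc n) / (1 - inverse (u ^ 2))"
    using gint_eq[of "inverse (u ^ 2)" "Suc n"] nz by (simp add: field_simps)
  moreover have "u - inverse u = u * (1 - inverse (u ^ 2))"
    using u0 by (simp add: field_simps power2_eq_square)
  moreover have "u ^ Suc n - inverse u ^ Suc n = u * (u ^ n * (1 - inverse (u ^ 2) ^ Suc n))"
  proof -
    have "inverse (u ^ 2) ^ Suc n = inverse (u ^ Suc n) * inverse (u ^ Suc n)"
      by (simp add: power2_eq_square power_mult_distrib power_inverse)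
    then show ?thesis using u0 by (simp add: field_simps power_inverse)
  qed
  ultimately show ?thesis unfolding sym using u0 by simp
qed

lemma qfact_gfact:
  assumes "qpar u" shows "qfact n = u ^ (\<Sum>k<n. k) * gfact (inverse (u ^ 2)) n"
proof (induction n)
  case 0 show ?case by (simp add: qfact_def)
next
  case (Suc n)
  have "qfact (Suc n) = qint (Suc n) * qfact n" by (simp add: qfact_def mult.commute)
  then show ?case
    unfolding qint_gint[OF assms] Suc by (simp add: power_add mult_ac)
qed

lemma qbinom_gbinom:
  assumes "qpar u" "r \<le> n" shows "qbinom n r = u ^ (r * (n - r)) * gbinom (inverse (u ^ 2)) n r"
proof -
  have u0: "u \<noteq> 0" by (rule qpar_nonzero[OF assms(1)])
  obtain s where n: "n = r + s" using assms(2) le_iff_add by blast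
  have "(\<Sum>k<r + s. k) = (\<Sum>k<r. k) + (\<Sum>k<s. k) + r * s"
    by (induction s) auto
  then show ?thesis
    using u0 by (simp add: qbinom_def gbinom_def qfact_gfact[OF assms(1)] n power_add)
qed

definition serre_op ::
  "(rat poly fract \<Rightarrow> 'v \<Rightarrow> 'v) \<Rightarrow> ('v \<Rightarrow> 'v) \<Rightarrow> ('v \<Rightarrow> 'v) \<Rightarrow> 'v::ab_group_add \<Rightarrow> nat \<Rightarrow> 'v" where
  "serre_op s L R w m = (\<Sum>r\<le>m. s ((-1) ^ r * qbinom m r) ((L ^^ r) ((R ^^ (m - r)) w)))"

lemma qbinom_sym: "r \<le> m \<Longrightarrow> qbinom m (m - r) = qbinom m r"
  by (simp add: qbinom_def mult.commute)

lemma qprod_eq_serre_op: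
  fixes scale :: "rat poly fract \<Rightarrow> 'v::ab_group_add \<Rightarrow> 'v"
  assumes "vec scale" "qpar u"
    and L: "Vector_Spaces.linear scale scale L" and R: "Vector_Spaces.linear scale scale R"
    and comm: "\<And>x. L (R x) = R (L x)"
  shows "vec.qprod scale (u ^ (m - 1)) (inverse (u ^ 2)) L R w m = scale ((-1) ^ m) (serre_op scale L R w m)"
proof -
  interpret vec scale by fact
  have u0: "u \<noteq> 0" by (rule qpar_nonzero[OF assms(2)])
  have c: "(- (u ^ (m - 1))) ^ r * inverse (u ^ 2) ^ (r * (r - 1) div 2) * gbinom (inverse (u ^ 2)) m r
      = (- 1) ^ r * qbinom m r" if rm: "r \<le> m" for r
  proof -
    have "even (r * (r - 1))" by (cases r) auto
    then have e: "inverse (u ^ 2) ^ (r * (r - 1) div 2) = inverse (u ^ (r * (r - 1)))"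
      by (simp add: power_inverse power_mult[symmetric])
    have "(m - 1) * r = r * (m - r) + r * (r - 1)"
    proof (cases r)
      case (Suc j)
      obtain s where "m = Suc j + s" using le_Suc_ex[OF rm] Suc by auto
      then have m: "m - 1 = j + s" "m - r = s" using Suc by simp_all
      show ?thesis unfolding m unfolding Suc by (simp add: algebra_simps)
    qed simp
    then have "u ^ ((m - 1) * r) * inverse (u ^ (r * (r - 1))) = u ^ (r * (m - r))"
      using u0 by (simp add: power_add)
    moreover have "(- (u ^ (m - 1))) ^ r = (- 1) ^ r * u ^ ((m - 1) * r)"
      unfolding power_minus[of "u ^ (m - 1)"] power_mult ..
    ultimately show ?thesis
      unfolding e qbinom_gbinom[OF assms(2) rm] by (simp only: mult.assoc[symmetric]) (simp only: mult.assoc)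
  qed
  have "qprod (u ^ (m - 1)) (inverse (u ^ 2)) L R w m =
      (\<Sum>r\<le>m. scale ((- 1) ^ r * qbinom m r) ((L ^^ (m - r)) ((R ^^ r) w)))"
    unfolding qprod_expand[OF qpar_not_root[OF assms(2)] L R comm] by (rule sum.cong) (simp_all only: c atMost_iff)
  also have "\<dots> = (\<Sum>r\<le>m. scale ((- 1) ^ (m - r) * qbinom m r) ((L ^^ r) ((R ^^ (m - r)) w)))"
    unfolding atLeast0AtMost[symmetric]
    by (subst sum.atLeastAtMost_rev) (rule sum.cong, simp_all add: qbinom_sym)
  also have "\<dots> = scale ((-1) ^ m) (serre_op scale L R w m)"
    unfolding serre_op_def scale_sum_right
  proof (rule sum.cong)
    fix r assume "r \<in> {..m}"
    then have "(- 1 :: rat poly fract) ^ (m - r) = (- 1) ^ m * (- 1) ^ r"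
      by (auto simp: minus_one_power_iff)
    then show "scale ((- 1) ^ (m - r) * qbinom m r) ((L ^^ r) ((R ^^ (m - r)) w)) =
        scale ((- 1) ^ m) (scale ((- 1) ^ r * qbinom m r) ((L ^^ r) ((R ^^ (m - r)) w)))"
      by (simp add: mult.assoc)
  qed simp
  finally show ?thesis .
qed

text \<open>
  Stated for two commuting operators instead of left and right multiplication, the Serre expression
  can be transported from words to the algebra that the words are evaluated in.
\<close>

lemma serre_op_intertwine:
  assumes "vec s" "vec t" "Vector_Spaces.linear s t f"
    "\<And>x. f (L x) = L' (f x)" "\<And>x. f (R x) = R' (f x)"
  shows "f (serre_op s L R w m) = serre_op t L' R' (f w) m"
proof -
  interpret f: Vector_Spaces.linear s t f by fact
  have "f ((L ^^ n) x) = (L' ^^ n) (f x)" "f ((R ^^ n) x) = (R' ^^ n) (f x)" for n x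
    by (induction n) (simp_all add: assms)
  then show ?thesis by (simp add: serre_op_def f.sum f.scale)
qed

section \<open>Associative algebras as records\<close>

locale kalg = ring A for A :: "('k::field, 'a, 'c) module_scheme" (structure) +
  assumes smult_closed [simp, intro]: "x \<in> carrier A \<Longrightarrow> c \<odot> x \<in> carrier A"
    and smult_l_distr: "x \<in> carrier A \<Longrightarrow> (c + d) \<odot> x = c \<odot> x \<oplus> d \<odot> x"
    and smult_r_distr: "x \<in> carrier A \<Longrightarrow> y \<in> carrier A \<Longrightarrow> c \<odot> (x \<oplus> y) = c \<odot> x \<oplus> c \<odot> y"
    and smult_assoc1: "x \<in> carrier A \<Longrightarrow> (c * d) \<odot> x = c \<odot> (d \<odot> x)"
    and smult_one [simp]: "x \<in> carrier A \<Longrightarrow> 1 \<odot> x = x"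
    and smult_assoc2: "x \<in> carrier A \<Longrightarrow> y \<in> carrier A \<Longrightarrow> (c \<odot> x) \<otimes> y = c \<odot> (x \<otimes> y)"
    and smult_assoc3: "x \<in> carrier A \<Longrightarrow> y \<in> carrier A \<Longrightarrow> x \<otimes> (c \<odot> y) = c \<odot> (x \<otimes> y)"
begin

lemma smult_l_null [simp]: "x \<in> carrier A \<Longrightarrow> 0 \<odot> x = \<zero>"
  using smult_l_distr[of x 0 0] by (metis add.l_cancel_one add_0 smult_closed)

lemma smult_r_null [simp]: "c \<odot> \<zero> = \<zero>"
  using smult_r_distr[of \<zero> \<zero> c] by (metis add.l_cancel_one l_zero smult_closed zero_closed)

lemma smult_minus_1: "x \<in> carrier A \<Longrightarrow> (- 1) \<odot> x = \<ominus> x"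
  using smult_l_distr[of x "- 1" 1] by (intro minus_equality[symmetric]) simp_all

end

text \<open>
  Representations need not be unital: they send the unit to an idempotent. In exchange, every
  algebra has a faithful representation by linear endomorphisms of a fixed type of vectors.
\<close>

definition (in scalar_ring) alg_rep :: "('k, 'a, 'c) module_scheme \<Rightarrow> ('a \<Rightarrow> 'r) \<Rightarrow> bool" where
  "alg_rep A h \<longleftrightarrow>
    (\<forall>x\<in>carrier A. \<forall>y\<in>carrier A. h (x \<oplus>\<^bsub>A\<^esub> y) = h x + h y) \<and>
    (\<forall>x\<in>carrier A. \<forall>y\<in>carrier A. h (x \<otimes>\<^bsub>A\<^esub> y) = h x * h y) \<and>
    (\<forall>c. \<forall>x\<in>carrier A. h (c \<odot>\<^bsub>A\<^esub> x) = c \<cdot> h x)"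

locale represented_algebra = scalar_ring scl + kalg A
  for scl :: "'k::field \<Rightarrow> 'r::ring_1 \<Rightarrow> 'r" (infixr \<open>\<cdot>\<close> 75)
  and A :: "('k, 'a, 'c) module_scheme" (structure) +
  fixes h :: "'a \<Rightarrow> 'r"
  assumes rep: "alg_rep A h"
begin

lemma rep_add [simp]: "x \<in> carrier A \<Longrightarrow> y \<in> carrier A \<Longrightarrow> h (x \<oplus> y) = h x + h y"
  and rep_mult [simp]: "x \<in> carrier A \<Longrightarrow> y \<in> carrier A \<Longrightarrow> h (x \<otimes> y) = h x * h y"
  and rep_smult [simp]: "x \<in> carrier A \<Longrightarrow> h (c \<odot> x) = c \<cdot> h x"
  using rep by (auto simp: alg_rep_def)

lemma rep_zero [simp]: "h \<zero> = 0"
  using rep_add[of \<zero> \<zero>] by simp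

lemma rep_a_inv [simp]: "x \<in> carrier A \<Longrightarrow> h (\<ominus> x) = - h x"
  using rep_add[of x "\<ominus> x"] by (simp add: r_neg eq_neg_iff_add_eq_0 add.commute)

lemma rep_minus [simp]: "x \<in> carrier A \<Longrightarrow> y \<in> carrier A \<Longrightarrow> h (x \<ominus> y) = h x - h y"
  by (simp add: a_minus_def)

lemma rep_finsum: "finite S \<Longrightarrow> (\<And>i. i \<in> S \<Longrightarrow> f i \<in> carrier A) \<Longrightarrow> h (\<Oplus>i\<in>S. f i) = (\<Sum>i\<in>S. h (f i))"
  by (induction S rule: finite_induct) (auto simp: Pi_def)

lemma rep_one_l [simp]: "x \<in> carrier A \<Longrightarrow> h \<one> * h x = h x"
  and rep_one_r [simp]: "x \<in> carrier A \<Longrightarrow> h x * h \<one> = h x"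
  by (simp_all add: rep_mult[symmetric] del: rep_mult)

lemma rep_pow_l: "x \<in> carrier A \<Longrightarrow> y \<in> carrier A \<Longrightarrow> h (x [^] (n::nat) \<otimes> y) = h x ^ n * h y"
proof (induction n arbitrary: y)
  case (Suc n)
  then show ?case by (simp add: power_commutes mult.assoc[symmetric])
qed simp

lemma rep_pow_r: "x \<in> carrier A \<Longrightarrow> y \<in> carrier A \<Longrightarrow> h (y \<otimes> x [^] (n::nat)) = h y * h x ^ n"
proof (induction n arbitrary: y)
  case (Suc n)
  then show ?case by (simp add: power_commutes mult.assoc[symmetric])
     (metis Suc.IH m_closed mult.assoc nat_pow_closed power_commutes rep_mult)
qed simp

end

subsection \<open>Monoid algebras\<close>

context
  fixes M :: "('m, 'c) monoid_scheme"
begin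

lemma monoid_algebra_mult:
  "f \<otimes>\<^bsub>monoid_algebra M\<^esub> g = pm.lin (\<lambda>x. pm.lin (\<lambda>y. Poly_Mapping.single (x \<otimes>\<^bsub>M\<^esub> y) 1) g) f"
  by (simp add: monoid_algebra_def pm.lin_def pm.scale_sum_right)

lemma monoid_algebra_simps [simp]:
  "carrier (monoid_algebra M) = {f :: 'm \<Rightarrow>\<^sub>0 'k::field. Poly_Mapping.keys f \<subseteq> carrier M}"
  "\<one>\<^bsub>monoid_algebra M\<^esub> = (Poly_Mapping.single \<one>\<^bsub>M\<^esub> 1 :: 'm \<Rightarrow>\<^sub>0 'k)"
  "\<zero>\<^bsub>monoid_algebra M\<^esub> = (0 :: 'm \<Rightarrow>\<^sub>0 'k)"
  "f \<oplus>\<^bsub>monoid_algebra M\<^esub> g = f + (g :: 'm \<Rightarrow>\<^sub>0 'k)"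
  "c \<odot>\<^bsub>monoid_algebra M\<^esub> f = pscale c (f :: 'm \<Rightarrow>\<^sub>0 'k)"
  by (simp_all add: monoid_algebra_def pscale_def)

lemma monoid_algebra_single [simp]:
  "Poly_Mapping.single x c \<otimes>\<^bsub>monoid_algebra M\<^esub> Poly_Mapping.single y d =
   Poly_Mapping.single (x \<otimes>\<^bsub>M\<^esub> y) (c * d :: 'k::field)"
  by (simp add: monoid_algebra_mult)

end

lemma kalg_monoid_algebra:
  assumes "Group.monoid M" shows "kalg (monoid_algebra M :: ('k::field, 'm \<Rightarrow>\<^sub>0 'k) module)"
proof -
  interpret M: Group.monoid M by fact
  let ?A = "monoid_algebra M :: ('k, 'm \<Rightarrow>\<^sub>0 'k) module"
  have [simp]: "pm.lin (\<lambda>x. pm.lin (\<phi> x) (g + g')) f = pm.lin (\<lambda>x. pm.lin (\<phi> x) g) f + pm.lin (\<lambda>x. pm.lin (\<phi> x) g') f"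
    for \<phi> :: "'m \<Rightarrow> 'm \<Rightarrow> 'm \<Rightarrow>\<^sub>0 'k" and g g' f
    by (simp add: pm.lin_add pm.lin_fun_add)
  have [simp]: "pm.lin (\<lambda>x. pm.lin (\<phi> x) (pscale c g)) f = pscale c (pm.lin (\<lambda>x. pm.lin (\<phi> x) g) f)"
    for \<phi> :: "'m \<Rightarrow> 'm \<Rightarrow> 'm \<Rightarrow>\<^sub>0 'k" and g f c
    by (simp add: pm.lin_scale pm.lin_fun_scale)
  have keys_add: "Poly_Mapping.keys f \<subseteq> S \<Longrightarrow> Poly_Mapping.keys g \<subseteq> S \<Longrightarrow> Poly_Mapping.keys (f + g) \<subseteq> S"
    for f g :: "'m \<Rightarrow>\<^sub>0 'k" and S
    using Poly_Mapping.keys_add[of f g] by blast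
  have closed: "Poly_Mapping.keys (f \<otimes>\<^bsub>?A\<^esub> g) \<subseteq> carrier M"
    if "Poly_Mapping.keys f \<subseteq> carrier M" "Poly_Mapping.keys g \<subseteq> carrier M" for f g
    unfolding monoid_algebra_mult using that by (intro keys_lin) auto
  have assoc: "f \<otimes>\<^bsub>?A\<^esub> g \<otimes>\<^bsub>?A\<^esub> k = f \<otimes>\<^bsub>?A\<^esub> (g \<otimes>\<^bsub>?A\<^esub> k)"
    if f: "Poly_Mapping.keys f \<subseteq> carrier M" and g: "Poly_Mapping.keys g \<subseteq> carrier M" and k: "Poly_Mapping.keys k \<subseteq> carrier M" for f g k
  proof -
    let ?s = "\<lambda>x. Poly_Mapping.single x (1::'k)"
    have l: "Vector_Spaces.linear pscale pscale (\<lambda>f. pm.lin (\<lambda>x. pm.lin (\<lambda>y. ?s (x \<otimes>\<^bsub>M\<^esub> y)) k) f)"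
      by (rule pm.linear_lin)
    have r: "Vector_Spaces.linear pscale pscale (\<lambda>g. pm.lin (\<lambda>y. ?s (x \<otimes>\<^bsub>M\<^esub> y)) g)" for x
      by (rule pm.linear_lin)
    have "f \<otimes>\<^bsub>?A\<^esub> g \<otimes>\<^bsub>?A\<^esub> k = pm.lin (\<lambda>x. pm.lin (\<lambda>y. pm.lin (\<lambda>z. ?s (x \<otimes>\<^bsub>M\<^esub> y \<otimes>\<^bsub>M\<^esub> z)) k) g) f"
      unfolding monoid_algebra_mult by (simp add: linear_lin_comp[OF l])
    also have "\<dots> = pm.lin (\<lambda>x. pm.lin (\<lambda>y. pm.lin (\<lambda>z. ?s (x \<otimes>\<^bsub>M\<^esub> (y \<otimes>\<^bsub>M\<^esub> z))) k) g) f"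
      by (intro pm.lin_cong) (use f g k in \<open>auto simp: M.m_assoc subset_iff\<close>)
    also have "\<dots> = f \<otimes>\<^bsub>?A\<^esub> (g \<otimes>\<^bsub>?A\<^esub> k)"
      unfolding monoid_algebra_mult by (simp add: linear_lin_comp[OF r])
    finally show ?thesis .
  qed
  have one: "pm.lin (\<lambda>x. Poly_Mapping.single (\<one>\<^bsub>M\<^esub> \<otimes>\<^bsub>M\<^esub> x) 1) f = f" "pm.lin (\<lambda>x. Poly_Mapping.single (x \<otimes>\<^bsub>M\<^esub> \<one>\<^bsub>M\<^esub>) 1) f = f"
    if "Poly_Mapping.keys f \<subseteq> carrier M" for f :: "'m \<Rightarrow>\<^sub>0 'k"
  proof -
    have "pm.lin (\<lambda>x. Poly_Mapping.single (\<one>\<^bsub>M\<^esub> \<otimes>\<^bsub>M\<^esub> x) 1) f = pm.lin (\<lambda>x. Poly_Mapping.single x 1) f"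
      by (rule pm.lin_cong) (use that in auto)
    then show "pm.lin (\<lambda>x. Poly_Mapping.single (\<one>\<^bsub>M\<^esub> \<otimes>\<^bsub>M\<^esub> x) 1) f = f" by (simp add: poly_mapping_sum_singles)
    have "pm.lin (\<lambda>x. Poly_Mapping.single (x \<otimes>\<^bsub>M\<^esub> \<one>\<^bsub>M\<^esub>) 1) f = pm.lin (\<lambda>x. Poly_Mapping.single x 1) f"
      by (rule pm.lin_cong) (use that in auto)
    then show "pm.lin (\<lambda>x. Poly_Mapping.single (x \<otimes>\<^bsub>M\<^esub> \<one>\<^bsub>M\<^esub>) 1) f = f" by (simp add: poly_mapping_sum_singles)
  qed
  have ring: "ring ?A"
  proof (rule ringI)
    show "abelian_group ?A"
    proof (rule abelian_groupI)
      fix x assume "x \<in> carrier ?A"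
      then show "\<exists>y\<in>carrier ?A. y \<oplus>\<^bsub>?A\<^esub> x = \<zero>\<^bsub>?A\<^esub>"
        by (intro bexI[of _ "- x"]) auto
    qed (simp_all add: keys_add add_ac)
    show "Group.monoid ?A"
      by (rule Group.monoidI) (simp_all add: closed assoc, simp_all add: monoid_algebra_mult one)
  qed (simp_all add: monoid_algebra_mult pm.lin_add pm.lin_fun_add)
  show ?thesis
    by (rule kalg.intro[OF ring], unfold_locales)
      (use keys_pscale in \<open>force simp: pm.scale_left_distrib pm.scale_right_distrib monoid_algebra_mult pm.lin_scale pm.lin_fun_scale\<close>)+
qed

subsection \<open>Quotients\<close>

locale kalg_ideal = kalg A + ideal I A
  for A :: "('k::field, 'a, 'c) module_scheme" (structure) and I
begin

abbreviation "Q \<equiv> quot_alg A I"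

lemma smult_ideal: assumes "x \<in> I" shows "c \<odot> x \<in> I"
proof -
  have x: "x \<in> carrier A" using assms by (rule a_Hcarr)
  have "c \<odot> x = (c \<odot> \<one>) \<otimes> x" using x by (simp add: smult_assoc2)
  then show ?thesis using assms by (simp add: I_l_closed)
qed

lemma coset_eq_iff: "x \<in> carrier A \<Longrightarrow> y \<in> carrier A \<Longrightarrow> I +> x = I +> y \<longleftrightarrow> x \<ominus> y \<in> I"
  by (metis (no_types, lifting) a_rcos_self a_repr_independence' minus_eq
      a_rcos_module abelian_subgroup.a_rcos_module abelian_group_axioms abelian_subgroupI3 additive_subgroup_axioms)

lemma coset_zero: "I +> \<zero> = I"
  by (simp add: a_coset_add_zero a_subset)

lemma quot_one: "\<one>\<^bsub>Q\<^esub> = I +> \<one>"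
  and quot_zero: "\<zero>\<^bsub>Q\<^esub> = I +> \<zero>"
  and quot_carrier: "carrier Q = (\<lambda>x. I +> x) ` carrier A"
  by (auto simp: quot_alg_def ring.defs FactRing_def coset_zero A_RCOSETS_defs a_r_coset_def[symmetric])

lemma quot_add: "x \<in> carrier A \<Longrightarrow> y \<in> carrier A \<Longrightarrow> (I +> x) \<oplus>\<^bsub>Q\<^esub> (I +> y) = I +> (x \<oplus> y)"
  by (simp add: quot_alg_def ring.defs FactRing_def a_rcos_sum)

lemma quot_mult: "x \<in> carrier A \<Longrightarrow> y \<in> carrier A \<Longrightarrow> (I +> x) \<otimes>\<^bsub>Q\<^esub> (I +> y) = I +> (x \<otimes> y)"
  by (simp add: quot_alg_def ring.defs FactRing_def rcoset_mult_add)

lemma quot_smult: assumes "x \<in> carrier A" shows "c \<odot>\<^bsub>Q\<^esub> (I +> x) = I +> (c \<odot> x)"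
proof -
  have eq: "I +> (c \<odot> y) = I +> (c \<odot> x)" if "y \<in> I +> x" for y
  proof -
    obtain i where i: "i \<in> I" "y = i \<oplus> x" using \<open>y \<in> I +> x\<close> by (auto simp: a_r_coset_def')
    then have ic: "i \<in> carrier A" by (simp add: a_Hcarr)
    have "c \<odot> y \<ominus> c \<odot> x = c \<odot> i"
      using ic assms by (simp add: i smult_r_distr minus_eq a_assoc r_neg)
    then show ?thesis
      using ic assms i smult_ideal by (subst coset_eq_iff) auto
  qed
  have "c \<odot>\<^bsub>Q\<^esub> (I +> x) = (\<Union>y\<in>I +> x. I +> (c \<odot> y))"
    by (simp add: quot_alg_def ring.defs module.defs)
  also have "\<dots> = (\<Union>y\<in>I +> x. I +> (c \<odot> x))"
    by (rule SUP_cong[OF refl eq])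
  also have "\<dots> = I +> (c \<odot> x)"
    using a_rcos_self[OF assms] by blast
  finally show ?thesis .
qed

lemma coset_closed [simp]: "x \<in> carrier A \<Longrightarrow> I +> x \<in> carrier Q"
  by (auto simp: quot_carrier)

lemma kalg_quot: "kalg Q"
proof -
  note qs = quot_carrier quot_add quot_mult quot_smult quot_one quot_zero
  have "ring Q"
  proof (rule ringI)
    show "abelian_group Q"
    proof (rule abelian_groupI)
      fix x assume "x \<in> carrier Q"
      then obtain y where "y \<in> carrier A" "x = I +> y" by (auto simp: quot_carrier)
      then show "\<exists>y\<in>carrier Q. y \<oplus>\<^bsub>Q\<^esub> x = \<zero>\<^bsub>Q\<^esub>"
        by (intro bexI[of _ "I +> (\<ominus> y)"]) (auto simp: quot_add quot_zero l_neg)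
    qed (auto simp: qs a_ac)
    show "Group.monoid Q"
      by (rule Group.monoidI) (auto simp: qs m_assoc)
  qed (auto simp: qs l_distr r_distr)
  then show ?thesis
    by (rule kalg.intro, unfold_locales)
      (auto simp: qs smult_l_distr smult_r_distr smult_assoc1 smult_assoc2 smult_assoc3)
qed

end

context represented_algebra
begin

lemma ideal_kernel: "ideal {x \<in> carrier A. h x = 0} A"
proof (rule idealI)
  show "subgroup {x \<in> carrier A. h x = 0} (add_monoid A)"
    by (rule add.subgroupI) (auto intro!: exI[of _ \<zero>] simp: a_inv_def[symmetric])
qed (auto simp: ring_axioms)

lemma kills_genideal:
  assumes "S \<subseteq> carrier A" "\<And>s. s \<in> S \<Longrightarrow> h s = 0" "x \<in> Idl S"
  shows "h x = 0"
proof -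
  have "Idl S \<subseteq> {x \<in> carrier A. h x = 0}"
    by (rule genideal_minimal[OF ideal_kernel]) (use assms in auto)
  then show ?thesis using assms(3) by auto
qed

lemma rep_quotient:
  assumes "ideal I A" "\<And>x. x \<in> I \<Longrightarrow> h x = 0"
  shows "\<exists>g. alg_rep (quot_alg A I) g \<and> (\<forall>x\<in>carrier A. g (I +> x) = h x)"
proof -
  interpret kalg_ideal A I using assms(1) kalg_axioms by (simp add: kalg_ideal_def)
  have eq: "h x = h y" if "x \<in> carrier A" "y \<in> carrier A" "I +> x = I +> y" for x y
    using assms(2)[of "x \<ominus> y"] that by (simp add: coset_eq_iff)
  define g where "g X = h (SOME x. x \<in> carrier A \<and> X = I +> x)" for X
  have g: "g (I +> x) = h x" if "x \<in> carrier A" for x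
  proof -
    have "(SOME y. y \<in> carrier A \<and> I +> x = I +> y) \<in> carrier A \<and> I +> x = I +> (SOME y. y \<in> carrier A \<and> I +> x = I +> y)"
      by (rule someI[of _ x]) (use that in simp)
    then show ?thesis unfolding g_def using eq[of x] that by metis
  qed
  have "alg_rep (quot_alg A I) g"
    by (auto simp: alg_rep_def quot_carrier quot_add quot_mult quot_smult g)
  then show ?thesis using g by blast
qed

end

lemma projection_along:
  assumes "pm.subspace (N :: ('b \<Rightarrow>\<^sub>0 'k::field) set)"
  shows "\<exists>P. Vector_Spaces.linear pscale pscale P \<and> (\<forall>f. P f = 0 \<longleftrightarrow> f \<in> N) \<and> (\<forall>f. P f - f \<in> N)"
proof -
  interpret vector_space_pair "pscale :: 'k \<Rightarrow> ('b \<Rightarrow>\<^sub>0 'k) \<Rightarrow> _" "pscale :: 'k \<Rightarrow> ('b \<Rightarrow>\<^sub>0 'k) \<Rightarrow> _"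
    by unfold_locales
  obtain B where B: "B \<subseteq> N" "pm.independent B" "pm.span B = N"
    using pm.basis_exists[of N] assms by (metis pm.span_eq_iff pm.span_minimal subset_antisym)
  let ?E = "pm.extend_basis B"
  define P where "P = construct ?E (\<lambda>b. if b \<in> B then 0 else b)"
  have E: "pm.independent ?E" "B \<subseteq> ?E" "pm.span ?E = UNIV"
    using pm.independent_extend_basis[OF B(2)] pm.extend_basis_superset[OF B(2)] pm.span_extend_basis[OF B(2)] by auto
  have lin: "Vector_Spaces.linear pscale pscale P" unfolding P_def by (rule linear_construct[OF E(1)])
  interpret P: Vector_Spaces.linear pscale pscale P by (rule lin)
  have Pb: "P b = (if b \<in> B then 0 else b)" if "b \<in> ?E" for b
    unfolding P_def by (rule construct_basis[OF E(1) that])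
  have PN: "P f = 0" if "f \<in> N" for f
  proof -
    have "f \<in> pm.span B" using that B(3) by simp
    then show ?thesis
    proof (induction rule: pm.span_induct_alt)
      case (step c b y)
      then show ?case using Pb[of b] E(2) by (auto simp: P.add P.scale)
    qed (simp add: P.zero)
  qed
  have d: "P f - f \<in> N" for f
  proof -
    have "f \<in> pm.span ?E" using E(3) by simp
    then show ?thesis
    proof (induction rule: pm.span_induct_alt)
      case base
      then show ?case using assms by (simp add: P.zero pm.subspace_0)
    next
      case (step c b y)
      have "P b - b \<in> N" using Pb[OF step(1)] B(1) assms by (auto simp: pm.subspace_0 pm.subspace_neg)
      moreover have eq: "P (pscale c b + y) - (pscale c b + y) = pscale c (P b - b) + (P y - y)"
        by (simp add: P.add P.scale pm.scale_right_diff_distrib)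
      ultimately show ?case unfolding eq using step(2) assms by (intro pm.subspace_add pm.subspace_scale)
    qed
  qed
  have "f \<in> N" if "P f = 0" for f
    using d[of f] that assms pm.subspace_neg[of N "- f"] by simp
  then show ?thesis using lin PN d by blast
qed

text \<open>
  The algebra is a quotient, as a vector space, of the free vector space on its elements; a linear
  projection along the kernel makes it a subspace, on which the algebra acts by left multiplication.
  Outside that subspace the unit acts as the projection.
\<close>

lemma kalg_faithful_rep:
  fixes A :: "('k::field, 'a, 'c) module_scheme"
  assumes "kalg A"
  shows "\<exists>h :: 'a \<Rightarrow> ('a, 'k) lend. lend.alg_rep A h \<and> inj_on h (carrier A)"
proof -
  interpret kalg A by fact
  let ?C = "{f :: 'a \<Rightarrow>\<^sub>0 'k. Poly_Mapping.keys f \<subseteq> carrier A}"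
  define ev where "ev f = (\<Oplus>\<^bsub>A\<^esub>x\<in>Poly_Mapping.keys f \<inter> carrier A. Poly_Mapping.lookup f x \<odot>\<^bsub>A\<^esub> x)" for f :: "'a \<Rightarrow>\<^sub>0 'k"
  have ev_closed [simp]: "ev f \<in> carrier A" for f
    unfolding ev_def by (rule finsum_closed) auto
  have ev_super: "ev f = (\<Oplus>\<^bsub>A\<^esub>x\<in>S \<inter> carrier A. Poly_Mapping.lookup f x \<odot>\<^bsub>A\<^esub> x)"
    if "finite S" "Poly_Mapping.keys f \<subseteq> S" for f S
    unfolding ev_def
    by (rule add.finprod_mono_neutral_cong_left) (use that in \<open>auto simp: in_keys_iff\<close>)
  have ev_add: "ev (f + g) = ev f \<oplus>\<^bsub>A\<^esub> ev g" for f g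
  proof -
    let ?S = "Poly_Mapping.keys f \<union> Poly_Mapping.keys g"
    have "ev (f + g) = (\<Oplus>\<^bsub>A\<^esub>x\<in>?S \<inter> carrier A. (Poly_Mapping.lookup f x + Poly_Mapping.lookup g x) \<odot>\<^bsub>A\<^esub> x)"
      using Poly_Mapping.keys_add[of f g] by (subst ev_super[of ?S]) (auto simp: lookup_add)
    also have "\<dots> = (\<Oplus>\<^bsub>A\<^esub>x\<in>?S \<inter> carrier A. Poly_Mapping.lookup f x \<odot>\<^bsub>A\<^esub> x \<oplus>\<^bsub>A\<^esub> Poly_Mapping.lookup g x \<odot>\<^bsub>A\<^esub> x)"
      by (rule finsum_cong') (auto simp: smult_l_distr)
    also have "\<dots> = ev f \<oplus>\<^bsub>A\<^esub> ev g"
      by (subst finsum_addf) (auto simp: ev_super[of ?S])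
    finally show ?thesis .
  qed
  have smult_finsum: "c \<odot>\<^bsub>A\<^esub> (\<Oplus>\<^bsub>A\<^esub>x\<in>S. f x) = (\<Oplus>\<^bsub>A\<^esub>x\<in>S. c \<odot>\<^bsub>A\<^esub> f x)"
    if "finite S" "\<And>x. x \<in> S \<Longrightarrow> f x \<in> carrier A" for c S and f :: "'a \<Rightarrow> 'a"
    using that by (induction S rule: finite_induct) (auto simp: Pi_def smult_r_distr)
  have ev_scale: "ev (pscale c f) = c \<odot>\<^bsub>A\<^esub> ev f" for c f
  proof -
    have "ev (pscale c f) = (\<Oplus>\<^bsub>A\<^esub>x\<in>Poly_Mapping.keys f \<inter> carrier A. c \<odot>\<^bsub>A\<^esub> (Poly_Mapping.lookup f x \<odot>\<^bsub>A\<^esub> x))"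
      using keys_pscale[of c f]
      by (subst ev_super[of "Poly_Mapping.keys f"]) (auto simp: smult_assoc1 intro!: finsum_cong')
    also have "\<dots> = c \<odot>\<^bsub>A\<^esub> ev f"
      unfolding ev_def by (rule smult_finsum[symmetric]) auto
    finally show ?thesis .
  qed
  have ev_single: "ev (Poly_Mapping.single x 1) = x" if "x \<in> carrier A" for x
    using that by (simp add: ev_def)
  define N where "N = {f. ev f = \<zero>\<^bsub>A\<^esub>}"
  have ev_0: "ev 0 = \<zero>\<^bsub>A\<^esub>" by (simp add: ev_def)
  have N: "pm.subspace N"
    by (rule pm.subspaceI) (auto simp: N_def ev_0 ev_add ev_scale)
  obtain P where P: "Vector_Spaces.linear pscale pscale P" "\<And>f. P f = 0 \<longleftrightarrow> f \<in> N" "\<And>f. P f - f \<in> N"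
    using projection_along[OF N] by blast
  have evP: "ev (P f) = ev f" for f
  proof -
    have "ev (P f) = ev ((P f - f) + f)" by simp
    also have "\<dots> = ev f" using P(3)[of f] by (simp only: ev_add) (simp add: N_def)
    finally show ?thesis .
  qed
  have P_eq: "P f = P g" if "ev f = ev g" for f g
  proof -
    have "ev (f - g) = ev f \<oplus>\<^bsub>A\<^esub> (- 1) \<odot>\<^bsub>A\<^esub> ev g" unfolding ev_scale[symmetric] ev_add[symmetric] by simp
    also have "\<dots> = \<zero>\<^bsub>A\<^esub>" using that by (simp add: smult_minus_1 r_neg)
    finally have "P (f - g) = 0" by (simp add: P(2) N_def)
    then show ?thesis by (simp add: linear_pscale_iff Vector_Spaces.linear_def module_hom.diff[OF Vector_Spaces.linear.axioms(3)[OF P(1)]])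
  qed
  define s where "s a = P (Poly_Mapping.single a 1)" for a
  have ev_s: "ev (s a) = a" if "a \<in> carrier A" for a
    using that by (simp add: s_def evP ev_single)
  have s_ev: "s (ev f) = P f" for f
    unfolding s_def by (rule P_eq) (simp add: ev_single)
  define h where "h a = (if a \<in> carrier A then Lend (\<lambda>f. s (a \<otimes>\<^bsub>A\<^esub> ev f)) else 0)" for a
  have s_add: "s (a \<oplus>\<^bsub>A\<^esub> b) = s a + s b" if "a \<in> carrier A" "b \<in> carrier A" for a b
  proof -
    have "s (a \<oplus>\<^bsub>A\<^esub> b) = P (s a + s b)"
      unfolding s_ev[symmetric] by (simp add: ev_add ev_s that)
    also have "\<dots> = P (s a) + P (s b)" using P(1) by (simp add: linear_pscale_iff)
    also have "\<dots> = s a + s b" using that by (simp add: s_ev[symmetric] ev_s)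
    finally show ?thesis .
  qed
  have s_scale: "s (c \<odot>\<^bsub>A\<^esub> a) = pscale c (s a)" if "a \<in> carrier A" for a c
  proof -
    have "s (c \<odot>\<^bsub>A\<^esub> a) = P (pscale c (s a))"
      unfolding s_ev[symmetric] by (simp add: ev_scale ev_s that)
    also have "\<dots> = pscale c (P (s a))" using P(1) by (simp add: linear_pscale_iff)
    also have "\<dots> = pscale c (s a)" using that by (simp add: s_ev[symmetric] ev_s)
    finally show ?thesis .
  qed
  have app_h: "app (h a) f = s (a \<otimes>\<^bsub>A\<^esub> ev f)" if "a \<in> carrier A" for a f
  proof -
    have "Vector_Spaces.linear pscale pscale (\<lambda>f. s (a \<otimes>\<^bsub>A\<^esub> ev f))"
      using that by (simp add: linear_pscale_iff ev_add ev_scale r_distr smult_assoc3 s_add s_scale)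
    then show ?thesis using that by (simp add: h_def Lend_inverse)
  qed
  have "lend.alg_rep A h"
    unfolding lend.alg_rep_def
    by (auto intro!: lend_eqI simp: app_h app_simps l_distr s_add smult_assoc2 s_scale ev_s m_assoc)
  moreover have "inj_on h (carrier A)"
  proof (rule inj_onI)
    fix a b assume ab: "a \<in> carrier A" "b \<in> carrier A" "h a = h b"
    then have "ev (app (h a) (Poly_Mapping.single \<one>\<^bsub>A\<^esub> 1)) = ev (app (h b) (Poly_Mapping.single \<one>\<^bsub>A\<^esub> 1))" by simp
    then show "a = b" using ab(1,2) by (simp add: app_h ev_single ev_s)
  qed
  ultimately show ?thesis by blast
qed

subsection \<open>Presented algebras\<close>

lemma kalg_free_algebra: "kalg (free_algebra X)"
  unfolding free_algebra_def
  by (rule kalg_monoid_algebra, rule Group.monoidI) auto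

lemma free_algebra_simps [simp]:
  "carrier (free_algebra X :: ('k::field, _) module) = {f. Poly_Mapping.keys f \<subseteq> lists X}"
  "\<one>\<^bsub>free_algebra X\<^esub> = (Poly_Mapping.single [] 1 :: 'g list \<Rightarrow>\<^sub>0 'k::field)"
  "\<zero>\<^bsub>free_algebra X\<^esub> = (0 :: 'g list \<Rightarrow>\<^sub>0 'k::field)"
  "f \<oplus>\<^bsub>free_algebra X\<^esub> g = f + (g :: 'g list \<Rightarrow>\<^sub>0 'k::field)"
  "c \<odot>\<^bsub>free_algebra X\<^esub> f = pscale c (f :: 'g list \<Rightarrow>\<^sub>0 'k::field)"
  by (simp_all add: free_algebra_def)

lemma free_algebra_mult:
  "f \<otimes>\<^bsub>free_algebra X\<^esub> g = pm.lin (\<lambda>u. pm.lin (\<lambda>w. Poly_Mapping.single (u @ w) (1 :: 'k::field)) g) f"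
  by (simp add: free_algebra_def monoid_algebra_mult)

lemma free_gen_closed: "g \<in> X \<Longrightarrow> free_gen g \<in> carrier (free_algebra X :: ('k::field, _) module)"
  by (auto simp: free_gen_def)

context scalar_ring
begin

definition word_rep :: "('g \<Rightarrow> 'r) \<Rightarrow> 'r \<Rightarrow> 'g list \<Rightarrow> 'r" where
  "word_rep \<eta> e w = foldr (\<lambda>g y. \<eta> g * y) w e"

text \<open>
  The generators live in the corner \<open>e R e\<close> of the ring, whose unit is the idempotent \<open>e\<close>.
\<close>

definition corner :: "'g set \<Rightarrow> ('g \<Rightarrow> 'r) \<Rightarrow> 'r \<Rightarrow> bool" where
  "corner X \<eta> e \<longleftrightarrow> e * e = e \<and> (\<forall>g\<in>X. e * \<eta> g = \<eta> g \<and> \<eta> g * e = \<eta> g)"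

lemma word_rep_simps [simp]: "word_rep \<eta> e [] = e" "word_rep \<eta> e (g # w) = \<eta> g * word_rep \<eta> e w"
  by (simp_all add: word_rep_def)

lemma word_rep_append:
  assumes "corner X \<eta> e" "u \<in> lists X" "w \<in> lists X"
  shows "word_rep \<eta> e (u @ w) = word_rep \<eta> e u * word_rep \<eta> e w"
proof -
  have e: "e * word_rep \<eta> e w = word_rep \<eta> e w"
    using assms(1,3) by (cases w) (auto simp: corner_def mult.assoc[symmetric])
  show ?thesis
    using assms(2) by (induction u) (auto simp: e mult.assoc)
qed

lemma alg_rep_free:
  fixes \<eta> :: "'g \<Rightarrow> 'r"
  assumes "corner X \<eta> e"
  shows "alg_rep (free_algebra X) (lin (word_rep \<eta> e))"
proof -
  have "lin (word_rep \<eta> e) (f \<otimes>\<^bsub>free_algebra X\<^esub> g) = lin (word_rep \<eta> e) f * lin (word_rep \<eta> e) g"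
    if fg: "Poly_Mapping.keys f \<subseteq> lists X" "Poly_Mapping.keys g \<subseteq> lists X" for f g :: "'g list \<Rightarrow>\<^sub>0 'k"
  proof -
    have "lin (word_rep \<eta> e) (f \<otimes>\<^bsub>free_algebra X\<^esub> g) = lin (\<lambda>u. lin (\<lambda>w. word_rep \<eta> e (u @ w)) g) f"
      unfolding free_algebra_mult by (simp add: linear_lin_comp[OF linear_lin])
    also have "\<dots> = lin (\<lambda>u. lin (\<lambda>w. word_rep \<eta> e u * word_rep \<eta> e w) g) f"
      by (intro lin_cong word_rep_append[OF assms]) (use fg in auto)
    also have "\<dots> = lin (word_rep \<eta> e) f * lin (word_rep \<eta> e) g"
      by (simp add: lin_def sum_distrib_left sum_distrib_right scl_mult_left scl_mult_right scale_sum_right)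
        (subst sum.swap, simp add: mult.commute)
    finally show ?thesis .
  qed
  then show ?thesis by (simp add: alg_rep_def lin_add lin_scale)
qed

end

locale presentation =
  fixes X :: "'g set" and R :: "(('g list \<Rightarrow>\<^sub>0 'k::field) \<times> ('g list \<Rightarrow>\<^sub>0 'k)) set"
  assumes rels_closed: "(l, r) \<in> R \<Longrightarrow> l \<in> carrier (free_algebra X) \<and> r \<in> carrier (free_algebra X)"
begin

abbreviation "W \<equiv> free_algebra X :: ('k, 'g list \<Rightarrow>\<^sub>0 'k) module"
abbreviation "I \<equiv> relation_ideal X R"

lemma rel_differences: "{l \<ominus>\<^bsub>W\<^esub> r | l r. (l, r) \<in> R} \<subseteq> carrier W"
proof -
  interpret W: kalg W by (rule kalg_free_algebra)
  show ?thesis using rels_closed W.minus_closed by blast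
qed

sublocale kalg_ideal W I
proof -
  interpret W: kalg W by (rule kalg_free_algebra)
  show "kalg_ideal W I"
    unfolding kalg_ideal_def relation_ideal_def using W.genideal_ideal[OF rel_differences] W.kalg_axioms by simp
qed

lemma presented_eq: "presented_algebra X R = quot_alg W I"
  by (simp add: presented_algebra_def)

lemma kalg_presented: "kalg (presented_algebra X R)"
  unfolding presented_eq by (rule kalg_quot)

lemma relation_holds: "(l, r) \<in> R \<Longrightarrow> I +>\<^bsub>W\<^esub> l = I +>\<^bsub>W\<^esub> r"
proof -
  assume lr: "(l, r) \<in> R"
  have "{l \<ominus>\<^bsub>W\<^esub> r | l r. (l, r) \<in> R} \<subseteq> I"
    unfolding relation_ideal_def by (rule genideal_self[OF rel_differences])
  then have "l \<ominus>\<^bsub>W\<^esub> r \<in> I" using lr by blast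
  then show ?thesis using rels_closed[OF lr] by (subst coset_eq_iff) auto
qed

lemma gen_eq: "presented_gen X R g = I +>\<^bsub>W\<^esub> free_gen g"
  by (simp add: presented_gen_def)

lemma gen_closed [simp]: "g \<in> X \<Longrightarrow> presented_gen X R g \<in> carrier (presented_algebra X R)"
  unfolding gen_eq presented_eq by (rule coset_closed) (rule free_gen_closed)

end

context scalar_ring
begin

lemma rep_presented:
  fixes R :: "(('g list \<Rightarrow>\<^sub>0 'k) \<times> ('g list \<Rightarrow>\<^sub>0 'k)) set"
  assumes "presentation X R" "corner X \<eta> e"
    and rels: "\<And>l r. (l, r) \<in> R \<Longrightarrow> lin (word_rep \<eta> e) l = lin (word_rep \<eta> e) r"
  shows "\<exists>g. alg_rep (presented_algebra X R) g \<and> (\<forall>x\<in>X. g (presented_gen X R x) = \<eta> x)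
    \<and> g \<one>\<^bsub>presented_algebra X R\<^esub> = e
    \<and> g ` carrier (presented_algebra X R) \<subseteq> lin (word_rep \<eta> e) ` {f. Poly_Mapping.keys f \<subseteq> lists X}"
proof -
  interpret presentation X R by fact
  interpret rep: represented_algebra scl W "lin (word_rep \<eta> e)"
    by unfold_locales (rule alg_rep_free[OF assms(2)])
  have "\<exists>g. alg_rep (quot_alg W I) g \<and> (\<forall>x\<in>carrier W. g (I +>\<^bsub>W\<^esub> x) = lin (word_rep \<eta> e) x)"
  proof (rule rep.rep_quotient)
    show "ideal I W" by (rule ideal_axioms)
    show "lin (word_rep \<eta> e) x = 0" if "x \<in> I" for x
    proof (rule rep.kills_genideal[OF rel_differences])
      show "x \<in> Idl\<^bsub>W\<^esub> {l \<ominus>\<^bsub>W\<^esub> r |l r. (l, r) \<in> R}" using that by (simp add: relation_ideal_def)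
      fix s assume "s \<in> {l \<ominus>\<^bsub>W\<^esub> r |l r. (l, r) \<in> R}"
      then obtain l r where lr: "(l, r) \<in> R" "s = l \<ominus>\<^bsub>W\<^esub> r" by blast
      then show "lin (word_rep \<eta> e) s = 0"
        using rep.rep_minus[of l r] rels_closed[OF lr(1)] rels[OF lr(1)] by simp
    qed
  qed
  then obtain g where g: "alg_rep (quot_alg W I) g" "\<And>x. x \<in> carrier W \<Longrightarrow> g (I +>\<^bsub>W\<^esub> x) = lin (word_rep \<eta> e) x"
    by blast
  have "g (presented_gen X R x) = \<eta> x" if "x \<in> X" for x
    unfolding gen_eq using assms(2) that by (subst g(2)[OF free_gen_closed]) (auto simp: free_gen_def corner_def)
  moreover have "g \<one>\<^bsub>presented_algebra X R\<^esub> = e"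
    unfolding presented_eq quot_one by (subst g(2)) auto
  moreover have "g ` carrier (presented_algebra X R) \<subseteq> lin (word_rep \<eta> e) ` {f. Poly_Mapping.keys f \<subseteq> lists X}"
    unfolding presented_eq quot_carrier using g(2) by auto
  ultimately show ?thesis using g(1) unfolding presented_eq by blast
qed

end

section \<open>Quantum groups in rings\<close>

locale qring = scalar_ring scl for scl :: "rat poly fract \<Rightarrow> 'r::ring_1 \<Rightarrow> 'r" (infixr \<open>\<cdot>\<close> 75)
begin

definition serre :: "'r \<Rightarrow> 'r \<Rightarrow> nat \<Rightarrow> 'r" where
  "serre x w m = (\<Sum>r\<le>m. ((-1) ^ r * qbinom m r) \<cdot> (x ^ r * w * x ^ (m - r)))"

lemma serre_eq_op: "serre x w m = serre_op scl (\<lambda>y. x * y) (\<lambda>y. y * x) w m"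
proof -
  have "((*) x ^^ n) y = x ^ n * y" for n y by (induction n) (simp_all add: mult.assoc)
  moreover have "((\<lambda>y. y * x) ^^ n) y = y * x ^ n" for n y by (induction n) (simp_all add: mult.assoc power_commutes)
  ultimately show ?thesis by (simp add: serre_def serre_op_def mult.assoc)
qed

lemma qprod_eq_serre:
  assumes "qpar u"
  shows "qprod (u ^ (m - 1)) (inverse (u ^ 2)) (\<lambda>y. x * y) (\<lambda>y. y * x) w m = (-1) ^ m \<cdot> serre x w m"
  unfolding serre_eq_op
  by (rule qprod_eq_serre_op[OF vec_axioms assms linear_times_left linear_times_right]) (simp add: mult.assoc)

definition quantum_system ::
  "('i, 'a) pre_digraph \<Rightarrow> ('i \<Rightarrow> 'r) \<Rightarrow> ('i \<Rightarrow> 'r) \<Rightarrow> ('i \<Rightarrow> 'r) \<Rightarrow> ('i \<Rightarrow> 'r) \<Rightarrow> bool" where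
  "quantum_system Q E F K K' \<longleftrightarrow>
    (\<forall>i\<in>verts Q. \<forall>j\<in>verts Q.
      E i * F j - F j * E i = (if i = j then (1 / (qv - inverse qv)) \<cdot> (K i - K' i) else 0) \<and>
      K i * K j = K j * K i \<and> K i * K' j = K' j * K i \<and> K' i * K' j = K' j * K' i \<and>
      K i * E j = (qv powi cartan Q i j) \<cdot> (E j * K i) \<and>
      K i * F j = (qv powi (- cartan Q i j)) \<cdot> (F j * K i) \<and>
      K' i * E j = (qv powi (- cartan Q i j)) \<cdot> (E j * K' i) \<and>
      K' i * F j = (qv powi cartan Q i j) \<cdot> (F j * K' i) \<and>
      (i \<noteq> j \<longrightarrow> serre (E i) (E j) (nat (1 - cartan Q i j)) = 0 \<and> serre (F i) (F j) (nat (1 - cartan Q i j)) = 0))"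

end

locale qrepresented = represented_algebra scl A h + qring scl
  for scl :: "rat poly fract \<Rightarrow> 'r::ring_1 \<Rightarrow> 'r" (infixr \<open>\<cdot>\<close> 75)
  and A :: "(rat poly fract, 'a, 'c) module_scheme" (structure) and h
begin

lemma rep_serre_sum:
  assumes "x \<in> carrier A" "y \<in> carrier A"
  shows "(\<Oplus>r\<in>{0..m}. c r \<odot> (x [^] (r::nat) \<otimes> y \<otimes> x [^] (m - r))) \<in> carrier A"
    and "h (\<Oplus>r\<in>{0..m}. ((-1) ^ r * qbinom m r) \<odot> (x [^] r \<otimes> y \<otimes> x [^] (m - r))) = serre (h x) (h y) m"
proof -
  show "(\<Oplus>r\<in>{0..m}. c r \<odot> (x [^] (r::nat) \<otimes> y \<otimes> x [^] (m - r))) \<in> carrier A"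
    using assms by (intro finsum_closed) auto
  show "h (\<Oplus>r\<in>{0..m}. ((-1) ^ r * qbinom m r) \<odot> (x [^] r \<otimes> y \<otimes> x [^] (m - r))) = serre (h x) (h y) m"
    using assms by (subst rep_finsum) (auto simp: serre_def rep_pow_l rep_pow_r atLeast0AtMost simp del: rep_mult)
qed

lemma quantum_relations_closed:
  assumes "\<And>i. i \<in> verts Q \<Longrightarrow> e i \<in> carrier A \<and> f i \<in> carrier A \<and> k i \<in> carrier A \<and> k' i \<in> carrier A"
    and "(l, r) \<in> quantum_relations Q A e f k k'"
  shows "l \<in> carrier A \<and> r \<in> carrier A"
  using assms(2) unfolding quantum_relations_def serre_relations_def
  by (auto simp: assms(1) rep_serre_sum(1) split: if_splits)

lemma quantum_relations_iff:
  assumes c: "\<And>i. i \<in> verts Q \<Longrightarrow> e i \<in> carrier A \<and> f i \<in> carrier A \<and> k i \<in> carrier A \<and> k' i \<in> carrier A"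
  shows "(\<forall>(l, r)\<in>quantum_relations Q A e f k k'. h l = h r) \<longleftrightarrow>
    quantum_system Q (h \<circ> e) (h \<circ> f) (h \<circ> k) (h \<circ> k')"
proof -
  have S: "(\<forall>(l, r)\<in>serre_relations Q A x. h l = h r) \<longleftrightarrow>
      (\<forall>i\<in>verts Q. \<forall>j\<in>verts Q. i \<noteq> j \<longrightarrow> serre (h (x i)) (h (x j)) (nat (1 - cartan Q i j)) = 0)"
    if "\<And>i. i \<in> verts Q \<Longrightarrow> x i \<in> carrier A" for x
    unfolding serre_relations_def using that by (fastforce simp: rep_serre_sum(2))
  show ?thesis
    unfolding quantum_relations_def quantum_system_def ball_Un
    using c by (subst (1 2) S) (auto simp: split_beta)
qed

lemma inverse_relations_closed:
  assumes "\<And>i. i \<in> verts Q \<Longrightarrow> x i \<in> carrier A \<and> y i \<in> carrier A" "(l, r) \<in> inverse_relations Q A x y"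
  shows "l \<in> carrier A \<and> r \<in> carrier A"
  using assms(2) unfolding inverse_relations_def by (auto simp: assms(1))

lemma inverse_relations_iff:
  assumes "\<And>i. i \<in> verts Q \<Longrightarrow> x i \<in> carrier A \<and> y i \<in> carrier A"
  shows "(\<forall>(l, r)\<in>inverse_relations Q A x y. h l = h r) \<longleftrightarrow>
    (\<forall>i\<in>verts Q. h (x i) * h (y i) = h \<one> \<and> h (y i) * h (x i) = h \<one>)"
  unfolding inverse_relations_def using assms by auto

end

lemma Ut_gens_iff [simp]:
  "tE i \<in> Ut_gens Q \<longleftrightarrow> i \<in> verts Q" "tF i \<in> Ut_gens Q \<longleftrightarrow> i \<in> verts Q"
  "tK i \<in> Ut_gens Q \<longleftrightarrow> i \<in> verts Q" "tK' i \<in> Ut_gens Q \<longleftrightarrow> i \<in> verts Q"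
  "tKinv i \<in> Ut_gens Q \<longleftrightarrow> i \<in> verts Q" "tK'inv i \<in> Ut_gens Q \<longleftrightarrow> i \<in> verts Q"
  by (simp_all add: Ut_gens_def)

lemma Uq_gens_iff [simp]:
  "qE i \<in> Uq_gens Q \<longleftrightarrow> i \<in> verts Q" "qF i \<in> Uq_gens Q \<longleftrightarrow> i \<in> verts Q"
  "qK i \<in> Uq_gens Q \<longleftrightarrow> i \<in> verts Q" "qKinv i \<in> Uq_gens Q \<longleftrightarrow> i \<in> verts Q"
  by (simp_all add: Uq_gens_def)

lemma free_algebra_rep_ex:
  "\<exists>h :: ('g list \<Rightarrow>\<^sub>0 rat poly fract) \<Rightarrow> (('g list \<Rightarrow>\<^sub>0 rat poly fract), rat poly fract) lend.
     qrepresented lscale (free_algebra X) h"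
proof -
  obtain h :: "('g list \<Rightarrow>\<^sub>0 rat poly fract) \<Rightarrow> (('g list \<Rightarrow>\<^sub>0 rat poly fract), rat poly fract) lend"
    where "lend.alg_rep (free_algebra X) h"
    using kalg_faithful_rep[OF kalg_free_algebra] by blast
  then show ?thesis
    by (auto simp: qrepresented_def represented_algebra_def represented_algebra_axioms_def qring_def
        lend.scalar_ring_axioms kalg_free_algebra)
qed

lemma presentation_Ut: "presentation (Ut_gens Q) (Ut_rels Q)"
proof
  fix l r assume lr: "(l, r) \<in> Ut_rels Q"
  obtain h :: "('a tgen list \<Rightarrow>\<^sub>0 rat poly fract) \<Rightarrow> (('a tgen list \<Rightarrow>\<^sub>0 rat poly fract), rat poly fract) lend"
    where "qrepresented lscale (free_algebra (Ut_gens Q)) h" using free_algebra_rep_ex by blast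
  then interpret qrepresented lscale "free_algebra (Ut_gens Q)" h .
  have g: "g \<in> Ut_gens Q \<Longrightarrow> free_gen g \<in> carrier (free_algebra (Ut_gens Q))" for g
    by (rule free_gen_closed)
  show "l \<in> carrier (free_algebra (Ut_gens Q)) \<and> r \<in> carrier (free_algebra (Ut_gens Q))"
    using lr unfolding Ut_rels_def Let_def
    apply (elim UnE)
    subgoal by (rule quantum_relations_closed) (auto simp: g simp del: free_algebra_simps)
    subgoal by (rule inverse_relations_closed) (auto simp: g simp del: free_algebra_simps)
    subgoal by (rule inverse_relations_closed) (auto simp: g simp del: free_algebra_simps)
    done
qed

lemma presentation_Uq: "presentation (Uq_gens Q) (Uq_rels Q)"
proof
  fix l r assume lr: "(l, r) \<in> Uq_rels Q"
  obtain h :: "('a qgen list \<Rightarrow>\<^sub>0 rat poly fract) \<Rightarrow> (('a qgen list \<Rightarrow>\<^sub>0 rat poly fract), rat poly fract) lend"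
    where "qrepresented lscale (free_algebra (Uq_gens Q)) h" using free_algebra_rep_ex by blast
  then interpret qrepresented lscale "free_algebra (Uq_gens Q)" h .
  have g: "g \<in> Uq_gens Q \<Longrightarrow> free_gen g \<in> carrier (free_algebra (Uq_gens Q))" for g
    by (rule free_gen_closed)
  show "l \<in> carrier (free_algebra (Uq_gens Q)) \<and> r \<in> carrier (free_algebra (Uq_gens Q))"
    using lr unfolding Uq_rels_def Let_def
    apply (elim UnE)
    subgoal by (rule quantum_relations_closed) (auto simp: g simp del: free_algebra_simps)
    subgoal by (rule inverse_relations_closed) (auto simp: g simp del: free_algebra_simps)
    done
qed

lemma kalg_Ut: "kalg (Ut Q)"
  unfolding Ut_def by (rule presentation.kalg_presented[OF presentation_Ut])

lemma kalg_Uq: "kalg (Uq Q)"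
  unfolding Uq_def by (rule presentation.kalg_presented[OF presentation_Uq])

lemma Ut_gen_closed [simp]: "g \<in> Ut_gens Q \<Longrightarrow> Ut_gen Q g \<in> carrier (Ut Q)"
  unfolding Ut_def Ut_gen_def by (rule presentation.gen_closed[OF presentation_Ut])

lemma Uq_gen_closed [simp]: "g \<in> Uq_gens Q \<Longrightarrow> Uq_gen Q g \<in> carrier (Uq Q)"
  unfolding Uq_def Uq_gen_def by (rule presentation.gen_closed[OF presentation_Uq])

context qring
begin

definition Ut_data :: "('i, 'a) pre_digraph \<Rightarrow> ('i tgen \<Rightarrow> 'r) \<Rightarrow> 'r \<Rightarrow> bool" where
  "Ut_data Q \<eta> e \<longleftrightarrow> corner (Ut_gens Q) \<eta> e \<and>
    quantum_system Q (\<eta> \<circ> tE) (\<eta> \<circ> tF) (\<eta> \<circ> tK) (\<eta> \<circ> tK') \<and>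
    (\<forall>i\<in>verts Q. \<eta> (tK i) * \<eta> (tKinv i) = e \<and> \<eta> (tKinv i) * \<eta> (tK i) = e) \<and>
    (\<forall>i\<in>verts Q. \<eta> (tK' i) * \<eta> (tK'inv i) = e \<and> \<eta> (tK'inv i) * \<eta> (tK' i) = e)"

definition Uq_data :: "('i, 'a) pre_digraph \<Rightarrow> ('i qgen \<Rightarrow> 'r) \<Rightarrow> 'r \<Rightarrow> bool" where
  "Uq_data Q \<eta> e \<longleftrightarrow> corner (Uq_gens Q) \<eta> e \<and>
    quantum_system Q (\<eta> \<circ> qE) (\<eta> \<circ> qF) (\<eta> \<circ> qK) (\<eta> \<circ> qKinv) \<and>
    (\<forall>i\<in>verts Q. \<eta> (qK i) * \<eta> (qKinv i) = e \<and> \<eta> (qKinv i) * \<eta> (qK i) = e)"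

lemma Ut_rels_iff:
  assumes "alg_rep (free_algebra (Ut_gens Q)) \<theta>"
  shows "(\<forall>(l, r)\<in>Ut_rels Q. \<theta> l = \<theta> r) \<longleftrightarrow> Ut_data Q (\<theta> \<circ> free_gen) (\<theta> \<one>\<^bsub>free_algebra (Ut_gens Q)\<^esub>)"
proof -
  let ?W = "free_algebra (Ut_gens Q) :: (rat poly fract, _) module"
  interpret W: kalg ?W by (rule kalg_free_algebra)
  interpret qrepresented scl ?W \<theta>
    by unfold_locales (rule assms)
  have g: "g \<in> Ut_gens Q \<Longrightarrow> free_gen g \<in> carrier ?W" for g
    by (rule free_gen_closed)
  have c: "corner (Ut_gens Q) (\<theta> \<circ> free_gen) (\<theta> \<one>\<^bsub>?W\<^esub>)"
    unfolding corner_def using rep_one_l[OF g] rep_one_r[OF g] rep_one_l[OF W.one_closed] by (simp del: free_algebra_simps)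
  show ?thesis
    unfolding Ut_rels_def Let_def ball_Un Ut_data_def
    by (subst quantum_relations_iff, use g in simp, subst (1 2) inverse_relations_iff)
       (use g c in \<open>auto simp: comp_assoc simp del: free_algebra_simps\<close>)
qed

lemma Uq_rels_iff:
  assumes "alg_rep (free_algebra (Uq_gens Q)) \<theta>"
  shows "(\<forall>(l, r)\<in>Uq_rels Q. \<theta> l = \<theta> r) \<longleftrightarrow> Uq_data Q (\<theta> \<circ> free_gen) (\<theta> \<one>\<^bsub>free_algebra (Uq_gens Q)\<^esub>)"
proof -
  let ?W = "free_algebra (Uq_gens Q) :: (rat poly fract, _) module"
  interpret W: kalg ?W by (rule kalg_free_algebra)
  interpret qrepresented scl ?W \<theta>
    by unfold_locales (rule assms)
  have g: "g \<in> Uq_gens Q \<Longrightarrow> free_gen g \<in> carrier ?W" for g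
    by (rule free_gen_closed)
  have c: "corner (Uq_gens Q) (\<theta> \<circ> free_gen) (\<theta> \<one>\<^bsub>?W\<^esub>)"
    unfolding corner_def using rep_one_l[OF g] rep_one_r[OF g] rep_one_l[OF W.one_closed] by (simp del: free_algebra_simps)
  show ?thesis
    unfolding Uq_rels_def Let_def ball_Un Uq_data_def
    by (subst quantum_relations_iff, use g in simp, subst inverse_relations_iff)
       (use g c in \<open>auto simp: comp_assoc simp del: free_algebra_simps\<close>)
qed

lemma presented_rep_pullback:
  assumes "presentation X R" "alg_rep (presented_algebra X R) h"
  shows "alg_rep (free_algebra X) (\<lambda>f. h (relation_ideal X R +>\<^bsub>free_algebra X\<^esub> f))"
proof -
  interpret presentation X R by fact
  show ?thesis
    using assms(2) unfolding alg_rep_def presented_eq quot_carrier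
    by (auto simp: quot_add[symmetric] quot_mult[symmetric] quot_smult[symmetric] simp del: free_algebra_simps)
qed

lemma Ut_data_of_rep:
  assumes "alg_rep (Ut Q) h"
  shows "Ut_data Q (h \<circ> Ut_gen Q) (h \<one>\<^bsub>Ut Q\<^esub>)"
proof -
  interpret presentation "Ut_gens Q" "Ut_rels Q" by (rule presentation_Ut)
  let ?\<theta> = "\<lambda>f. h (I +>\<^bsub>W\<^esub> f)"
  have "\<forall>(l, r)\<in>Ut_rels Q. ?\<theta> l = ?\<theta> r"
    using relation_holds by auto
  then have "Ut_data Q (?\<theta> \<circ> free_gen) (?\<theta> \<one>\<^bsub>W\<^esub>)"
    using Ut_rels_iff[OF presented_rep_pullback[OF presentation_Ut assms[unfolded Ut_def]]] by blast
  then show ?thesis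
    by (simp only: Ut_def Ut_gen_def presented_eq quot_one comp_def presented_gen_def)
qed

lemma Uq_data_of_rep:
  assumes "alg_rep (Uq Q) h"
  shows "Uq_data Q (h \<circ> Uq_gen Q) (h \<one>\<^bsub>Uq Q\<^esub>)"
proof -
  interpret presentation "Uq_gens Q" "Uq_rels Q" by (rule presentation_Uq)
  let ?\<theta> = "\<lambda>f. h (I +>\<^bsub>W\<^esub> f)"
  have "\<forall>(l, r)\<in>Uq_rels Q. ?\<theta> l = ?\<theta> r"
    using relation_holds by auto
  then have "Uq_data Q (?\<theta> \<circ> free_gen) (?\<theta> \<one>\<^bsub>W\<^esub>)"
    using Uq_rels_iff[OF presented_rep_pullback[OF presentation_Uq assms[unfolded Uq_def]]] by blast
  then show ?thesis
    by (simp only: Uq_def Uq_gen_def presented_eq quot_one comp_def presented_gen_def)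
qed

lemma corner_free_gen:
  assumes "corner X \<eta> e" "x \<in> X" shows "lin (word_rep \<eta> e) (free_gen x) = \<eta> x"
  using assms by (simp add: free_gen_def corner_def)

lemma Ut_data_cong:
  assumes "\<And>x. x \<in> Ut_gens Q \<Longrightarrow> \<eta> x = \<eta>' x" "Ut_data Q \<eta> e" shows "Ut_data Q \<eta>' e"
proof -
  have "i \<in> verts Q \<Longrightarrow> \<eta>' (tE i) = \<eta> (tE i) \<and> \<eta>' (tF i) = \<eta> (tF i) \<and> \<eta>' (tK i) = \<eta> (tK i) \<and>
     \<eta>' (tK' i) = \<eta> (tK' i) \<and> \<eta>' (tKinv i) = \<eta> (tKinv i) \<and> \<eta>' (tK'inv i) = \<eta> (tK'inv i)" for i
    using assms(1) by simp
  moreover have "corner (Ut_gens Q) \<eta>' e" using assms by (simp add: Ut_data_def corner_def)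
  ultimately show ?thesis using assms(2) by (simp add: Ut_data_def quantum_system_def)
qed

lemma Uq_data_cong:
  assumes "\<And>x. x \<in> Uq_gens Q \<Longrightarrow> \<eta> x = \<eta>' x" "Uq_data Q \<eta> e" shows "Uq_data Q \<eta>' e"
proof -
  have "i \<in> verts Q \<Longrightarrow> \<eta>' (qE i) = \<eta> (qE i) \<and> \<eta>' (qF i) = \<eta> (qF i) \<and> \<eta>' (qK i) = \<eta> (qK i) \<and>
     \<eta>' (qKinv i) = \<eta> (qKinv i)" for i
    using assms(1) by simp
  moreover have "corner (Uq_gens Q) \<eta>' e" using assms by (simp add: Uq_data_def corner_def)
  ultimately show ?thesis using assms(2) by (simp add: Uq_data_def quantum_system_def)
qed

text \<open>
  The universal property of the presentation. The description of the image is what allows a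
  representation into endomorphisms to be pulled back to another algebra record.
\<close>

lemma rep_of_Ut_data:
  assumes "Ut_data Q \<eta> e"
  shows "\<exists>g. alg_rep (Ut Q) g \<and> (\<forall>x\<in>Ut_gens Q. g (Ut_gen Q x) = \<eta> x) \<and> g \<one>\<^bsub>Ut Q\<^esub> = e
    \<and> g ` carrier (Ut Q) \<subseteq> lin (word_rep \<eta> e) ` {f. Poly_Mapping.keys f \<subseteq> lists (Ut_gens Q)}"
  unfolding Ut_def Ut_gen_def
proof (rule rep_presented[OF presentation_Ut])
  show c: "corner (Ut_gens Q) \<eta> e" using assms by (simp add: Ut_data_def)
  have "Ut_data Q (lin (word_rep \<eta> e) \<circ> free_gen) (lin (word_rep \<eta> e) \<one>\<^bsub>free_algebra (Ut_gens Q)\<^esub>)"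
    using Ut_data_cong[OF _ assms] corner_free_gen[OF c] by simp
  then show "(l, r) \<in> Ut_rels Q \<Longrightarrow> lin (word_rep \<eta> e) l = lin (word_rep \<eta> e) r" for l r
    using Ut_rels_iff[OF alg_rep_free[OF c]] by blast
qed

lemma rep_of_Uq_data:
  assumes "Uq_data Q \<eta> e"
  shows "\<exists>g. alg_rep (Uq Q) g \<and> (\<forall>x\<in>Uq_gens Q. g (Uq_gen Q x) = \<eta> x) \<and> g \<one>\<^bsub>Uq Q\<^esub> = e"
proof -
  have c: "corner (Uq_gens Q) \<eta> e" using assms by (simp add: Uq_data_def)
  have "Uq_data Q (lin (word_rep \<eta> e) \<circ> free_gen) (lin (word_rep \<eta> e) \<one>\<^bsub>free_algebra (Uq_gens Q)\<^esub>)"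
    using Uq_data_cong[OF _ assms] corner_free_gen[OF c] by simp
  then have "(l, r) \<in> Uq_rels Q \<Longrightarrow> lin (word_rep \<eta> e) l = lin (word_rep \<eta> e) r" for l r
    using Uq_rels_iff[OF alg_rep_free[OF c]] by blast
  from rep_presented[OF presentation_Uq c this] show ?thesis
    unfolding Uq_def Uq_gen_def by blast
qed

end

context qring
begin

lemma serre_scale: "serre x (c \<cdot> w) m = c \<cdot> serre x w m"
  by (simp add: serre_def scl_mult_left scl_mult_right scale_sum_right mult.commute)

lemma serre_diff: "serre x (w - w') m = serre x w m - serre x w' m"
  by (simp add: serre_def left_diff_distrib right_diff_distrib scale_right_diff_distrib sum_subtractf)

lemma serre_add: "serre x (w + w') m = serre x w m + serre x w' m"
  by (simp add: serre_def distrib_left distrib_right scale_right_distrib sum.distrib)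

lemma power_commuting:
  fixes e a :: 'r
  shows "e * a = a * e \<Longrightarrow> e * a ^ n = a ^ n * e"
  using power_commuting_commutes[of a e n] by simp

lemma serre_mult_left: "e * a = a * e \<Longrightarrow> e * serre a w m = serre a (e * w) m"
proof -
  assume ea: "e * a = a * e"
  have "e * (a ^ r * w * a ^ s) = (e * a ^ r) * w * a ^ s" for r s
    by (simp add: mult.assoc)
  then have "e * (a ^ r * w * a ^ s) = a ^ r * (e * w) * a ^ s" for r s
    unfolding power_commuting[OF ea] by (simp add: mult.assoc)
  then show ?thesis by (simp add: serre_def sum_distrib_left scl_mult_right)
qed

lemma serre_mult_right: "e * a = a * e \<Longrightarrow> serre a w m * e = serre a (w * e) m"
proof -
  assume ea: "e * a = a * e"
  have "a ^ r * w * a ^ s * e = a ^ r * (w * e) * a ^ s" for r s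
    unfolding mult.assoc power_commuting[OF ea, of s] ..
  then show ?thesis by (simp add: serre_def sum_distrib_right scl_mult_left)
qed

lemma serre_commute:
  assumes "e * a = a * e" "e * w = w * e" shows "e * serre a w m = serre a w m * e"
  using serre_mult_left[OF assms(1)] serre_mult_right[OF assms(1)] assms(2) by simp

lemma serre_eq_0_iff:
  assumes "qpar u"
  shows "serre x w m = 0 \<longleftrightarrow> qprod (u ^ (m - 1)) (inverse (u ^ 2)) (\<lambda>y. x * y) (\<lambda>y. y * x) w m = 0"
  unfolding qprod_eq_serre[OF assms] by simp

lemma serre_q_commuting:
  assumes "qpar u" "m > 0" "g * a = inverse (u ^ (m - 1)) \<cdot> (a * g)"
  shows "serre a g m = 0"
proof -
  have u0: "u \<noteq> 0" using assms(1) by (rule qpar_nonzero)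
  have "qprod (u ^ (m - 1)) (inverse (u ^ 2)) (\<lambda>y. a * y) (\<lambda>y. y * a) g (Suc n) = 0" for n
    using u0 by (induction n) (simp_all add: assms(3))
  then show ?thesis
    unfolding serre_eq_0_iff[OF assms(1)] using assms(2) by (metis Suc_pred)
qed

lemma serre_coeffs_qpar:
  assumes "qpar u" "m > 0"
  shows "serre_coeffs (inverse (u ^ 2)) (inverse (u ^ (m - 1))) m"
proof -
  interpret not_root_of_unity "inverse (u ^ 2)" by (rule qpar_not_root[OF assms(1)])
  show ?thesis
    by unfold_locales (use qpar_nonzero[OF assms(1)] assms(2) in
      \<open>auto simp: power_inverse power_mult[symmetric] power2_eq_square power_mult_distrib\<close>)
qed

text \<open>
  The element \<open>e K'\<close> is of the kind of \<open>b\<close> in the previous section, where the Serre element was seen to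
  \<open>q\<close>-commute with \<open>b\<close>; dividing by \<open>K'\<close> gives the claim.
\<close>

lemma quantum_serre_commutes:
  fixes d :: "rat poly fract"
  assumes u: "qpar u" and m: "m > 0"
    and ea: "e * a = a * e + d \<cdot> (K - K')"
    and ew: "e * w = w * e"
    and K'a: "K' * a = (u ^ 2) \<cdot> (a * K')" and Ka: "K * a = inverse (u ^ 2) \<cdot> (a * K)"
    and K'e: "K' * e = inverse (u ^ 2) \<cdot> (e * K')" and Ke: "K * e = (u ^ 2) \<cdot> (e * K)"
    and K'w: "K' * w = inverse (u ^ (m - 1)) \<cdot> (w * K')" and Kw: "K * w = (u ^ (m - 1)) \<cdot> (w * K)"
    and KK: "K * K' = K' * K" and inv: "K' * Z = 1"
  shows "e * serre a w m = serre a w m * e"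
proof -
  have u0: "u \<noteq> 0" using u by (rule qpar_nonzero)
  define b where "b = e * K'"
  interpret serre_coeffs "inverse (u ^ 2)" "inverse (u ^ (m - 1))" m
    by (rule serre_coeffs_qpar[OF u m])
  note ext = arg_cong[where f = "\<lambda>z. z * X" for X]
  have KK': "K * (K' * X) = K' * (K * X)" for X using ext[OF KK, of X] by (simp add: mult.assoc)
  have K'a': "K' * (a * X) = (u ^ 2) \<cdot> (a * (K' * X))" for X using ext[OF K'a, of X] by (simp add: scl_nf)
  have Ka': "K * (a * X) = inverse (u ^ 2) \<cdot> (a * (K * X))" for X using ext[OF Ka, of X] by (simp add: scl_nf)
  have K'e': "K' * (e * X) = inverse (u ^ 2) \<cdot> (e * (K' * X))" for X using ext[OF K'e, of X] by (simp add: scl_nf)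
  have Ke': "K * (e * X) = (u ^ 2) \<cdot> (e * (K * X))" for X using ext[OF Ke, of X] by (simp add: scl_nf)
  have K'w': "K' * (w * X) = inverse (u ^ (m - 1)) \<cdot> (w * (K' * X))" for X using ext[OF K'w, of X] by (simp add: scl_nf)
  have Kw': "K * (w * X) = (u ^ (m - 1)) \<cdot> (w * (K * X))" for X using ext[OF Kw, of X] by (simp add: scl_nf)
  have ea': "e * (a * X) = a * (e * X) + d \<cdot> (K * X - K' * X)" for X using ext[OF ea, of X] by (simp add: scl_nf)
  have ew': "e * (w * X) = w * (e * X)" for X using ext[OF ew, of X] by (simp add: scl_nf)
  interpret P: serre_pair_2 scl "inverse (u ^ 2)" "inverse (u ^ (m - 1))" m a b w
    "(u ^ 2 * d) \<cdot> (K * K')" K' "u ^ 2 * d"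
  proof
    show "b * a = inverse (inverse (u\<^sup>2)) \<cdot> (a * b) + (u\<^sup>2 * d) \<cdot> (K * K') - (u\<^sup>2 * d) \<cdot> (K' * K')"
      by (simp add: b_def scl_nf K'a ea')
    show "b * w = inverse (u ^ (m - 1)) \<cdot> (w * b)"
      by (simp add: b_def scl_nf K'w ew')
    show "K' * a = inverse (inverse (u\<^sup>2)) \<cdot> (a * K')" by (simp add: K'a)
    show "K' * b = inverse (u\<^sup>2) \<cdot> (b * K')" by (simp add: b_def scl_nf K'e')
    show "K' * w = inverse (u ^ (m - 1)) \<cdot> (w * K')" by (rule K'w)
    show "(u\<^sup>2 * d) \<cdot> (K * K') * a = a * (u\<^sup>2 * d) \<cdot> (K * K')"
      using u0 by (simp add: scl_nf K'a Ka')
    show "(u\<^sup>2 * d) \<cdot> (K * K') * b = b * (u\<^sup>2 * d) \<cdot> (K * K')"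
      using u0 by (simp add: b_def scl_nf K'e' Ke' KK')
    show "(u\<^sup>2 * d) \<cdot> (K * K') * w = w * (u\<^sup>2 * d) \<cdot> (K * K')"
      using u0 by (simp add: scl_nf K'w Kw')
    show "(u\<^sup>2 * d) \<cdot> (K * K') * K' = K' * (u\<^sup>2 * d) \<cdot> (K * K')"
      by (simp add: scl_nf KK KK')
  qed
  have zs: "P.zs m = (-1) ^ m \<cdot> serre a w m"
    unfolding P.zs_def using qprod_eq_serre[OF u] by simp
  let ?c = "inverse (u ^ (m - 1)) / inverse (u ^ 2) ^ m"
  have c: "?c \<noteq> 0" using u0 by simp
  have "?c \<cdot> (e * (P.zs m * K')) = e * (K' * P.zs m)"
    unfolding P.y_zs by (simp only: scl_mult_right)
  also have "\<dots> = ?c \<cdot> (P.zs m * (e * K'))"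
    using P.b_zs_top by (simp add: b_def mult.assoc)
  finally have "e * (P.zs m * K') = P.zs m * (e * K')"
    using c u0 by simp
  then have "e * (P.zs m * K') * Z = P.zs m * (e * K') * Z" by simp
  then have "e * P.zs m * (K' * Z) = P.zs m * e * (K' * Z)"
    by (simp only: mult.assoc)
  then show ?thesis
    unfolding inv zs by (simp add: scl_nf)
qed

lemma quantum_serre_commutes':
  fixes d :: "rat poly fract"
  assumes u: "qpar u" and m: "m > 0"
    and ea: "e * a = a * e" and ew: "e * w = w * e + d \<cdot> (K - K')"
    and K'a: "K' * a = inverse (u ^ (m - 1)) \<cdot> (a * K')" and Ka: "K * a = (u ^ (m - 1)) \<cdot> (a * K)"
  shows "e * serre a w m = serre a w m * e"
proof -
  have u': "qpar (inverse u)" using u by (auto simp: qpar_def)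
  have "e * serre a w m - serre a w m * e = serre a (e * w - w * e) m"
    unfolding serre_mult_left[OF ea] serre_mult_right[OF ea] serre_diff ..
  also have "\<dots> = d \<cdot> (serre a K m - serre a K' m)"
    by (simp add: ew serre_scale serre_diff)
  also have "\<dots> = 0"
    using serre_q_commuting[OF u m K'a] serre_q_commuting[OF u' m, of K a] Ka by (simp add: power_inverse)
  finally show ?thesis by simp
qed

end

section \<open>Verma modules\<close>

lemma lend_ext:
  assumes "\<And>x. app S (Poly_Mapping.single x 1) = app T (Poly_Mapping.single x 1)" shows "S = T"
proof (rule lend_eqI)
  fix f show "app S f = app T f"
    using assms by (rule pm.linear_ext_on_keys[OF linear_app linear_app])
qed

definition lend_of :: "('b \<Rightarrow> ('b \<Rightarrow>\<^sub>0 'k::field)) \<Rightarrow> ('b, 'k) lend" where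
  "lend_of \<phi> = Lend (pm.lin \<phi>)"

lemma app_lend_of [simp]: "app (lend_of \<phi>) f = pm.lin \<phi> f"
  by (simp add: lend_of_def Lend_inverse pm.linear_lin)

interpretation lendq: qring "lscale :: rat poly fract \<Rightarrow> ('b, rat poly fract) lend \<Rightarrow> ('b, rat poly fract) lend"
  by (simp add: qring_def lend.scalar_ring_axioms)

locale gcm =
  fixes c :: "'i \<Rightarrow> 'i \<Rightarrow> int"
  assumes c_sym: "c i j = c j i" and c_diag [simp]: "c i i = 2" and c_off: "i \<noteq> j \<Longrightarrow> c i j \<le> 0"
begin

definition mm :: "'i \<Rightarrow> 'i \<Rightarrow> nat" where "mm i j = nat (1 - c i j)"

lemma mm_pos: "i \<noteq> j \<Longrightarrow> mm i j > 0"
  using c_off[of i j] by (simp add: mm_def)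

lemma c_mm: "i \<noteq> j \<Longrightarrow> c i j = - int (mm i j - 1)"
  using c_off[of i j] by (simp add: mm_def)

end

definition wsum :: "('i \<Rightarrow> int) \<Rightarrow> 'i list \<Rightarrow> int" where "wsum \<chi> J = sum_list (map \<chi> J)"

lemma wsum_simps [simp]: "wsum \<chi> [] = 0" "wsum \<chi> (j # J) = \<chi> j + wsum \<chi> J"
  "wsum \<chi> (J @ J') = wsum \<chi> J + wsum \<chi> J'" "wsum \<chi> (replicate n i) = int n * \<chi> i"
  by (simp_all add: wsum_def sum_list_replicate)

lemma wsum_add: "wsum (\<lambda>i. \<chi> i + \<chi>' i) J = wsum \<chi> J + wsum \<chi>' J"
  by (simp add: wsum_def sum_list_addf)

lemma wsum_0 [simp]: "wsum (\<lambda>i. 0) J = 0"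
  by (simp add: wsum_def)

type_synonym ('i, 'g) verma = "('i list \<times> 'g, rat poly fract) lend"

definition vF :: "'i \<Rightarrow> ('i, 'g) verma" where
  "vF j = lend_of (\<lambda>(J, g). Poly_Mapping.single (j # J, g) 1)"

definition vT :: "('i \<Rightarrow> int) \<Rightarrow> 'g \<Rightarrow> ('i, 'g::ab_group_add) verma" where
  "vT \<chi> s = lend_of (\<lambda>(J, g). Poly_Mapping.single (J, g + s) (qv powi wsum \<chi> J))"

lemma vF_single [simp]: "app (vF j) (Poly_Mapping.single (J, g) a) = Poly_Mapping.single (j # J, g) a"
  by (simp add: vF_def)

lemma vT_single [simp]: "app (vT \<chi> s) (Poly_Mapping.single (J, g) a) = Poly_Mapping.single (J, g + s) (a * qv powi wsum \<chi> J)"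
  by (simp add: vT_def)

lemma vT_mult: "vT \<chi> s * vT \<chi>' s' = vT (\<lambda>i. \<chi> i + \<chi>' i) (s + s')"
  by (rule lend_ext) (auto simp: app_simps wsum_add power_int_add ac_simps)

lemma vT_0: "vT (\<lambda>i. 0) 0 = 1"
  by (rule lend_ext) (auto simp: app_simps)

lemma vT_vF: "vT \<chi> s * vF j = lscale (qv powi \<chi> j) (vF j * vT \<chi> s)"
  by (rule lend_ext) (auto simp: app_simps power_int_add)

context gcm
begin

definition serre_word :: "'i list \<Rightarrow> 'i \<Rightarrow> 'i \<Rightarrow> 'i list \<Rightarrow> 'g \<Rightarrow> (('i list \<times> 'g) \<Rightarrow>\<^sub>0 rat poly fract)" where
  "serre_word J i j J' g = (\<Sum>r\<le>mm i j. Poly_Mapping.single (J @ replicate r i @ j # replicate (mm i j - r) i @ J', g) ((-1) ^ r * qbinom (mm i j) r))"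

text \<open>
  The two-sided ideal of the Serre relations in the free algebra on the \<open>F\<^sub>i\<close>, tensored with the group
  algebra of the torus.
\<close>

definition vN :: "(('i list \<times> 'g) \<Rightarrow>\<^sub>0 rat poly fract) set" where
  "vN = pm.span {serre_word J i j J' g | J i j J' g. i \<noteq> j}"

lemma serre_word_vN: "i \<noteq> j \<Longrightarrow> serre_word J i j J' g \<in> vN"
  unfolding vN_def by (rule pm.span_base) blast

lemma subspace_vN: "pm.subspace vN"
  by (simp add: vN_def)

lemma vN_image:
  assumes T: "Vector_Spaces.linear pscale pscale T" and M: "pm.subspace M"
    and gen: "\<And>J i j J' g. i \<noteq> j \<Longrightarrow> T (serre_word J i j J' g) \<in> M" and v: "v \<in> vN"
  shows "T v \<in> M"
  using v unfolding vN_def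
proof (induction rule: pm.span_induct_alt)
  case base
  then show ?case using T M by (metis linear_pscale_iff pm.subspace_0 pm.scale_zero_left)
next
  case (step c b w)
  then show ?case using T M gen by (auto simp: linear_pscale_iff intro!: pm.subspace_add pm.subspace_scale)
qed

lemma vF_pow [simp]: "app (vF i ^ n) (Poly_Mapping.single (J, g) a) = Poly_Mapping.single (replicate n i @ J, g) a"
  by (induction n) (simp_all add: app_simps)

lemma serre_vF: "app (lendq.serre (vF i) (vF j) (mm i j)) (Poly_Mapping.single (J, g) 1) = serre_word [] i j J g"
  by (simp add: lendq.serre_def serre_word_def app_sum_lend app_simps)

lemma vF_serre_word: "app (vF l) (serre_word J i j J' g) = serre_word (l # J) i j J' g"
  by (simp add: serre_word_def app_sum)

lemma vT_serre_word: "app (vT \<chi> s) (serre_word J i j J' g) =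
  pscale (qv powi (wsum \<chi> J + int (mm i j) * \<chi> i + \<chi> j + wsum \<chi> J')) (serre_word J i j J' (g + s))"
  unfolding serre_word_def app_sum pm.scale_sum_right
proof (rule sum.cong)
  fix r assume "r \<in> {..mm i j}"
  then have "int r * \<chi> i + int (mm i j - r) * \<chi> i = int (mm i j) * \<chi> i"
    by (simp add: distrib_right[symmetric] of_nat_diff)
  then have "wsum \<chi> (J @ replicate r i @ j # replicate (mm i j - r) i @ J') =
      wsum \<chi> J + int (mm i j) * \<chi> i + \<chi> j + wsum \<chi> J'" by simp
  then show "app (vT \<chi> s) (Poly_Mapping.single (J @ replicate r i @ j # replicate (mm i j - r) i @ J', g) ((- 1) ^ r * qbinom (mm i j) r)) =
    pscale (qv powi (wsum \<chi> J + int (mm i j) * \<chi> i + \<chi> j + wsum \<chi> J'))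
      (Poly_Mapping.single (J @ replicate r i @ j # replicate (mm i j - r) i @ J', g + s) ((- 1) ^ r * qbinom (mm i j) r))"
    by (simp only: vT_single pscale_single mult.commute)
qed simp

end

locale verma = gcm c for c :: "'i \<Rightarrow> 'i \<Rightarrow> int" +
  fixes x y :: "'i \<Rightarrow> 'g::ab_group_add"
begin

definition vK :: "'i \<Rightarrow> ('i, 'g) verma" where "vK i = vT (\<lambda>j. - c i j) (x i)"
definition vK' :: "'i \<Rightarrow> ('i, 'g) verma" where "vK' i = vT (c i) (y i)"

text \<open>
  The action of \<open>E\<^sub>k\<close> on a word, forced by the commutation relations with the \<open>F\<^sub>j\<close> and by
  \<open>E\<^sub>k\<close> killing the empty word.
\<close>

primrec e_basis :: "'i \<Rightarrow> 'g \<Rightarrow> 'i list \<Rightarrow> (('i list \<times> 'g) \<Rightarrow>\<^sub>0 rat poly fract)" where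
  "e_basis k g [] = 0"
| "e_basis k g (j # J) = app (vF j) (e_basis k g J) +
     (if k = j then pscale (1 / (qv - inverse qv)) (app (vK k) (Poly_Mapping.single (J, g) 1) - app (vK' k) (Poly_Mapping.single (J, g) 1)) else 0)"

definition vE :: "'i \<Rightarrow> ('i, 'g) verma" where
  "vE k = lend_of (\<lambda>(J, g). e_basis k g J)"

lemma vE_single: "app (vE k) (Poly_Mapping.single (J, g) 1) = e_basis k g J"
  by (simp add: vE_def)

lemma vE_vF: "vE k * vF j = vF j * vE k + (if k = j then lscale (1 / (qv - inverse qv)) (vK k - vK' k) else 0)"
  by (rule lend_ext) (auto simp: app_simps vE_single)

lemma vT_vE: "vT \<chi> s * vE k = lscale (qv powi (- \<chi> k)) (vE k * vT \<chi> s)"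
proof (rule lend_ext, clarify)
  fix J :: "'i list" and g :: 'g
  show "app (vT \<chi> s * vE k) (Poly_Mapping.single (J, g) 1) =
        app (lscale (qv powi (- \<chi> k)) (vE k * vT \<chi> s)) (Poly_Mapping.single (J, g) 1)"
  proof (induction J)
    case Nil
    have "app (vE k) (Poly_Mapping.single ([], g + s) 1) = 0" by (simp add: vE_single)
    then show ?case by (simp add: app_simps vE_single)
  next
    case (Cons j J)
    let ?v = "Poly_Mapping.single (J, g) (1 :: rat poly fract)"
    have 1: "Poly_Mapping.single (j # J, g) 1 = app (vF j) ?v" by simp
    have TF: "app (vT \<chi> s) (app (vF j) w) = pscale (qv powi \<chi> j) (app (vF j) (app (vT \<chi> s) w))" for w
      using vT_vF[of \<chi> s j] by (metis app_simps(6,7))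
    have EF: "app (vE k) (app (vF j) w) = app (vF j) (app (vE k) w) +
        (if k = j then pscale (1 / (qv - inverse qv)) (app (vK k) w - app (vK' k) w) else 0)" for w
      using arg_cong[OF vE_vF[of k j], of "\<lambda>S. app S w"] by (auto simp: app_simps split: if_splits)
    have TK: "app (vT \<chi> s) (app (vK i) w) = app (vK i) (app (vT \<chi> s) w)"
      "app (vT \<chi> s) (app (vK' i) w) = app (vK' i) (app (vT \<chi> s) w)" for i w
    proof -
      have "vT \<chi> s * vT \<chi>' s' = vT \<chi>' s' * vT \<chi> s" for \<chi>' :: "'i \<Rightarrow> int" and s' :: 'g
        by (simp add: vT_mult add.commute)
      then have "app (vT \<chi> s) (app (vT \<chi>' s') w) = app (vT \<chi>' s') (app (vT \<chi> s) w)" for \<chi>' :: "'i \<Rightarrow> int" and s' :: 'g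
        by (metis times_lend.rep_eq)
      then show "app (vT \<chi> s) (app (vK i) w) = app (vK i) (app (vT \<chi> s) w)"
        "app (vT \<chi> s) (app (vK' i) w) = app (vK' i) (app (vT \<chi> s) w)" by (simp_all only: vK_def vK'_def)
    qed
    have "app (vT \<chi> s * vE k) (app (vF j) ?v) = pscale (qv powi \<chi> j) (app (vF j) (app (vT \<chi> s * vE k) ?v))
       + (if k = j then pscale (1 / (qv - inverse qv)) (app (vK k) (app (vT \<chi> s) ?v) - app (vK' k) (app (vT \<chi> s) ?v)) else 0)"
      by (simp add: app_simps EF TF TK app_add app_diff app_pscale del: vT_single vF_single)
    also have "app (vT \<chi> s * vE k) ?v = pscale (qv powi (- \<chi> k)) (app (vE k) (app (vT \<chi> s) ?v))"
      unfolding Cons by (simp add: app_simps del: vT_single)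
    also have "pscale (qv powi \<chi> j) (app (vF j) (pscale (qv powi (- \<chi> k)) (app (vE k) (app (vT \<chi> s) ?v)))) =
       pscale (qv powi \<chi> j * qv powi (- \<chi> k)) (app (vF j) (app (vE k) (app (vT \<chi> s) ?v)))"
      by (simp add: app_pscale)
    finally have L: "app (vT \<chi> s * vE k) (app (vF j) ?v) =
       pscale (qv powi \<chi> j * qv powi (- \<chi> k)) (app (vF j) (app (vE k) (app (vT \<chi> s) ?v)))
       + (if k = j then pscale (1 / (qv - inverse qv)) (app (vK k) (app (vT \<chi> s) ?v) - app (vK' k) (app (vT \<chi> s) ?v)) else 0)" .
    have R: "app (lscale (qv powi (- \<chi> k)) (vE k * vT \<chi> s)) (app (vF j) ?v) =
       pscale (qv powi (- \<chi> k) * qv powi \<chi> j) (app (vF j) (app (vE k) (app (vT \<chi> s) ?v)) +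
        (if k = j then pscale (1 / (qv - inverse qv)) (app (vK k) (app (vT \<chi> s) ?v) - app (vK' k) (app (vT \<chi> s) ?v)) else 0))"
      by (simp only: app_simps TF app_pscale EF pm.scale_scale)
    have "qv powi \<chi> j * qv powi (- \<chi> j) = 1" by (simp add: power_int_minus)
    then show ?case
      unfolding 1 L R by (simp add: pm.scale_right_distrib mult.commute del: vT_single vF_single)
  qed
qed

definition Nop :: "('i, 'g) verma \<Rightarrow> bool" where
  "Nop T \<longleftrightarrow> (\<forall>v\<in>vN. app T v \<in> vN)"

lemma Nop_mult: "Nop S \<Longrightarrow> Nop T \<Longrightarrow> Nop (S * T)"
  by (simp add: Nop_def app_simps)

lemma Nop_1: "Nop 1"
  by (simp add: Nop_def app_simps)

lemma Nop_pow: "Nop S \<Longrightarrow> Nop (S ^ n)"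
  by (induction n) (simp_all add: Nop_1 Nop_mult)

lemma Nop_I: "(\<And>J i j J' g. i \<noteq> j \<Longrightarrow> app T (serre_word J i j J' g) \<in> vN) \<Longrightarrow> Nop T"
  unfolding Nop_def using vN_image[OF linear_app subspace_vN] by blast

lemma Nop_vF: "Nop (vF l)"
  by (rule Nop_I) (simp add: vF_serre_word serre_word_vN)

lemma Nop_vT: "Nop (vT \<chi> s)"
  by (rule Nop_I) (simp add: vT_serre_word serre_word_vN pm.subspace_scale[OF subspace_vN])

lemma vKZ: "vK i * vT (c i) (- x i) = 1" "vT (c i) (- x i) * vK i = 1"
    "vK' i * vT (\<lambda>j. - c i j) (- y i) = 1" "vT (\<lambda>j. - c i j) (- y i) * vK' i = 1"
  by (simp_all add: vK_def vK'_def vT_mult vT_0)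

lemma qv_c:
  assumes "i \<noteq> j"
  shows "qv powi c i j = inverse (qv ^ (mm i j - 1))" "qv powi (- c i j) = qv ^ (mm i j - 1)"
  unfolding c_mm[OF assms] by (simp_all add: power_int_minus)

lemma qpar_qv: "qpar qv" by (simp add: qpar_def)

lemma vE_serre_vF:
  assumes ij: "i \<noteq> j"
  shows "vE k * lendq.serre (vF i) (vF j) (mm i j) = lendq.serre (vF i) (vF j) (mm i j) * vE k"
proof -
  note m = mm_pos[OF ij] and q = qv_c[OF ij]
  consider "k = i" | "k = j" "k \<noteq> i" | "k \<noteq> i" "k \<noteq> j" by blast
  then show ?thesis
  proof cases
    case 1
    show ?thesis unfolding 1
    proof (rule lendq.quantum_serre_commutes[OF qpar_qv m, where d = "1 / (qv - inverse qv)" and K = "vK i" and K' = "vK' i"])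
      show "vE i * vF i = vF i * vE i + lscale (1 / (qv - inverse qv)) (vK i - vK' i)"
        using vE_vF[of i i] by simp
      show "vE i * vF j = vF j * vE i" using vE_vF[of i j] ij by simp
      show "vK' i * vT (\<lambda>j. - c i j) (- y i) = 1" by (rule vKZ)
    qed (simp_all add: vK_def vK'_def vT_vF vT_vE q power_int_minus vT_mult add.commute)
  next
    case 2
    show ?thesis unfolding 2(1)
    proof (rule lendq.quantum_serre_commutes'[OF qpar_qv m, where d = "1 / (qv - inverse qv)" and K = "vK j" and K' = "vK' j"])
      show "vE j * vF i = vF i * vE j" using vE_vF[of j i] ij by simp
      show "vE j * vF j = vF j * vE j + lscale (1 / (qv - inverse qv)) (vK j - vK' j)"
        using vE_vF[of j j] by simp
    qed (simp_all add: vK_def vK'_def vT_vF c_sym[of j i] q)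
  next
    case 3
    then show ?thesis
      by (intro lendq.serre_commute) (simp_all add: vE_vF)
  qed
qed

lemma vF_serre_vE:
  assumes ij: "i \<noteq> j"
  shows "vF k * lendq.serre (vE i) (vE j) (mm i j) = lendq.serre (vE i) (vE j) (mm i j) * vF k"
proof -
  note m = mm_pos[OF ij] and q = qv_c[OF ij]
  have FE: "vF k * vE l = vE l * vF k + (if k = l then lscale (1 / (qv - inverse qv)) (vK' k - vK k) else 0)" for l
    unfolding vE_vF by (auto simp: lend.scale_right_diff_distrib)
  consider "k = i" | "k = j" "k \<noteq> i" | "k \<noteq> i" "k \<noteq> j" by blast
  then show ?thesis
  proof cases
    case 1
    show ?thesis unfolding 1
    proof (rule lendq.quantum_serre_commutes[OF qpar_qv m, where d = "1 / (qv - inverse qv)" and K = "vK' i" and K' = "vK i"])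
      show "vF i * vE i = vE i * vF i + lscale (1 / (qv - inverse qv)) (vK' i - vK i)"
        using FE[of i] 1 by simp
      show "vF i * vE j = vE j * vF i" using FE[of j] ij 1 by simp
      show "vK i * vT (c i) (- x i) = 1" by (rule vKZ)
    qed (simp_all add: vK_def vK'_def vT_vF vT_vE q power_int_minus vT_mult add.commute)
  next
    case 2
    show ?thesis unfolding 2(1)
    proof (rule lendq.quantum_serre_commutes'[OF qpar_qv m, where d = "1 / (qv - inverse qv)" and K = "vK' j" and K' = "vK j"])
      show "vF j * vE i = vE i * vF j" using FE[of i] 2 by simp
      show "vF j * vE j = vE j * vF j + lscale (1 / (qv - inverse qv)) (vK' j - vK j)"
        using FE[of j] 2 by simp
    qed (simp_all add: vK_def vK'_def vT_vE c_sym[of j i] q)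
  next
    case 3
    then show ?thesis
      by (intro lendq.serre_commute) (simp_all add: FE)
  qed
qed

lemma vE_vac [simp]: "app (vE k) (Poly_Mapping.single ([], g) 1) = 0"
  by (simp add: vE_single)

text \<open>
  The Serre element in the \<open>E\<^sub>i\<close> commutes with all \<open>F\<^sub>k\<close> and kills the empty word, hence kills
  every word.
\<close>

lemma serre_vE:
  assumes ij: "i \<noteq> j" shows "lendq.serre (vE i) (vE j) (mm i j) = 0"
proof (rule lend_ext, clarify)
  let ?S = "lendq.serre (vE i) (vE j) (mm i j)"
  fix J :: "'i list" and g :: 'g
  have "app ?S (Poly_Mapping.single (J, g) 1) = 0"
  proof (induction J)
    case Nil
    have pow: "app (vE k ^ Suc n) (Poly_Mapping.single ([], g) 1) = 0" for k n
      by (simp only: power_Suc2 times_lend.rep_eq vE_vac app_zero)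
    have "app (vE i ^ r * vE j * vE i ^ s) (Poly_Mapping.single ([], g) 1) = 0" for r s
      by (cases s) (simp_all only: times_lend.rep_eq pow app_zero power_0 one_lend.rep_eq vE_vac)
    then show ?case
      by (simp add: lendq.serre_def app_sum_lend lscale.rep_eq)
  next
    case (Cons l J)
    have "app ?S (Poly_Mapping.single (l # J, g) 1) = app (?S * vF l) (Poly_Mapping.single (J, g) 1)"
      by (simp add: app_simps)
    also have "\<dots> = app (vF l * ?S) (Poly_Mapping.single (J, g) 1)"
      unfolding vF_serre_vE[OF ij] ..
    also have "\<dots> = 0" by (simp add: times_lend.rep_eq Cons)
    finally show ?case .
  qed
  then show "app ?S (Poly_Mapping.single (J, g) 1) = app 0 (Poly_Mapping.single (J, g) 1)"
    by (simp add: app_simps)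
qed

lemma serre_vF_vN:
  assumes "i \<noteq> j" shows "app (lendq.serre (vF i) (vF j) (mm i j)) v \<in> (vN :: (('i list \<times> 'g) \<Rightarrow>\<^sub>0 rat poly fract) set)"
proof -
  have "app (lendq.serre (vF i) (vF j) (mm i j)) v =
     pm.lin (\<lambda>z. app (lendq.serre (vF i) (vF j) (mm i j)) (Poly_Mapping.single z 1)) v"
    by (rule pm.linear_eq_lin[OF linear_app])
  also have "\<dots> \<in> vN"
    unfolding pm.lin_def
    by (intro pm.subspace_sum[OF subspace_vN] pm.subspace_scale[OF subspace_vN])
       (use assms in \<open>auto simp: serre_vF serre_word_vN\<close>)
  finally show ?thesis .
qed

lemma Nop_vE: "Nop (vE k)"
proof (rule Nop_I)
  fix J i j J' and g :: 'g assume ij: "i \<noteq> (j :: 'i)"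
  show "app (vE k) (serre_word J i j J' g) \<in> vN"
  proof (induction J)
    case Nil
    have "app (vE k) (serre_word [] i j J' g) = app (vE k * lendq.serre (vF i) (vF j) (mm i j)) (Poly_Mapping.single (J', g) 1)"
      by (simp add: times_lend.rep_eq serre_vF)
    then show ?case
      unfolding vE_serre_vF[OF ij] by (simp add: times_lend.rep_eq serre_vF_vN[OF ij])
  next
    case (Cons l J)
    let ?w = "serre_word J i j J' g"
    have w: "?w \<in> vN" by (rule serre_word_vN[OF ij])
    have "app (vE k) (serre_word (l # J) i j J' g) = app (vE k * vF l) ?w"
      by (simp add: times_lend.rep_eq vF_serre_word)
    also have "\<dots> = app (vF l) (app (vE k) ?w) + (if k = l then pscale (1 / (qv - inverse qv)) (app (vK k) ?w - app (vK' k) ?w) else 0)"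
      unfolding vE_vF by (simp add: app_simps)
    also have "\<dots> \<in> vN"
      using Cons w Nop_vF[of l] Nop_vT
      by (auto simp: Nop_def vK_def vK'_def intro!: pm.subspace_add[OF subspace_vN] pm.subspace_scale[OF subspace_vN] pm.subspace_diff[OF subspace_vN])
    finally show ?case .
  qed
qed

end

text \<open>
  The quotient of the free module by the Serre ideal, realised as the image of a projection \<open>P\<close>. An
  operator \<open>S\<close> that preserves the ideal acts on the quotient as \<open>P S\<close>.
\<close>

locale verma_quotient = verma c x y for c :: "'i \<Rightarrow> 'i \<Rightarrow> int" and x y :: "'i \<Rightarrow> 'g::ab_group_add" +
  fixes P :: "('i, 'g) verma"
  assumes P_0: "app P f = 0 \<longleftrightarrow> f \<in> vN" and P_diff: "app P f - f \<in> vN"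
begin

lemma P_P: "P * P = P"
proof (rule lend_eqI)
  fix f
  have "app P (app P f - f) = 0" using P_0 P_diff by blast
  then show "app (P * P) f = app P f" by (simp add: times_lend.rep_eq app_diff)
qed

lemma P_S_P: "Nop S \<Longrightarrow> P * (S * P) = P * S"
proof (rule lend_eqI)
  fix f assume "Nop S"
  then have "app S (app P f - f) \<in> vN" using P_diff by (auto simp: Nop_def)
  then have "app P (app S (app P f - f)) = 0" using P_0 by blast
  then show "app (P * (S * P)) f = app (P * S) f" by (simp add: times_lend.rep_eq app_diff)
qed

lemma P_S_P': "Nop S \<Longrightarrow> P * (S * (P * T)) = P * (S * T)"
  using arg_cong[OF P_S_P[of S], of "\<lambda>z. z * T"] by (simp add: mult.assoc)

lemma P_pow: "Nop S \<Longrightarrow> P * (T * (P * S) ^ n) = P * (T * S ^ n)" if "Nop T"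
  using that
proof (induction n arbitrary: T)
  case (Suc n)
  have "P * (T * (P * S) ^ Suc n) = P * (T * (P * (S * (P * S) ^ n)))"
    by (simp add: mult.assoc)
  also have "\<dots> = P * ((T * S) * (P * S) ^ n)" using Suc.prems by (simp add: P_S_P' mult.assoc)
  also have "\<dots> = P * ((T * S) * S ^ n)" by (rule Suc.IH) (use Suc.prems in \<open>auto intro: Nop_mult\<close>)
  finally show ?case by (simp add: mult.assoc)
qed simp

lemma P_pow_left: "Nop S \<Longrightarrow> (P * S) ^ n * (P * T) = P * (S ^ n * T)"
proof (induction n)
  case (Suc n)
  then show ?case by (simp add: mult.assoc P_S_P')
qed simp

lemma P_serre:
  assumes "Nop a" "Nop w" shows "lendq.serre (P * a) (P * w) m = P * lendq.serre a w m"
proof -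
  have "(P * a) ^ r * (P * w) * (P * a) ^ s = P * (a ^ r * w * a ^ s)" for r s
  proof -
    have "(P * a) ^ r * (P * w) * (P * a) ^ s = P * ((a ^ r * w) * (P * a) ^ s)"
      unfolding P_pow_left[OF assms(1)] by (simp add: mult.assoc)
    also have "\<dots> = P * ((a ^ r * w) * a ^ s)"
      by (rule P_pow) (use assms in \<open>auto intro: Nop_mult Nop_pow\<close>)
    finally show ?thesis .
  qed
  then show ?thesis by (simp add: lendq.serre_def sum_distrib_left lend.scl_mult_right)
qed

end

lemma (in verma) verma_quotient_ex: "\<exists>P :: ('i, 'g) verma. verma_quotient c P"
proof -
  obtain P where P: "Vector_Spaces.linear pscale pscale P" "\<And>f. P f = 0 \<longleftrightarrow> f \<in> vN"
    "\<And>f. P f - f \<in> (vN :: (('i list \<times> 'g) \<Rightarrow>\<^sub>0 rat poly fract) set)"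
    using projection_along[OF subspace_vN] by blast
  then have "verma_quotient c (Lend P)"
    by unfold_locales (simp_all add: Lend_inverse)
  then show ?thesis by blast
qed

lemma gcm_cartan:
  assumes "fin_digraph Q" "acyclic (arcs_ends Q)" shows "gcm (cartan Q)"
proof
  interpret fin_digraph Q by fact
  show "cartan Q i j = cartan Q j i" for i j
    unfolding cartan_def num_edges_def by (simp add: disj_commute eq_commute)
  show "cartan Q i i = 2" for i
  proof -
    have "{e \<in> arcs Q. tail Q e = i \<and> head Q e = i} = {}"
      using assms(2) by (force simp: acyclic_def arcs_ends_def arc_to_ends_def)
    then show ?thesis by (simp add: cartan_def num_edges_def)
  qed
  show "i \<noteq> j \<Longrightarrow> cartan Q i j \<le> 0" for i j
    by (simp add: cartan_def)
qed

lemma cartan_outside: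
  assumes "fin_digraph Q" "i \<notin> verts Q" "i \<noteq> j" shows "cartan Q i j = 0"
proof -
  interpret fin_digraph Q by fact
  have "{e \<in> arcs Q. tail Q e = i \<and> head Q e = j \<or> tail Q e = j \<and> head Q e = i} = {}"
    using assms(2) tail_in_verts head_in_verts by auto
  then show ?thesis using assms(3) by (simp add: cartan_def num_edges_def)
qed

context verma_quotient
begin

lemma P_mult: "Nop S \<Longrightarrow> (P * S) * (P * T) = P * (S * T)"
  by (simp add: mult.assoc P_S_P')

lemma Nops: "Nop (vF i)" "Nop (vE i)" "Nop (vK i)" "Nop (vK' i)" "Nop (vT \<chi> s)"
  by (simp_all add: Nop_vF Nop_vE Nop_vT vK_def vK'_def)

lemma verma_quantum_system:
  assumes "c = cartan Q"
  shows "lendq.quantum_system Q (\<lambda>i. P * vE i) (\<lambda>i. P * vF i) (\<lambda>i. P * vK i) (\<lambda>i. P * vK' i)"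
  unfolding lendq.quantum_system_def
proof (intro ballI conjI impI)
  fix i j
  have mm: "nat (1 - cartan Q i j) = mm i j" unfolding mm_def by (simp add: assms)
  show "P * vE i * (P * vF j) - P * vF j * (P * vE i) =
      (if i = j then lscale (1 / (qv - inverse qv)) (P * vK i - P * vK' i) else 0)"
    unfolding P_mult[OF Nops(1)] P_mult[OF Nops(2)] vE_vF
    by (simp add: lend.scl_nf)
  show "P * vK i * (P * vK j) = P * vK j * (P * vK i)" "P * vK i * (P * vK' j) = P * vK' j * (P * vK i)"
    "P * vK' i * (P * vK' j) = P * vK' j * (P * vK' i)"
    by (simp_all add: P_mult Nops) (simp_all add: vK_def vK'_def vT_mult add.commute)
  show "P * vK i * (P * vE j) = lscale (qv powi cartan Q i j) (P * vE j * (P * vK i))"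
    "P * vK i * (P * vF j) = lscale (qv powi - cartan Q i j) (P * vF j * (P * vK i))"
    "P * vK' i * (P * vE j) = lscale (qv powi - cartan Q i j) (P * vE j * (P * vK' i))"
    "P * vK' i * (P * vF j) = lscale (qv powi cartan Q i j) (P * vF j * (P * vK' i))"
    by (simp_all add: P_mult Nops) (simp_all add: vK_def vK'_def vT_vF vT_vE lend.scl_nf assms[symmetric])
  assume ij: "i \<noteq> j"
  show "lendq.serre (P * vE i) (P * vE j) (nat (1 - cartan Q i j)) = 0"
    unfolding mm P_serre[OF Nops(2) Nops(2)] serre_vE[OF ij] by simp
  show "lendq.serre (P * vF i) (P * vF j) (nat (1 - cartan Q i j)) = 0"
    unfolding mm P_serre[OF Nops(1) Nops(1)]
    by (rule lend_eqI) (simp add: times_lend.rep_eq zero_lend.rep_eq P_0 serre_vF_vN[OF ij])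
qed

text \<open>
  The parameters \<open>x\<close> and \<open>y\<close> are the shifts of the torus index by \<open>K\<^sub>i\<close> and \<open>K'\<^sub>i\<close>. If they are
  independent, the representation sees all of the torus of the larger algebra; with \<open>y = - x\<close> it is a
  representation of the quantum group itself.
\<close>

lemma verma_Ut_rep:
  assumes "c = cartan Q"
  shows "\<exists>g. lend.alg_rep (Ut Q) g \<and> (\<forall>i\<in>verts Q. g (Ut_gen Q (tE i)) = P * vE i \<and> g (Ut_gen Q (tF i)) = P * vF i
    \<and> g (Ut_gen Q (tK i)) = P * vK i \<and> g (Ut_gen Q (tK' i)) = P * vK' i) \<and> g \<one>\<^bsub>Ut Q\<^esub> = P"
proof -
  define \<eta> where "\<eta> g = (case g of tE i \<Rightarrow> P * vE i | tF i \<Rightarrow> P * vF i | tK i \<Rightarrow> P * vK i | tK' i \<Rightarrow> P * vK' i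
    | tKinv i \<Rightarrow> P * vT (c i) (- x i) | tK'inv i \<Rightarrow> P * vT (\<lambda>j. - c i j) (- y i))" for g
  have e: "\<exists>S. \<eta> g = P * S \<and> Nop S" for g
    unfolding \<eta>_def using Nops by (cases g) auto
  have "lend.corner (Ut_gens Q) \<eta> P"
    unfolding lend.corner_def
  proof (intro conjI ballI)
    fix g
    obtain S where S: "\<eta> g = P * S" "Nop S" using e by blast
    show "P * \<eta> g = \<eta> g" "\<eta> g * P = \<eta> g"
      using S P_S_P[of S] by (simp_all add: mult.assoc[symmetric] P_P)
  qed (rule P_P)
  moreover have "lendq.quantum_system Q (\<eta> \<circ> tE) (\<eta> \<circ> tF) (\<eta> \<circ> tK) (\<eta> \<circ> tK')"
    using verma_quantum_system[OF assms] by (simp add: \<eta>_def comp_def)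
  ultimately have "lendq.Ut_data Q \<eta> P"
    unfolding lendq.Ut_data_def by (simp add: \<eta>_def P_mult Nops vKZ)
  from lendq.rep_of_Ut_data[OF this] show ?thesis
    by (auto simp: \<eta>_def)
qed

lemma verma_Uq_rep:
  assumes "c = cartan Q" and y: "\<And>i. y i = - x i"
  shows "\<exists>g. lend.alg_rep (Uq Q) g \<and> (\<forall>i\<in>verts Q. g (Uq_gen Q (qE i)) = P * vE i \<and> g (Uq_gen Q (qF i)) = P * vF i
    \<and> g (Uq_gen Q (qK i)) = P * vK i \<and> g (Uq_gen Q (qKinv i)) = P * vK' i) \<and> g \<one>\<^bsub>Uq Q\<^esub> = P"
proof -
  define \<eta> where "\<eta> g = (case g of qE i \<Rightarrow> P * vE i | qF i \<Rightarrow> P * vF i | qK i \<Rightarrow> P * vK i | qKinv i \<Rightarrow> P * vK' i)" for g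
  have e: "\<exists>S. \<eta> g = P * S \<and> Nop S" for g
    unfolding \<eta>_def using Nops by (cases g) auto
  have "lend.corner (Uq_gens Q) \<eta> P"
    unfolding lend.corner_def
  proof (intro conjI ballI)
    fix g
    obtain S where S: "\<eta> g = P * S" "Nop S" using e by blast
    show "P * \<eta> g = \<eta> g" "\<eta> g * P = \<eta> g"
      using S P_S_P[of S] by (simp_all add: mult.assoc[symmetric] P_P)
  qed (rule P_P)
  moreover have "lendq.quantum_system Q (\<eta> \<circ> qE) (\<eta> \<circ> qF) (\<eta> \<circ> qK) (\<eta> \<circ> qKinv)"
    using verma_quantum_system[OF assms(1)] by (simp add: \<eta>_def comp_def)
  moreover have "vK i * vK' i = 1" "vK' i * vK i = 1" for i
    by (simp_all add: vK_def vK'_def vT_mult vT_0 y)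
  ultimately have "lendq.Uq_data Q \<eta> P"
    unfolding lendq.Uq_data_def by (simp add: \<eta>_def P_mult Nops)
  from lendq.rep_of_Uq_data[OF this] show ?thesis
    by (auto simp: \<eta>_def)
qed

end

section \<open>Leading terms\<close>

definition shorter :: "nat \<Rightarrow> (('i list \<times> 'g) \<Rightarrow>\<^sub>0 rat poly fract) set" where
  "shorter l = {v. \<forall>z\<in>Poly_Mapping.keys v. length (fst z) < l}"

lemma subspace_shorter: "pm.subspace (shorter l)"
proof (rule pm.subspaceI)
  fix v w :: "('a list \<times> 'b) \<Rightarrow>\<^sub>0 rat poly fract" assume "v \<in> shorter l" "w \<in> shorter l"
  then show "v + w \<in> shorter l" using Poly_Mapping.keys_add[of v w] by (auto simp: shorter_def)
next
  fix c and v :: "('a list \<times> 'b) \<Rightarrow>\<^sub>0 rat poly fract" assume "v \<in> shorter l"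
  then show "pscale c v \<in> shorter l" using keys_pscale[of c v] by (auto simp: shorter_def)
qed (simp add: shorter_def)

lemma single_shorter [simp]: "length J < l \<Longrightarrow> Poly_Mapping.single (J, g) a \<in> shorter l"
  by (simp add: shorter_def)

lemma shorter_mono: "v \<in> shorter l \<Longrightarrow> l \<le> l' \<Longrightarrow> v \<in> shorter l'"
  by (auto simp: shorter_def)

lemma shorter_0: "v \<in> shorter 0 \<longleftrightarrow> v = 0"
  unfolding keys_eq_empty[symmetric] shorter_def by (simp only: mem_Collect_eq not_less_zero) blast

lemma shorter_lin:
  assumes "\<And>J g. (J, g) \<in> Poly_Mapping.keys v \<Longrightarrow> \<phi> (J, g) \<in> shorter l"
  shows "pm.lin \<phi> v \<in> shorter l"
  unfolding pm.lin_def
  by (intro pm.subspace_sum[OF subspace_shorter] pm.subspace_scale[OF subspace_shorter]) (use assms in auto)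

lemma shorter_linear:
  assumes T: "Vector_Spaces.linear pscale pscale T"
    and "\<And>J g. length J < l \<Longrightarrow> T (Poly_Mapping.single (J, g) 1) \<in> shorter l'" and "v \<in> shorter l"
  shows "T v \<in> shorter l'"
  unfolding pm.linear_eq_lin[OF T, of v]
proof (rule shorter_lin)
  fix J g assume "(J, g) \<in> Poly_Mapping.keys v"
  then have "length J < l" using assms(3) by (force simp: shorter_def)
  then show "T (Poly_Mapping.single (J, g) 1) \<in> shorter l'" by (rule assms(2))
qed

definition top_part :: "'i set \<Rightarrow> nat \<Rightarrow> (('i list \<times> 'g) \<Rightarrow>\<^sub>0 rat poly fract) \<Rightarrow> (('i list \<times> 'g) \<Rightarrow>\<^sub>0 rat poly fract)" where
  "top_part V l = pm.lin (\<lambda>(J, g). if length J = l \<and> set J \<subseteq> V then Poly_Mapping.single (J, g) 1 else 0)"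

lemma top_part_single [simp]:
  "top_part V l (Poly_Mapping.single (J, g) a) = (if length J = l \<and> set J \<subseteq> V then Poly_Mapping.single (J, g) a else 0)"
  by (simp add: top_part_def)

lemma linear_top_part: "Vector_Spaces.linear pscale pscale (top_part V l)"
  unfolding top_part_def by (rule pm.linear_lin)

lemma top_part_shorter: "v \<in> shorter l \<Longrightarrow> top_part V l v = 0"
proof -
  assume "v \<in> shorter l"
  then have "top_part V l v = pm.lin (\<lambda>x. 0) v"
    unfolding top_part_def by (intro pm.lin_cong) (auto simp: shorter_def)
  then show ?thesis by simp
qed

lemma top_part_rest: "v \<in> shorter (Suc l) \<Longrightarrow> v - top_part UNIV l v \<in> shorter l"
proof -
  assume v: "v \<in> shorter (Suc l)"
  have "v - top_part UNIV l v = pm.lin (\<lambda>x. Poly_Mapping.single x 1) v - top_part UNIV l v"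
    by (simp add: poly_mapping_sum_singles)
  also have "\<dots> = pm.lin (\<lambda>x. Poly_Mapping.single x 1 + pscale (- 1) (case x of (J, g) \<Rightarrow> if length J = l \<and> set J \<subseteq> UNIV then Poly_Mapping.single (J, g) 1 else 0)) v"
    unfolding pm.lin_fun_add pm.lin_fun_scale top_part_def by simp
  also have "\<dots> \<in> shorter l"
    by (rule shorter_lin) (use v in \<open>auto simp: shorter_def less_Suc_eq\<close>)
  finally show ?thesis .
qed

context gcm
begin

lemma top_part_serre_word:
  "top_part V l (serre_word J i j J' g) =
    (if length J + mm i j + 1 + length J' = l \<and> (mm i j > 0 \<longrightarrow> i \<in> V) \<and> j \<in> V \<and> set J \<subseteq> V \<and> set J' \<subseteq> V then serre_word J i j J' g else 0)"
proof -
  interpret T: Vector_Spaces.linear pscale pscale "top_part V l" by (rule linear_top_part)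
  have "length (J @ replicate r i @ j # replicate (mm i j - r) i @ J') = length J + mm i j + 1 + length J'"
    "set (J @ replicate r i @ j # replicate (mm i j - r) i @ J') \<subseteq> V \<longleftrightarrow> (mm i j > 0 \<longrightarrow> i \<in> V) \<and> j \<in> V \<and> set J \<subseteq> V \<and> set J' \<subseteq> V"
    if "r \<le> mm i j" for r
    using that by (auto simp: set_replicate_conv_if)
  moreover define C where "C \<longleftrightarrow> length J + mm i j + 1 + length J' = l \<and> (mm i j > 0 \<longrightarrow> i \<in> V) \<and> j \<in> V \<and> set J \<subseteq> V \<and> set J' \<subseteq> V"
  ultimately have t: "top_part V l (Poly_Mapping.single (J @ replicate r i @ j # replicate (mm i j - r) i @ J', g) a) =
     (if C then Poly_Mapping.single (J @ replicate r i @ j # replicate (mm i j - r) i @ J', g) a else 0)"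
    if "r \<le> mm i j" for r a
    using that unfolding top_part_single by presburger
  have "top_part V l (serre_word J i j J' g) = (\<Sum>r\<le>mm i j. (if C
      then Poly_Mapping.single (J @ replicate r i @ j # replicate (mm i j - r) i @ J', g) ((- 1) ^ r * qbinom (mm i j) r) else 0))"
    unfolding serre_word_def T.sum by (rule sum.cong) (simp_all only: t atMost_iff)
  then show ?thesis
    unfolding C_def[symmetric] by (cases C) (simp_all add: serre_word_def)
qed

lemma top_part_vN: "v \<in> vN \<Longrightarrow> top_part V l v \<in> vN"
  by (rule vN_image[OF linear_top_part subspace_vN])
    (simp_all add: top_part_serre_word serre_word_vN pm.subspace_0[OF subspace_vN])

end

context verma
begin

lemma vF_shorter: "v \<in> shorter l \<Longrightarrow> app (vF i) v \<in> shorter (Suc l)"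
  by (rule shorter_linear[OF linear_app]) auto

lemma vT_shorter: "v \<in> shorter l \<Longrightarrow> app (vT \<chi> s) v \<in> shorter l"
  by (rule shorter_linear[OF linear_app]) auto

lemma e_basis_shorter: "e_basis k g J \<in> shorter (length J)"
proof (induction J)
  case Nil
  then show ?case by (simp add: pm.subspace_0[OF subspace_shorter])
next
  case (Cons j J)
  have "app (vT \<chi> s) (Poly_Mapping.single (J, g) 1) \<in> shorter (Suc (length J))" for \<chi> s
    by (rule vT_shorter) simp
  then have "pscale (1 / (qv - inverse qv)) (app (vK k) (Poly_Mapping.single (J, g) 1) - app (vK' k) (Poly_Mapping.single (J, g) 1)) \<in> shorter (Suc (length J))"
    unfolding vK_def vK'_def
    by (intro pm.subspace_scale[OF subspace_shorter] pm.subspace_diff[OF subspace_shorter]) auto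
  then show ?case
    using vF_shorter[OF Cons, of j] by (auto intro: pm.subspace_add[OF subspace_shorter] pm.subspace_0[OF subspace_shorter])
qed

lemma vE_shorter: "v \<in> shorter (Suc l) \<Longrightarrow> app (vE k) v \<in> shorter l"
  by (rule shorter_linear[OF linear_app]) (auto simp: vE_single intro: shorter_mono[OF e_basis_shorter])

end

text \<open>
  The elements \<open>B\<^sub>J k\<^sup>n\<close>, where \<open>J\<close> is a word and \<open>k\<^sup>n\<close> a Laurent monomial, and their
  linear combinations.
\<close>

definition (in scalar_ring) iev :: "('i \<Rightarrow> 'r) \<Rightarrow> ('n \<Rightarrow> 'r) \<Rightarrow> (('i list \<times> 'n) \<Rightarrow>\<^sub>0 'k) \<Rightarrow> 'r" where
  "iev b t = lin (\<lambda>(J, n). word_rep b (t n) J)"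

context verma_quotient
begin

text \<open>
  Applied to the vacuum, the empty word with index \<open>0\<close>, the product \<open>B\<^sub>J t\<^sub>n\<close> yields the word \<open>J\<close> with
  index \<open>\<theta> n\<close> plus shorter words, because \<open>B\<^sub>i\<close> is \<open>F\<^sub>i\<close> plus an operator that shortens words. So
  the longest words of a combination that evaluates to zero form an element of the Serre ideal.
\<close>

lemma leading_term:
  fixes \<tau> :: "'i \<Rightarrow> 'i" and s :: "'i \<Rightarrow> rat poly fract" and t :: "'n \<Rightarrow> ('i, 'g) verma"
  assumes b: "\<And>i. b i = (if i \<in> V then P * (vF i + lscale (s i) (vE (\<tau> i) * vK' i)) else 0)"
    and t: "\<And>n. \<exists>\<chi>. t n = lscale (sca n) (P * vT \<chi> (\<theta> n))"
    and v: "v \<in> shorter (Suc l)" and ev: "lend.iev b t v = 0"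
  shows "pm.lin (\<lambda>(J, n). if length J = l \<and> set J \<subseteq> V then Poly_Mapping.single (J, \<theta> n) (sca n) else 0) v \<in> vN"
proof -
  obtain \<chi> where t: "\<And>n. t n = lscale (sca n) (P * vT (\<chi> n) (\<theta> n))" using t by metis
  define B where "B i = vF i + lscale (s i) (vE (\<tau> i) * vK' i)" for i
  define W where "W J n = lend.word_rep B (lscale (sca n) (vT (\<chi> n) (\<theta> n))) J" for J n
  let ?vac = "Poly_Mapping.single ([], 0) (1 :: rat poly fract) :: ('i list \<times> 'g) \<Rightarrow>\<^sub>0 rat poly fract"
  have NB: "Nop (B i)" for i
  proof -
    have "Nop (vE (\<tau> i) * vK' i)" by (intro Nop_mult Nops)
    then show ?thesis using Nops(1)[of i]
      by (auto simp: Nop_def B_def app_simps intro!: pm.subspace_add[OF subspace_vN] pm.subspace_scale[OF subspace_vN])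
  qed
  have W: "lend.word_rep b (t n) J = (if set J \<subseteq> V then P * W J n else 0)" for J n
  proof (induction J)
    case Nil then show ?case by (simp add: W_def t lend.scl_mult_right)
  next
    case (Cons i J)
    show ?case
    proof (cases "set J \<subseteq> V \<and> i \<in> V")
      case True
      then have "lend.word_rep b (t n) (i # J) = P * B i * (P * W J n)"
      proof -
        have "b i = P * B i" using True b[of i] by (simp add: B_def)
        then show ?thesis using Cons True by simp
      qed
      also have "\<dots> = P * W (i # J) n"
        unfolding P_mult[OF NB] by (simp add: W_def)
      finally show ?thesis using True by simp
    next
      case False
      then show ?thesis using Cons by (auto simp: b)
    qed
  qed
  have lead: "app (W J n) ?vac - Poly_Mapping.single (J, \<theta> n) (sca n) \<in> shorter (length J)" for J n
  proof (induction J)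
    case Nil
    then show ?case by (simp add: W_def app_simps pm.subspace_0[OF subspace_shorter])
  next
    case (Cons i J)
    define r where "r = app (W J n) ?vac - Poly_Mapping.single (J, \<theta> n) (sca n)"
    have r: "r \<in> shorter (length J)" unfolding r_def by (rule Cons)
    have Wr: "app (W J n) ?vac = Poly_Mapping.single (J, \<theta> n) (sca n) + r" by (simp add: r_def)
    have "Poly_Mapping.single (J, \<theta> n) (sca n) + r \<in> shorter (Suc (length J))"
      by (intro pm.subspace_add[OF subspace_shorter]) (use shorter_mono[OF r] in auto)
    then have low: "app (vE (\<tau> i)) (app (vK' i) (Poly_Mapping.single (J, \<theta> n) (sca n) + r)) \<in> shorter (length J)"
      unfolding vK'_def by (intro vE_shorter vT_shorter)
    have "app (W (i # J) n) ?vac - Poly_Mapping.single (i # J, \<theta> n) (sca n) =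
       app (vF i) r + pscale (s i) (app (vE (\<tau> i)) (app (vK' i) (Poly_Mapping.single (J, \<theta> n) (sca n) + r)))"
    proof -
      have "W (i # J) n = B i * W J n" by (simp add: W_def)
      then have "app (W (i # J) n) ?vac = app (B i) (Poly_Mapping.single (J, \<theta> n) (sca n) + r)"
        by (simp only: times_lend.rep_eq Wr)
      then show ?thesis by (simp add: B_def app_simps app_add)
    qed
    also have "\<dots> \<in> shorter (length (i # J))"
      using vF_shorter[OF r, of i] shorter_mono[OF pm.subspace_scale[OF subspace_shorter low, of "s i"]]
      by (auto intro!: pm.subspace_add[OF subspace_shorter])
    finally show ?case .
  qed
  define u where "u = pm.lin (\<lambda>(J, n). if set J \<subseteq> V then app (W J n) ?vac else 0) v"
  have "app (lend.iev b t v) ?vac = app P u"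
  proof -
    have "app (lend.iev b t v) ?vac = pm.lin (\<lambda>(J, n). app (lend.word_rep b (t n) J) ?vac) v"
      by (simp add: lend.iev_def lend.lin_def pm.lin_def app_sum_lend lscale.rep_eq split_beta)
    also have "\<dots> = pm.lin (\<lambda>z. app P (case z of (J, n) \<Rightarrow> if set J \<subseteq> V then app (W J n) ?vac else 0)) v"
      by (rule pm.lin_cong) (auto simp: W times_lend.rep_eq zero_lend.rep_eq)
    also have "\<dots> = app P u"
      unfolding u_def by (rule linear_lin_comp[OF linear_app, symmetric])
    finally show ?thesis .
  qed
  then have "u \<in> vN" using ev P_0 by (simp add: zero_lend.rep_eq)
  then have "top_part V l u \<in> vN" by (rule top_part_vN)
  also have "top_part V l u = pm.lin (\<lambda>z. top_part V l (case z of (J, n) \<Rightarrow> if set J \<subseteq> V then app (W J n) ?vac else 0)) v"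
    unfolding u_def by (rule linear_lin_comp[OF linear_top_part])
  also have "\<dots> = pm.lin (\<lambda>(J, n). if length J = l \<and> set J \<subseteq> V then Poly_Mapping.single (J, \<theta> n) (sca n) else 0) v"
  proof (rule pm.lin_cong, clarify)
    fix J n assume "(J, n) \<in> Poly_Mapping.keys v"
    then have len: "length J \<le> l" using v by (auto simp: shorter_def)
    interpret T: Vector_Spaces.linear pscale pscale "top_part V l" by (rule linear_top_part)
    have "top_part V l (app (W J n) ?vac) =
        top_part V l (Poly_Mapping.single (J, \<theta> n) (sca n)) + top_part V l (app (W J n) ?vac - Poly_Mapping.single (J, \<theta> n) (sca n))"
      by (simp add: T.diff del: top_part_single)
    also have "top_part V l (app (W J n) ?vac - Poly_Mapping.single (J, \<theta> n) (sca n)) = 0"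
      by (rule top_part_shorter) (rule shorter_mono[OF lead len])
    finally show "top_part V l (if set J \<subseteq> V then app (W J n) ?vac else 0) =
       (if length J = l \<and> set J \<subseteq> V then Poly_Mapping.single (J, \<theta> n) (sca n) else 0)"
      by (auto simp: T.zero)
  qed
  finally show ?thesis .
qed

end

section \<open>Serre relations for the generators of i-quantum groups\<close>

context qring
begin

lemma continuant_eq_qprod:
  "continuant (\<lambda>k z. a * z - (A ^ k / p) \<cdot> (z * a)) (\<lambda>k z. 0) w n = qprod (inverse p) A (\<lambda>y. a * y) (\<lambda>y. y * a) w n"
  by (induction n rule: induct_nat_012) (simp_all add: divide_inverse mult.commute)

text \<open>
  The case \<open>K = 0\<close>, \<open>e = 0\<close> of the recursion: the Serre relation is inherited by the sum of two
  \<open>q\<close>-commuting elements.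
\<close>

lemma serre_sum:
  assumes u: "qpar u" and m: "m > 0"
    and ba: "b * a = (u ^ 2) \<cdot> (a * b)" and bw: "b * w = inverse (u ^ (m - 1)) \<cdot> (w * b)"
    and aw: "serre a w m = 0"
  shows "serre (a + b) w m = 0"
proof -
  interpret serre_coeffs "inverse (u ^ 2)" "inverse (u ^ (m - 1))" m
    by (rule serre_coeffs_qpar[OF u m])
  interpret P: serre_pair_2 scl "inverse (u ^ 2)" "inverse (u ^ (m - 1))" m a b w 0 0 0
    by unfold_locales (simp_all add: ba bw)
  have "P.zs m = 0" using aw unfolding P.zs_def serre_eq_0_iff[OF u] by simp
  then have "continuant (\<lambda>k z. P.x * z - (inverse (u ^ 2) ^ k / inverse (u ^ (m - 1))) \<cdot> (z * P.x)) (\<lambda>k z. 0) w m = 0"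
    using P.continuant_eq_zs by simp
  then show ?thesis
    unfolding continuant_eq_qprod serre_eq_0_iff[OF u] P.x_def by simp
qed

text \<open>
  Multiplication by torus elements changes the twisted commutators only by scalars and by torus
  elements on the right.
\<close>

lemma serre_twist:
  assumes ke: "k * e = \<alpha> \<cdot> (e * k)" and kw: "k * w = \<beta> \<cdot> (w * k)" and le: "l * e = \<beta> \<cdot> (e * l)"
    and kl: "k * l = l * k" and ew: "serre e w m = 0"
  shows "serre (d \<cdot> (e * k)) (d' \<cdot> (w * l)) m = 0"
proof -
  have u: "qpar qv" by (simp add: qpar_def)
  let ?t = "qv ^ (m - 1)" and ?A = "inverse (qv ^ 2)"
  define z where "z n = qprod ?t ?A (\<lambda>y. e * y) (\<lambda>y. y * e) w n" for n
  have kz: "k * z n = (\<alpha> ^ n * \<beta>) \<cdot> (z n * k)" for n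
  proof (induction n)
    case 0 then show ?case by (simp add: z_def kw)
  next
    case (Suc n)
    have "k * z (Suc n) = (k * e) * z n - (?t * ?A ^ n) \<cdot> ((k * z n) * e)"
      by (simp add: z_def scl_nf)
    also have "\<dots> = \<alpha> \<cdot> (e * (k * z n)) - (?t * ?A ^ n) \<cdot> ((k * z n) * e)"
      unfolding ke by (simp add: scl_nf)
    also have "\<dots> = (\<alpha> ^ Suc n * \<beta>) \<cdot> (z (Suc n) * k)"
      unfolding Suc by (simp add: z_def scl_nf ke mult_ac)
    finally show ?case .
  qed
  have kpow: "k ^ n * e = \<alpha> ^ n \<cdot> (e * k ^ n)" for n
  proof (induction n)
    case (Suc n)
    have "k ^ Suc n * e = k * (k ^ n * e)" by (simp add: mult.assoc)
    also have "\<dots> = \<alpha> ^ Suc n \<cdot> (e * k ^ Suc n)"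
      unfolding Suc by (simp add: scl_nf) (simp add: mult.assoc[symmetric] ke scl_mult_left mult.commute)
    finally show ?case .
  qed simp
  have lk: "l * k ^ n = k ^ n * l" for n
    using power_commuting[of l k n] kl by simp
  have "\<exists>\<gamma>. qprod ?t ?A (\<lambda>y. d \<cdot> (e * k) * y) (\<lambda>y. y * d \<cdot> (e * k)) (d' \<cdot> (w * l)) n = \<gamma> \<cdot> (z n * (k ^ n * l))" for n
  proof (induction n)
    case 0 then show ?case by (auto simp: z_def)
  next
    case (Suc n)
    then obtain \<gamma> where g: "qprod ?t ?A (\<lambda>y. d \<cdot> (e * k) * y) (\<lambda>y. y * d \<cdot> (e * k)) (d' \<cdot> (w * l)) n = \<gamma> \<cdot> (z n * (k ^ n * l))" by blast
    have 1: "d \<cdot> (e * k) * \<gamma> \<cdot> (z n * (k ^ n * l)) = (d * \<gamma> * (\<alpha> ^ n * \<beta>)) \<cdot> (e * (z n * (k ^ Suc n * l)))"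
    proof -
      have "d \<cdot> (e * k) * \<gamma> \<cdot> (z n * (k ^ n * l)) = (d * \<gamma>) \<cdot> (e * ((k * z n) * (k ^ n * l)))"
        by (simp add: scl_nf mult.commute)
      then show ?thesis unfolding kz by (simp add: scl_nf)
    qed
    have 2: "\<gamma> \<cdot> (z n * (k ^ n * l)) * d \<cdot> (e * k) = (d * \<gamma> * (\<alpha> ^ n * \<beta>)) \<cdot> (z n * (e * (k ^ Suc n * l)))"
    proof -
      have "\<gamma> \<cdot> (z n * (k ^ n * l)) * d \<cdot> (e * k) = (d * \<gamma>) \<cdot> (z n * (k ^ n * ((l * e) * k)))"
        by (simp add: scl_nf mult.commute)
      also have "\<dots> = (d * \<gamma> * \<beta>) \<cdot> (z n * ((k ^ n * e) * (l * k)))"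
        unfolding le by (simp add: scl_nf)
      also have "\<dots> = (d * \<gamma> * (\<alpha> ^ n * \<beta>)) \<cdot> (z n * (e * (k ^ n * (l * k))))"
        unfolding kpow by (simp add: scl_nf mult_ac)
      also have "k ^ n * (l * k) = k ^ Suc n * l"
        by (simp add: kl[symmetric] mult.assoc[symmetric] power_commutes)
      finally show ?thesis .
    qed
    have "z (Suc n) * (k ^ Suc n * l) = e * (z n * (k ^ Suc n * l)) - (?t * ?A ^ n) \<cdot> (z n * (e * (k ^ Suc n * l)))"
      by (simp add: z_def left_diff_distrib scl_mult_left mult.assoc)
    then show ?case
      unfolding qprod.simps g 1 2
      by (intro exI[of _ "d * \<gamma> * (\<alpha> ^ n * \<beta>)"]) (simp only: scale_right_diff_distrib scale_scale mult_ac)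
  qed
  then obtain \<gamma> where "qprod ?t ?A (\<lambda>y. d \<cdot> (e * k) * y) (\<lambda>y. y * d \<cdot> (e * k)) (d' \<cdot> (w * l)) m = \<gamma> \<cdot> (z m * (k ^ m * l))"
    by blast
  moreover have "z m = 0" using ew unfolding serre_eq_0_iff[OF u] z_def .
  ultimately show ?thesis unfolding serre_eq_0_iff[OF u] by simp
qed

end

abbreviation "c0 \<equiv> 1 / (qv - inverse qv)"
abbreviation "qA \<equiv> inverse (qv ^ 2)"

text \<open>The coefficients of the continuant that gives the relation between \<open>B\<^sub>i\<close>, \<open>B\<^sub>j\<close> for \<open>\<tau> i = i\<close>.\<close>

definition icoeff :: "nat \<Rightarrow> nat \<Rightarrow> rat poly fract" where
  "icoeff m k = c0 * gint qA k * (1 - qv ^ (2 * (m - k)))"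

text \<open>
  The relations common to both quantum groups. An index without a vertex is given the generators \<open>0\<close>,
  so that the relations may be required for all indices. Scalars \<open>s = 1\<close> give the generators of the
  algebra with independent Cartan generators, and \<open>s = \<sigma>\<close> those of the quantum group.
\<close>

locale itype = qring scl + gcm c
  for scl :: "rat poly fract \<Rightarrow> 'r::ring_1 \<Rightarrow> 'r" (infixr \<open>\<cdot>\<close> 75) and c :: "'i \<Rightarrow> 'i \<Rightarrow> int" +
  fixes \<tau> :: "'i \<Rightarrow> 'i" and s :: "'i \<Rightarrow> rat poly fract" and E F K K' :: "'i \<Rightarrow> 'r"
  assumes tau2 [simp]: "\<tau> (\<tau> i) = i" and c_tau: "c (\<tau> i) (\<tau> j) = c i j"
    and s_sym: "i \<noteq> \<tau> i \<Longrightarrow> c i (\<tau> i) = 0 \<Longrightarrow> s i = s (\<tau> i)"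
    and EF: "E i * F j = F j * E i + (if i = j then c0 \<cdot> (K i - K' i) else 0)"
    and KK: "K i * K j = K j * K i" and KK': "K i * K' j = K' j * K i" and K'K': "K' i * K' j = K' j * K' i"
    and KE: "K i * E j = (qv powi c i j) \<cdot> (E j * K i)" and KF: "K i * F j = (qv powi (- c i j)) \<cdot> (F j * K i)"
    and K'E: "K' i * E j = (qv powi (- c i j)) \<cdot> (E j * K' i)" and K'F: "K' i * F j = (qv powi c i j) \<cdot> (F j * K' i)"
    and SE: "i \<noteq> j \<Longrightarrow> serre (E i) (E j) (mm i j) = 0" and SF: "i \<noteq> j \<Longrightarrow> serre (F i) (F j) (mm i j) = 0"
begin

definition X :: "'i \<Rightarrow> 'r" where "X i = s i \<cdot> (E (\<tau> i) * K' i)"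
definition B :: "'i \<Rightarrow> 'r" where "B i = F i + X i"
definition kt :: "'i \<Rightarrow> 'r" where "kt i = s (\<tau> i) \<cdot> (K i * K' (\<tau> i))"

lemma tau_eq_iff: "\<tau> i = \<tau> j \<longleftrightarrow> i = j" by (metis tau2)
lemma tau_swap: "\<tau> i = j \<longleftrightarrow> i = \<tau> j" by (metis tau2)

lemma qpow_add: "qv powi a * qv powi b = qv powi (a + b)"
  by (simp add: power_int_add)

lemma ext:
  assumes "a * b = d \<cdot> (b' * a')" shows "a * (b * z) = d \<cdot> (b' * (a' * z))"
  using arg_cong[OF assms, of "\<lambda>y. y * z"] by (simp add: scl_nf)

lemma ext1: assumes "a * b = b' * (a' :: 'r)" shows "a * (b * z) = b' * (a' * z)"
  using arg_cong[OF assms, of "\<lambda>y. y * z"] by (simp add: mult.assoc)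

lemma EF': "E i * (F j * z) = F j * (E i * z) + (if i = j then c0 \<cdot> (K i * z - K' i * z) else 0)"
  using arg_cong[OF EF[of i j], of "\<lambda>y. y * z"] by (auto simp: scl_nf)

lemmas KE' = ext[OF KE] and KF' = ext[OF KF] and K'E' = ext[OF K'E] and K'F' = ext[OF K'F]
  and KK1 = ext1[OF KK] and KK'1 = ext1[OF KK'] and K'K'1 = ext1[OF K'K']

text \<open>Normal order: \<open>F\<close>, \<open>E\<close>, \<open>K'\<close>, \<open>K\<close>.\<close>

lemma K'X: "K' i * X j = (qv powi (- c i (\<tau> j))) \<cdot> (X j * K' i)"
  by (simp add: X_def scl_nf K'E' K'K'[of i j] mult.commute)

lemma KX: "K i * X j = (qv powi (c i (\<tau> j))) \<cdot> (X j * K i)"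
  by (simp add: X_def scl_nf KE' KK'[of i j] mult.commute)

lemma XF: "X i * F j = (qv powi c i j) \<cdot> (F j * X i) +
    (if \<tau> i = j then (s i * qv powi c i j * c0) \<cdot> (K j * K' i - K' j * K' i) else 0)"
  by (auto simp: X_def scl_nf K'F EF' mult_ac)

lemma FX: "F i * X j = (qv powi (- c i j)) \<cdot> (X j * F i) -
    (if \<tau> j = i then (s j * c0) \<cdot> (K i * K' j - K' i * K' j) else 0)"
proof -
  define q where "q = qv powi c i j"
  have q: "q \<noteq> 0" "qv powi (- c i j) = inverse q" by (simp_all add: q_def power_int_minus)
  have "X j * F i = q \<cdot> (F i * X j) + (if \<tau> j = i then (s j * q * c0) \<cdot> (K i * K' j - K' i * K' j) else 0)"
    unfolding XF c_sym[of j i] q_def ..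
  moreover have "inverse q * (a * q * b) = a * b" for a b using q(1) by simp
  ultimately have "inverse q \<cdot> (X j * F i) = F i * X j + (if \<tau> j = i then (s j * c0) \<cdot> (K i * K' j - K' i * K' j) else 0)"
    using q(1) by (simp only: scale_right_distrib scale_scale if_distrib[of "(\<cdot>) (inverse q)"] scale_zero_right left_inverse scale_one) simp
  then show ?thesis unfolding q(2) by simp
qed

lemma SX: "i \<noteq> j \<Longrightarrow> serre (X i) (X j) (mm i j) = 0"
proof -
  assume ij: "i \<noteq> j"
  have mm: "mm (\<tau> i) (\<tau> j) = mm i j" by (simp add: mm_def c_tau)
  have c: "c j (\<tau> i) = c i (\<tau> j)" using c_tau[of j "\<tau> i"] c_sym by simp
  show ?thesis unfolding X_def
    by (rule serre_twist[OF K'E K'E _ K'K'])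
      (use SE[of "\<tau> i" "\<tau> j"] ij in \<open>simp_all add: mm tau_eq_iff K'E c\<close>)
qed

lemma qparams: "qpar qv" "qpar (inverse qv)"
  by (simp_all add: qpar_def)

lemma qc:
  assumes "i \<noteq> j"
  shows "qv powi c i j = inverse (qv ^ (mm i j - 1))" "qv powi (- c i j) = qv ^ (mm i j - 1)"
  unfolding c_mm[OF assms] by (simp_all add: power_int_minus)

theorem serre_B_generic:
  assumes ij: "i \<noteq> j" and ti: "\<tau> i \<noteq> i" "\<tau> i \<noteq> j"
  shows "serre (B i) (B j) (mm i j) = 0"
proof -
  have tj: "\<tau> j \<noteq> i" using ti tau_swap by metis
  have "serre (F i + X i) (F j) (mm i j) = 0"
    by (rule serre_sum[OF qparams(1) mm_pos[OF ij] _ _ SF[OF ij]])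
      (use ti in \<open>simp_all add: XF qc[OF ij]\<close>)
  moreover have "serre (X i + F i) (X j) (mm i j) = 0"
    by (rule serre_sum[OF qparams(2) mm_pos[OF ij] _ _ SX[OF ij]])
      (use ti tj in \<open>simp_all add: FX qc[OF ij] power_int_minus power_inverse\<close>)
  ultimately show ?thesis by (simp add: B_def serre_add add.commute)
qed

lemma kt_F: "kt i * F j = (qv powi (c (\<tau> i) j - c i j)) \<cdot> (F j * kt i)"
  unfolding diff_conv_add_uminus qpow_add[symmetric] by (simp add: kt_def scl_nf K'F KF' mult_ac)

lemma kt_X: "kt i * X j = (qv powi (c (\<tau> i) j - c i j)) \<cdot> (X j * kt i)"
proof -
  have "c i (\<tau> j) = c (\<tau> i) j" using c_tau[of "\<tau> i" j] by simp
  then show ?thesis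
    unfolding diff_conv_add_uminus qpow_add[symmetric]
    by (simp add: kt_def scl_nf K'X ext[OF KX] c_tau mult_ac)
qed

lemma kt_B: "kt i * B j = (qv powi (c (\<tau> i) j - c i j)) \<cdot> (B j * kt i)"
  by (simp only: B_def distrib_left distrib_right kt_F kt_X scale_right_distrib)

lemma kt_kt: "kt i * kt j = kt j * kt i"
proof -
  have 1: "K' l * (K n * z) = K n * (K' l * z)" for l n z
    by (rule KK'1[symmetric])
  have "K i * (K' (\<tau> i) * (K j * K' (\<tau> j))) = K j * (K' (\<tau> j) * (K i * K' (\<tau> i)))"
    unfolding 1 KK1[of i j] K'K'[of "\<tau> i" "\<tau> j"] ..
  then show ?thesis by (simp add: kt_def scl_nf mult.commute)
qed

text \<open>
  The element \<open>B\<^sub>j\<close> is the sum of \<open>F\<^sub>j\<close> and \<open>X\<^sub>j\<close>, and the continuant is additive in it. For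
  \<open>F\<^sub>j\<close> the two summands of \<open>B\<^sub>i\<close> play the roles of \<open>a\<close> and \<open>b\<close> in this order, for \<open>X\<^sub>j\<close> in the
  opposite order and with inverse parameters; reversal of the continuant identifies the two results.
  The scalar \<open>s i\<close> enters only through \<open>kt i\<close>.
\<close>

theorem continuant_B_fixed:
  assumes ij: "i \<noteq> j" and ti: "\<tau> i = i"
  defines "m \<equiv> mm i j"
  shows "continuant (\<lambda>k z. B i * z - (qv ^ (m - 1) * qA ^ k) \<cdot> (z * B i)) (\<lambda>k z. icoeff m k \<cdot> (kt i * z)) (B j) m = 0"
proof -
  note m0 = mm_pos[OF ij, folded m_def] and q = qc[OF ij, folded m_def]
  have tj: "\<tau> j \<noteq> i" using ij ti tau_swap by metis
  have ct: "c i (\<tau> j) = c i j" using c_tau[of i j] ti by simp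
  let ?\<alpha> = "\<lambda>k z. B i * z - (qv ^ (m - 1) * qA ^ k) \<cdot> (z * B i)" and ?\<gamma> = "\<lambda>k z. icoeff m k \<cdot> (kt i * z)"
  have kt: "kt i = s i \<cdot> (K i * K' i)" by (simp add: kt_def ti)
  have ktF: "kt i * F l = F l * kt i" and ktX: "kt i * X l = X l * kt i" if "l = i \<or> l = j" for l
  proof -
    have "c i (\<tau> l) = c i l" using that ct ti by auto
    then show "kt i * F l = F l * kt i" "kt i * X l = X l * kt i"
      by (simp_all add: kt scl_nf K'F KF' K'X ext[OF KX] qpow_add)
  qed
  have ktK': "kt i * K' i = K' i * kt i" by (simp add: kt scl_nf KK' KK'1 K'K'1)
  have q0: "qv ^ n \<noteq> 0" for n by simp
  have F: "continuant ?\<alpha> ?\<gamma> (F j) m = 0"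
  proof -
    interpret serre_coeffs qA "inverse (qv ^ (m - 1))" m
      by (rule serre_coeffs_qpar[OF qparams(1) m0])
    interpret P: serre_pair_2 scl qA "inverse (qv ^ (m - 1))" m "F i" "X i" "F j"
      "(qv ^ 2 * c0) \<cdot> kt i" "K' i" "s i * qv ^ 2 * c0"
    proof
      show "X i * F i = inverse qA \<cdot> (F i * X i) + (qv\<^sup>2 * c0) \<cdot> kt i - (s i * qv\<^sup>2 * c0) \<cdot> (K' i * K' i)"
        by (simp add: XF ti kt scale_right_diff_distrib mult_ac)
      show "X i * F j = inverse (qv ^ (m - 1)) \<cdot> (F j * X i)" using ij by (simp add: XF ti q)
      show "K' i * F i = inverse qA \<cdot> (F i * K' i)" by (simp add: K'F)
      show "K' i * X i = qA \<cdot> (X i * K' i)" by (simp add: K'X ti power_int_minus)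
      show "K' i * F j = inverse (qv ^ (m - 1)) \<cdot> (F j * K' i)" by (simp add: K'F q)
      show "(qv\<^sup>2 * c0) \<cdot> kt i * F i = F i * (qv\<^sup>2 * c0) \<cdot> kt i" "(qv\<^sup>2 * c0) \<cdot> kt i * F j = F j * (qv\<^sup>2 * c0) \<cdot> kt i"
        "(qv\<^sup>2 * c0) \<cdot> kt i * X i = X i * (qv\<^sup>2 * c0) \<cdot> kt i" "(qv\<^sup>2 * c0) \<cdot> kt i * K' i = K' i * (qv\<^sup>2 * c0) \<cdot> kt i"
        by (simp_all add: scl_mult_left scl_mult_right ktF ktX ktK')
    qed
    have x: "P.x = B i" by (simp add: P.x_def B_def)
    have "P.zs m = 0" using SF[OF ij, folded m_def] unfolding P.zs_def serre_eq_0_iff[OF qparams(1)] by simp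
    then have "continuant (\<lambda>k z. P.x * z - (qA ^ k / inverse (qv ^ (m - 1))) \<cdot> (z * P.x))
      (\<lambda>k z. (qA * gint qA k * \<mu> (k - 1)) \<cdot> ((qv\<^sup>2 * c0) \<cdot> kt i * z)) (F j) m = 0"
      using P.continuant_eq_zs by simp
    also have "continuant (\<lambda>k z. P.x * z - (qA ^ k / inverse (qv ^ (m - 1))) \<cdot> (z * P.x))
      (\<lambda>k z. (qA * gint qA k * \<mu> (k - 1)) \<cdot> ((qv\<^sup>2 * c0) \<cdot> kt i * z)) (F j) m = continuant ?\<alpha> ?\<gamma> (F j) m"
    proof (rule continuant_cong)
      fix k z assume k: "0 < k" "k < m"
      have "\<mu> (k - 1) = 1 - qv ^ (2 * (m - k))"
      proof -
        have "2 * (m - 1) = 2 * (m - k) + 2 * (k - 1)" using k by simp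
        then have "qv ^ (m - 1) * qv ^ (m - 1) = qv ^ (2 * (m - k)) * qv ^ (2 * (k - 1))"
          unfolding power_add[symmetric] mult_2 by simp
        then show ?thesis
          unfolding \<mu>_def by (simp add: power_inverse power_mult[symmetric] field_simps)
      qed
      then show "(qA * gint qA k * \<mu> (k - 1)) \<cdot> ((qv\<^sup>2 * c0) \<cdot> kt i * z) = icoeff m k \<cdot> (kt i * z)"
        by (simp add: icoeff_def scl_mult_left)
    qed (simp add: x divide_inverse mult.commute)
    finally show ?thesis .
  qed
  have X: "continuant ?\<alpha> ?\<gamma> (X j) m = 0"
  proof -
    have iA: "inverse ((inverse qv) ^ 2) = qv ^ 2" "inverse ((inverse qv) ^ (m - 1)) = qv ^ (m - 1)"
      by (simp_all add: power_inverse)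
    interpret serre_coeffs "qv ^ 2" "qv ^ (m - 1)" m
      using serre_coeffs_qpar[OF qparams(2) m0] unfolding iA .
    interpret P: serre_pair_2 scl "qv ^ 2" "qv ^ (m - 1)" m "X i" "F i" "X j"
      "(- c0) \<cdot> kt i" "K' i" "- s i * c0"
    proof
      show "F i * X i = inverse (qv\<^sup>2) \<cdot> (X i * F i) + (- c0) \<cdot> kt i - (- s i * c0) \<cdot> (K' i * K' i)"
        by (simp add: FX ti kt scale_right_diff_distrib mult_ac power_int_minus scale_minus_left)
      show "F i * X j = qv ^ (m - 1) \<cdot> (X j * F i)" using tj by (simp add: FX q)
      show "K' i * X i = inverse (qv\<^sup>2) \<cdot> (X i * K' i)" by (simp add: K'X ti power_int_minus)
      show "K' i * F i = (qv\<^sup>2) \<cdot> (F i * K' i)" by (simp add: K'F)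
      show "K' i * X j = qv ^ (m - 1) \<cdot> (X j * K' i)" by (simp add: K'X ct q)
      show "(- c0) \<cdot> kt i * X i = X i * (- c0) \<cdot> kt i" "(- c0) \<cdot> kt i * X j = X j * (- c0) \<cdot> kt i"
        "(- c0) \<cdot> kt i * F i = F i * (- c0) \<cdot> kt i" "(- c0) \<cdot> kt i * K' i = K' i * (- c0) \<cdot> kt i"
        by (simp_all add: scl_mult_left scl_mult_right ktF ktX ktK')
    qed
    have x: "P.x = B i" by (simp add: P.x_def B_def add.commute)
    have "P.zs m = 0"
      using SX[OF ij, folded m_def] unfolding P.zs_def serre_eq_0_iff[OF qparams(2)] iA by (simp add: power_inverse)
    then have z: "continuant (\<lambda>k z. P.x * z - ((qv\<^sup>2) ^ k / qv ^ (m - 1)) \<cdot> (z * P.x))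
      (\<lambda>k z. (qv\<^sup>2 * gint (qv\<^sup>2) k * \<mu> (k - 1)) \<cdot> ((- c0) \<cdot> kt i * z)) (X j) m = 0"
      using P.continuant_eq_zs by simp
    have com: "kt i * B i = B i * kt i" by (simp add: B_def distrib_left distrib_right ktF ktX)
    have "continuant ?\<alpha> ?\<gamma> (X j) m = continuant (\<lambda>k. ?\<alpha> (m - 1 - k)) (\<lambda>k. ?\<gamma> (m - k)) (X j) m"
    proof (rule continuant_rev)
      fix k l z
      show "?\<alpha> k (?\<alpha> l z) = ?\<alpha> l (?\<alpha> k z)" by (simp add: scl_nf mult_ac)
      have "kt i * (B i * z) = B i * (kt i * z)" using com by (metis mult.assoc)
      then show "?\<alpha> k (?\<gamma> l z) = ?\<gamma> l (?\<alpha> k z)" by (simp add: scl_nf mult_ac)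
      show "?\<gamma> k (?\<gamma> l z) = ?\<gamma> l (?\<gamma> k z)" by (simp add: scl_nf mult_ac)
    qed (simp_all add: scl_nf algebra_simps)
    also have "\<dots> = continuant (\<lambda>k z. P.x * z - ((qv\<^sup>2) ^ k / qv ^ (m - 1)) \<cdot> (z * P.x))
      (\<lambda>k z. (qv\<^sup>2 * gint (qv\<^sup>2) k * \<mu> (k - 1)) \<cdot> ((- c0) \<cdot> kt i * z)) (X j) m"
    proof (rule continuant_cong)
      fix k z assume k: "k < m"
      have "2 * (m - 1) = 2 * (m - 1 - k) + 2 * k" using k by simp
      then have "qv ^ (m - 1) * qv ^ (m - 1) = qv ^ (2 * (m - 1 - k)) * qv ^ (2 * k)"
        unfolding power_add[symmetric] mult_2 by simp
      then have "qv ^ (m - 1) * qA ^ (m - 1 - k) = (qv\<^sup>2) ^ k / qv ^ (m - 1)"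
        by (simp add: power_inverse power_mult[symmetric] field_simps)
      then show "?\<alpha> (m - 1 - k) z = P.x * z - ((qv\<^sup>2) ^ k / qv ^ (m - 1)) \<cdot> (z * P.x)"
        by (simp add: x)
    next
      fix k z assume k: "0 < k" "k < m"
      have mu: "\<mu> (k - 1) = 1 - qA ^ (m - k)"
      proof -
        have "2 * (m - 1) = 2 * (m - k) + 2 * (k - 1)" using k by simp
        then have "qv ^ (m - 1) * qv ^ (m - 1) = qv ^ (2 * (m - k)) * qv ^ (2 * (k - 1))"
          unfolding power_add[symmetric] mult_2 by simp
        then show ?thesis
          unfolding \<mu>_def by (simp add: power_inverse power_mult[symmetric] field_simps)
      qed
      have nq: "qv ^ 2 \<noteq> 1" using qv_power_neq_1[of 2] by simp
      have nA: "qA \<noteq> 1" using nq by (simp add: field_simps)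
      have "gint qA (m - k) * (1 - qA) = 1 - qA ^ (m - k)" "gint (qv ^ 2) k * (1 - qv ^ 2) = 1 - (qv ^ 2) ^ k"
        by (rule gint_eq)+
      moreover have "1 - qv ^ 2 = - (qv ^ 2) * (1 - qA)" by (simp add: algebra_simps)
      ultimately have star: "gint (qv ^ 2) k * (- (qv ^ 2) * (1 - qA)) * (gint qA (m - k) * (1 - qA)) = (1 - (qv ^ 2) ^ k) * (gint qA (m - k) * (1 - qA))"
        by metis
      then have "gint (qv ^ 2) k * (- (qv ^ 2)) * (gint qA (m - k) * (1 - qA)) = (1 - (qv ^ 2) ^ k) * gint qA (m - k)"
      proof -
        have nz: "1 - qA \<noteq> 0" using nA by simp
        from star have "(1 - qA) * (gint (qv ^ 2) k * (- (qv ^ 2)) * (gint qA (m - k) * (1 - qA))) = (1 - qA) * ((1 - (qv ^ 2) ^ k) * gint qA (m - k))"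
          by (simp only: mult_ac)
        then show ?thesis using mult_left_cancel[OF nz] by blast
      qed
      then have key: "qv\<^sup>2 * gint (qv\<^sup>2) k * \<mu> (k - 1) * (- d) = (1 - (qv ^ 2) ^ k) * gint qA (m - k) * d" for d
        unfolding mu gint_eq[of qA "m - k", symmetric]
      proof -
        assume h: "gint (qv ^ 2) k * (- (qv ^ 2)) * (gint qA (m - k) * (1 - qA)) = (1 - (qv ^ 2) ^ k) * gint qA (m - k)"
        have "q * a * x * (- d) = a * (- q) * x * d" for q a x :: "rat poly fract" by simp
        then show "qv\<^sup>2 * gint (qv\<^sup>2) k * (gint qA (m - k) * (1 - qA)) * - d = (1 - (qv\<^sup>2) ^ k) * gint qA (m - k) * d"
          unfolding h[symmetric] by blast
      qed
      have mk: "m - (m - k) = k" using k by simp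
      have "icoeff m (m - k) = (1 - (qv ^ 2) ^ k) * gint qA (m - k) * c0"
        unfolding icoeff_def mk power_mult by (simp only: mult_ac)
      then have "qv\<^sup>2 * gint (qv\<^sup>2) k * \<mu> (k - 1) * (- c0) = icoeff m (m - k)"
        using key[of c0] by simp
      then show "?\<gamma> (m - k) z = (qv\<^sup>2 * gint (qv\<^sup>2) k * \<mu> (k - 1)) \<cdot> ((- c0) \<cdot> kt i * z)"
        by (simp only: scl_mult_left scale_scale)
    qed
    finally show ?thesis using z by simp
  qed
  have add: "?\<alpha> k (y + z) = ?\<alpha> k y + ?\<alpha> k z" "?\<gamma> k (y + z) = ?\<gamma> k y + ?\<gamma> k z" for k y z
    by (simp_all add: scl_nf algebra_simps)
  have "continuant ?\<alpha> ?\<gamma> (y + z) n = continuant ?\<alpha> ?\<gamma> y n + continuant ?\<alpha> ?\<gamma> z n" for y z n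
    by (induction n rule: induct_nat_012) (simp_all only: continuant.simps add add_ac)
  then show ?thesis using F X by (simp add: B_def[of j])
qed

text \<open>
  As before the summands \<open>F\<^sub>j\<close> and \<open>X\<^sub>j\<close> of \<open>B\<^sub>j\<close> are treated separately; each contributes one of
  the two torus elements.
\<close>

theorem serre_B_swapped:
  assumes ij: "i \<noteq> j" and ti: "\<tau> i = j" and m2: "mm i j \<ge> 2"
  defines "m \<equiv> mm i j"
  shows "(-1) ^ m \<cdot> serre (B i) (B j) m = B i ^ (m - 1) *
    ((serre_coeffs.\<xi> qA (inverse (qv ^ (m - 1))) m * (inverse (qv ^ (m - 1)) * c0)) \<cdot> kt j
     + (serre_coeffs.\<xi> (qv ^ 2) (qv ^ (m - 1)) m * (- c0)) \<cdot> kt i)"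
proof -
  have m0: "m > 0" using m2 by (simp add: m_def)
  note q = qc[OF ij, folded m_def]
  have tj: "\<tau> j = i" using ti tau2 by metis
  have ktj: "kt j = s i \<cdot> (K j * K' i)" and kti: "kt i = s j \<cdot> (K i * K' j)"
    by (simp_all add: kt_def ti tj)
  have cj: "c j j = 2" "c j i = c i j" by (simp_all add: c_sym)
  have iA: "inverse ((inverse qv) ^ 2) = qv ^ 2" "inverse ((inverse qv) ^ (m - 1)) = qv ^ (m - 1)"
    by (simp_all add: power_inverse)
  have cii: "qv powi (c i i) = qv ^ 2" "qv powi (c j j) = qv ^ 2" "qv powi (- c i i) = qA" "qv powi (- c j j) = qA"
    by (simp_all add: power_int_minus)
  have ji: "j \<noteq> i" "\<tau> i \<noteq> i" using ij ti by auto
  have F: "(-1) ^ m \<cdot> serre (B i) (F j) m = serre_coeffs.\<xi> qA (inverse (qv ^ (m - 1))) m \<cdot> (B i ^ (m - 1) * (inverse (qv ^ (m - 1)) * c0) \<cdot> kt j)"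
  proof -
    interpret serre_coeffs qA "inverse (qv ^ (m - 1))" m
      by (rule serre_coeffs_qpar[OF qparams(1) m0])
    interpret P: serre_pair_3 scl qA "inverse (qv ^ (m - 1))" m "F i" "X i" "F j"
      "(inverse (qv ^ (m - 1)) * c0) \<cdot> kt j" "(s i * inverse (qv ^ (m - 1)) * c0) \<cdot> (K' j * K' i)"
    proof
      show "X i * F i = inverse qA \<cdot> (F i * X i)" using ji by (simp add: XF)
      show "X i * F j = inverse (qv ^ (m - 1)) \<cdot> (F j * X i) + (inverse (qv ^ (m - 1)) * c0) \<cdot> kt j
          - (s i * inverse (qv ^ (m - 1)) * c0) \<cdot> (K' j * K' i)"
        by (simp add: XF ti q ktj scale_right_diff_distrib mult_ac)
      show "(inverse (qv ^ (m - 1)) * c0) \<cdot> kt j * F i = inverse (qA * inverse (qv ^ (m - 1))) \<cdot> (F i * (inverse (qv ^ (m - 1)) * c0) \<cdot> kt j)"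
        by (simp add: ktj scl_nf K'F KF' cj q mult_ac)
      show "(inverse (qv ^ (m - 1)) * c0) \<cdot> kt j * X i = inverse (qA * inverse (qv ^ (m - 1))) \<cdot> (X i * (inverse (qv ^ (m - 1)) * c0) \<cdot> kt j)"
        by (simp add: ktj scl_nf K'X ext[OF KX] ti cj q mult_ac)
      show "(s i * inverse (qv ^ (m - 1)) * c0) \<cdot> (K' j * K' i) * F i = (inverse (qv ^ (m - 1)) / qA) \<cdot> (F i * (s i * inverse (qv ^ (m - 1)) * c0) \<cdot> (K' j * K' i))"
        by (simp add: scl_nf K'F K'F' cj q divide_inverse mult_ac)
      show "(s i * inverse (qv ^ (m - 1)) * c0) \<cdot> (K' j * K' i) * X i = (qA / inverse (qv ^ (m - 1))) \<cdot> (X i * (s i * inverse (qv ^ (m - 1)) * c0) \<cdot> (K' j * K' i))"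
        by (simp add: scl_nf K'X ext[OF K'X] ti cj q cii mult_ac divide_inverse power_int_minus)
    qed
    have x: "P.x = B i" by (simp add: P.x_def B_def)
    have "P.zs m = 0" using SF[OF ij, folded m_def] unfolding P.zs_def serre_eq_0_iff[OF qparams(1)] by simp
    then show ?thesis
      using P.qprod_x_top[OF m2[folded m_def]] qprod_eq_serre[OF qparams(1), of m "B i" "F j"] unfolding x by simp
  qed
  have X: "(-1) ^ m \<cdot> serre (B i) (X j) m = serre_coeffs.\<xi> (qv ^ 2) (qv ^ (m - 1)) m \<cdot> (B i ^ (m - 1) * (- c0) \<cdot> kt i)"
  proof -
    interpret serre_coeffs "qv ^ 2" "qv ^ (m - 1)" m
      using serre_coeffs_qpar[OF qparams(2) m0] unfolding iA .
    interpret P: serre_pair_3 scl "qv ^ 2" "qv ^ (m - 1)" m "X i" "F i" "X j"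
      "(- c0) \<cdot> kt i" "(- (s j * c0)) \<cdot> (K' i * K' j)"
    proof
      show "F i * X i = inverse (qv\<^sup>2) \<cdot> (X i * F i)" using ji by (simp add: FX power_int_minus)
      show "F i * X j = qv ^ (m - 1) \<cdot> (X j * F i) + (- c0) \<cdot> kt i - (- (s j * c0)) \<cdot> (K' i * K' j)"
        by (simp add: FX tj q kti scale_right_diff_distrib scale_minus_left mult_ac)
      show "(- c0) \<cdot> kt i * F i = inverse (qv\<^sup>2 * qv ^ (m - 1)) \<cdot> (F i * (- c0) \<cdot> kt i)"
        by (simp add: kti scl_nf K'F KF' cj q cii power_int_minus mult_ac)
      show "(- c0) \<cdot> kt i * X i = inverse (qv\<^sup>2 * qv ^ (m - 1)) \<cdot> (X i * (- c0) \<cdot> kt i)"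
        by (simp add: kti scl_nf K'X ext[OF KX] ti cj q cii power_int_minus mult_ac)
      show "(- (s j * c0)) \<cdot> (K' i * K' j) * X i = (qv ^ (m - 1) / qv\<^sup>2) \<cdot> (X i * (- (s j * c0)) \<cdot> (K' i * K' j))"
        by (simp add: scl_nf K'X ext[OF K'X] ti cj q cii power_int_minus mult_ac divide_inverse)
      show "(- (s j * c0)) \<cdot> (K' i * K' j) * F i = (qv\<^sup>2 / qv ^ (m - 1)) \<cdot> (F i * (- (s j * c0)) \<cdot> (K' i * K' j))"
        by (simp add: scl_nf K'F K'F' cj q cii power_int_minus mult_ac divide_inverse)
    qed
    have x: "P.x = B i" by (simp add: P.x_def B_def add.commute)
    have "P.zs m = 0"
      using SX[OF ij, folded m_def] unfolding P.zs_def serre_eq_0_iff[OF qparams(2)] iA by (simp add: power_inverse)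
    then show ?thesis
      using P.qprod_x_top[OF m2[folded m_def]] qprod_eq_serre[OF qparams(2), of m "B i" "X j"] unfolding x iA
      by (simp add: power_inverse)
  qed
  have "(-1) ^ m \<cdot> serre (B i) (B j) m = (-1) ^ m \<cdot> serre (B i) (F j) m + (-1) ^ m \<cdot> serre (B i) (X j) m"
    by (simp add: B_def[of j] serre_add scale_right_distrib)
  then show ?thesis
    unfolding F X by (simp only: distrib_left scl_mult_right scale_scale)
qed

text \<open>
  The only place where \<open>s i = s (\<tau> i)\<close> matters: without it a multiple of \<open>K'\<^sub>i K'\<^sub>j\<close> would
  remain.
\<close>

theorem commutator_B:
  assumes ij: "i \<noteq> j" and ti: "\<tau> i = j" and c: "c i j = 0"
  shows "serre (B i) (B j) (mm i j) = c0 \<cdot> kt i - c0 \<cdot> kt j"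
proof -
  have tj: "\<tau> j = i" using ti tau2 by metis
  have m: "mm i j = 1" by (simp add: mm_def c)
  have s: "s i = s j" using s_sym[of i] ij c ti by simp
  have qb: "qbinom 1 0 = 1" "qbinom (Suc 0) (Suc 0) = 1"
    using qv_power_neq_1[of 2] by (simp_all add: qbinom_def qfact_def qint_def field_simps power2_eq_square)
  have z: "serre (F i) (F j) (Suc 0) = 0" "serre (X i) (X j) (Suc 0) = 0"
    using SF[OF ij] SX[OF ij] by (simp_all add: m)
  have e: "serre a w (Suc 0) = w * a - a * w" for a w
    using qb by (simp add: serre_def scale_minus_left)
  have kt: "kt j = s i \<cdot> (K j * K' i)" "kt i = s j \<cdot> (K i * K' j)" by (simp_all add: kt_def ti tj)
  have "serre (B i) (B j) (Suc 0) = (F j * F i - F i * F j) + (X j * X i - X i * X j) + (X j * F i - F i * X j) + (F j * X i - X i * F j)"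
    unfolding e B_def by (simp add: algebra_simps)
  also have "\<dots> = (X j * F i - F i * X j) + (F j * X i - X i * F j)"
    using z by (simp add: e)
  also have "\<dots> = c0 \<cdot> kt i - c0 \<cdot> kt j"
  proof -
    have "X j * F i - F i * X j = c0 \<cdot> kt i - (s j * c0) \<cdot> (K' i * K' j)"
      using c c_sym[of j i] by (simp add: XF tj kt scale_right_diff_distrib mult.commute)
    moreover have "F j * X i - X i * F j = (s j * c0) \<cdot> (K' i * K' j) - c0 \<cdot> kt j"
      using c by (simp add: XF ti kt s scale_right_diff_distrib K'K'[of i j] mult.commute)
    ultimately show ?thesis by simp
  qed
  finally show ?thesis by (simp add: m)
qed

end

section \<open>The relations of the i-quantum groups\<close>

locale idata = gcm c for c :: "'i \<Rightarrow> 'i \<Rightarrow> int" +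
  fixes \<tau> :: "'i \<Rightarrow> 'i" and V :: "'i set"
begin

text \<open>
  The exponent of \<open>v\<close> in the commutation of the torus element \<open>n\<close> with \<open>B\<^sub>j\<close>. Additive maps on
  the free abelian group are extended from its basis; the index \<open>()\<close> makes a free group of rank one out
  of the integers.
\<close>

definition tw :: "('i \<Rightarrow>\<^sub>0 int) \<Rightarrow> 'i \<Rightarrow> int" where
  "tw n j = Poly_Mapping.lookup (frag_extend (\<lambda>i. Poly_Mapping.single () (c (\<tau> i) j - c i j)) n) ()"

lemma tw_simps [simp]: "tw 0 j = 0" "tw (frag_of i) j = c (\<tau> i) j - c i j" "tw (a + b) j = tw a j + tw b j"
  "tw (a - b) j = tw a j - tw b j"
  by (simp_all add: tw_def frag_extend_add frag_extend_diff lookup_add lookup_minus)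

text \<open>
  Multiplication by \<open>B\<^sub>J\<close> on the left and by \<open>B\<^sub>J\<^sub>' t\<^sub>n\<close> on the right, in terms of the words
  with all torus elements collected at the end.
\<close>

definition wrap :: "'i list \<Rightarrow> 'i list \<Rightarrow> ('i \<Rightarrow>\<^sub>0 int) \<Rightarrow> (('i list \<times> ('i \<Rightarrow>\<^sub>0 int)) \<Rightarrow>\<^sub>0 rat poly fract)
    \<Rightarrow> (('i list \<times> ('i \<Rightarrow>\<^sub>0 int)) \<Rightarrow>\<^sub>0 rat poly fract)" where
  "wrap J J' n = pm.lin (\<lambda>(w, p). Poly_Mapping.single (J @ w @ J', p + n) (qv powi wsum (tw p) J'))"

definition kop :: "'i \<Rightarrow> (('i list \<times> ('i \<Rightarrow>\<^sub>0 int)) \<Rightarrow>\<^sub>0 rat poly fract)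
    \<Rightarrow> (('i list \<times> ('i \<Rightarrow>\<^sub>0 int)) \<Rightarrow>\<^sub>0 rat poly fract)" where
  "kop i = pm.lin (\<lambda>(w, p). Poly_Mapping.single (w, p + frag_of i) (qv powi wsum (tw (frag_of i)) w))"

lemma wrap_single [simp]:
  "wrap J J' n (Poly_Mapping.single (w, p) a) = Poly_Mapping.single (J @ w @ J', p + n) (a * qv powi wsum (tw p) J')"
  by (simp add: wrap_def)

lemma kop_single [simp]:
  "kop i (Poly_Mapping.single (w, p) a) = Poly_Mapping.single (w, p + frag_of i) (a * qv powi wsum (tw (frag_of i)) w)"
  by (simp add: kop_def)

lemma linear_wrap: "Vector_Spaces.linear pscale pscale (wrap J J' n)"
  and linear_kop: "Vector_Spaces.linear pscale pscale (kop i)"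
  unfolding wrap_def kop_def by (rule pm.linear_lin)+

lemma wrap_add: "wrap J J' n (a + b) = wrap J J' n a + wrap J J' n b"
  and wrap_scale: "wrap J J' n (pscale d a) = pscale d (wrap J J' n a)"
  and kop_add: "kop i (a + b) = kop i a + kop i b"
  using linear_wrap[of J J' n] linear_kop[of i] by (simp_all add: linear_pscale_iff)

lemma wrap_shorter: "v \<in> shorter l \<Longrightarrow> wrap J J' n v \<in> shorter (length J + l + length J')"
  by (rule shorter_linear[OF linear_wrap]) auto

lemma kop_shorter: "v \<in> shorter l \<Longrightarrow> kop i v \<in> shorter l"
  by (rule shorter_linear[OF linear_kop]) auto

lemma wsum_tw_0 [simp]: "wsum (tw 0) J = 0"
  by (induction J) (simp_all add: wsum_def)

abbreviation "Lop i \<equiv> wrap [i] [] 0"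
abbreviation "Rop i \<equiv> wrap [] [i] 0"

definition sw :: "'i \<Rightarrow> 'i \<Rightarrow> (('i list \<times> ('i \<Rightarrow>\<^sub>0 int)) \<Rightarrow>\<^sub>0 rat poly fract)" where
  "sw i j = serre_word [] i j [] 0"

lemma sw_eq_op: "sw i j = serre_op pscale (Lop i) (Rop i) (Poly_Mapping.single ([j], 0) 1) (mm i j)"
proof -
  have R: "(Rop i ^^ n) (Poly_Mapping.single ([j], 0) 1) = Poly_Mapping.single (j # replicate n i, 0) 1" for n
    by (induction n) (simp_all add: replicate_append_same)
  have L: "(Lop i ^^ n) (Poly_Mapping.single (w, 0) 1) = Poly_Mapping.single (replicate n i @ w, 0) 1" for n w
    by (induction n) (simp_all add: wsum_def)
  show ?thesis
    unfolding sw_def serre_word_def serre_op_def R L by simp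
qed

lemma wrap_sw: "wrap J J' n (sw i j) = serre_word J i j J' n"
proof -
  interpret Vector_Spaces.linear pscale pscale "wrap J J' n" by (rule linear_wrap)
  show ?thesis unfolding sw_def serre_word_def sum by (simp add: mult.commute)
qed

definition icont :: "'i \<Rightarrow> 'i \<Rightarrow> nat \<Rightarrow> (('i list \<times> ('i \<Rightarrow>\<^sub>0 int)) \<Rightarrow>\<^sub>0 rat poly fract)" where
  "icont i j = continuant (\<lambda>k z. Lop i z - pscale (qv ^ (mm i j - 1) * qA ^ k) (Rop i z))
     (\<lambda>k z. pscale (icoeff (mm i j) k) (kop i z)) (Poly_Mapping.single ([j], 0) 1)"

text \<open>
  Each relation between \<open>B\<^sub>i\<close> and \<open>B\<^sub>j\<close> has the Serre combination of words as its part of maximal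
  length; these are the remaining terms. They are the same for both quantum groups, since they depend on
  the scalars only through the torus elements, and this makes the two algebras comparable.
\<close>

definition lower_terms :: "'i \<Rightarrow> 'i \<Rightarrow> (('i list \<times> ('i \<Rightarrow>\<^sub>0 int)) \<Rightarrow>\<^sub>0 rat poly fract)" where
  "lower_terms i j = (let m = mm i j in
     if i \<notin> V \<or> j \<notin> V then 0
     else if \<tau> i = i then pscale ((-1) ^ m) (icont i j m) - sw i j
     else if \<tau> i = j \<and> c i j = 0 then
       Poly_Mapping.single ([], frag_of j) c0 - Poly_Mapping.single ([], frag_of i) c0
     else if \<tau> i = j then
       pscale (- ((-1) ^ m)) (
         Poly_Mapping.single (replicate (m - 1) i, frag_of j) (serre_coeffs.\<xi> qA (inverse (qv ^ (m - 1))) m * (inverse (qv ^ (m - 1)) * c0))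
       + Poly_Mapping.single (replicate (m - 1) i, frag_of i) (serre_coeffs.\<xi> (qv ^ 2) (qv ^ (m - 1)) m * (- c0)))
     else 0)"

text \<open>
  Each use of the torus operator in the recursion replaces two letters, so the continuant differs from
  the product of its linear entries by shorter words.
\<close>

lemma icont_lead:
  "icont i j n \<in> shorter (n + 2) \<and>
   icont i j n - pm.qprod (qv ^ (mm i j - 1)) qA (Lop i) (Rop i) (Poly_Mapping.single ([j], 0) 1) n \<in> shorter (n + 1)"
proof (induction n rule: induct_nat_012)
  case 0 show ?case by (simp add: icont_def pm.subspace_0[OF subspace_shorter])
next
  case 1
  show ?case
    by (auto simp: icont_def pm.subspace_0[OF subspace_shorter] intro!: pm.subspace_diff[OF subspace_shorter])
next
  case (ge2 n)
  let ?w = "Poly_Mapping.single ([j], 0 :: 'i \<Rightarrow>\<^sub>0 int) (1::rat poly fract)"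
  let ?p = "\<lambda>n. pm.qprod (qv ^ (mm i j - 1)) qA (Lop i) (Rop i) ?w n"
  let ?a = "\<lambda>z. Lop i z - pscale (qv ^ (mm i j - 1) * qA ^ Suc n) (Rop i z)"
  let ?g = "pscale (icoeff (mm i j) (Suc n)) (kop i (icont i j n))"
  have c: "icont i j (Suc (Suc n)) = ?a (icont i j (Suc n)) + ?g"
    by (simp add: icont_def)
  have g: "?g \<in> shorter (n + 2)"
    using ge2 by (intro pm.subspace_scale[OF subspace_shorter] kop_shorter) simp
  have a: "?a z \<in> shorter (Suc l)" if "z \<in> shorter l" for z l
    using wrap_shorter[OF that, of "[i]" "[]" 0] wrap_shorter[OF that, of "[]" "[i]" 0]
    by (intro pm.subspace_diff[OF subspace_shorter] pm.subspace_scale[OF subspace_shorter]) auto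
  have 1: "icont i j (Suc (Suc n)) \<in> shorter (Suc (Suc n) + 2)"
    unfolding c using a[of "icont i j (Suc n)" "Suc n + 2"] ge2 shorter_mono[OF g, of "Suc (Suc n) + 2"]
    by (intro pm.subspace_add[OF subspace_shorter]) auto
  have "?a (x - y) = ?a x - ?a y" for x y
  proof -
    interpret L: Vector_Spaces.linear pscale pscale "Lop i" by (rule linear_wrap)
    interpret R: Vector_Spaces.linear pscale pscale "Rop i" by (rule linear_wrap)
    show ?thesis by (simp add: L.diff R.diff pm.scale_right_diff_distrib)
  qed
  then have "icont i j (Suc (Suc n)) - ?p (Suc (Suc n)) = ?a (icont i j (Suc n) - ?p (Suc n)) + ?g"
    unfolding c by simp
  also have "\<dots> \<in> shorter (Suc (Suc n) + 1)"
    using a[of "icont i j (Suc n) - ?p (Suc n)" "Suc n + 1"] ge2 shorter_mono[OF g, of "Suc (Suc n) + 1"]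
    by (intro pm.subspace_add[OF subspace_shorter]) auto
  finally show ?case using 1 by simp
qed

lemma lower_terms_shorter:
  assumes "i \<noteq> j" shows "lower_terms i j \<in> shorter (mm i j + 1)"
proof -
  let ?m = "mm i j"
  have q: "pm.qprod (qv ^ (?m - 1)) qA (Lop i) (Rop i) (Poly_Mapping.single ([j], 0) 1) ?m = pscale ((-1) ^ ?m) (sw i j)"
    unfolding sw_eq_op
  proof (rule qprod_eq_serre_op[OF pm.vec_axioms _ linear_wrap linear_wrap])
    show "qpar qv" by (simp add: qpar_def)
    show "Lop i (Rop i x) = Rop i (Lop i x)" for x
      by (rule pm.linear_ext_on_keys[of "\<lambda>x. Lop i (Rop i x)" "\<lambda>x. Rop i (Lop i x)"])
        (auto simp: linear_pscale_iff wrap_add wrap_scale wsum_def)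
  qed
  have "pscale ((-1) ^ ?m) (icont i j ?m - pscale ((-1) ^ ?m) (sw i j)) \<in> shorter (?m + 1)"
    using icont_lead[of i j ?m] unfolding q by (intro pm.subspace_scale[OF subspace_shorter]) simp
  moreover have "(-1 :: rat poly fract) ^ ?m * (-1) ^ ?m = 1" by (simp add: power_mult_distrib[symmetric])
  ultimately have "pscale ((-1) ^ ?m) (icont i j ?m) - sw i j \<in> shorter (?m + 1)"
    by (simp add: pm.scale_right_diff_distrib)
  then show ?thesis
    using mm_pos[OF assms] unfolding lower_terms_def Let_def
    by (auto intro!: pm.subspace_diff[OF subspace_shorter] pm.subspace_add[OF subspace_shorter]
       pm.subspace_scale[OF subspace_shorter] pm.subspace_0[OF subspace_shorter] pm.subspace_neg[OF subspace_shorter])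
qed

text \<open>
  A word that contains an index without a vertex evaluates to zero, as \<open>B\<close> is zero there.
\<close>

definition irels :: "(('i list \<times> ('i \<Rightarrow>\<^sub>0 int)) \<Rightarrow>\<^sub>0 rat poly fract) set" where
  "irels = pm.span ({wrap J J' n (sw i j + lower_terms i j) | J J' n i j. i \<noteq> j} \<union>
     {Poly_Mapping.single (J, n) 1 | J n. \<not> set J \<subseteq> V})"

lemma subspace_irels: "pm.subspace irels" by (simp add: irels_def)

lemma irels_outside: "\<not> set J \<subseteq> V \<Longrightarrow> Poly_Mapping.single (J, n) a \<in> irels"
proof -
  assume "\<not> set J \<subseteq> V"
  then have "Poly_Mapping.single (J, n) 1 \<in> irels" unfolding irels_def by (intro pm.span_base) blast
  from pm.subspace_scale[OF subspace_irels this, of a] show ?thesis by simp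
qed

text \<open>
  A Serre combination of words is, modulo the relations, minus the lower terms of the relation it
  starts.
\<close>

lemma vN_reduce:
  assumes "v \<in> vN" shows "\<exists>v'\<in>shorter l. top_part V l v - v' \<in> irels"
proof -
  define M where "M = {v :: ('i list \<times> ('i \<Rightarrow>\<^sub>0 int)) \<Rightarrow>\<^sub>0 rat poly fract. \<exists>v'\<in>shorter l. v - v' \<in> irels}"
  have M: "pm.subspace M"
  proof (rule pm.subspaceI)
    show "0 \<in> M" using pm.subspace_0[OF subspace_shorter] pm.subspace_0[OF subspace_irels] by (force simp: M_def)
  next
    fix v w assume "v \<in> M" "w \<in> M"
    then obtain v' w' where h: "v' \<in> shorter l" "w' \<in> shorter l" "v - v' \<in> irels" "w - w' \<in> irels" by (auto simp: M_def)
    have "(v + w) - (v' + w') = (v - v') + (w - w')" by simp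
    then have "(v + w) - (v' + w') \<in> irels" using pm.subspace_add[OF subspace_irels h(3,4)] by (simp only:)
    then show "v + w \<in> M" using pm.subspace_add[OF subspace_shorter h(1,2)] by (auto simp: M_def)
  next
    fix d v assume "v \<in> M"
    then obtain v' where h: "v' \<in> shorter l" "v - v' \<in> irels" by (auto simp: M_def)
    have "pscale d v - pscale d v' \<in> irels"
      using pm.subspace_scale[OF subspace_irels h(2), of d] by (simp add: pm.scale_right_diff_distrib)
    then show "pscale d v \<in> M" using pm.subspace_scale[OF subspace_shorter h(1)] by (auto simp: M_def)
  qed
  have "top_part V l v \<in> M"
  proof (rule vN_image[OF linear_top_part M _ assms])
    fix J J' :: "'i list" and i j :: 'i and g :: "'i \<Rightarrow>\<^sub>0 int" assume ij: "i \<noteq> j"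
    define C where "C \<longleftrightarrow> length J + mm i j + 1 + length J' = l \<and> (mm i j > 0 \<longrightarrow> i \<in> V) \<and> j \<in> V \<and> set J \<subseteq> V \<and> set J' \<subseteq> V"
    show "top_part V l (serre_word J i j J' g) \<in> M"
    proof (cases C)
      case True
      then have "length J + (mm i j + 1) + length J' = l" by (simp add: C_def)
      then have "wrap J J' g (lower_terms i j) \<in> shorter l"
        using wrap_shorter[OF lower_terms_shorter[OF ij], of J J' g] by simp
      then have "- wrap J J' g (lower_terms i j) \<in> shorter l" by (rule pm.subspace_neg[OF subspace_shorter])
      moreover have "serre_word J i j J' g - (- wrap J J' g (lower_terms i j)) \<in> irels"
        unfolding wrap_sw[symmetric] irels_def diff_minus_eq_add wrap_add[symmetric]
        by (rule pm.span_base) (use ij in blast)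
      ultimately show ?thesis using True unfolding top_part_serre_word M_def C_def[symmetric] mem_Collect_eq if_P[OF True] by blast
    next
      case False
      then show ?thesis unfolding top_part_serre_word C_def[symmetric] using pm.subspace_0[OF M] by simp
    qed
  qed
  then show ?thesis by (simp add: M_def)
qed

end

text \<open>
  An algebra together with a torus of commuting units through which the \<open>kt\<^sub>i\<close> extend to all
  integral exponents.
\<close>

locale ireal = itype scl c \<tau> s E F K K' + idata c \<tau> V
  for scl :: "rat poly fract \<Rightarrow> 'r::ring_1 \<Rightarrow> 'r" (infixr \<open>\<cdot>\<close> 75) and c :: "'i \<Rightarrow> 'i \<Rightarrow> int" and \<tau> s E F K K' V +
  fixes t :: "('i \<Rightarrow>\<^sub>0 int) \<Rightarrow> 'r"
  assumes outside: "i \<notin> V \<Longrightarrow> B i = 0"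
    and t_add: "t (n + p) = t n * t p" and t_gen: "i \<in> V \<Longrightarrow> t (frag_of i) = kt i"
    and t_B: "t n * B i = (qv powi tw n i) \<cdot> (B i * t n)" and t0_B: "t 0 * B i = B i"
begin

abbreviation "ev \<equiv> iev B t"

lemma t0_t: "t 0 * t n = t n" "t n * t 0 = t n"
  using t_add[of 0 n] t_add[of n 0] by simp_all

lemma B_t0: "B i * t 0 = B i"
  using t_B[of 0 i] t0_B[of i] by simp

lemma ev_single [simp]: "ev (Poly_Mapping.single (J, n) a) = a \<cdot> word_rep B (t n) J"
  by (simp add: iev_def)

lemma linear_ev: "Vector_Spaces.linear pscale scl ev"
  unfolding iev_def by (rule linear_lin)

lemma ev_add: "ev (a + b) = ev a + ev b" and ev_scale: "ev (pscale d a) = d \<cdot> ev a"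
  and ev_diff: "ev (a - b) = ev a - ev b" and ev_zero: "ev 0 = 0"
  unfolding iev_def by (simp_all add: lin_add lin_scale lin_diff)

lemma word_t: "word_rep B (t n * z) J = word_rep B (t n) J * z"
  by (induction J) (simp_all add: mult.assoc)

lemma word_t0: "word_rep B (t n) J = word_rep B (t 0) J * t n"
  using word_t[of 0 "t n" J] by (simp add: t0_t)

lemma t0_word: "t 0 * word_rep B (t n) J = word_rep B (t n) J"
  by (cases J) (simp_all add: t0_t t0_B mult.assoc[symmetric])

lemma word_append: "word_rep B (t n) (J @ J') = word_rep B (t 0) J * word_rep B (t n) J'"
  by (induction J) (simp_all add: t0_word mult.assoc)

lemma t_word: "t p * word_rep B (t n) J = (qv powi wsum (tw p) J) \<cdot> word_rep B (t (p + n)) J"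
proof (induction J)
  case (Cons i J)
  have "t p * word_rep B (t n) (i # J) = (qv powi tw p i) \<cdot> (B i * (t p * word_rep B (t n) J))"
    by (simp add: mult.assoc[symmetric] t_B scl_mult_left)
  then show ?case by (simp add: Cons scl_mult_right wsum_def power_int_add)
qed (simp add: wsum_def t_add)

lemma ev_wrap: "ev (wrap J J' n v) = word_rep B (t 0) J * ev v * word_rep B (t n) J'"
proof -
  have "ev (wrap J J' n v) = lin (\<lambda>z. ev (case z of (w, p) \<Rightarrow> Poly_Mapping.single (J @ w @ J', p + n) (qv powi wsum (tw p) J'))) v"
    unfolding wrap_def by (rule linear_lin_comp[OF linear_ev])
  also have "\<dots> = lin (\<lambda>z. word_rep B (t 0) J * (case z of (w, p) \<Rightarrow> word_rep B (t p) w) * word_rep B (t n) J') v"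
  proof (rule lin_cong, clarify)
    fix w p
    have "word_rep B (t p) w * word_rep B (t n) J' = word_rep B (t 0) w * (t p * word_rep B (t n) J')"
      by (subst word_t0) (simp add: mult.assoc)
    then show "ev (Poly_Mapping.single (J @ w @ J', p + n) (qv powi wsum (tw p) J')) =
        word_rep B (t 0) J * word_rep B (t p) w * word_rep B (t n) J'"
      by (simp add: t_word word_append scl_mult_right mult.assoc)
  qed
  also have "\<dots> = word_rep B (t 0) J * ev v * word_rep B (t n) J'"
    by (simp add: iev_def lin_def sum_distrib_left sum_distrib_right scl_mult_left scl_mult_right split_beta)
  finally show ?thesis .
qed

lemma ev_kop: assumes "i \<in> V" shows "ev (kop i v) = kt i * ev v"
proof -
  have "ev (kop i v) = lin (\<lambda>z. ev (case z of (w, p) \<Rightarrow> Poly_Mapping.single (w, p + frag_of i) (qv powi wsum (tw (frag_of i)) w))) v"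
    unfolding kop_def by (rule linear_lin_comp[OF linear_ev])
  also have "\<dots> = lin (\<lambda>z. kt i * (case z of (w, p) \<Rightarrow> word_rep B (t p) w)) v"
    by (rule lin_cong) (auto simp: t_gen[OF assms, symmetric] t_word add.commute)
  also have "\<dots> = kt i * ev v"
    by (simp add: iev_def lin_def sum_distrib_left scl_mult_right split_beta)
  finally show ?thesis .
qed

lemma t0_ev: "t 0 * ev v = ev v" and ev_t0: "ev v * t 0 = ev v"
proof -
  have "word_rep B (t n) J * t 0 = word_rep B (t n) J" for n J by (simp add: word_t[symmetric] t0_t)
  then show "t 0 * ev v = ev v" "ev v * t 0 = ev v"
    by (simp_all add: iev_def lin_def sum_distrib_left sum_distrib_right scl_mult_right scl_mult_left t0_word split_beta)
qed

lemma ev_Lop: "ev (Lop i v) = B i * ev v" and ev_Rop: "ev (Rop i v) = ev v * B i"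
  by (simp_all add: ev_wrap B_t0 mult.assoc t0_ev t0_B ev_t0)

lemma ev_sw: "ev (sw i j) = serre (B i) (B j) (mm i j)"
  unfolding sw_eq_op serre_eq_op
  by (subst serre_op_intertwine[where f = ev, OF pm.vec_axioms vec_axioms linear_ev])
    (simp_all add: ev_Lop ev_Rop B_t0 del: wrap_single)

lemma word_replicate: "word_rep B z (replicate n i) = B i ^ n * z"
  by (induction n) (simp_all add: mult.assoc)

theorem ev_relation:
  assumes ij: "i \<noteq> j" shows "ev (sw i j + lower_terms i j) = 0"
proof -
  note m = mm_pos[OF ij]
  consider "i \<notin> V \<or> j \<notin> V" | "i \<in> V" "j \<in> V" "\<tau> i = i" | "i \<in> V" "j \<in> V" "\<tau> i = j" "c i j = 0" | "i \<in> V" "j \<in> V" "\<tau> i = j" "c i j \<noteq> 0"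
    | "i \<in> V" "j \<in> V" "\<tau> i \<noteq> i" "\<tau> i \<noteq> j" by blast
  then show ?thesis
  proof cases
    case 1
    then have "serre (B i) (B j) (mm i j) = 0"
      using outside m by (auto simp: serre_def power_0_left intro!: sum.neutral)
    then show ?thesis using 1 by (auto simp: lower_terms_def ev_add ev_sw)
  next
    case 2
    have "ev (icont i j (mm i j)) = continuant (\<lambda>k z. B i * z - (qv ^ (mm i j - 1) * qA ^ k) \<cdot> (z * B i))
       (\<lambda>k z. icoeff (mm i j) k \<cdot> (kt i * z)) (ev (Poly_Mapping.single ([j], 0) 1)) (mm i j)"
      unfolding icont_def
      by (rule continuant_apply)
        (simp_all only: ev_add ev_diff ev_scale ev_Lop ev_Rop ev_kop[OF 2(1)] wrap_add kop_add pm.scale_right_distrib add_diff_add)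
    also have "ev (Poly_Mapping.single ([j], 0) 1) = B j" by (simp add: B_t0)
    finally have "ev (icont i j (mm i j)) = 0" unfolding continuant_B_fixed[OF ij 2(3)] .
    then show ?thesis using 2 by (simp add: lower_terms_def Let_def ev_add ev_diff ev_scale)
  next
    case 3
    then show ?thesis
      using ij by (simp add: lower_terms_def ev_add ev_diff ev_sw commutator_B t_gen)
  next
    case 4
    then have m2: "mm i j \<ge> 2" using c_off[OF ij] by (simp add: mm_def)
    let ?m = "mm i j"
    have sq: "(-1 :: rat poly fract) ^ ?m * (-1) ^ ?m = 1" by (simp add: power_mult_distrib[symmetric])
    define a where "a = serre_coeffs.\<xi> qA (inverse (qv ^ (?m - 1))) ?m * (inverse (qv ^ (?m - 1)) * c0)"
    define b where "b = serre_coeffs.\<xi> (qv ^ 2) (qv ^ (?m - 1)) ?m * (- c0)"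
    have "(-1) ^ ?m \<cdot> serre (B i) (B j) ?m = B i ^ (?m - 1) * (a \<cdot> kt j + b \<cdot> kt i)"
      unfolding a_def b_def by (rule serre_B_swapped[OF ij 4(3) m2])
    then have "(-1) ^ ?m \<cdot> ((-1) ^ ?m \<cdot> serre (B i) (B j) ?m) = (-1) ^ ?m \<cdot> (B i ^ (?m - 1) * (a \<cdot> kt j + b \<cdot> kt i))" by simp
    then have s: "serre (B i) (B j) ?m = (-1) ^ ?m \<cdot> (B i ^ (?m - 1) * (a \<cdot> kt j + b \<cdot> kt i))"
      by (simp only: scale_scale sq scale_one)
    have "lower_terms i j = pscale (- ((-1) ^ ?m)) (Poly_Mapping.single (replicate (?m - 1) i, frag_of j) a + Poly_Mapping.single (replicate (?m - 1) i, frag_of i) b)"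
      using 4 ij by (simp add: lower_terms_def Let_def a_def b_def)
    then have "ev (lower_terms i j) = (- ((-1) ^ ?m)) \<cdot> (a \<cdot> (B i ^ (?m - 1) * kt j) + b \<cdot> (B i ^ (?m - 1) * kt i))"
      using 4 by (simp only: ev_scale ev_add ev_single word_replicate t_gen)
    then show ?thesis
      unfolding ev_add ev_sw s by (simp only: distrib_left scl_mult_right scale_minus_left right_minus)
  next
    case 5
    then show ?thesis using serre_B_generic[OF ij] by (simp add: lower_terms_def ev_add ev_sw)
  qed
qed

lemma ev_irels: "v \<in> irels \<Longrightarrow> ev v = 0"
proof -
  interpret Vector_Spaces.linear pscale scl ev by (rule linear_ev)
  have w: "word_rep B (t n) J = 0" if "\<not> set J \<subseteq> V" for n J
    using that by (induction J) (use outside in \<open>fastforce+\<close>)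
  assume "v \<in> irels"
  then show "ev v = 0"
    unfolding irels_def
  proof (induction rule: pm.span_induct_alt)
    case (step d x y)
    have "ev x = 0"
      using step(1)
    proof
      assume "x \<in> {Poly_Mapping.single (J, n) 1 | J n. \<not> set J \<subseteq> V}"
      then obtain J n where "\<not> set J \<subseteq> V" "x = Poly_Mapping.single (J, n) 1" by blast
      then show ?thesis by (simp add: w)
    qed (auto simp: ev_wrap ev_relation)
    then show ?case using step by (simp add: ev_add ev_scale)
  qed (simp add: ev_zero)
qed

end

section \<open>All relations of the i-quantum groups\<close>

text \<open>
  The units in the double centraliser of the \<open>f\<^sub>i\<close> form a commutative group, to which the universal
  property of the free abelian group applies.
\<close>

lemma (in Group.monoid) commuting_units_hom:
  assumes f: "\<And>i. f i \<in> Units G" and c: "\<And>i j. f i \<otimes> f j = f j \<otimes> f i"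
  shows "\<exists>t :: ('i \<Rightarrow>\<^sub>0 int) \<Rightarrow> 'a. (\<forall>n. t n \<in> carrier G) \<and> (\<forall>n p. t (n + p) = t n \<otimes> t p) \<and> t 0 = \<one> \<and> (\<forall>i. t (frag_of i) = f i)"
proof -
  define C where "C = {w \<in> carrier G. \<forall>i. w \<otimes> f i = f i \<otimes> w}"
  define Z where "Z = {u \<in> Units G. \<forall>w\<in>C. w \<otimes> u = u \<otimes> w}"
  have fc: "f i \<in> carrier G" for i using f by (rule Units_closed)
  have fZ: "f i \<in> Z" for i using f by (auto simp: Z_def C_def)
  have ZC: "u \<in> C" if "u \<in> Z" for u
  proof -
    have "f i \<in> C" for i using fc c by (auto simp: C_def)
    then show ?thesis using that by (auto simp: Z_def C_def Units_closed)
  qed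
  have ZU: "u \<in> Units G" "u \<in> carrier G" if "u \<in> Z" for u using that by (auto simp: Z_def Units_closed)
  have CC: "w \<in> carrier G" if "w \<in> C" for w using that by (simp add: C_def)
  have inv: "inv u \<in> Z" if "u \<in> Z" for u
  proof -
    have "w \<otimes> inv u = inv u \<otimes> w" if "w \<in> C" for w
    proof -
      note h = ZU[OF \<open>u \<in> Z\<close>] CC[OF \<open>w \<in> C\<close>]
      have wu: "w \<otimes> u = u \<otimes> w" using \<open>u \<in> Z\<close> \<open>w \<in> C\<close> by (simp add: Z_def)
      have "w \<otimes> inv u = inv u \<otimes> (u \<otimes> w) \<otimes> inv u"
        using h by (simp add: m_assoc[symmetric])
      also have "\<dots> = inv u \<otimes> w"
        unfolding wu[symmetric] using h by (simp add: m_assoc)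
      finally show ?thesis .
    qed
    then show ?thesis using ZU[OF that] by (simp add: Z_def)
  qed
  let ?H = "G\<lparr>carrier := Z\<rparr>"
  have "comm_group ?H"
  proof (rule comm_groupI)
    fix u w assume u: "u \<in> carrier ?H" and w: "w \<in> carrier ?H"
    then have uw: "u \<in> Z" "w \<in> Z" by simp_all
    note h = ZU[OF uw(1)] ZU[OF uw(2)]
    have "z \<otimes> (u \<otimes> w) = u \<otimes> w \<otimes> z" if "z \<in> C" for z
    proof -
      have e: "z \<otimes> u = u \<otimes> z" "z \<otimes> w = w \<otimes> z" using uw that by (auto simp: Z_def)
      have "z \<otimes> (u \<otimes> w) = (z \<otimes> u) \<otimes> w" using h CC[OF that] by (simp add: m_assoc)
      also have "\<dots> = u \<otimes> (z \<otimes> w)" unfolding e(1) using h CC[OF that] by (simp add: m_assoc)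
      finally show ?thesis unfolding e(2) using h CC[OF that] by (simp add: m_assoc)
    qed
    then show "u \<otimes>\<^bsub>?H\<^esub> w \<in> carrier ?H" using h by (simp add: Z_def)
    show "u \<otimes>\<^bsub>?H\<^esub> w = w \<otimes>\<^bsub>?H\<^esub> u" using ZC[OF uw(1)] uw(2) by (simp add: Z_def)
  next
    fix u assume "u \<in> carrier ?H"
    then show "\<exists>w\<in>carrier ?H. w \<otimes>\<^bsub>?H\<^esub> u = \<one>\<^bsub>?H\<^esub>"
      using inv[of u] ZU[of u] by (auto intro!: bexI[of _ "inv u"])
  qed (auto simp: Z_def C_def Units_closed m_assoc)
  then interpret H: comm_group ?H .
  obtain t where t: "t \<in> hom (free_Abelian_group (UNIV :: 'i set)) ?H" "\<And>i. t (frag_of i) = f i"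
    using H.free_Abelian_group_universal[of f UNIV] fZ by auto
  have tZ: "t n \<in> Z" for n using t(1) by (auto simp: hom_def Pi_def)
  have ta: "t (n + p) = t n \<otimes> t p" for n p using t(1) by (auto simp: hom_def)
  have "t 0 \<otimes> t 0 = t 0 \<otimes> \<one>" using ta[of 0 0] ZU[OF tZ] by simp
  then have "t 0 = \<one>" using ZU[OF tZ] Units_l_cancel[of "t 0" "t 0" \<one>] by simp
  then show ?thesis using t(2) ta ZU(2)[OF tZ] by blast
qed

definition torus_char :: "('i \<Rightarrow> 'k::field) \<Rightarrow> ('i \<Rightarrow>\<^sub>0 int) \<Rightarrow> 'k" where
  "torus_char f n = (\<Prod>i\<in>Poly_Mapping.keys n. f i powi Poly_Mapping.lookup n i)"

lemma torus_char_frag_of [simp]: "torus_char f (frag_of i) = f i"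
  by (simp add: torus_char_def)

lemma torus_char_0 [simp]: "torus_char f 0 = 1"
  by (simp add: torus_char_def)

lemma torus_char_add:
  assumes "\<And>i. f i \<noteq> 0" shows "torus_char f (n + p) = torus_char f n * torus_char f p"
proof -
  have super: "torus_char f q = (\<Prod>i\<in>S. f i powi Poly_Mapping.lookup q i)"
    if "finite S" "Poly_Mapping.keys q \<subseteq> S" for S q
    unfolding torus_char_def by (rule prod.mono_neutral_left) (use that in \<open>auto simp: in_keys_iff\<close>)
  let ?S = "Poly_Mapping.keys n \<union> Poly_Mapping.keys p"
  show ?thesis
    using Poly_Mapping.keys_add[of n p]
    by (simp add: super[of ?S] lookup_add power_int_add assms prod.distrib)
qed

lemma torus_char_nonzero: "(\<And>i. f i \<noteq> 0) \<Longrightarrow> torus_char f n \<noteq> 0"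
  by (simp add: torus_char_def)

lemma torus_char_diff:
  assumes "\<And>i. f i \<noteq> 0" shows "torus_char f (n - p) = torus_char f n / torus_char f p"
  using torus_char_add[of f "n - p" p, OF assms] torus_char_nonzero[of f p, OF assms] by (simp add: field_simps)

lemma lin_mem:
  assumes "pm.subspace M" "\<And>x. x \<in> Poly_Mapping.keys v \<Longrightarrow> \<phi> x \<in> M" shows "pm.lin \<phi> v \<in> M"
  unfolding pm.lin_def using assms by (intro pm.subspace_sum pm.subspace_scale)

text \<open>
  A quantum group with the two features that matter here: it satisfies the relations, and it acts on the
  quotient of a Verma module through \<open>g\<close>. The shifts \<open>x\<close> and \<open>y\<close> determine how much of the
  torus this action sees.
\<close>

locale iquantum = kalg A + verma_quotient "cartan Q" x y P
  for A :: "(rat poly fract, 'a, 'b) module_scheme" (structure)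
    and Q :: "('i, 'q) pre_digraph" and x y :: "'i \<Rightarrow> ('j \<Rightarrow>\<^sub>0 int)" and P +
  fixes \<tau> :: "'i \<Rightarrow> 'i" and s :: "'i \<Rightarrow> rat poly fract" and E F K K' Ki K'i :: "'i \<Rightarrow> 'a" and g
  assumes fin: "fin_digraph Q" and tau_perm: "\<tau> permutes verts Q"
    and tau2_verts: "\<And>i. i \<in> verts Q \<Longrightarrow> \<tau> (\<tau> i) = i"
    and cartan_tau: "\<And>i j. i \<in> verts Q \<Longrightarrow> j \<in> verts Q \<Longrightarrow> cartan Q (\<tau> i) (\<tau> j) = cartan Q i j"
    and s_nz: "\<And>i. i \<in> verts Q \<Longrightarrow> s i \<noteq> 0"
    and s_tau: "\<And>i. i \<in> verts Q \<Longrightarrow> cartan Q i (\<tau> i) = 0 \<Longrightarrow> s i = s (\<tau> i)"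
    and closed [simp]: "E i \<in> carrier A" "F i \<in> carrier A" "K i \<in> carrier A" "K' i \<in> carrier A"
    and closed_inv: "i \<in> verts Q \<Longrightarrow> Ki i \<in> carrier A" "i \<in> verts Q \<Longrightarrow> K'i i \<in> carrier A"
    and out: "i \<notin> verts Q \<Longrightarrow> E i = \<zero>" "i \<notin> verts Q \<Longrightarrow> F i = \<zero>" "i \<notin> verts Q \<Longrightarrow> K i = \<zero>" "i \<notin> verts Q \<Longrightarrow> K' i = \<zero>"
    and rels: "\<And>l r. (l, r) \<in> quantum_relations Q A E F K K' \<Longrightarrow> l = r"
    and invs: "\<And>i. i \<in> verts Q \<Longrightarrow> K i \<otimes> Ki i = \<one> \<and> Ki i \<otimes> K i = \<one> \<and> K' i \<otimes> K'i i = \<one> \<and> K'i i \<otimes> K' i = \<one>"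
    and g_rep: "lend.alg_rep A g" and g_one: "g \<one> = P"
    and g_gen: "\<And>i. i \<in> verts Q \<Longrightarrow> g (E i) = P * vE i \<and> g (F i) = P * vF i \<and> g (K i) = P * vK i \<and> g (K' i) = P * vK' i"
begin

abbreviation "V \<equiv> verts Q"

definition B where "B i = F i \<oplus> s i \<odot> (E (\<tau> i) \<otimes> K' i)"
definition k where "k i = s (\<tau> i) \<odot> (K i \<otimes> K' (\<tau> i))"

lemma B_closed [simp]: "B i \<in> carrier A" and k_closed [simp]: "k i \<in> carrier A"
  by (simp_all add: B_def k_def)

lemma tau_verts: "\<tau> i \<in> V \<longleftrightarrow> i \<in> V"
  using tau_perm by (rule permutes_in_image)

lemma tau_out: "i \<notin> V \<Longrightarrow> \<tau> i = i"
  using tau_perm by (rule permutes_not_in)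

lemma tau_tau: "\<tau> (\<tau> i) = i"
  using tau2_verts tau_out by metis

lemma cartan_tau': "cartan Q (\<tau> i) (\<tau> j) = cartan Q i j"
proof (cases "i \<in> V \<and> j \<in> V")
  case False
  show ?thesis
  proof (cases "i = j")
    case False
    then have "\<tau> i \<noteq> \<tau> j" using tau_tau by metis
    then show ?thesis
      using \<open>\<not> (i \<in> V \<and> j \<in> V)\<close> False cartan_outside[OF fin] c_sym tau_verts by metis
  qed simp
qed (simp add: cartan_tau)

lemma itype_of_rep:
  assumes "lend.alg_rep A h"
  shows "itype lscale (cartan Q) \<tau> s (h \<circ> E) (h \<circ> F) (h \<circ> K) (h \<circ> K')"
    and "itype.B lscale \<tau> s (h \<circ> E) (h \<circ> F) (h \<circ> K') i = h (B i)"
    and "itype.kt lscale \<tau> s (h \<circ> K) (h \<circ> K') i = h (k i)"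
proof -
  interpret r: qrepresented lscale A h
    by unfold_locales (rule assms)
  have "lendq.quantum_system Q (h \<circ> E) (h \<circ> F) (h \<circ> K) (h \<circ> K')"
    using rels by (subst r.quantum_relations_iff[symmetric]) auto
  note q = this[unfolded lendq.quantum_system_def comp_def]
  have z: "i \<notin> V \<Longrightarrow> h (E i) = 0 \<and> h (F i) = 0 \<and> h (K i) = 0 \<and> h (K' i) = 0" for i
    by (simp add: out)
  have m: "mm i j = nat (1 - cartan Q i j)" for i j by (simp add: mm_def)
  have S: "lendq.serre a b (mm i j) = 0" if "i \<noteq> j" "a = 0 \<or> b = 0" for i j and a b :: "('z, rat poly fract) lend"
    using that(2) mm_pos[OF that(1)] by (auto simp: lendq.serre_def power_0_left intro!: sum.neutral)
  show it: "itype lscale (cartan Q) \<tau> s (h \<circ> E) (h \<circ> F) (h \<circ> K) (h \<circ> K')"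
  proof (unfold_locales, goal_cases)
    case 1 show ?case by (rule tau_tau)
  next
    case 2 show ?case by (rule cartan_tau')
  next
    case (3 i) then show ?case using s_tau tau_out by metis
  next
    case (4 i j)
    show ?case
    proof (cases "i \<in> V \<and> j \<in> V")
      case True
      then have "h (E i) * h (F j) - h (F j) * h (E i) = (if i = j then lscale c0 (h (K i) - h (K' i)) else 0)" using q by blast
      then show ?thesis by (simp add: diff_eq_eq add.commute)
    qed (use z in auto)
  next
    case (5 i j) show ?case by (cases "i \<in> V \<and> j \<in> V") (use q z in auto)
  next
    case (6 i j) show ?case by (cases "i \<in> V \<and> j \<in> V") (use q z in auto)
  next
    case (7 i j) show ?case by (cases "i \<in> V \<and> j \<in> V") (use q z in auto)
  next
    case (8 i j) show ?case by (cases "i \<in> V \<and> j \<in> V") (use q z in auto)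
  next
    case (9 i j) show ?case by (cases "i \<in> V \<and> j \<in> V") (use q z in auto)
  next
    case (10 i j) show ?case by (cases "i \<in> V \<and> j \<in> V") (use q z in auto)
  next
    case (11 i j) show ?case by (cases "i \<in> V \<and> j \<in> V") (use q z in auto)
  next
    case (12 i j)
    show ?case
    proof (cases "i \<in> V \<and> j \<in> V")
      case False
      then have "h (E i) = 0 \<or> h (E j) = 0" using z by blast
      then show ?thesis using S[OF 12] unfolding comp_def by blast
    qed (use q 12 m in \<open>auto simp: comp_def\<close>)
  next
    case (13 i j)
    show ?case
    proof (cases "i \<in> V \<and> j \<in> V")
      case False
      then have "h (F i) = 0 \<or> h (F j) = 0" using z by blast
      then show ?thesis using S[OF 13] unfolding comp_def by blast
    qed (use q 13 m in \<open>auto simp: comp_def\<close>)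
  qed
  show "itype.B lscale \<tau> s (h \<circ> E) (h \<circ> F) (h \<circ> K') i = h (B i)"
    unfolding itype.B_def[OF it] itype.X_def[OF it] by (simp add: B_def)
  show "itype.kt lscale \<tau> s (h \<circ> K) (h \<circ> K') i = h (k i)"
    unfolding itype.kt_def[OF it] by (simp add: k_def)
qed

definition h0 :: "'a \<Rightarrow> ('a, rat poly fract) lend" where
  "h0 = (SOME h. lend.alg_rep A h \<and> inj_on h (carrier A))"

lemma h0: "lend.alg_rep A h0" "inj_on h0 (carrier A)"
  using someI_ex[OF kalg_faithful_rep[OF kalg_axioms]] unfolding h0_def by blast+

lemma h0_eqI: "a \<in> carrier A \<Longrightarrow> b \<in> carrier A \<Longrightarrow> h0 a = h0 b \<Longrightarrow> a = b"
  using h0(2) by (rule inj_onD)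

sublocale r0: represented_algebra lscale A h0
  by unfold_locales (rule h0)

lemma k_commute: "k i \<otimes> k j = k j \<otimes> k i"
proof (rule h0_eqI)
  interpret i: itype lscale "cartan Q" \<tau> s "h0 \<circ> E" "h0 \<circ> F" "h0 \<circ> K" "h0 \<circ> K'"
    by (rule itype_of_rep[OF h0(1)])
  show "h0 (k i \<otimes> k j) = h0 (k j \<otimes> k i)"
    using i.kt_kt[of i j] by (simp add: itype_of_rep(3)[OF h0(1)])
qed auto

lemma k_unit: assumes "i \<in> V" shows "k i \<in> Units A"
proof -
  let ?j = "inverse (s (\<tau> i)) \<odot> (K'i (\<tau> i) \<otimes> Ki i)"
  have t: "\<tau> i \<in> V" "s (\<tau> i) \<noteq> 0" using assms tau_verts s_nz by auto
  note c = closed_inv(1)[OF assms] closed_inv(2)[OF t(1)] and i = invs[OF assms] invs[OF t(1)]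
  have sm: "(a \<odot> u) \<otimes> (b \<odot> v) = (a * b) \<odot> (u \<otimes> v)" if "u \<in> carrier A" "v \<in> carrier A" for a b u v
    using that by (simp add: smult_assoc1[symmetric] smult_assoc2 smult_assoc3 mult.commute)
  have "K i \<otimes> K' (\<tau> i) \<otimes> (K'i (\<tau> i) \<otimes> Ki i) = K i \<otimes> ((K' (\<tau> i) \<otimes> K'i (\<tau> i)) \<otimes> Ki i)" using c by (simp add: m_assoc)
  also have "\<dots> = \<one>" using i c by simp
  finally have 1: "K i \<otimes> K' (\<tau> i) \<otimes> (K'i (\<tau> i) \<otimes> Ki i) = \<one>" .
  have "K'i (\<tau> i) \<otimes> Ki i \<otimes> (K i \<otimes> K' (\<tau> i)) = K'i (\<tau> i) \<otimes> ((Ki i \<otimes> K i) \<otimes> K' (\<tau> i))" using c by (simp add: m_assoc)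
  also have "\<dots> = \<one>" using i c by simp
  finally have 2: "K'i (\<tau> i) \<otimes> Ki i \<otimes> (K i \<otimes> K' (\<tau> i)) = \<one>" .
  show ?thesis
    unfolding Units_def k_def using t c 1 2 by (auto simp: sm intro!: bexI[of _ ?j])
qed

definition tor :: "('i \<Rightarrow>\<^sub>0 int) \<Rightarrow> 'a" where
  "tor = (SOME t. (\<forall>n. t n \<in> carrier A) \<and> (\<forall>n p. t (n + p) = t n \<otimes> t p) \<and> t 0 = \<one>
     \<and> (\<forall>i. t (frag_of i) = (if i \<in> V then k i else \<one>)))"

lemma tor: "tor n \<in> carrier A" "tor (n + p) = tor n \<otimes> tor p" "tor 0 = \<one>"
  "tor (frag_of i) = (if i \<in> V then k i else \<one>)"
proof -
  have "\<exists>t :: ('i \<Rightarrow>\<^sub>0 int) \<Rightarrow> 'a. (\<forall>n. t n \<in> carrier A) \<and> (\<forall>n p. t (n + p) = t n \<otimes> t p) \<and> t 0 = \<one>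
     \<and> (\<forall>i. t (frag_of i) = (if i \<in> V then k i else \<one>))"
    by (rule commuting_units_hom) (auto simp: k_unit k_commute)
  from someI_ex[OF this]
  show "tor n \<in> carrier A" "tor (n + p) = tor n \<otimes> tor p" "tor 0 = \<one>"
    "tor (frag_of i) = (if i \<in> V then k i else \<one>)"
    unfolding tor_def[symmetric] by blast+
qed

declare tor(1) [simp]

lemma tor_neg: "tor n \<otimes> tor (- n) = \<one>" "tor (- n) \<otimes> tor n = \<one>"
  unfolding tor(2)[symmetric] by (simp_all add: tor(3))

lemma ireal_of_rep:
  assumes "lend.alg_rep A h"
  shows "ireal lscale (cartan Q) \<tau> s (h \<circ> E) (h \<circ> F) (h \<circ> K) (h \<circ> K') V (h \<circ> tor)"
proof -
  interpret i: itype lscale "cartan Q" \<tau> s "h \<circ> E" "h \<circ> F" "h \<circ> K" "h \<circ> K'"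
    by (rule itype_of_rep[OF assms])
  interpret idata "cartan Q" \<tau> V by unfold_locales
  interpret r: represented_algebra lscale A h
    by unfold_locales (rule assms)
  note iB = itype_of_rep(2)[OF assms] and ik = itype_of_rep(3)[OF assms]
  show ?thesis
  proof (unfold_locales, unfold iB ik, unfold comp_def)
    show "i \<notin> V \<Longrightarrow> h (B i) = 0" for i by (simp add: B_def out)
    show "h (tor (n + p)) = h (tor n) * h (tor p)" for n p by (simp add: tor)
    show "i \<in> V \<Longrightarrow> h (tor (frag_of i)) = h (k i)" for i by (simp add: tor)
    show "h (tor 0) * h (B i) = h (B i)" for i by (simp add: tor)
    fix n i
    show "h (tor n) * h (B i) = lscale (qv powi tw n i) (h (B i) * h (tor n))"
      using subset_UNIV
    proof (induction n rule: frag_induction)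
      case zero
      then show ?case by (simp add: tor)
    next
      case (one j)
      show ?case
      proof (cases "j \<in> V")
        case True
        then show ?thesis using i.kt_B[of j i] by (simp add: tor iB ik)
      next
        case False
        then show ?thesis by (simp add: tor tau_out)
      qed
    next
      case (diff a b)
      let ?t = "\<lambda>n. h (tor n)" and ?B = "h (B i)"
      have n: "?t (- b) * ?t b = h \<one>" "?t b * ?t (- b) = h \<one>"
        by (simp_all add: r.rep_mult[symmetric] tor_neg del: r.rep_mult)
      have "?t (- b) * (?t b * ?B) * ?t (- b) = ?t (- b) * lscale (qv powi tw b i) (?B * ?t b) * ?t (- b)"
        unfolding diff ..
      also have "?t (- b) * (?t b * ?B) * ?t (- b) = (?t (- b) * ?t b) * (?B * ?t (- b))" by (simp add: mult.assoc)
      also have "?t (- b) * lscale (qv powi tw b i) (?B * ?t b) * ?t (- b) = lscale (qv powi tw b i) (?t (- b) * (?B * (?t b * ?t (- b))))"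
        by (simp add: lend.scl_nf)
      finally have e: "?B * ?t (- b) = lscale (qv powi tw b i) (?t (- b) * ?B)"
        unfolding n by (simp add: mult.assoc[symmetric])
      have "tor (a - b) = tor (- b) \<otimes> tor a" using tor(2)[of "- b" a] by simp
      then have d: "?t (a - b) = ?t (- b) * ?t a" by simp
      have "?B * ?t (a - b) = (?B * ?t (- b)) * ?t a" unfolding d by (simp add: mult.assoc)
      also have "\<dots> = lscale (qv powi tw b i) (?t (- b) * (?B * ?t a))"
        unfolding e by (simp add: lend.scl_nf)
      finally have "lscale (qv powi (tw a i - tw b i)) (?B * ?t (a - b)) = ?t (- b) * lscale (qv powi tw a i) (?B * ?t a)"
        by (simp add: lend.scl_nf power_int_add[symmetric])
      also have "\<dots> = ?t (a - b) * ?B"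
        unfolding diff(1)[symmetric] d by (simp add: mult.assoc)
      finally show ?case by simp
    qed
  qed
qed

definition evA :: "(('i list \<times> ('i \<Rightarrow>\<^sub>0 int)) \<Rightarrow>\<^sub>0 rat poly fract) \<Rightarrow> 'a" where
  "evA v = (\<Oplus>z\<in>Poly_Mapping.keys v. Poly_Mapping.lookup v z \<odot> foldr (\<lambda>i w. B i \<otimes> w) (fst z) (tor (snd z)))"

lemma word_closed: "foldr (\<lambda>i w. B i \<otimes> w) J (tor n) \<in> carrier A"
  by (induction J) auto

lemma evA_closed [simp]: "evA v \<in> carrier A"
  unfolding evA_def by (intro finsum_closed) (auto simp: word_closed)

lemma rep_evA:
  assumes "lend.alg_rep A h" shows "h (evA v) = lend.iev (h \<circ> B) (h \<circ> tor) v"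
proof -
  interpret r: represented_algebra lscale A h
    by unfold_locales (rule assms)
  have w: "h (foldr (\<lambda>i w. B i \<otimes> w) J (tor n)) = lend.word_rep (h \<circ> B) (h (tor n)) J" for J n
    by (induction J) (simp_all add: word_closed)
  show ?thesis
    unfolding evA_def lend.iev_def lend.lin_def
    by (subst r.rep_finsum) (auto simp: word_closed w split_beta)
qed

sublocale i0: ireal lscale "cartan Q" \<tau> s "h0 \<circ> E" "h0 \<circ> F" "h0 \<circ> K" "h0 \<circ> K'" V "h0 \<circ> tor"
  by (rule ireal_of_rep[OF h0(1)])

lemma h0_evA: "h0 (evA v) = i0.ev v"
proof -
  have "h0 \<circ> B = i0.B" using itype_of_rep(2)[OF h0(1)] by (simp add: fun_eq_iff)
  then show ?thesis by (simp add: rep_evA[OF h0(1)])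
qed

lemma evA_add: "evA (a + b) = evA a \<oplus> evA b"
  and evA_scale: "evA (pscale d a) = d \<odot> evA a" and evA_zero: "evA 0 = \<zero>"
  by (rule h0_eqI; simp add: h0_evA i0.ev_add i0.ev_scale i0.ev_zero)+

lemma evA_eq_0: "evA v = \<zero> \<longleftrightarrow> i0.ev v = 0"
  using h0_eqI[of "evA v" \<zero>] by (auto simp: h0_evA[symmetric])

lemma evA_torus: "evA (Poly_Mapping.single ([], n) a) = a \<odot> tor n"
  and evA_B: "evA (Poly_Mapping.single ([i], 0) 1) = B i"
  by (rule h0_eqI; simp add: h0_evA itype_of_rep[OF h0(1)] tor)+

text \<open>
  The product on words that corresponds to multiplication after evaluation. It involves neither the
  algebra nor the scalars \<open>s\<close>.
\<close>

definition imult :: "(('i list \<times> ('i \<Rightarrow>\<^sub>0 int)) \<Rightarrow>\<^sub>0 rat poly fract) \<Rightarrow> _ \<Rightarrow> _" where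
  "imult u v = pm.lin (\<lambda>(J, n). i0.wrap [] J n u) v"

lemma evA_mult: "evA (imult u v) = evA u \<otimes> evA v"
proof (rule h0_eqI)
  have "i0.ev (imult u v) = lend.lin (\<lambda>z. i0.ev (case z of (J, n) \<Rightarrow> i0.wrap [] J n u)) v"
    unfolding imult_def by (rule linear_lin_comp[OF i0.linear_ev])
  also have "\<dots> = lend.lin (\<lambda>z. i0.ev u * (case z of (J, n) \<Rightarrow> lend.word_rep i0.B ((h0 \<circ> tor) n) J)) v"
    by (rule lend.lin_cong) (use i0.t0_ev in \<open>auto simp: i0.ev_wrap\<close>)
  also have "\<dots> = i0.ev u * i0.ev v"
    by (simp add: lend.iev_def lend.lin_def sum_distrib_left lend.scl_mult_right split_beta)
  finally show "h0 (evA (imult u v)) = h0 (evA u \<otimes> evA v)" by (simp add: h0_evA)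
qed auto

text \<open>
  On the Verma module the torus element \<open>n\<close> acts as a shift by \<open>\<theta> n\<close>, scaled by \<open>sca n\<close>.
\<close>

definition \<theta> where "\<theta> = frag_extend (\<lambda>i. if i \<in> V then x i + y (\<tau> i) else 0)"
definition sca where "sca = torus_char (\<lambda>i. if i \<in> V then s (\<tau> i) else 1)"

lemma sca_gen_nz: "(if i \<in> V then s (\<tau> i) else 1) \<noteq> 0"
  using s_nz tau_verts by simp

lemma sca_nz: "sca n \<noteq> 0" and sca_diff: "sca (n - p) = sca n / sca p"
  and sca_add: "sca (n + p) = sca n * sca p"
  unfolding sca_def by (rule torus_char_nonzero torus_char_diff torus_char_add, rule sca_gen_nz)+

lemma g_tor: "\<exists>\<chi>. g (tor n) = lscale (sca n) (P * vT \<chi> (\<theta> n))"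
proof -
  interpret r: represented_algebra lscale A g
    by unfold_locales (rule g_rep)
  note PP = P_mult[OF Nops(5)]
  show ?thesis
    using subset_UNIV
  proof (induction n rule: frag_induction)
    case zero
    have "P * vT (\<lambda>_. 0) 0 = P" by (simp add: vT_0)
    then show ?case by (intro exI[of _ "\<lambda>_. 0"]) (simp add: tor g_one \<theta>_def sca_def)
  next
    case (one i)
    show ?case
    proof (cases "i \<in> V")
      case True
      then have "g (tor (frag_of i)) = lscale (s (\<tau> i)) (P * (vK i * vK' (\<tau> i)))"
        using tau_verts by (simp add: tor k_def g_gen P_mult[OF Nops(3)])
      moreover have "\<exists>\<chi>. vK i * vK' (\<tau> i) = vT \<chi> (x i + y (\<tau> i))"
        by (auto simp: vK_def vK'_def vT_mult)
      ultimately show ?thesis using True by (auto simp: \<theta>_def sca_def)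
    next
      case False
      have "P * vT (\<lambda>_. 0) 0 = P" by (simp add: vT_0)
      then show ?thesis using False by (intro exI[of _ "\<lambda>_. 0"]) (simp add: tor g_one \<theta>_def sca_def)
    qed
  next
    case (diff a b)
    then obtain \<chi>a \<chi>b where ab: "g (tor a) = lscale (sca a) (P * vT \<chi>a (\<theta> a))" "g (tor b) = lscale (sca b) (P * vT \<chi>b (\<theta> b))" by blast
    define w where "w = lscale (1 / sca b) (P * vT (\<lambda>j. - \<chi>b j) (- \<theta> b))"
    have "g (tor b) * w = P"
      using sca_nz by (simp add: ab w_def lend.scl_mult_left lend.scl_mult_right PP vT_mult vT_0)
    then have "g (tor (- b)) * P = g (tor (- b)) * (g (tor b) * w)" by simp
    also have "\<dots> = g (tor (- b) \<otimes> tor b) * w" by (simp add: mult.assoc)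
    also have "\<dots> = w" unfolding tor_neg g_one w_def by (simp add: lend.scl_mult_right mult.assoc[symmetric] P_P)
    finally have w: "g (tor (- b)) = w" using r.rep_one_r[of "tor (- b)"] by (simp add: g_one)
    have "g (tor (a - b)) = g (tor a) * g (tor (- b))" using tor(2)[of a "- b"] by simp
    also have "\<dots> = lscale (sca (a - b)) (P * vT (\<lambda>j. \<chi>a j - \<chi>b j) (\<theta> (a - b)))"
      unfolding w w_def ab by (simp add: lend.scl_mult_left lend.scl_mult_right PP vT_mult sca_diff \<theta>_def frag_extend_diff)
    finally show ?case by blast
  qed
qed

text \<open>
  The relations \<open>t\<^sub>n = (sca n / sca n') t\<^sub>n\<^sub>'\<close> between torus elements that the Verma module cannot
  distinguish up to scalars.
\<close>

definition torus_rels :: "(('i list \<times> ('i \<Rightarrow>\<^sub>0 int)) \<Rightarrow>\<^sub>0 rat poly fract) set" where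
  "torus_rels = {Poly_Mapping.single (J, n) 1 - Poly_Mapping.single (J, n') (sca n / sca n') | J n n'. \<theta> n = \<theta> n'}"

text \<open>
  By induction on the length of the longest words. If a combination evaluates to zero, its longest
  words form, after a choice of one torus index in each fibre of \<open>\<theta>\<close>, an element of the Serre ideal.
  Modulo the relations they may be replaced by shorter words, and the induction hypothesis applies to
  the result, which still evaluates to zero.
\<close>

theorem evA_kernel:
  assumes ker: "\<And>d. \<theta> d = 0 \<Longrightarrow> tor d = sca d \<odot> \<one>"
  shows "evA v = \<zero> \<longleftrightarrow> v \<in> pm.span (i0.irels \<union> torus_rels)"
proof -
  let ?M = "pm.span (i0.irels \<union> torus_rels)"
  have M: "pm.subspace ?M" by simp
  have sound: "i0.ev v = 0" if "v \<in> ?M" for v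
    using that
  proof (induction rule: pm.span_induct_alt)
    case (step d u w)
    have "i0.ev u = 0"
      using step(1)
    proof
      assume "u \<in> torus_rels"
      then obtain J n n' where u: "u = Poly_Mapping.single (J, n) 1 - Poly_Mapping.single (J, n') (sca n / sca n')" "\<theta> n = \<theta> n'"
        by (auto simp: torus_rels_def)
      then have "\<theta> (n - n') = 0" by (simp add: \<theta>_def frag_extend_diff)
      from ker[OF this] have "tor n = sca (n - n') \<odot> tor n'"
        using tor(2)[of "n - n'" n'] by (simp add: smult_assoc2)
      then have "h0 (tor n) = lscale (sca n / sca n') (h0 (tor n'))" by (simp add: sca_diff)
      moreover have "lend.word_rep b (lscale a z) J = lscale a (lend.word_rep b z J)" for a b and z :: "('a, rat poly fract) lend"
        by (induction J) (simp_all add: lend.scl_mult_right)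
      ultimately show ?thesis by (simp add: u i0.ev_diff)
    qed (rule i0.ev_irels)
    then show ?case by (simp only: i0.ev_add i0.ev_scale step lend.scale_zero_right add_0)
  qed (rule i0.ev_zero)
  have "v \<in> ?M" if "v \<in> shorter l" "i0.ev v = 0" for v l
    using that
  proof (induction l arbitrary: v)
    case 0
    then show ?case using pm.subspace_0[OF M] by (simp add: shorter_0)
  next
    case (Suc l)
    \<comment> \<open>one torus index is chosen in each fibre of \<open>\<theta>\<close>\<close>
    define sec where "sec = inv_into UNIV \<theta>"
    have sec: "\<theta> (sec (\<theta> n)) = \<theta> n" for n unfolding sec_def by (simp add: f_inv_into_f)
    define u where "u = pm.lin (\<lambda>(J, n). if length J = l \<and> set J \<subseteq> V then Poly_Mapping.single (J, sec (\<theta> n)) (sca n / sca (sec (\<theta> n))) else 0) v"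
    have "u \<in> vN"
    proof -
      have b: "(g \<circ> B) i = (if i \<in> V then P * (vF i + lscale (s i) (vE (\<tau> i) * vK' i)) else 0)" for i
      proof -
        interpret r: represented_algebra lscale A g
          by unfold_locales (rule g_rep)
        show ?thesis
        proof (cases "i \<in> V")
          case True
          then show ?thesis using tau_verts
            by (simp add: B_def g_gen P_mult[OF Nops(2)] distrib_left lend.scl_mult_right)
        qed (simp add: B_def out)
      qed
      have "evA v = \<zero>" using Suc.prems(2) evA_eq_0 by blast
      moreover have "g \<zero> = 0"
        using g_rep kalg_axioms lend.scalar_ring_axioms
        by (intro represented_algebra.rep_zero[of lscale]) (auto simp: represented_algebra_def represented_algebra_axioms_def)
      ultimately have "lend.iev (g \<circ> B) (g \<circ> tor) v = 0"
        using rep_evA[OF g_rep, of v] by simp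
      from leading_term[OF b _ Suc.prems(1) this, of sca \<theta>] g_tor
      have lead: "pm.lin (\<lambda>(J, n). if length J = l \<and> set J \<subseteq> V then Poly_Mapping.single (J, \<theta> n) (sca n) else 0) v \<in> vN"
        by simp
      \<comment> \<open>back from the torus of the Verma module to exponents, correcting the scalars\<close>
      define \<psi> where "\<psi> = pm.lin (\<lambda>(J :: 'i list, q). Poly_Mapping.single (J, sec q) (1 / sca (sec q)))"
      have lin: "Vector_Spaces.linear pscale pscale \<psi>" unfolding \<psi>_def by (rule pm.linear_lin)
      interpret \<psi>: Vector_Spaces.linear pscale pscale \<psi> by (rule lin)
      have \<psi>s: "\<psi> (Poly_Mapping.single (J, q) a) = Poly_Mapping.single (J, sec q) (a / sca (sec q))" for J q a
        by (simp add: \<psi>_def)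
      have eq: "\<psi> (pm.lin (\<lambda>(J, n). if length J = l \<and> set J \<subseteq> V then Poly_Mapping.single (J, \<theta> n) (sca n) else 0) v) = u"
        unfolding u_def by (subst linear_lin_comp[OF lin], rule pm.lin_cong) (auto simp: \<psi>s \<psi>.zero)
      have img: "\<psi> w \<in> vN" if "w \<in> vN" for w
      proof (rule vN_image[OF lin subspace_vN _ that])
        fix J J' :: "'i list" and i j :: 'i and q :: "'j \<Rightarrow>\<^sub>0 int" assume ij: "i \<noteq> j"
        have "\<psi> (serre_word J i j J' q) = pscale (1 / sca (sec q)) (serre_word J i j J' (sec q))"
          unfolding serre_word_def \<psi>.sum \<psi>s pm.scale_sum_right pscale_single
          by (intro sum.cong refl arg_cong[of _ _ "Poly_Mapping.single _"]) simp
        then show "\<psi> (serre_word J i j J' q) \<in> vN"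
          by (simp only: pm.subspace_scale[OF subspace_vN serre_word_vN[OF ij]])
      qed
      show ?thesis using img[OF lead] unfolding eq .
    qed
    then obtain v' where v': "v' \<in> shorter l" "top_part V l u - v' \<in> i0.irels"
      using i0.vN_reduce by blast
    have top: "top_part V l u = u"
      unfolding u_def
    proof (subst linear_lin_comp[OF linear_top_part], rule pm.lin_cong)
      interpret T: Vector_Spaces.linear pscale pscale "top_part V l :: (('i list \<times> ('i \<Rightarrow>\<^sub>0 int)) \<Rightarrow>\<^sub>0 rat poly fract) \<Rightarrow> _" by (rule linear_top_part)
      fix z :: "'i list \<times> ('i \<Rightarrow>\<^sub>0 int)"
      show "top_part V l (case z of (J, n) \<Rightarrow> if length J = l \<and> set J \<subseteq> V then Poly_Mapping.single (J, sec (\<theta> n)) (sca n / sca (sec (\<theta> n))) else 0)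
        = (case z of (J, n) \<Rightarrow> if length J = l \<and> set J \<subseteq> V then Poly_Mapping.single (J, sec (\<theta> n)) (sca n / sca (sec (\<theta> n))) else 0)"
        by (auto simp: T.zero split: prod.split)
    qed
    have diff: "top_part UNIV l v - u \<in> ?M"
    proof -
      have "top_part UNIV l v - u = top_part UNIV l v + pscale (- 1) u" by simp
      also have "\<dots> = pm.lin (\<lambda>z. (case z of (J, n) \<Rightarrow> if length J = l \<and> set J \<subseteq> UNIV then Poly_Mapping.single (J, n) 1 else 0) + pscale (- 1)
          (case z of (J, n) \<Rightarrow> if length J = l \<and> set J \<subseteq> V then Poly_Mapping.single (J, sec (\<theta> n)) (sca n / sca (sec (\<theta> n))) else 0)) v"
        unfolding pm.lin_fun_add pm.lin_fun_scale top_part_def u_def ..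
      also have "\<dots> \<in> ?M"
      proof (rule lin_mem[OF M], clarify)
        fix J n
        have 1: "Poly_Mapping.single (J, n) 1 - Poly_Mapping.single (J, sec (\<theta> n)) (sca n / sca (sec (\<theta> n))) \<in> ?M"
          by (rule pm.span_base, rule UnI2, unfold torus_rels_def mem_Collect_eq) (intro exI conjI, rule refl, rule sec[symmetric])
        have 2: "Poly_Mapping.single (J, n) 1 \<in> ?M" if "\<not> set J \<subseteq> V"
          by (rule pm.span_base) (use i0.irels_outside[OF that] in blast)
        show "(if length J = l \<and> set J \<subseteq> UNIV then Poly_Mapping.single (J, n) 1 else 0) + pscale (- 1)
          (if length J = l \<and> set J \<subseteq> V then Poly_Mapping.single (J, sec (\<theta> n)) (sca n / sca (sec (\<theta> n))) else 0) \<in> ?M"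
          using 1 2 pm.subspace_0[OF M] by auto
      qed
      finally show ?thesis .
    qed
    \<comment> \<open>the remainder of \<open>v\<close> after rewriting its longest words\<close>
    define r where "r = (v - top_part UNIV l v) + v'"
    have r: "r \<in> shorter l"
      unfolding r_def by (intro pm.subspace_add[OF subspace_shorter] top_part_rest Suc.prems v')
    have "v - r = (top_part UNIV l v - u) + (top_part V l u - v')" unfolding top by (simp add: r_def)
    also have "\<dots> \<in> ?M"
      using diff v'(2) by (intro pm.subspace_add[OF M]) (auto intro: pm.span_base)
    finally have vr: "v - r \<in> ?M" .
    have "i0.ev v - i0.ev r = 0" using sound[OF vr] by (simp add: i0.ev_diff)
    then have "i0.ev r = 0" using Suc.prems(2) by simp
    then have "r \<in> ?M" using Suc.IH r by blast
    then have "(v - r) + r \<in> ?M" using vr by (intro pm.subspace_add[OF M])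
    then show ?case by simp
  qed
  moreover have "v \<in> shorter (Suc (Max (insert 0 ((length \<circ> fst) ` Poly_Mapping.keys v))))"
    by (auto simp: shorter_def less_Suc_eq_le intro!: Max_ge)
  ultimately show ?thesis using sound evA_eq_0 by blast
qed

end

section \<open>Specialising the parameters\<close>

context kalg
begin

lemma scalar_factor:
  assumes "u \<in> carrier A" "u \<otimes> (\<beta> \<odot> \<one>) = \<alpha> \<odot> \<one>" "\<beta> \<noteq> 0"
  shows "u = (\<alpha> / \<beta>) \<odot> \<one>"
proof -
  have "\<beta> \<odot> u = \<alpha> \<odot> \<one>" using assms by (simp add: smult_assoc3)
  then have "inverse \<beta> \<odot> (\<beta> \<odot> u) = inverse \<beta> \<odot> (\<alpha> \<odot> \<one>)" by simp
  then show ?thesis using assms by (simp add: smult_assoc1[symmetric] divide_inverse mult.commute)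
qed

lemma kalg_subalg:
  assumes "subalg T A" shows "kalg (A\<lparr>carrier := T\<rparr>)"
proof -
  have T: "subring T A" "\<And>d x. x \<in> T \<Longrightarrow> d \<odot> x \<in> T" using assms by (auto simp: subalg_def)
  have sub: "x \<in> T \<Longrightarrow> x \<in> carrier A" for x using subringE(1)[OF T(1)] by blast
  show ?thesis
    by (rule kalg.intro[OF subring_is_ring[OF T(1)]], unfold_locales)
      (auto simp: sub T(2) smult_l_distr smult_r_distr smult_assoc1 smult_assoc2 smult_assoc3)
qed

lemma generated_subalg_eq:
  assumes "subalg T A" "S \<subseteq> T" "\<And>T'. subalg T' A \<Longrightarrow> S \<subseteq> T' \<Longrightarrow> T \<subseteq> T'"
  shows "generated_subalg A S = A\<lparr>carrier := T\<rparr>"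
proof -
  have "\<Inter>{T. subalg T A \<and> S \<subseteq> T} = T" using assms by blast
  then show ?thesis by (simp add: generated_subalg_def)
qed

end

text \<open>
  The \<open>\<tau>\<close>-invariant exponents form the group generated by the exponents in the last two cases,
  which are those of the generators of the specialisation ideal.
\<close>

lemma tau_invariant_induct [case_names tau_tau tau_V invariant zero diff fixed swapped]:
  fixes d :: "'i \<Rightarrow>\<^sub>0 int"
  assumes tau: "\<And>i. \<tau> (\<tau> i) = i" "\<And>i. \<tau> i \<in> V \<longleftrightarrow> i \<in> V"
    and d: "\<And>i. i \<in> V \<Longrightarrow> Poly_Mapping.lookup d i = Poly_Mapping.lookup d (\<tau> i)"
    and P0: "P 0" and Pdiff: "\<And>a b. P a \<Longrightarrow> P b \<Longrightarrow> P (a - b)"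
    and P1: "\<And>i. i \<notin> V \<or> \<tau> i = i \<Longrightarrow> P (frag_of i)"
    and P2: "\<And>i. i \<in> V \<Longrightarrow> \<tau> i \<noteq> i \<Longrightarrow> P (frag_of i + frag_of (\<tau> i))"
  shows "P d"
  using d
proof (induction "card (Poly_Mapping.keys d)" arbitrary: d rule: less_induct)
  case less
  show ?case
  proof (cases "d = 0")
    case False
    then obtain i where i: "i \<in> Poly_Mapping.keys d" using keys_eq_empty[of d] by blast
    define w where "w = frag_cmul (Poly_Mapping.lookup d i) (if i \<notin> V \<or> \<tau> i = i then frag_of i else frag_of i + frag_of (\<tau> i))"
    have w: "P w"
      unfolding w_def by (rule frag_closure_minus_cmul[of P]) (use P0 Pdiff P1 P2 in auto)
    have lw: "Poly_Mapping.lookup w j = (if j = i \<or> j = \<tau> i \<and> i \<in> V then Poly_Mapping.lookup d i else 0)" for j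
      by (auto simp: w_def lookup_add)
    have inv: "Poly_Mapping.lookup (d - w) j = Poly_Mapping.lookup (d - w) (\<tau> j)" if "j \<in> V" for j
    proof -
      have "j = \<tau> i \<longleftrightarrow> \<tau> j = i" "\<tau> j = \<tau> i \<longleftrightarrow> j = i" using tau(1) by metis+
      moreover have "i \<in> V" if "j = i \<or> j = \<tau> i" using that \<open>j \<in> V\<close> tau(2) by auto
      ultimately show ?thesis using less.prems[OF that] by (auto simp: lookup_minus lw)
    qed
    have "Poly_Mapping.lookup d (\<tau> i) = Poly_Mapping.lookup d i" if "i \<in> V" using less.prems[OF that] by simp
    then have "j \<in> Poly_Mapping.keys d \<and> j \<noteq> i" if "j \<in> Poly_Mapping.keys (d - w)" for j
      using that by (auto simp: in_keys_iff lookup_minus lw split: if_splits)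
    then have "Poly_Mapping.keys (d - w) \<subset> Poly_Mapping.keys d" using i by blast
    then have "P (d - w)"
      by (intro less.hyps inv psubset_card_mono) auto
    from Pdiff[OF this Pdiff[OF P0 w]] show ?thesis by simp
  qed (simp add: P0)
qed

context iquantum
begin

lemma tor_scalar_diff:
  assumes "tor a = sca a \<odot> \<one>" "tor b = sca b \<odot> \<one>" shows "tor (a - b) = sca (a - b) \<odot> \<one>"
proof -
  have "tor (a - b) \<otimes> tor b = tor a" using tor(2)[of "a - b" b] by simp
  then show ?thesis unfolding assms sca_diff using sca_nz by (intro scalar_factor) auto
qed

lemma tor_scalar_outside:
  assumes "Poly_Mapping.keys d \<subseteq> - V" shows "tor d = sca d \<odot> \<one>"
  using assms
proof (induction d rule: frag_induction)
  case zero show ?case by (simp add: tor sca_def)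
next
  case (one i) then show ?case by (simp add: tor sca_def)
qed (rule tor_scalar_diff)

lemma evA_minus: "evA (a - b) = evA a \<ominus> evA b"
proof (rule h0_eqI)
  have "h0 (evA (a - b)) = h0 (evA a) - h0 (evA b)" unfolding h0_evA by (rule i0.ev_diff)
  then show "h0 (evA (a - b)) = h0 (evA a \<ominus> evA b)" by simp
qed auto

lemma evA_single: "evA (Poly_Mapping.single (J, n) a) = a \<odot> (evA (Poly_Mapping.single (J, 0) 1) \<otimes> tor n)"
proof (rule h0_eqI)
  show "h0 (evA (Poly_Mapping.single (J, n) a)) = h0 (a \<odot> (evA (Poly_Mapping.single (J, 0) 1) \<otimes> tor n))"
    using i0.word_t0[of n J] by (simp add: h0_evA)
qed auto

lemma evA_one: "evA (Poly_Mapping.single ([], 0) 1) = \<one>"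
  by (simp add: evA_torus tor)

lemma subalg_range_evA: "subalg (range evA) A"
  unfolding subalg_def
proof (intro conjI subringI allI ballI)
  show "\<one> \<in> range evA" using evA_one by (metis rangeI)
  show "h \<in> range evA \<Longrightarrow> \<ominus> h \<in> range evA" for h
    by (auto simp: smult_minus_1[symmetric] evA_scale[symmetric])
  show "h \<in> range evA \<Longrightarrow> l \<in> range evA \<Longrightarrow> h \<otimes> l \<in> range evA" for h l
    by (auto simp: evA_mult[symmetric])
  show "h \<in> range evA \<Longrightarrow> l \<in> range evA \<Longrightarrow> h \<oplus> l \<in> range evA" for h l
    by (auto simp: evA_add[symmetric])
  show "h \<in> range evA \<Longrightarrow> d \<odot> h \<in> range evA" for d h
    by (auto simp: evA_scale[symmetric])
qed auto

lemma inv_k: "i \<in> V \<Longrightarrow> inv (k i) = tor (- frag_of i)"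
  using tor_neg[of "frag_of i"] by (intro inv_char) (auto simp: tor(4))

text \<open>
  The inverses \<open>tor (- n)\<close> are carried along in the induction, as subalgebras are not closed under
  inverses.
\<close>

lemma range_evA_minimal:
  assumes "subalg T A" and gens: "\<And>i. i \<in> V \<Longrightarrow> B i \<in> T \<and> k i \<in> T \<and> inv (k i) \<in> T"
  shows "range evA \<subseteq> T"
proof -
  have T: "subring T A" "\<And>d x. x \<in> T \<Longrightarrow> d \<odot> x \<in> T" using assms by (auto simp: subalg_def)
  note TE = subringE[OF T(1)]
  have B: "B i \<in> T" for i using gens TE(2) by (cases "i \<in> V") (auto simp: B_def out)
  have "tor n \<in> T \<and> tor (- n) \<in> T" for n
    using subset_UNIV
  proof (induction n rule: frag_induction)
    case zero show ?case using TE(3) by (simp add: tor)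
  next
    case (one i)
    show ?case
    proof (cases "i \<in> V")
      case True
      then show ?thesis using gens[OF True] inv_k[OF True] by (simp add: tor)
    next
      case False
      then have "tor (frag_of i) = \<one>" by (simp add: tor)
      moreover have "tor (- frag_of i) = \<one>" using tor_neg(2)[of "frag_of i"] False by (simp add: tor(4))
      ultimately show ?thesis using TE(3) by simp
    qed
  next
    case (diff a b)
    then show ?case using tor(2)[of a "- b"] tor(2)[of b "- a"] TE(6) by simp
  qed
  then have "foldr (\<lambda>i w. B i \<otimes> w) J (tor n) \<in> T" for J n
    by (induction J) (use B TE(6) in auto)
  then have w: "d \<odot> foldr (\<lambda>i w. B i \<otimes> w) J (tor n) \<in> T" for J n d using T(2) by blast
  have "finite S \<Longrightarrow> (\<Oplus>z\<in>S. Poly_Mapping.lookup v z \<odot> foldr (\<lambda>i w. B i \<otimes> w) (fst z) (tor (snd z))) \<in> T" for S v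
    by (induction S rule: finite_induct) (use w TE(2,7) word_closed in \<open>auto simp: Pi_def\<close>)
  then show ?thesis by (auto simp: evA_def)
qed

end

lemma quantum_relations_hold:
  assumes "kalg A" "lend.alg_rep A h" "inj_on h (carrier A)"
    and "\<And>i. i \<in> verts Q \<Longrightarrow> e i \<in> carrier A \<and> f i \<in> carrier A \<and> k i \<in> carrier A \<and> k' i \<in> carrier A"
    and "lendq.quantum_system Q (h \<circ> e) (h \<circ> f) (h \<circ> k) (h \<circ> k')"
    and lr: "(l, r) \<in> quantum_relations Q A e f k k'"
  shows "l = r"
proof -
  interpret kalg A by fact
  interpret qrepresented lscale A h by unfold_locales (rule assms(2))
  have "\<forall>(l, r)\<in>quantum_relations Q A e f k k'. h l = h r"
    using assms(5) quantum_relations_iff[of Q e f k k', OF assms(4)] by blast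
  then have "h l = h r" using lr by blast
  then show ?thesis using quantum_relations_closed[OF assms(4) lr] assms(3) by (auto dest: inj_onD)
qed

text \<open>
  Default value \<open>\<zero>\<close>, in accordance with the convention for indices without a vertex.
\<close>

definition zext :: "('i, 'q) pre_digraph \<Rightarrow> ('k, 'a, 'b) module_scheme \<Rightarrow> ('i \<Rightarrow> 'a) \<Rightarrow> 'i \<Rightarrow> 'a" where
  "zext Q A f i = (if i \<in> verts Q then f i else \<zero>\<^bsub>A\<^esub>)"

lemma zext_eq [simp]: "i \<in> verts Q \<Longrightarrow> zext Q A f i = f i" "i \<notin> verts Q \<Longrightarrow> zext Q A f i = \<zero>\<^bsub>A\<^esub>"
  by (simp_all add: zext_def)

locale satake_data =
  fixes Q :: "('i, 'q) pre_digraph" and \<tau> :: "'i \<Rightarrow> 'i" and \<sigma> :: "'i \<Rightarrow> rat poly fract"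
  assumes fin: "fin_digraph Q" and acyc: "acyclic (arcs_ends Q)" and tau: "\<tau> permutes verts Q"
    and tau2: "\<And>i. i \<in> verts Q \<Longrightarrow> \<tau> (\<tau> i) = i"
    and ct: "\<And>i j. i \<in> verts Q \<Longrightarrow> j \<in> verts Q \<Longrightarrow> cartan Q (\<tau> i) (\<tau> j) = cartan Q i j"
    and s_nz: "\<And>i. i \<in> verts Q \<Longrightarrow> \<sigma> i \<noteq> 0"
    and s_tau: "\<And>i. i \<in> verts Q \<Longrightarrow> cartan Q i (\<tau> i) = 0 \<Longrightarrow> \<sigma> i = \<sigma> (\<tau> i)"
begin

text \<open>
  The shifts are left open; for independent \<open>x\<close> and \<open>y\<close> the torus acts faithfully.
\<close>

lemma iquantum_Ut:
  fixes x y :: "'i \<Rightarrow> ('j \<Rightarrow>\<^sub>0 int)"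
  shows "\<exists>P g. iquantum (Ut Q) Q x y P \<tau> (\<lambda>_. 1)
    (zext Q (Ut Q) (\<lambda>i. Ut_gen Q (tE i))) (zext Q (Ut Q) (\<lambda>i. Ut_gen Q (tF i))) (zext Q (Ut Q) (\<lambda>i. Ut_gen Q (tK i))) (zext Q (Ut Q) (\<lambda>i. Ut_gen Q (tK' i)))
    (\<lambda>i. Ut_gen Q (tKinv i)) (\<lambda>i. Ut_gen Q (tK'inv i)) g"
proof -
  interpret D: fin_digraph Q by (rule fin)
  interpret gcm "cartan Q" by (rule gcm_cartan[OF fin acyc])
  interpret verma "cartan Q" x y by unfold_locales
  obtain P :: "('i, 'j \<Rightarrow>\<^sub>0 int) verma" where "verma_quotient (cartan Q) P" using verma_quotient_ex by blast
  then interpret verma_quotient "cartan Q" x y P .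
  obtain g where g: "lend.alg_rep (Ut Q) g" "\<And>i. i \<in> verts Q \<Longrightarrow> g (Ut_gen Q (tE i)) = P * vE i \<and> g (Ut_gen Q (tF i)) = P * vF i
    \<and> g (Ut_gen Q (tK i)) = P * vK i \<and> g (Ut_gen Q (tK' i)) = P * vK' i" "g \<one>\<^bsub>Ut Q\<^esub> = P"
    using verma_Ut_rep[OF refl] by blast
  interpret kalg "Ut Q" by (rule kalg_Ut)
  obtain h :: "_ \<Rightarrow> (('i tgen list \<Rightarrow>\<^sub>0 rat poly fract) set, rat poly fract) lend" where h: "lend.alg_rep (Ut Q) h" "inj_on h (carrier (Ut Q))"
    using kalg_faithful_rep[OF kalg_Ut[of Q]] by blast
  interpret r: represented_algebra lscale "Ut Q" h by unfold_locales (rule h)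
  note d = lendq.Ut_data_of_rep[OF h(1), unfolded lendq.Ut_data_def]
  have "iquantum (Ut Q) Q x y P \<tau> (\<lambda>_. 1)
    (zext Q (Ut Q) (\<lambda>i. Ut_gen Q (tE i))) (zext Q (Ut Q) (\<lambda>i. Ut_gen Q (tF i))) (zext Q (Ut Q) (\<lambda>i. Ut_gen Q (tK i))) (zext Q (Ut Q) (\<lambda>i. Ut_gen Q (tK' i)))
    (\<lambda>i. Ut_gen Q (tKinv i)) (\<lambda>i. Ut_gen Q (tK'inv i)) g"
  proof unfold_locales
    show "l = r" if "(l, r) \<in> quantum_relations Q (Ut Q) (zext Q (Ut Q) (\<lambda>i. Ut_gen Q (tE i))) (zext Q (Ut Q) (\<lambda>i. Ut_gen Q (tF i))) (zext Q (Ut Q) (\<lambda>i. Ut_gen Q (tK i))) (zext Q (Ut Q) (\<lambda>i. Ut_gen Q (tK' i)))" for l r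
    proof (rule quantum_relations_hold[OF kalg_Ut h _ _ that])
      show "lendq.quantum_system Q (h \<circ> zext Q (Ut Q) (\<lambda>i. Ut_gen Q (tE i))) (h \<circ> zext Q (Ut Q) (\<lambda>i. Ut_gen Q (tF i)))
         (h \<circ> zext Q (Ut Q) (\<lambda>i. Ut_gen Q (tK i))) (h \<circ> zext Q (Ut Q) (\<lambda>i. Ut_gen Q (tK' i)))"
        using d unfolding lendq.quantum_system_def by simp
    qed simp
    have e: "a = \<one>\<^bsub>Ut Q\<^esub>" if "a \<in> carrier (Ut Q)" "h a = h \<one>\<^bsub>Ut Q\<^esub>" for a
      using h(2) that by (auto dest: inj_onD)
    show "(zext Q (Ut Q) (\<lambda>i. Ut_gen Q (tK i))) i \<otimes>\<^bsub>Ut Q\<^esub> (\<lambda>i. Ut_gen Q (tKinv i)) i = \<one>\<^bsub>Ut Q\<^esub> \<and> (\<lambda>i. Ut_gen Q (tKinv i)) i \<otimes>\<^bsub>Ut Q\<^esub> (zext Q (Ut Q) (\<lambda>i. Ut_gen Q (tK i))) i = \<one>\<^bsub>Ut Q\<^esub> \<and> (zext Q (Ut Q) (\<lambda>i. Ut_gen Q (tK' i))) i \<otimes>\<^bsub>Ut Q\<^esub> (\<lambda>i. Ut_gen Q (tK'inv i)) i = \<one>\<^bsub>Ut Q\<^esub> \<and> (\<lambda>i. Ut_gen Q (tK'inv i)) i \<otimes>\<^bsub>Ut Q\<^esub> (zext Q (Ut Q) (\<lambda>i. Ut_gen Q (tK' i))) i = \<one>\<^bsub>Ut Q\<^esub>"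 if "i \<in> verts Q" for i
      using that d by (auto intro!: e)
  qed (use fin tau tau2 ct g in \<open>auto simp: zext_def\<close>)
  then show ?thesis by blast
qed

lemma iquantum_Uq:
  fixes x :: "'i \<Rightarrow> ('j \<Rightarrow>\<^sub>0 int)"
  shows "\<exists>P g. iquantum (Uq Q) Q x (\<lambda>i. - x i) P \<tau> \<sigma>
    (zext Q (Uq Q) (\<lambda>i. Uq_gen Q (qE i))) (zext Q (Uq Q) (\<lambda>i. Uq_gen Q (qF i))) (zext Q (Uq Q) (\<lambda>i. Uq_gen Q (qK i))) (zext Q (Uq Q) (\<lambda>i. Uq_gen Q (qKinv i)))
    (\<lambda>i. Uq_gen Q (qKinv i)) (\<lambda>i. Uq_gen Q (qK i)) g"
proof -
  interpret D: fin_digraph Q by (rule fin)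
  interpret gcm "cartan Q" by (rule gcm_cartan[OF fin acyc])
  interpret verma "cartan Q" x "\<lambda>i. - x i" by unfold_locales
  obtain P :: "('i, 'j \<Rightarrow>\<^sub>0 int) verma" where "verma_quotient (cartan Q) P" using verma_quotient_ex by blast
  then interpret verma_quotient "cartan Q" x "\<lambda>i. - x i" P .
  obtain g where g: "lend.alg_rep (Uq Q) g" "\<And>i. i \<in> verts Q \<Longrightarrow> g (Uq_gen Q (qE i)) = P * vE i \<and> g (Uq_gen Q (qF i)) = P * vF i
    \<and> g (Uq_gen Q (qK i)) = P * vK i \<and> g (Uq_gen Q (qKinv i)) = P * vK' i" "g \<one>\<^bsub>Uq Q\<^esub> = P"
    using verma_Uq_rep[OF refl refl] by blast
  interpret kalg "Uq Q" by (rule kalg_Uq)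
  obtain h :: "_ \<Rightarrow> (('i qgen list \<Rightarrow>\<^sub>0 rat poly fract) set, rat poly fract) lend" where h: "lend.alg_rep (Uq Q) h" "inj_on h (carrier (Uq Q))"
    using kalg_faithful_rep[OF kalg_Uq[of Q]] by blast
  interpret r: represented_algebra lscale "Uq Q" h by unfold_locales (rule h)
  note d = lendq.Uq_data_of_rep[OF h(1), unfolded lendq.Uq_data_def]
  have "iquantum (Uq Q) Q x (\<lambda>i. - x i) P \<tau> \<sigma>
    (zext Q (Uq Q) (\<lambda>i. Uq_gen Q (qE i))) (zext Q (Uq Q) (\<lambda>i. Uq_gen Q (qF i))) (zext Q (Uq Q) (\<lambda>i. Uq_gen Q (qK i))) (zext Q (Uq Q) (\<lambda>i. Uq_gen Q (qKinv i)))
    (\<lambda>i. Uq_gen Q (qKinv i)) (\<lambda>i. Uq_gen Q (qK i)) g"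
  proof unfold_locales
    show "l = r" if "(l, r) \<in> quantum_relations Q (Uq Q) (zext Q (Uq Q) (\<lambda>i. Uq_gen Q (qE i))) (zext Q (Uq Q) (\<lambda>i. Uq_gen Q (qF i))) (zext Q (Uq Q) (\<lambda>i. Uq_gen Q (qK i))) (zext Q (Uq Q) (\<lambda>i. Uq_gen Q (qKinv i)))" for l r
    proof (rule quantum_relations_hold[OF kalg_Uq h _ _ that])
      show "lendq.quantum_system Q (h \<circ> zext Q (Uq Q) (\<lambda>i. Uq_gen Q (qE i))) (h \<circ> zext Q (Uq Q) (\<lambda>i. Uq_gen Q (qF i)))
         (h \<circ> zext Q (Uq Q) (\<lambda>i. Uq_gen Q (qK i))) (h \<circ> zext Q (Uq Q) (\<lambda>i. Uq_gen Q (qKinv i)))"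
        using d unfolding lendq.quantum_system_def by simp
    qed simp
    have e: "a = \<one>\<^bsub>Uq Q\<^esub>" if "a \<in> carrier (Uq Q)" "h a = h \<one>\<^bsub>Uq Q\<^esub>" for a
      using h(2) that by (auto dest: inj_onD)
    show "(zext Q (Uq Q) (\<lambda>i. Uq_gen Q (qK i))) i \<otimes>\<^bsub>Uq Q\<^esub> (\<lambda>i. Uq_gen Q (qKinv i)) i = \<one>\<^bsub>Uq Q\<^esub> \<and> (\<lambda>i. Uq_gen Q (qKinv i)) i \<otimes>\<^bsub>Uq Q\<^esub> (zext Q (Uq Q) (\<lambda>i. Uq_gen Q (qK i))) i = \<one>\<^bsub>Uq Q\<^esub> \<and> (zext Q (Uq Q) (\<lambda>i. Uq_gen Q (qKinv i))) i \<otimes>\<^bsub>Uq Q\<^esub> (\<lambda>i. Uq_gen Q (qK i)) i = \<one>\<^bsub>Uq Q\<^esub> \<and> (\<lambda>i. Uq_gen Q (qK i)) i \<otimes>\<^bsub>Uq Q\<^esub> (zext Q (Uq Q) (\<lambda>i. Uq_gen Q (qKinv i))) i = \<one>\<^bsub>Uq Q\<^esub>" if "i \<in> verts Q" for i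
      using that d by (auto intro!: e)
  qed (use fin tau tau2 ct g s_nz s_tau in \<open>auto simp: zext_def\<close>)
  then show ?thesis by blast
qed

end

locale ipair = satake_data Q \<tau> \<sigma> +
  T: iquantum "Ut Q" Q "\<lambda>i. frag_of (Inl i)" "\<lambda>i. frag_of (Inr i)" P \<tau> "\<lambda>_. 1"
    "zext Q (Ut Q) (\<lambda>i. Ut_gen Q (tE i))" "zext Q (Ut Q) (\<lambda>i. Ut_gen Q (tF i))" "zext Q (Ut Q) (\<lambda>i. Ut_gen Q (tK i))" "zext Q (Ut Q) (\<lambda>i. Ut_gen Q (tK' i))"
    "\<lambda>i. Ut_gen Q (tKinv i)" "\<lambda>i. Ut_gen Q (tK'inv i)" g +
  S: iquantum "Uq Q" Q "\<lambda>i. frag_of i" "\<lambda>i. - frag_of i" P' \<tau> \<sigma>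
    "zext Q (Uq Q) (\<lambda>i. Uq_gen Q (qE i))" "zext Q (Uq Q) (\<lambda>i. Uq_gen Q (qF i))" "zext Q (Uq Q) (\<lambda>i. Uq_gen Q (qK i))" "zext Q (Uq Q) (\<lambda>i. Uq_gen Q (qKinv i))"
    "\<lambda>i. Uq_gen Q (qKinv i)" "\<lambda>i. Uq_gen Q (qK i)" g'
  for Q :: "('i, 'q) pre_digraph" and \<tau> \<sigma> P g P' g'
begin

abbreviation "V \<equiv> verts Q"

lemma T_gens:
  assumes "i \<in> V" shows "T.B i = Bti Q \<tau> i" "T.k i = kti Q \<tau> i"
proof -
  have t: "\<tau> i \<in> V" using assms T.tau_verts by simp
  show "T.B i = Bti Q \<tau> i" "T.k i = kti Q \<tau> i"
    unfolding T.B_def T.k_def Bti_def kti_def using assms t by simp_all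
qed

lemma kti_closed: "i \<in> V \<Longrightarrow> kti Q \<tau> i \<in> carrier (Ut Q)"
  unfolding T_gens(2)[symmetric] by simp

lemma S_gens:
  assumes "i \<in> V" shows "S.B i = Bi Q \<tau> \<sigma> i" "S.k i = \<sigma> (\<tau> i) \<odot>\<^bsub>Uq Q\<^esub> ki Q \<tau> i"
proof -
  have t: "\<tau> i \<in> V" using assms T.tau_verts by simp
  show "S.B i = Bi Q \<tau> \<sigma> i" "S.k i = \<sigma> (\<tau> i) \<odot>\<^bsub>Uq Q\<^esub> ki Q \<tau> i"
    unfolding S.B_def S.k_def Bi_def ki_def using assms t by simp_all
qed

lemma ki_closed: "i \<in> V \<Longrightarrow> ki Q \<tau> i \<in> carrier (Uq Q)"
  using T.tau_verts[of i] by (simp add: ki_def)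

lemma ki_eq: "i \<in> V \<Longrightarrow> ki Q \<tau> i = inverse (\<sigma> (\<tau> i)) \<odot>\<^bsub>Uq Q\<^esub> S.k i"
  using s_nz T.tau_verts[of i] ki_closed[of i] by (simp add: S_gens S.smult_assoc1[symmetric])

lemma ki_ki:
  assumes "i \<in> V" shows "ki Q \<tau> i \<otimes>\<^bsub>Uq Q\<^esub> ki Q \<tau> (\<tau> i) = \<one>\<^bsub>Uq Q\<^esub>"
proof -
  have t: "\<tau> i \<in> V" using assms T.tau_verts by simp
  let ?K = "\<lambda>i. Uq_gen Q (qK i)" and ?L = "\<lambda>i. Uq_gen Q (qKinv i)"
  have "?K i \<otimes>\<^bsub>Uq Q\<^esub> ?L (\<tau> i) \<otimes>\<^bsub>Uq Q\<^esub> (?K (\<tau> i) \<otimes>\<^bsub>Uq Q\<^esub> ?L i) =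
     ?K i \<otimes>\<^bsub>Uq Q\<^esub> (?L (\<tau> i) \<otimes>\<^bsub>Uq Q\<^esub> ?K (\<tau> i)) \<otimes>\<^bsub>Uq Q\<^esub> ?L i"
    using assms t by (simp add: S.m_assoc)
  also have "\<dots> = \<one>\<^bsub>Uq Q\<^esub>" using S.invs[OF assms] S.invs[OF t] assms t by simp
  finally show ?thesis by (simp add: ki_def T.tau_tau)
qed

lemma inv_ki: "i \<in> V \<Longrightarrow> inv\<^bsub>Uq Q\<^esub> (ki Q \<tau> i) = ki Q \<tau> (\<tau> i)"
  using ki_ki[of i] ki_ki[of "\<tau> i"] T.tau_verts[of i] ki_closed by (intro S.inv_char) (auto simp: T.tau_tau)

lemma ki_fixed: "i \<in> V \<Longrightarrow> \<tau> i = i \<Longrightarrow> ki Q \<tau> i = \<one>\<^bsub>Uq Q\<^esub>"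
  using S.invs[of i] by (simp add: ki_def)

subsection \<open>The kernels of the two evaluations\<close>

lemma T_kernel: "T.evA v = \<zero>\<^bsub>Ut Q\<^esub> \<longleftrightarrow> v \<in> pm.span (T.i0.irels \<union> T.torus_rels)"
  and T_theta: "Poly_Mapping.lookup (T.\<theta> d) (Inl j) = (if j \<in> V then Poly_Mapping.lookup d j else 0)"
proof -
  show l: "Poly_Mapping.lookup (T.\<theta> d) (Inl j) = (if j \<in> V then Poly_Mapping.lookup d j else 0)" for d j
    using subset_UNIV
    by (induction d rule: frag_induction) (auto simp: T.\<theta>_def frag_extend_diff lookup_minus lookup_add)
  show "T.evA v = \<zero>\<^bsub>Ut Q\<^esub> \<longleftrightarrow> v \<in> pm.span (T.i0.irels \<union> T.torus_rels)"
  proof (rule T.evA_kernel)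
    fix d assume "T.\<theta> d = 0"
    then have "j \<in> V \<Longrightarrow> Poly_Mapping.lookup d j = 0" for j using l[of d j] by simp
    then have "Poly_Mapping.keys d \<subseteq> - V" by (auto simp: in_keys_iff)
    then show "T.tor d = T.sca d \<odot>\<^bsub>Ut Q\<^esub> \<one>\<^bsub>Ut Q\<^esub>" by (rule T.tor_scalar_outside)
  qed
qed

lemma S_theta: "j \<in> V \<Longrightarrow> Poly_Mapping.lookup (S.\<theta> d) j = Poly_Mapping.lookup d j - Poly_Mapping.lookup d (\<tau> j)"
proof -
  assume j: "j \<in> V"
  show ?thesis
    using subset_UNIV
  proof (induction d rule: frag_induction)
    case (one i)
    have e: "\<tau> i = j \<longleftrightarrow> i = \<tau> j" using T.tau_tau[of i] T.tau_tau[of j] by auto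
    have "i \<in> V" if "i = j \<or> i = \<tau> j" using that j T.tau_verts[of j] by auto
    then show ?case by (cases "i \<in> V") (auto simp: S.\<theta>_def lookup_add lookup_minus e)
  qed (auto simp: S.\<theta>_def frag_extend_diff lookup_minus)
qed

lemma sca_fixed: "i \<in> V \<Longrightarrow> S.sca (frag_of i) = \<sigma> (\<tau> i)"
  and sca_swapped: "i \<in> V \<Longrightarrow> S.sca (frag_of i + frag_of (\<tau> i)) = \<sigma> i * \<sigma> (\<tau> i)"
  using T.tau_verts[of i] by (simp_all add: S.sca_add) (simp_all add: S.sca_def T.tau_tau)

lemma S_kernel: "S.evA v = \<zero>\<^bsub>Uq Q\<^esub> \<longleftrightarrow> v \<in> pm.span (T.i0.irels \<union> S.torus_rels)"
proof (rule S.evA_kernel)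
  fix d assume d: "S.\<theta> d = 0"
  show "S.tor d = S.sca d \<odot>\<^bsub>Uq Q\<^esub> \<one>\<^bsub>Uq Q\<^esub>"
  proof (induction d rule: tau_invariant_induct[where \<tau> = \<tau> and V = V])
    case (invariant i) then show ?case using S_theta[of i d] d by simp
  next
    case zero show ?case by (simp add: S.tor S.sca_def)
  next
    case (diff a b) then show ?case by (rule S.tor_scalar_diff)
  next
    case (fixed i)
    show ?case
    proof (cases "i \<in> V")
      case True
      then have "\<tau> i = i" using fixed by simp
      then show ?thesis using True by (simp add: S.tor S_gens ki_fixed sca_fixed)
    qed (simp add: S.tor S.sca_def)
  next
    case (swapped i)
    have t: "\<tau> i \<in> V" using swapped T.tau_verts by simp
    have "S.tor (frag_of i + frag_of (\<tau> i)) = S.k i \<otimes>\<^bsub>Uq Q\<^esub> S.k (\<tau> i)" using swapped t by (simp add: S.tor)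
    also have "\<dots> = (\<sigma> i * \<sigma> (\<tau> i)) \<odot>\<^bsub>Uq Q\<^esub> (ki Q \<tau> i \<otimes>\<^bsub>Uq Q\<^esub> ki Q \<tau> (\<tau> i))"
      using swapped t ki_closed[OF swapped(1)] ki_closed[OF t]
      by (simp add: S_gens T.tau_tau S.smult_assoc1[symmetric] S.smult_assoc2 S.smult_assoc3)
    finally show ?case using ki_ki[OF swapped(1)] sca_swapped[OF swapped(1)] by simp
  qed (simp_all add: T.tau_tau T.tau_verts)
qed

text \<open>
  The relations among words are literally the same in both algebras, and the torus of the larger one
  satisfies only the relations \<open>t\<^sub>i = 1\<close> for indices \<open>i\<close> without a vertex.
\<close>

lemma T_kernel_S: assumes "T.evA v = \<zero>\<^bsub>Ut Q\<^esub>" shows "S.evA v = \<zero>\<^bsub>Uq Q\<^esub>"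
proof -
  have "T.torus_rels \<subseteq> S.torus_rels"
  proof
    fix u assume "u \<in> T.torus_rels"
    then obtain J n n' where u: "u = Poly_Mapping.single (J, n) 1 - Poly_Mapping.single (J, n') (T.sca n / T.sca n')" "T.\<theta> n = T.\<theta> n'"
      by (auto simp: T.torus_rels_def)
    have "T.\<theta> (n - n') = 0" using u(2) by (simp add: T.\<theta>_def frag_extend_diff)
    then have k: "i \<notin> V" if "i \<in> Poly_Mapping.keys (n - n')" for i
      using T_theta[of "n - n'" i] that by (auto simp: in_keys_iff)
    have "S.\<theta> (n - n') = 0" unfolding S.\<theta>_def by (rule frag_extend_eq_0) (use k in simp)
    then have th: "S.\<theta> n = S.\<theta> n'" by (simp add: S.\<theta>_def frag_extend_diff)
    have "S.sca (n - n') = 1" unfolding S.sca_def torus_char_def by (rule prod.neutral) (use k in simp)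
    then have "S.sca n / S.sca n' = 1" unfolding S.sca_diff .
    moreover have "T.sca m = 1" for m by (simp add: T.sca_def torus_char_def)
    ultimately have "u = Poly_Mapping.single (J, n) 1 - Poly_Mapping.single (J, n') (S.sca n / S.sca n')" using u by simp
    then show "u \<in> S.torus_rels" using th unfolding S.torus_rels_def by blast
  qed
  then have "pm.span (T.i0.irels \<union> T.torus_rels) \<subseteq> pm.span (T.i0.irels \<union> S.torus_rels)"
    by (intro pm.span_mono) blast
  then show ?thesis using assms unfolding T_kernel S_kernel by blast
qed

subsection \<open>The subalgebras\<close>

lemma Uit_eq: "Uit Q \<tau> = (Ut Q)\<lparr>carrier := range T.evA\<rparr>"
  unfolding Uit_def
proof (rule T.generated_subalg_eq[OF T.subalg_range_evA])
  show "(\<Union>i\<in>V. {Bti Q \<tau> i, kti Q \<tau> i, inv\<^bsub>Ut Q\<^esub> kti Q \<tau> i}) \<subseteq> range T.evA"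
  proof clarify
    fix x i assume i: "i \<in> V" and x: "x \<in> {Bti Q \<tau> i, kti Q \<tau> i, inv\<^bsub>Ut Q\<^esub> kti Q \<tau> i}"
    have "T.evA (Poly_Mapping.single ([i], 0) 1) = Bti Q \<tau> i" "T.evA (Poly_Mapping.single ([], frag_of i) 1) = kti Q \<tau> i"
      "T.evA (Poly_Mapping.single ([], - frag_of i) 1) = inv\<^bsub>Ut Q\<^esub> kti Q \<tau> i"
      using i T.inv_k[OF i] by (simp_all add: T.evA_B T.evA_torus T.tor(4) T_gens kti_closed)
    from this[symmetric] show "x \<in> range T.evA" using x by auto
  qed
next
  fix T' assume T': "subalg T' (Ut Q)" "(\<Union>i\<in>V. {Bti Q \<tau> i, kti Q \<tau> i, inv\<^bsub>Ut Q\<^esub> kti Q \<tau> i}) \<subseteq> T'"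
  show "range T.evA \<subseteq> T'" by (rule T.range_evA_minimal[OF T'(1)]) (use T'(2) T_gens in auto)
qed

text \<open>
  The subalgebra contains the \<open>k\<^sub>i\<close> for all vertices \<open>i\<close>, not only for those outside \<open>J\<close>: if \<open>i\<close>
  is fixed then \<open>k\<^sub>i = 1\<close>, and otherwise \<open>k\<^sub>i\<close> is inverse to \<open>k\<^sub>\<tau>\<^sub>i\<close>, where \<open>\<tau> i\<close> is outside \<open>J\<close>.
\<close>

lemma Uiq_eq:
  assumes J: "orbit_representatives \<tau> V J" shows "Uiq Q \<tau> J \<sigma> = (Uq Q)\<lparr>carrier := range S.evA\<rparr>"
  unfolding Uiq_def
proof (rule S.generated_subalg_eq[OF S.subalg_range_evA])
  let ?G = "(\<Union>i\<in>V. {Bi Q \<tau> \<sigma> i}) \<union> (\<Union>j\<in>V - J. {ki Q \<tau> j, inv\<^bsub>Uq Q\<^esub> ki Q \<tau> j})"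
  have ev: "S.evA (Poly_Mapping.single ([i], 0) 1) = Bi Q \<tau> \<sigma> i"
    "S.evA (Poly_Mapping.single ([], frag_of i) (inverse (\<sigma> (\<tau> i)))) = ki Q \<tau> i" if "i \<in> V" for i
    using that by (simp_all add: S.evA_B S.evA_torus S.tor(4) S_gens(1) ki_eq)
  show "?G \<subseteq> range S.evA"
  proof
    fix x assume "x \<in> ?G"
    then obtain i where "i \<in> V" "x = Bi Q \<tau> \<sigma> i \<or> x = ki Q \<tau> i \<or> x = ki Q \<tau> (\<tau> i)" using inv_ki by auto
    then show "x \<in> range S.evA"
      using ev[of i, symmetric] ev(2)[of "\<tau> i", symmetric] T.tau_verts[of i] by auto
  qed
  fix T' assume T': "subalg T' (Uq Q)" "?G \<subseteq> T'"
  have sub: "subring T' (Uq Q)" and scal: "\<And>d x. x \<in> T' \<Longrightarrow> d \<odot>\<^bsub>Uq Q\<^esub> x \<in> T'" using T'(1) by (auto simp: subalg_def)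
  have k: "ki Q \<tau> i \<in> T'" if i: "i \<in> V" for i
  proof -
    have t: "\<tau> i \<in> V" using i T.tau_verts by simp
    consider "\<tau> i = i" | "i \<notin> J" | "\<tau> i \<noteq> i" "i \<in> J" by blast
    then show ?thesis
    proof cases
      case 1 then show ?thesis using ki_fixed[OF i] subringE(3)[OF sub] by simp
    next
      case 2 then show ?thesis using T'(2) i by auto
    next
      case 3
      then have "\<tau> i \<notin> J" using J i unfolding orbit_representatives_def by blast
      then have "inv\<^bsub>Uq Q\<^esub> ki Q \<tau> (\<tau> i) \<in> T'" using T'(2) t by auto
      then show ?thesis using inv_ki[OF t] by (simp add: T.tau_tau)
    qed
  qed
  show "range S.evA \<subseteq> T'"
  proof (rule S.range_evA_minimal[OF T'(1)])
    fix i assume i: "i \<in> V"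
    have t: "\<tau> i \<in> V" using i T.tau_verts by simp
    have "\<sigma> (\<tau> i) \<noteq> 0" using s_nz t by simp
    then have "inv\<^bsub>Uq Q\<^esub> (S.k i) = inverse (\<sigma> (\<tau> i)) \<odot>\<^bsub>Uq Q\<^esub> ki Q \<tau> (\<tau> i)"
      using ki_closed[OF i] ki_closed[OF t] ki_ki[OF i] ki_ki[OF t]
      by (intro S.inv_char) (simp_all add: S_gens[OF i] T.tau_tau S.smult_assoc1[symmetric] S.smult_assoc2 S.smult_assoc3)
    then show "S.B i \<in> T' \<and> S.k i \<in> T' \<and> inv\<^bsub>Uq Q\<^esub> (S.k i) \<in> T'"
      using T'(2) i scal[OF k[OF i]] scal[OF k[OF t]] by (auto simp: S_gens)
  qed
qed

subsection \<open>The isomorphism\<close>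

abbreviation "R \<equiv> Uit Q \<tau>"
abbreviation "I \<equiv> specialisation_ideal Q \<tau> \<sigma>"

sublocale R: kalg R
  unfolding Uit_eq by (rule T.kalg_subalg[OF T.subalg_range_evA])

lemma R_simps: "x \<otimes>\<^bsub>R\<^esub> y = x \<otimes>\<^bsub>Ut Q\<^esub> y" "x \<oplus>\<^bsub>R\<^esub> y = x \<oplus>\<^bsub>Ut Q\<^esub> y" "\<one>\<^bsub>R\<^esub> = \<one>\<^bsub>Ut Q\<^esub>" "\<zero>\<^bsub>R\<^esub> = \<zero>\<^bsub>Ut Q\<^esub>"
  "d \<odot>\<^bsub>R\<^esub> x = d \<odot>\<^bsub>Ut Q\<^esub> x" "carrier R = range T.evA"
  by (simp_all add: Uit_eq)

lemma R_minus: "T.evA u \<ominus>\<^bsub>R\<^esub> T.evA v = T.evA (u - v)"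
proof -
  have "T.evA v \<in> carrier R" by (simp add: R_simps)
  then have "T.evA u \<ominus>\<^bsub>R\<^esub> T.evA v = T.evA u \<oplus>\<^bsub>R\<^esub> (- 1) \<odot>\<^bsub>R\<^esub> T.evA v"
    by (simp add: R.minus_eq R.smult_minus_1)
  also have "\<dots> = T.evA (u + pscale (- 1) v)" by (simp only: R_simps T.evA_add T.evA_scale)
  finally show ?thesis by simp
qed

text \<open>
  The differences that generate the specialisation ideal, for arbitrary exponents \<open>d\<close>.
\<close>

definition trel :: "('i \<Rightarrow>\<^sub>0 int) \<Rightarrow> (('i list \<times> ('i \<Rightarrow>\<^sub>0 int)) \<Rightarrow>\<^sub>0 rat poly fract)" where
  "trel d = Poly_Mapping.single ([], d) 1 - Poly_Mapping.single ([], 0) (S.sca d)"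

lemma T_trel: "T.evA (trel d) = T.tor d \<ominus>\<^bsub>R\<^esub> S.sca d \<odot>\<^bsub>R\<^esub> \<one>\<^bsub>R\<^esub>"
  unfolding trel_def R_minus[symmetric] by (simp add: T.evA_torus T.tor R_simps)

definition gens where
  "gens = {kti Q \<tau> i \<ominus>\<^bsub>R\<^esub> \<sigma> i \<odot>\<^bsub>R\<^esub> \<one>\<^bsub>R\<^esub> | i. i \<in> verts Q \<and> i = \<tau> i} \<union>
            {kti Q \<tau> i \<otimes>\<^bsub>R\<^esub> kti Q \<tau> (\<tau> i) \<ominus>\<^bsub>R\<^esub> (\<sigma> i * \<sigma> (\<tau> i)) \<odot>\<^bsub>R\<^esub> \<one>\<^bsub>R\<^esub>
               | i. i \<in> verts Q \<and> i \<noteq> \<tau> i}"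

lemma I_eq: "I = Idl\<^bsub>R\<^esub> gens"
  by (simp add: specialisation_ideal_def gens_def Let_def)

lemma gens_eq: "gens = {T.evA (trel (frag_of i)) | i. i \<in> V \<and> i = \<tau> i} \<union> {T.evA (trel (frag_of i + frag_of (\<tau> i))) | i. i \<in> V \<and> i \<noteq> \<tau> i}"
proof -
  have 1: "kti Q \<tau> i \<ominus>\<^bsub>R\<^esub> \<sigma> i \<odot>\<^bsub>R\<^esub> \<one>\<^bsub>R\<^esub> = T.evA (trel (frag_of i))" if "i \<in> V" "i = \<tau> i" for i
    unfolding T_trel using that(1) that(2)[symmetric] by (simp add: T.tor T_gens sca_fixed)
  have 2: "kti Q \<tau> i \<otimes>\<^bsub>R\<^esub> kti Q \<tau> (\<tau> i) \<ominus>\<^bsub>R\<^esub> (\<sigma> i * \<sigma> (\<tau> i)) \<odot>\<^bsub>R\<^esub> \<one>\<^bsub>R\<^esub> = T.evA (trel (frag_of i + frag_of (\<tau> i)))" if "i \<in> V" for i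
    unfolding T_trel sca_swapped[OF that] using that T.tau_verts[of i] by (simp add: T.tor T_gens R_simps)
  show ?thesis unfolding gens_def using 1 2 by (intro arg_cong2[of _ _ _ _ "(\<union>)"]) (auto, metis+)
qed

lemma gens_closed: "gens \<subseteq> carrier R"
  by (auto simp: gens_eq R_simps)

sublocale I: kalg_ideal R I
  using R.genideal_ideal[OF gens_closed] R.kalg_axioms by (simp add: kalg_ideal_def I_eq)

sublocale Q: kalg "quot_alg R I"
  by (rule I.kalg_quot)

lemma S_trel:
  assumes "i \<in> V" shows "\<tau> i = i \<Longrightarrow> S.evA (trel (frag_of i)) = \<zero>\<^bsub>Uq Q\<^esub>" "S.evA (trel (frag_of i + frag_of (\<tau> i))) = \<zero>\<^bsub>Uq Q\<^esub>"
proof -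
  have t: "\<tau> i \<in> V" using assms T.tau_verts by simp
  have rel: "S.evA (trel d) = \<zero>\<^bsub>Uq Q\<^esub>" if "S.\<theta> d = 0" for d
  proof -
    have "trel d = Poly_Mapping.single ([], d) 1 - Poly_Mapping.single ([], 0) (S.sca d / S.sca 0)"
      by (simp add: trel_def S.sca_def)
    moreover have "S.\<theta> d = S.\<theta> 0" using that by (simp add: S.\<theta>_def)
    ultimately have "trel d \<in> S.torus_rels" unfolding S.torus_rels_def by blast
    then show ?thesis unfolding S_kernel by (intro pm.span_base) blast
  qed
  show "\<tau> i = i \<Longrightarrow> S.evA (trel (frag_of i)) = \<zero>\<^bsub>Uq Q\<^esub>"
    by (rule rel) (simp add: S.\<theta>_def)
  show "S.evA (trel (frag_of i + frag_of (\<tau> i))) = \<zero>\<^bsub>Uq Q\<^esub>"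
    by (rule rel) (use assms t in \<open>simp add: S.\<theta>_def frag_extend_add T.tau_tau\<close>)
qed

text \<open>
  Evaluation in the quantum group factors through the larger algebra and kills the generators of the
  ideal.
\<close>

lemma S_zero_of_T_ideal:
  assumes "T.evA v \<in> I" shows "S.evA v = \<zero>\<^bsub>Uq Q\<^esub>"
proof -
  \<comment> \<open>well defined on the larger algebra because its kernel of evaluation is the smaller one\<close>
  define \<rho> where "\<rho> x = S.h0 (S.evA (SOME v. T.evA v = x))" for x
  have \<rho>: "\<rho> (T.evA v) = S.h0 (S.evA v)" for v
  proof -
    have "T.evA (SOME w. T.evA w = T.evA v) = T.evA v" by (rule someI[of _ v]) simp
    then have "T.evA ((SOME w. T.evA w = T.evA v) - v) = \<zero>\<^bsub>Ut Q\<^esub>" by (simp add: T.evA_minus T.r_neg T.minus_eq)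
    from T_kernel_S[OF this] have "S.h0 (S.evA (SOME w. T.evA w = T.evA v)) - S.h0 (S.evA v) = 0"
      by (simp add: S.evA_minus S.r0.rep_minus[symmetric] del: S.r0.rep_minus)
    then show ?thesis by (simp add: \<rho>_def)
  qed
  have "lend.alg_rep R \<rho>"
    unfolding lend.alg_rep_def R_simps
    by (auto simp: \<rho> T.evA_add[symmetric] T.evA_mult[symmetric] T.evA_scale[symmetric])
       (simp_all add: S.evA_add S.evA_mult S.evA_scale)
  then interpret \<rho>: represented_algebra lscale R \<rho> by unfold_locales
  have "\<rho> (T.evA v) = 0"
    by (rule \<rho>.kills_genideal[OF gens_closed _ assms[unfolded I_eq]])
      (auto simp: gens_eq \<rho> S_trel)
  then have "S.h0 (S.evA v) = S.h0 \<zero>\<^bsub>Uq Q\<^esub>" unfolding \<rho> by simp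
  then show ?thesis by (intro S.h0_eqI) auto
qed

lemma tor_closed_R: "T.tor d \<in> carrier R"
proof -
  have "T.tor d = T.evA (Poly_Mapping.single ([], d) 1)" by (simp add: T.evA_torus)
  then show ?thesis by (simp add: R_simps)
qed

lemma tor_mod_I:
  assumes "S.\<theta> d = 0" shows "I +>\<^bsub>R\<^esub> T.tor d = S.sca d \<odot>\<^bsub>quot_alg R I\<^esub> \<one>\<^bsub>quot_alg R I\<^esub>"
proof -
  have base: "I +>\<^bsub>R\<^esub> T.tor d = S.sca d \<odot>\<^bsub>quot_alg R I\<^esub> \<one>\<^bsub>quot_alg R I\<^esub>" if "T.evA (trel d) \<in> I" for d
    using that unfolding T_trel I.quot_one I.quot_smult[OF R.one_closed]
    by (subst I.coset_eq_iff) (auto simp: tor_closed_R)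
  have gen: "x \<in> gens \<Longrightarrow> x \<in> I" for x unfolding I_eq using R.genideal_self[OF gens_closed] by blast
  show ?thesis
  proof (induction d rule: tau_invariant_induct[where \<tau> = \<tau> and V = V])
    case (invariant i) then show ?case using S_theta[of i d] assms by simp
  next
    case zero
    have "T.tor 0 = \<one>\<^bsub>R\<^esub>" "S.sca 0 = 1" by (simp_all add: T.tor S.sca_def R_simps)
    then show ?case by (simp only: Q.smult_one[OF Q.one_closed]) (rule I.quot_one[symmetric])
  next
    case (diff a b)
    have "(I +>\<^bsub>R\<^esub> T.tor (a - b)) \<otimes>\<^bsub>quot_alg R I\<^esub> (I +>\<^bsub>R\<^esub> T.tor b) = I +>\<^bsub>R\<^esub> T.tor a"
      using T.tor(2)[of "a - b" b] by (simp add: I.quot_mult tor_closed_R R_simps(1))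
    then show ?case unfolding diff S.sca_diff
      using S.sca_nz tor_closed_R by (intro Q.scalar_factor) auto
  next
    case (fixed i)
    show ?case
    proof (cases "i \<in> V")
      case True
      then show ?thesis using fixed by (intro base gen) (auto simp: gens_eq)
    next
      case False
      then have "T.tor (frag_of i) = \<one>\<^bsub>R\<^esub>" "S.sca (frag_of i) = 1" by (simp_all add: T.tor S.sca_def R_simps)
      then show ?thesis by (simp only: Q.smult_one[OF Q.one_closed]) (rule I.quot_one[symmetric])
    qed
  next
    case (swapped i) then show ?case by (intro base gen) (auto simp: gens_eq)
  qed (simp_all add: T.tau_tau T.tau_verts)
qed

text \<open>
  The kernel of the evaluation in the quantum group is spanned by relations that hold in the larger
  algebra as well and by relations among torus elements, which hold modulo the ideal.
\<close>

lemma T_ideal_of_S_zero: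
  assumes "S.evA v = \<zero>\<^bsub>Uq Q\<^esub>" shows "T.evA v \<in> I"
proof -
  have "v \<in> pm.span (T.i0.irels \<union> S.torus_rels)" using assms unfolding S_kernel .
  then show ?thesis
  proof (induction rule: pm.span_induct_alt)
    case base show ?case using I.zero_closed by (simp only: T.evA_zero R_simps)
  next
    case (step d u w)
    have "T.evA u \<in> I"
      using step(1)
    proof
      assume "u \<in> T.i0.irels"
      then have "T.evA u = \<zero>\<^bsub>Ut Q\<^esub>" unfolding T_kernel by (intro pm.span_base) blast
      then show ?thesis using I.zero_closed by (simp add: R_simps)
    next
      assume "u \<in> S.torus_rels"
      then obtain J n n' where u: "u = Poly_Mapping.single (J, n) 1 - Poly_Mapping.single (J, n') (S.sca n / S.sca n')" "S.\<theta> n = S.\<theta> n'"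
        by (auto simp: S.torus_rels_def)
      then have d: "S.\<theta> (n - n') = 0" by (simp add: S.\<theta>_def frag_extend_diff)
      let ?w = "T.evA (Poly_Mapping.single (J, 0) 1)" and ?c = "S.sca n / S.sca n'"
      have w: "?w \<in> carrier R" by (simp add: R_simps)
      have "I +>\<^bsub>R\<^esub> T.tor n = (I +>\<^bsub>R\<^esub> T.tor (n - n')) \<otimes>\<^bsub>quot_alg R I\<^esub> (I +>\<^bsub>R\<^esub> T.tor n')"
        using T.tor(2)[of "n - n'" n'] by (simp add: I.quot_mult tor_closed_R R_simps(1))
      also have "\<dots> = I +>\<^bsub>R\<^esub> (?c \<odot>\<^bsub>R\<^esub> T.tor n')"
        unfolding tor_mod_I[OF d] S.sca_diff by (simp add: Q.smult_assoc2 tor_closed_R I.quot_smult)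
      finally have "T.tor n \<ominus>\<^bsub>R\<^esub> ?c \<odot>\<^bsub>R\<^esub> T.tor n' \<in> I"
        by (subst I.coset_eq_iff[symmetric]) (auto simp: tor_closed_R)
      then have "?w \<otimes>\<^bsub>R\<^esub> (T.tor n \<ominus>\<^bsub>R\<^esub> ?c \<odot>\<^bsub>R\<^esub> T.tor n') \<in> I" using w by (rule I.I_l_closed)
      also have "?w \<otimes>\<^bsub>R\<^esub> (T.tor n \<ominus>\<^bsub>R\<^esub> ?c \<odot>\<^bsub>R\<^esub> T.tor n') = T.evA (Poly_Mapping.single (J, n) 1) \<ominus>\<^bsub>R\<^esub> T.evA (Poly_Mapping.single (J, n') ?c)"
      proof -
        have e: "T.evA (Poly_Mapping.single (J, n) a) = a \<odot>\<^bsub>R\<^esub> (?w \<otimes>\<^bsub>R\<^esub> T.tor n)" for n a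
          unfolding R_simps by (rule T.evA_single)
        show ?thesis unfolding e[of n 1] e[of n' ?c]
          using w by (simp add: tor_closed_R R.minus_eq R.r_distr R.r_minus R.smult_assoc3)
      qed
      also have "\<dots> = T.evA u" unfolding R_minus u(1) ..
      finally show ?thesis .
    qed
    from I.smult_ideal[OF this, of d] step(2) have "d \<odot>\<^bsub>R\<^esub> T.evA u \<oplus>\<^bsub>R\<^esub> T.evA w \<in> I" by (rule I.a_closed)
    then show ?case by (simp only: R_simps T.evA_add T.evA_scale)
  qed
qed

text \<open>
  A word is sent to the class of the same word. The two preceding inclusions say that this is well
  defined and injective; multiplicativity holds because words multiply by the same rule in both
  algebras.
\<close>

theorem specialisation_iso:
  assumes J: "orbit_representatives \<tau> V J"
  shows "\<exists>\<phi> \<in> alg_iso (Uiq Q \<tau> J \<sigma>) (quot_alg R I).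
            (\<forall>i\<in>verts Q. \<phi> (Bi Q \<tau> \<sigma> i) = I +>\<^bsub>R\<^esub> Bti Q \<tau> i) \<and>
            (\<forall>j\<in>verts Q - J.
               \<phi> (ki Q \<tau> j) = I +>\<^bsub>R\<^esub> (inverse (\<sigma> (\<tau> j)) \<odot>\<^bsub>R\<^esub> kti Q \<tau> j) \<and>
               \<phi> (inv\<^bsub>Uq Q\<^esub> (ki Q \<tau> j)) = I +>\<^bsub>R\<^esub> (inverse (\<sigma> j) \<odot>\<^bsub>R\<^esub> kti Q \<tau> (\<tau> j)))"
proof -
  define \<phi> where "\<phi> x = I +>\<^bsub>R\<^esub> T.evA (SOME v. S.evA v = x)" for x
  have eq: "I +>\<^bsub>R\<^esub> T.evA v = I +>\<^bsub>R\<^esub> T.evA w \<longleftrightarrow> S.evA v = S.evA w" for v w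
  proof -
    have "I +>\<^bsub>R\<^esub> T.evA v = I +>\<^bsub>R\<^esub> T.evA w \<longleftrightarrow> T.evA (v - w) \<in> I"
      by (subst I.coset_eq_iff) (simp_all add: R_simps(6) R_minus)
    also have "\<dots> \<longleftrightarrow> S.evA (v - w) = \<zero>\<^bsub>Uq Q\<^esub>" using S_zero_of_T_ideal T_ideal_of_S_zero by blast
    also have "\<dots> \<longleftrightarrow> S.evA v = S.evA w" unfolding S.evA_minus by (simp add: S.r_right_minus_eq)
    finally show ?thesis .
  qed
  have \<phi>: "\<phi> (S.evA v) = I +>\<^bsub>R\<^esub> T.evA v" for v
    unfolding \<phi>_def eq by (rule someI[of _ v]) simp
  have U: "x \<otimes>\<^bsub>Uiq Q \<tau> J \<sigma>\<^esub> y = x \<otimes>\<^bsub>Uq Q\<^esub> y" "x \<oplus>\<^bsub>Uiq Q \<tau> J \<sigma>\<^esub> y = x \<oplus>\<^bsub>Uq Q\<^esub> y" "\<one>\<^bsub>Uiq Q \<tau> J \<sigma>\<^esub> = \<one>\<^bsub>Uq Q\<^esub>"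
    "d \<odot>\<^bsub>Uiq Q \<tau> J \<sigma>\<^esub> x = d \<odot>\<^bsub>Uq Q\<^esub> x" "carrier (Uiq Q \<tau> J \<sigma>) = range S.evA" for x y d
    by (simp_all add: Uiq_eq[OF J])
  have c: "T.evA v \<in> carrier R" for v by (simp add: R_simps)
  have "\<phi> \<in> ring_hom (Uiq Q \<tau> J \<sigma>) (quot_alg R I)"
  proof (rule ring_hom_memI, unfold U)
    fix x y assume "x \<in> range S.evA" "y \<in> range S.evA"
    then obtain v w where x: "x = S.evA v" "y = S.evA w" by blast
    show "\<phi> (x \<otimes>\<^bsub>Uq Q\<^esub> y) = \<phi> x \<otimes>\<^bsub>quot_alg R I\<^esub> \<phi> y"
      unfolding x S.evA_mult[symmetric] \<phi> I.quot_mult[OF c c] unfolding R_simps T.evA_mult[symmetric]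
      by (simp add: T.imult_def S.imult_def)
    show "\<phi> (x \<oplus>\<^bsub>Uq Q\<^esub> y) = \<phi> x \<oplus>\<^bsub>quot_alg R I\<^esub> \<phi> y"
      unfolding x S.evA_add[symmetric] \<phi> I.quot_add[OF c c] unfolding R_simps T.evA_add[symmetric] ..
  next
    show "\<phi> \<one>\<^bsub>Uq Q\<^esub> = \<one>\<^bsub>quot_alg R I\<^esub>"
      unfolding S.evA_one[symmetric] \<phi> I.quot_one by (simp add: T.evA_one R_simps)
  qed (auto simp: \<phi> c)
  moreover have "\<phi> (d \<odot>\<^bsub>Uiq Q \<tau> J \<sigma>\<^esub> x) = d \<odot>\<^bsub>quot_alg R I\<^esub> \<phi> x" if x: "x \<in> carrier (Uiq Q \<tau> J \<sigma>)" for d x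
  proof -
    obtain v where x: "x = S.evA v" using x unfolding U by blast
    show ?thesis unfolding x U S.evA_scale[symmetric] \<phi> I.quot_smult[OF c] unfolding R_simps T.evA_scale[symmetric] ..
  qed
  moreover have "bij_betw \<phi> (carrier (Uiq Q \<tau> J \<sigma>)) (carrier (quot_alg R I))"
    unfolding U bij_betw_def
  proof
    show "inj_on \<phi> (range S.evA)" by (rule inj_onI) (auto simp: \<phi> eq)
    show "\<phi> ` range S.evA = carrier (quot_alg R I)" by (simp add: I.quot_carrier R_simps(6) image_image \<phi>)
  qed
  ultimately have iso: "\<phi> \<in> alg_iso (Uiq Q \<tau> J \<sigma>) (quot_alg R I)"
    unfolding alg_iso_def alg_hom_def by blast
  have b: "\<phi> (Bi Q \<tau> \<sigma> i) = I +>\<^bsub>R\<^esub> Bti Q \<tau> i" if "i \<in> V" for i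
    using \<phi>[of "Poly_Mapping.single ([i], 0) 1"] unfolding S.evA_B T.evA_B S_gens(1)[OF that] T_gens(1)[OF that] .
  have k: "\<phi> (ki Q \<tau> i) = I +>\<^bsub>R\<^esub> (inverse (\<sigma> (\<tau> i)) \<odot>\<^bsub>R\<^esub> kti Q \<tau> i)" if "i \<in> V" for i
    using \<phi>[of "Poly_Mapping.single ([], frag_of i) (inverse (\<sigma> (\<tau> i)))"]
    unfolding S.evA_torus T.evA_torus S.tor(4) T.tor(4) if_P[OF that] ki_eq[OF that, symmetric] T_gens(2)[OF that] R_simps .
  have ik: "\<phi> (inv\<^bsub>Uq Q\<^esub> (ki Q \<tau> i)) = I +>\<^bsub>R\<^esub> (inverse (\<sigma> i) \<odot>\<^bsub>R\<^esub> kti Q \<tau> (\<tau> i))" if "i \<in> V" for i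
    using k[of "\<tau> i"] that T.tau_verts[of i] unfolding inv_ki[OF that] T.tau_tau by blast
  show ?thesis by (intro bexI[OF _ iso] conjI ballI b k ik) auto
qed

end

section \<open>Tensor products\<close>

locale kalg_tensor = A: kalg A + B: kalg B
  for A :: "('k::field, 'a, 'c) module_scheme" and B :: "('k, 'b, 'd) module_scheme"
begin

abbreviation "W \<equiv> monoid_algebra (A \<times>\<times> B) :: ('k, 'a \<times> 'b \<Rightarrow>\<^sub>0 'k) module"
abbreviation "Tn \<equiv> tensor_alg A B"
abbreviation "t \<equiv> pure_tensor A B"

sublocale W: kalg W
  by (rule kalg_monoid_algebra[OF DirProd_monoid[OF A.monoid_axioms B.monoid_axioms]])

lemma bilinear_closed: "bilinear_relations A B \<subseteq> carrier W"
proof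
  fix z assume z: "z \<in> bilinear_relations A B"
  have s: "Poly_Mapping.single (x, y) d \<in> carrier W" if "x \<in> carrier A" "y \<in> carrier B" for x y d
    using that by simp
  have d: "u - v \<in> carrier W" if "u \<in> carrier W" "v \<in> carrier W" for u v
  proof -
    have "u - v = u \<oplus>\<^bsub>W\<^esub> (- 1) \<odot>\<^bsub>W\<^esub> v" by simp
    then show ?thesis using that W.a_closed W.smult_closed by metis
  qed
  show "z \<in> carrier W"
    using z unfolding bilinear_relations_def by (auto intro!: d s simp del: monoid_algebra_simps)
qed

sublocale I: kalg_ideal W "tensor_ideal A B"
  using W.genideal_ideal[OF bilinear_closed] W.kalg_axioms by (simp add: kalg_ideal_def tensor_ideal_def)

lemma Tn_eq: "Tn = quot_alg W (tensor_ideal A B)" by (simp add: tensor_alg_def)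

sublocale Tn: kalg Tn
  unfolding Tn_eq by (rule I.kalg_quot)

lemma single_closed: "x \<in> carrier A \<Longrightarrow> y \<in> carrier B \<Longrightarrow> Poly_Mapping.single (x, y) d \<in> carrier W"
  by simp

lemma t_closed [simp, intro]: "x \<in> carrier A \<Longrightarrow> y \<in> carrier B \<Longrightarrow> t x y \<in> carrier Tn"
  unfolding pure_tensor_def Tn_eq by (rule I.coset_closed[OF single_closed])

lemma t_one: "\<one>\<^bsub>Tn\<^esub> = t \<one>\<^bsub>A\<^esub> \<one>\<^bsub>B\<^esub>"
  unfolding Tn_eq I.quot_one pure_tensor_def by simp

lemma t_mult: "x \<in> carrier A \<Longrightarrow> y \<in> carrier B \<Longrightarrow> x' \<in> carrier A \<Longrightarrow> y' \<in> carrier B \<Longrightarrow>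
  t x y \<otimes>\<^bsub>Tn\<^esub> t x' y' = t (x \<otimes>\<^bsub>A\<^esub> x') (y \<otimes>\<^bsub>B\<^esub> y')"
  unfolding Tn_eq pure_tensor_def by (subst I.quot_mult) auto

lemma bilinear_in: "z \<in> bilinear_relations A B \<Longrightarrow> z \<in> tensor_ideal A B"
  unfolding tensor_ideal_def using W.genideal_self[OF bilinear_closed] by blast

lemma W_minus: "u \<in> carrier W \<Longrightarrow> v \<in> carrier W \<Longrightarrow> u \<ominus>\<^bsub>W\<^esub> v = u - v"
  unfolding W.minus_eq W.smult_minus_1[symmetric] by simp

lemma t_rel:
  assumes "u - v \<in> bilinear_relations A B" "u \<in> carrier W" "v \<in> carrier W"
  shows "tensor_ideal A B +>\<^bsub>W\<^esub> u = tensor_ideal A B +>\<^bsub>W\<^esub> v"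
  using bilinear_in[OF assms(1)] assms by (subst I.coset_eq_iff) (simp_all only: W_minus)

lemma t_add_left:
  assumes "x \<in> carrier A" "x' \<in> carrier A" "y \<in> carrier B" shows "t (x \<oplus>\<^bsub>A\<^esub> x') y = t x y \<oplus>\<^bsub>Tn\<^esub> t x' y"
proof -
  let ?v = "Poly_Mapping.single (x, y) (1::'k) + Poly_Mapping.single (x', y) 1"
  have "Poly_Mapping.single (x \<oplus>\<^bsub>A\<^esub> x', y) (1::'k) - ?v \<in> bilinear_relations A B"
    unfolding bilinear_relations_def diff_diff_eq[symmetric] using assms by blast
  moreover have "t x y \<oplus>\<^bsub>Tn\<^esub> t x' y = tensor_ideal A B +>\<^bsub>W\<^esub> ?v"
    unfolding Tn_eq pure_tensor_def using assms by (subst I.quot_add) auto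
  moreover have "?v \<in> carrier W"
    using W.a_closed[OF single_closed single_closed, of x y x' y 1 1] assms by simp
  ultimately show ?thesis unfolding pure_tensor_def using assms t_rel[OF _ single_closed, of "x \<oplus>\<^bsub>A\<^esub> x'" y 1 ?v] by simp
qed

lemma t_add_right:
  assumes "x \<in> carrier A" "y \<in> carrier B" "y' \<in> carrier B" shows "t x (y \<oplus>\<^bsub>B\<^esub> y') = t x y \<oplus>\<^bsub>Tn\<^esub> t x y'"
proof -
  let ?v = "Poly_Mapping.single (x, y) (1::'k) + Poly_Mapping.single (x, y') 1"
  have "Poly_Mapping.single (x, y \<oplus>\<^bsub>B\<^esub> y') (1::'k) - ?v \<in> bilinear_relations A B"
    unfolding bilinear_relations_def diff_diff_eq[symmetric] using assms by blast
  moreover have "t x y \<oplus>\<^bsub>Tn\<^esub> t x y' = tensor_ideal A B +>\<^bsub>W\<^esub> ?v"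
    unfolding Tn_eq pure_tensor_def using assms by (subst I.quot_add) auto
  moreover have "?v \<in> carrier W"
    using W.a_closed[OF single_closed single_closed, of x y x y' 1 1] assms by simp
  ultimately show ?thesis unfolding pure_tensor_def using assms t_rel[OF _ single_closed, of x "y \<oplus>\<^bsub>B\<^esub> y'" 1 ?v] by simp
qed

lemma t_scale:
  assumes "x \<in> carrier A" "y \<in> carrier B"
  shows "t (d \<odot>\<^bsub>A\<^esub> x) y = d \<odot>\<^bsub>Tn\<^esub> t x y" "t x (d \<odot>\<^bsub>B\<^esub> y) = d \<odot>\<^bsub>Tn\<^esub> t x y"
proof -
  have e: "d \<odot>\<^bsub>Tn\<^esub> t x y = tensor_ideal A B +>\<^bsub>W\<^esub> Poly_Mapping.single (x, y) d"
    unfolding Tn_eq pure_tensor_def using assms by (subst I.quot_smult) auto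
  have r: "Poly_Mapping.single (d \<odot>\<^bsub>A\<^esub> x, y) (1::'k) - Poly_Mapping.single (x, y) d \<in> bilinear_relations A B"
    "Poly_Mapping.single (x, d \<odot>\<^bsub>B\<^esub> y) (1::'k) - Poly_Mapping.single (x, y) d \<in> bilinear_relations A B"
    unfolding bilinear_relations_def using assms by blast+
  show "t (d \<odot>\<^bsub>A\<^esub> x) y = d \<odot>\<^bsub>Tn\<^esub> t x y" "t x (d \<odot>\<^bsub>B\<^esub> y) = d \<odot>\<^bsub>Tn\<^esub> t x y"
    unfolding e unfolding pure_tensor_def
    using t_rel[OF r(1) single_closed single_closed] t_rel[OF r(2) single_closed single_closed] assms by auto
qed

text \<open>
  A representation of a tensor product amounts to two commuting representations of the factors, and
  calculations with it reduce to calculations in each factor.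
\<close>

lemma reps_of_tensor_rep:
  assumes "lend.alg_rep Tn h"
  shows "lend.alg_rep A (\<lambda>x. h (t x \<one>\<^bsub>B\<^esub>))" "lend.alg_rep B (\<lambda>y. h (t \<one>\<^bsub>A\<^esub> y))"
    and "\<And>x y. x \<in> carrier A \<Longrightarrow> y \<in> carrier B \<Longrightarrow> h (t x y) = h (t x \<one>\<^bsub>B\<^esub>) * h (t \<one>\<^bsub>A\<^esub> y)"
    and "\<And>x y. x \<in> carrier A \<Longrightarrow> y \<in> carrier B \<Longrightarrow> h (t \<one>\<^bsub>A\<^esub> y) * h (t x \<one>\<^bsub>B\<^esub>) = h (t x \<one>\<^bsub>B\<^esub>) * h (t \<one>\<^bsub>A\<^esub> y)"
proof -
  interpret r: represented_algebra lscale Tn h by unfold_locales (rule assms)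
  show "lend.alg_rep A (\<lambda>x. h (t x \<one>\<^bsub>B\<^esub>))" "lend.alg_rep B (\<lambda>y. h (t \<one>\<^bsub>A\<^esub> y))"
    unfolding lend.alg_rep_def
    by (simp_all add: r.rep_add[symmetric] r.rep_mult[symmetric] r.rep_smult[symmetric] t_mult t_add_left t_add_right t_scale
        del: r.rep_add r.rep_mult r.rep_smult)
  fix x y assume xy: "x \<in> carrier A" "y \<in> carrier B"
  show "h (t x y) = h (t x \<one>\<^bsub>B\<^esub>) * h (t \<one>\<^bsub>A\<^esub> y)"
    "h (t \<one>\<^bsub>A\<^esub> y) * h (t x \<one>\<^bsub>B\<^esub>) = h (t x \<one>\<^bsub>B\<^esub>) * h (t \<one>\<^bsub>A\<^esub> y)"
    using xy by (simp_all add: r.rep_mult[symmetric] t_mult del: r.rep_mult)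
qed

subsection \<open>Subspaces of pure tensors\<close>

abbreviation "D S \<equiv> tensor_subspace A B S (carrier B)"

lemma D_zero: "\<zero>\<^bsub>Tn\<^esub> \<in> D S"
  unfolding tensor_subspace_def mem_Collect_eq by (rule exI[of _ 0]) simp

lemma D_add_pure:
  assumes S: "S \<subseteq> carrier A" and z: "z \<in> D S" "x \<in> S" "y \<in> carrier B"
  shows "z \<oplus>\<^bsub>Tn\<^esub> t x y \<in> D S"
proof -
  obtain n :: nat and s r where z: "z = (\<Oplus>\<^bsub>Tn\<^esub>k\<in>{..<n}. t (s k) (r k))" "s ` {..<n} \<subseteq> S" "r ` {..<n} \<subseteq> carrier B"
    using z unfolding tensor_subspace_def by blast
  define s' r' where "s' = s(n := x)" and "r' = r(n := y)"
  have c: "k < n \<Longrightarrow> t (s k) (r k) \<in> carrier Tn" for k using z S by (intro t_closed) auto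
  have "(\<Oplus>\<^bsub>Tn\<^esub>k\<in>{..<Suc n}. t (s' k) (r' k)) = t x y \<oplus>\<^bsub>Tn\<^esub> (\<Oplus>\<^bsub>Tn\<^esub>k\<in>{..<n}. t (s' k) (r' k))"
    unfolding lessThan_Suc using c assms by (subst Tn.finsum_insert) (auto simp: s'_def r'_def)
  also have "(\<Oplus>\<^bsub>Tn\<^esub>k\<in>{..<n}. t (s' k) (r' k)) = z"
    unfolding z(1) by (rule Tn.finsum_cong') (use c in \<open>auto simp: s'_def r'_def\<close>)
  finally have "z \<oplus>\<^bsub>Tn\<^esub> t x y = (\<Oplus>\<^bsub>Tn\<^esub>k\<in>{..<Suc n}. t (s' k) (r' k))"
    using c assms z(1) by (subst Tn.a_comm) (auto intro!: Tn.finsum_closed)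
  moreover have "s' ` {..<Suc n} \<subseteq> S" "r' ` {..<Suc n} \<subseteq> carrier B"
    using z assms by (auto simp: s'_def r'_def less_Suc_eq)
  ultimately show ?thesis unfolding tensor_subspace_def by blast
qed

text \<open>
  Elements of the subspace are sums of pure tensors of any length; induction on the length avoids
  manipulating the indexed sums.
\<close>

lemma D_induct [consumes 2, case_names zero add]:
  assumes S: "S \<subseteq> carrier A" and z: "z \<in> D S" and "P \<zero>\<^bsub>Tn\<^esub>"
    and step: "\<And>z x y. z \<in> D S \<Longrightarrow> z \<in> carrier Tn \<Longrightarrow> P z \<Longrightarrow> x \<in> S \<Longrightarrow> y \<in> carrier B \<Longrightarrow> P (z \<oplus>\<^bsub>Tn\<^esub> t x y)"
  shows "P z"
proof -
  have "s ` {..<n} \<subseteq> S \<Longrightarrow> r ` {..<n} \<subseteq> carrier B \<Longrightarrow> P (\<Oplus>\<^bsub>Tn\<^esub>k\<in>{..<n}. t (s k) (r k))" for n :: nat and s r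
  proof (induction n)
    case 0
    then show ?case using assms(3) by simp
  next
    case (Suc n)
    have c: "k < Suc n \<Longrightarrow> t (s k) (r k) \<in> carrier Tn" for k using Suc.prems S by (intro t_closed) auto
    let ?z = "\<Oplus>\<^bsub>Tn\<^esub>k\<in>{..<n}. t (s k) (r k)"
    have zc: "?z \<in> carrier Tn" using c by (intro Tn.finsum_closed) auto
    have sub: "s ` {..<n} \<subseteq> S" "r ` {..<n} \<subseteq> carrier B" using Suc.prems by auto
    have "?z \<in> D S" unfolding tensor_subspace_def using sub by blast
    then have "P (?z \<oplus>\<^bsub>Tn\<^esub> t (s n) (r n))" using Suc zc sub by (intro step) auto
    moreover have "(\<Oplus>\<^bsub>Tn\<^esub>k\<in>{..<Suc n}. t (s k) (r k)) = ?z \<oplus>\<^bsub>Tn\<^esub> t (s n) (r n)"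
      unfolding lessThan_Suc using c zc by (subst Tn.finsum_insert) (auto simp: Tn.a_comm)
    ultimately show ?case by simp
  qed
  then show ?thesis using z unfolding tensor_subspace_def by blast
qed

lemma subalg_D:
  assumes "subalg S A" shows "subalg (D S) Tn"
proof -
  have sub: "subring S A" and scal: "\<And>d x. x \<in> S \<Longrightarrow> d \<odot>\<^bsub>A\<^esub> x \<in> S" using assms by (auto simp: subalg_def)
  note S = subringE(1)[OF sub]
  have SA: "x \<in> S \<Longrightarrow> x \<in> carrier A" for x using S by blast
  have pure: "t x y \<in> D S" if "x \<in> S" "y \<in> carrier B" for x y
    using D_add_pure[OF S D_zero that] SA[OF that(1)] that(2) by simp
  have closed: "z \<in> carrier Tn" if "z \<in> D S" for z
    using S that by (induction z rule: D_induct) (auto dest: SA)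
  have plus: "z \<oplus>\<^bsub>Tn\<^esub> w \<in> D S" if w: "w \<in> D S" and z: "z \<in> D S" for z w
    using S w
  proof (induction w rule: D_induct)
    case zero then show ?case using z closed by simp
  next
    case (add w x y)
    then show ?case
      using D_add_pure[OF S add(5,3,4)] closed[OF z] SA by (simp add: Tn.a_assoc)
  qed
  have scale: "d \<odot>\<^bsub>Tn\<^esub> z \<in> D S" if "z \<in> D S" for d z
    using S that
  proof (induction z rule: D_induct)
    case zero show ?case using D_zero by simp
  next
    case (add z x y)
    have "d \<odot>\<^bsub>Tn\<^esub> (z \<oplus>\<^bsub>Tn\<^esub> t x y) = d \<odot>\<^bsub>Tn\<^esub> z \<oplus>\<^bsub>Tn\<^esub> t (d \<odot>\<^bsub>A\<^esub> x) y"
      using add SA by (simp add: Tn.smult_r_distr t_scale)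
    then show ?case using D_add_pure[OF S add(5) scal[OF add(3)] add(4)] by simp
  qed
  have mult_pure: "z \<otimes>\<^bsub>Tn\<^esub> t x y \<in> D S" if z: "z \<in> D S" and xy: "x \<in> S" "y \<in> carrier B" for z x y
    using S z
  proof (induction z rule: D_induct)
    case zero show ?case using D_zero xy SA by simp
  next
    case (add z x' y')
    have "(z \<oplus>\<^bsub>Tn\<^esub> t x' y') \<otimes>\<^bsub>Tn\<^esub> t x y = z \<otimes>\<^bsub>Tn\<^esub> t x y \<oplus>\<^bsub>Tn\<^esub> t (x' \<otimes>\<^bsub>A\<^esub> x) (y' \<otimes>\<^bsub>B\<^esub> y)"
      using add xy SA by (simp add: Tn.l_distr t_mult)
    then show ?case using D_add_pure[OF S add(5), of "x' \<otimes>\<^bsub>A\<^esub> x" "y' \<otimes>\<^bsub>B\<^esub> y"] add xy subringE(6)[OF sub] by simp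
  qed
  have mult: "z \<otimes>\<^bsub>Tn\<^esub> w \<in> D S" if w: "w \<in> D S" and z: "z \<in> D S" for z w
    using S w
  proof (induction w rule: D_induct)
    case zero then show ?case using D_zero closed[OF z] by simp
  next
    case (add w x y)
    then show ?case
      using plus[OF mult_pure[OF z add(3,4)] add(5)] closed[OF z] SA by (simp add: Tn.r_distr)
  qed
  have neg: "\<ominus>\<^bsub>Tn\<^esub> z \<in> D S" if "z \<in> D S" for z
    using scale[OF that, of "- 1"] closed[OF that] by (simp add: Tn.smult_minus_1)
  show ?thesis
    unfolding subalg_def
  proof (intro conjI Tn.subringI allI ballI)
    show "\<one>\<^bsub>Tn\<^esub> \<in> D S" unfolding t_one using pure subringE(3)[OF sub] by simp
  qed (auto intro: closed neg mult plus scale)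
qed

end

section \<open>The comultiplication\<close>

context qring
begin

text \<open>
  The Serre relation is additive in its second argument, and for each summand it is inherited from the
  \<open>q\<close>-commuting summands of the first.
\<close>

lemma serre_coproduct:
  assumes m: "m > 0" and cij: "qv powi cc = inverse (qv ^ (m - 1))"
    and yx: "y * x = (qv ^ 2) \<cdot> (x * y)" "y * x' = (qv powi cc) \<cdot> (x' * y)" "y' * x = (qv powi cc) \<cdot> (x * y')"
    and yy: "y * y' = y' * y"
    and z: "z * x = x * z" "z * y = y * z" "z * x' = x' * z" "z * y' = y' * z" "z' * x = x * z'" "z' * y = y * z'" "z' * y' = y' * z'"
    and sx: "serre x x' m = 0" and sz: "serre z z' m = 0"
  shows "serre (x + y * z) (x' + y' * z') m = 0"
proof -
  have q: "qpar qv" "qpar (inverse qv)" by (simp_all add: qpar_def)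
  have q0: "qv ^ n \<noteq> 0" for n by simp
  have zx: "z * (x * w) = x * (z * w)" "z * (x' * w) = x' * (z * w)" for w
    using z by (metis mult.assoc)+
  have 1: "serre (x + y * z) x' m = 0"
  proof (rule serre_sum[OF q(1) m _ _ sx])
    have "y * z * x = (y * x) * z" by (simp add: mult.assoc z)
    then show "y * z * x = (qv ^ 2) \<cdot> (x * (y * z))" unfolding yx by (simp add: scl_nf)
    have "y * z * x' = (y * x') * z" by (simp add: mult.assoc z)
    then show "y * z * x' = inverse (qv ^ (m - 1)) \<cdot> (x' * (y * z))" unfolding yx cij by (simp add: scl_nf)
  qed
  have "serre (1 \<cdot> (z * y)) (1 \<cdot> (z' * y')) m = 0"
    by (rule serre_twist[OF _ _ _ yy sz, of 1 1]) (simp_all add: z)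
  then have t: "serre (y * z) (y' * z') m = 0" by (simp add: z)
  have 2: "serre (y * z + x) (y' * z') m = 0"
  proof (rule serre_sum[OF q(2) m _ _ t])
    have "(qv ^ 2) \<cdot> (x * (y * z)) = (y * x) * z" unfolding yx by (simp add: scl_nf)
    also have "\<dots> = y * z * x" by (simp add: mult.assoc z)
    finally have "inverse (qv ^ 2) \<cdot> (y * z * x) = inverse (qv ^ 2) \<cdot> ((qv ^ 2) \<cdot> (x * (y * z)))" by simp
    then show "x * (y * z) = ((inverse qv)\<^sup>2) \<cdot> (y * z * x)" using q0[of 2] by (simp add: power_inverse)
    have "inverse (qv ^ (m - 1)) \<cdot> (x * (y' * z')) = (y' * x) * z'" unfolding yx cij by (simp add: scl_nf)
    also have "\<dots> = y' * z' * x" by (simp add: mult.assoc z)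
    finally have "(qv ^ (m - 1)) \<cdot> (y' * z' * x) = (qv ^ (m - 1)) \<cdot> (inverse (qv ^ (m - 1)) \<cdot> (x * (y' * z')))" by simp
    then show "x * (y' * z') = inverse ((inverse qv) ^ (m - 1)) \<cdot> (y' * z' * x)" using q0[of "m - 1"] by (simp add: power_inverse)
  qed
  show ?thesis
    unfolding serre_add 1 using 2 by (simp add: add.commute)
qed


text \<open>
  The formulas of the comultiplication for two commuting copies of the relations. The factors \<open>K\<^sub>i\<close>
  and \<open>L'\<^sub>i\<close> are placed such that the mixed terms in the commutator of the new \<open>E\<^sub>i\<close> and \<open>F\<^sub>j\<close> cancel.
\<close>

lemma quantum_system_coproduct:
  assumes "gcm (cartan Q)" and l: "quantum_system Q E F K K'" and r: "quantum_system Q E' F' L L'"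
    and com: "\<And>i j a b. i \<in> verts Q \<Longrightarrow> j \<in> verts Q \<Longrightarrow> a \<in> {E i, F i, K i, K' i} \<Longrightarrow> b \<in> {E' j, F' j, L j, L' j} \<Longrightarrow> b * a = a * b"
  shows "quantum_system Q (\<lambda>i. E i + K i * E' i) (\<lambda>i. F' i + F i * L' i) (\<lambda>i. K i * L i) (\<lambda>i. K' i * L' i)"
  unfolding quantum_system_def
proof (intro ballI)
  interpret gcm "cartan Q" by fact
  fix i j assume i: "i \<in> verts Q" and j: "j \<in> verts Q"
  define cc where "cc = cartan Q i j"
  have cs: "cartan Q j i = cc" unfolding cc_def by (rule c_sym)
  note c = com[OF i i] com[OF i j] com[OF j i] com[OF j j]
  have cm: "b * a = a * b" "b * (a * z) = a * (b * z)"
    if "a \<in> {E i, F i, K i, K' i, E j, F j, K j, K' j}" "b \<in> {E' i, F' i, L i, L' i, E' j, F' j, L j, L' j}" for a b z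
  proof -
    have "a \<in> {E i, F i, K i, K' i} \<or> a \<in> {E j, F j, K j, K' j}" "b \<in> {E' i, F' i, L i, L' i} \<or> b \<in> {E' j, F' j, L j, L' j}"
      using that by auto
    then show e: "b * a = a * b" by (elim disjE) (rule c(1) c(2) c(3) c(4); assumption)+
    show "b * (a * z) = a * (b * z)" unfolding mult.assoc[symmetric] e ..
  qed
  note cms = cm[of "E i"] cm[of "F i"] cm[of "K i"] cm[of "K' i"] cm[of "E j"] cm[of "F j"] cm[of "K j"] cm[of "K' j"]
  from l i j have L: "E i * F j - F j * E i = (if i = j then c0 \<cdot> (K i - K' i) else 0)"
      "K i * K j = K j * K i" "K i * K' j = K' j * K i" "K' i * K' j = K' j * K' i"
      "K i * E j = (qv powi cc) \<cdot> (E j * K i)" "K i * F j = (qv powi (- cc)) \<cdot> (F j * K i)"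
      "K' i * E j = (qv powi (- cc)) \<cdot> (E j * K' i)" "K' i * F j = (qv powi cc) \<cdot> (F j * K' i)"
      "i \<noteq> j \<Longrightarrow> serre (E i) (E j) (nat (1 - cc)) = 0" "i \<noteq> j \<Longrightarrow> serre (F i) (F j) (nat (1 - cc)) = 0"
    unfolding quantum_system_def cc_def by auto
  from l i j have L2: "K j * E i = (qv powi cc) \<cdot> (E i * K j)"
    "K i * E i = (qv ^ 2) \<cdot> (E i * K i)"
    unfolding quantum_system_def cs[symmetric] by auto
  from r i j have R: "E' i * F' j - F' j * E' i = (if i = j then c0 \<cdot> (L i - L' i) else 0)"
      "L i * L j = L j * L i" "L i * L' j = L' j * L i" "L' i * L' j = L' j * L' i"
      "L i * E' j = (qv powi cc) \<cdot> (E' j * L i)" "L i * F' j = (qv powi (- cc)) \<cdot> (F' j * L i)"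
      "L' i * E' j = (qv powi (- cc)) \<cdot> (E' j * L' i)" "L' i * F' j = (qv powi cc) \<cdot> (F' j * L' i)"
      "i \<noteq> j \<Longrightarrow> serre (E' i) (E' j) (nat (1 - cc)) = 0" "i \<noteq> j \<Longrightarrow> serre (F' i) (F' j) (nat (1 - cc)) = 0"
    unfolding quantum_system_def cc_def by auto
  from r i j have R2: "L' j * F' i = (qv powi cc) \<cdot> (F' i * L' j)" "L' j * E' i = (qv powi (- cc)) \<cdot> (E' i * L' j)"
    "L' i * F' i = (qv ^ 2) \<cdot> (F' i * L' i)"
    unfolding quantum_system_def cs[symmetric] by auto
  have ef: "(E i + K i * E' i) * (F' j + F j * L' j) - (F' j + F j * L' j) * (E i + K i * E' i) =
      (if i = j then c0 \<cdot> (K i * L i - K' i * L' i) else 0)"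
  proof -
    have "(E i + K i * E' i) * (F' j + F j * L' j) - (F' j + F j * L' j) * (E i + K i * E' i) =
       (E i * F j - F j * E i) * L' j + K i * (E' i * F' j - F' j * E' i)
       + (K i * F j * (E' i * L' j) - F j * K i * (L' j * E' i))"
      by (simp add: distrib_left distrib_right left_diff_distrib right_diff_distrib mult.assoc cms)
    also have "K i * F j * (E' i * L' j) - F j * K i * (L' j * E' i) = 0"
      unfolding L(6) R2(2) by (simp add: scl_nf)
    finally show ?thesis unfolding L(1) R(1) by (auto simp: scl_nf)
  qed
  have kk: "K i * L i * (K j * L j) = K j * L j * (K i * L i)" "K i * L i * (K' j * L' j) = K' j * L' j * (K i * L i)"
    "K' i * L' i * (K' j * L' j) = K' j * L' j * (K' i * L' i)"
  proof -
    have e: "a * b * (a' * b') = (a * a') * (b * b')" if "b * a' = a' * b" for a b a' b' :: 'r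
      using arg_cong[OF that, of "\<lambda>w. a * (w * b')"] by (simp add: mult.assoc)
    show "K i * L i * (K j * L j) = K j * L j * (K i * L i)" "K i * L i * (K' j * L' j) = K' j * L' j * (K i * L i)"
      "K' i * L' i * (K' j * L' j) = K' j * L' j * (K' i * L' i)"
      by (subst (1 2) e, simp_all only: cm insert_iff simp_thms L(2-4) R(2-4))+
  qed
  have ke: "K i * L i * (E j + K j * E' j) = (qv powi cc) \<cdot> ((E j + K j * E' j) * (K i * L i))"
  proof -
    have "K i * L i * (E j + K j * E' j) = (K i * E j) * L i + (K i * K j) * (L i * E' j)"
      by (simp add: distrib_left mult.assoc cms)
    then show ?thesis unfolding L(2,5) R(5) by (simp add: scl_nf cms)
  qed
  have kf: "K i * L i * (F' j + F j * L' j) = (qv powi (- cc)) \<cdot> ((F' j + F j * L' j) * (K i * L i))"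
  proof -
    have "K i * L i * (F' j + F j * L' j) = K i * (L i * F' j) + (K i * F j) * (L i * L' j)"
      by (simp add: distrib_left mult.assoc cms)
    then show ?thesis unfolding L(6) R(3,6) by (simp add: scl_nf cms)
  qed
  have k'e: "K' i * L' i * (E j + K j * E' j) = (qv powi (- cc)) \<cdot> ((E j + K j * E' j) * (K' i * L' i))"
  proof -
    have k: "K' i * K j = K j * K' i" using l i j unfolding quantum_system_def by auto
    have "K' i * L' i * (E j + K j * E' j) = (K' i * E j) * L' i + (K' i * K j) * (L' i * E' j)"
      by (simp add: distrib_left mult.assoc cms)
    then show ?thesis unfolding L(7) k R(7) by (simp add: scl_nf cms)
  qed
  have k'f: "K' i * L' i * (F' j + F j * L' j) = (qv powi cc) \<cdot> ((F' j + F j * L' j) * (K' i * L' i))"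
  proof -
    have "K' i * L' i * (F' j + F j * L' j) = K' i * (L' i * F' j) + (K' i * F j) * (L' i * L' j)"
      by (simp add: distrib_left mult.assoc cms)
    then show ?thesis unfolding L(8) R(4,8) by (simp add: scl_nf cms)
  qed
  have se: "serre (E i + K i * E' i) (E j + K j * E' j) (nat (1 - cc)) = 0"
    and sf: "serre (F' i + F i * L' i) (F' j + F j * L' j) (nat (1 - cc)) = 0" if ij: "i \<noteq> j"
  proof -
    have m: "mm i j = nat (1 - cc)" by (simp add: mm_def cc_def)
    note m0 = mm_pos[OF ij, unfolded m]
    have q: "qv powi cc = inverse (qv ^ (nat (1 - cc) - 1))"
    proof -
      have "qv powi cc = qv powi (- int (nat (1 - cc) - 1))"
        using arg_cong[OF c_mm[OF ij], of "\<lambda>z. qv powi z"] unfolding m cc_def[symmetric] .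
      then show ?thesis by (simp only: power_int_minus power_int_of_nat)
    qed
    show "serre (E i + K i * E' i) (E j + K j * E' j) (nat (1 - cc)) = 0"
      by (rule serre_coproduct[OF m0 q L2(2) L(5) L2(1) L(2) _ _ _ _ _ _ _ L(9)[OF ij] R(9)[OF ij]]) (simp_all add: cms)
    have "serre (F' i + L' i * F i) (F' j + L' j * F j) (nat (1 - cc)) = 0"
      by (rule serre_coproduct[OF m0 q R2(3) R(8) R2(1) R(4) _ _ _ _ _ _ _ R(10)[OF ij] L(10)[OF ij]]) (simp_all add: cms)
    then show "serre (F' i + F i * L' i) (F' j + F j * L' j) (nat (1 - cc)) = 0" by (simp add: cms)
  qed
  show "(E i + K i * E' i) * (F' j + F j * L' j) - (F' j + F j * L' j) * (E i + K i * E' i) =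
      (if i = j then c0 \<cdot> (K i * L i - K' i * L' i) else 0) \<and>
     K i * L i * (K j * L j) = K j * L j * (K i * L i) \<and>
     K i * L i * (K' j * L' j) = K' j * L' j * (K i * L i) \<and>
     K' i * L' i * (K' j * L' j) = K' j * L' j * (K' i * L' i) \<and>
     K i * L i * (E j + K j * E' j) = (qv powi cartan Q i j) \<cdot> ((E j + K j * E' j) * (K i * L i)) \<and>
     K i * L i * (F' j + F j * L' j) = (qv powi - cartan Q i j) \<cdot> ((F' j + F j * L' j) * (K i * L i)) \<and>
     K' i * L' i * (E j + K j * E' j) = (qv powi - cartan Q i j) \<cdot> ((E j + K j * E' j) * (K' i * L' i)) \<and>
     K' i * L' i * (F' j + F j * L' j) = (qv powi cartan Q i j) \<cdot> ((F' j + F j * L' j) * (K' i * L' i)) \<and>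
     (i \<noteq> j \<longrightarrow> serre (E i + K i * E' i) (E j + K j * E' j) (nat (1 - cartan Q i j)) = 0 \<and>
       serre (F' i + F i * L' i) (F' j + F j * L' j) (nat (1 - cartan Q i j)) = 0)"
    unfolding cc_def[symmetric] using ef kk ke kf k'e k'f se sf by blast
qed

end


text \<open>
  In a faithful representation of the tensor product the images of the generators satisfy the defining
  relations, so the universal property applies; its image stays in the tensor product because that is
  closed under products and linear combinations.
\<close>

lemma comultiplication_ex:
  fixes Q :: "('i, 'q) pre_digraph"
  assumes gcm: "gcm (cartan Q)"
  shows "\<exists>\<Delta>. is_comultiplication Q \<Delta>"
proof -
  let ?U = "Ut Q" and ?u = "Ut_gen Q"
  interpret kalg_tensor ?U ?U by (simp add: kalg_tensor_def kalg_Ut)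
  obtain h :: "_ \<Rightarrow> ((('i tgen list \<Rightarrow>\<^sub>0 rat poly fract) set \<times> ('i tgen list \<Rightarrow>\<^sub>0 rat poly fract) set \<Rightarrow>\<^sub>0 rat poly fract) set, rat poly fract) lend"
    where h: "lend.alg_rep Tn h" "inj_on h (carrier Tn)"
    using kalg_faithful_rep[OF Tn.kalg_axioms] by blast
  interpret h: represented_algebra lscale Tn h by unfold_locales (rule h)
  define l where "l x = h (t x \<one>\<^bsub>?U\<^esub>)" for x
  define r where "r x = h (t \<one>\<^bsub>?U\<^esub> x)" for x
  note lr = reps_of_tensor_rep[OF h(1), folded l_def r_def]
  define \<delta> where "\<delta> g = (case g of
      tE i \<Rightarrow> t (?u g) \<one>\<^bsub>?U\<^esub> \<oplus>\<^bsub>Tn\<^esub> t (?u (tK i)) (?u g)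
    | tF i \<Rightarrow> t \<one>\<^bsub>?U\<^esub> (?u g) \<oplus>\<^bsub>Tn\<^esub> t (?u g) (?u (tK' i))
    | _ \<Rightarrow> t (?u g) (?u g))" for g
  have \<delta>: "\<delta> g \<in> carrier Tn" if "g \<in> Ut_gens Q" for g
    using that by (cases g) (auto simp: \<delta>_def)
  have \<eta>: "h (\<delta> (tE i)) = l (?u (tE i)) + l (?u (tK i)) * r (?u (tE i))"
    "h (\<delta> (tF i)) = r (?u (tF i)) + l (?u (tF i)) * r (?u (tK' i))"
    "h (\<delta> (tK i)) = l (?u (tK i)) * r (?u (tK i))" "h (\<delta> (tK' i)) = l (?u (tK' i)) * r (?u (tK' i))"
    "h (\<delta> (tKinv i)) = l (?u (tKinv i)) * r (?u (tKinv i))" "h (\<delta> (tK'inv i)) = l (?u (tK'inv i)) * r (?u (tK'inv i))"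
    if "i \<in> verts Q" for i
    using that by (simp_all add: \<delta>_def l_def r_def h.rep_mult[symmetric] t_mult del: h.rep_mult)
  note dl = lendq.Ut_data_of_rep[OF lr(1), unfolded lendq.Ut_data_def] and dr = lendq.Ut_data_of_rep[OF lr(2), unfolded lendq.Ut_data_def]
  have one: "h \<one>\<^bsub>Tn\<^esub> = l \<one>\<^bsub>?U\<^esub> * r \<one>\<^bsub>?U\<^esub>" unfolding t_one by (simp add: lr(3))
  have "lendq.Ut_data Q (\<lambda>g. h (\<delta> g)) (h \<one>\<^bsub>Tn\<^esub>)"
    unfolding lendq.Ut_data_def
  proof (intro conjI ballI)
    show "lend.corner (Ut_gens Q) (\<lambda>g. h (\<delta> g)) (h \<one>\<^bsub>Tn\<^esub>)"
      unfolding lend.corner_def using \<delta> h.rep_one_l[OF Tn.one_closed] by simp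
    have "lendq.quantum_system Q (\<lambda>i. (l \<circ> ?u \<circ> tE) i + (l \<circ> ?u \<circ> tK) i * (r \<circ> ?u \<circ> tE) i) (\<lambda>i. (r \<circ> ?u \<circ> tF) i + (l \<circ> ?u \<circ> tF) i * (r \<circ> ?u \<circ> tK') i)
       (\<lambda>i. (l \<circ> ?u \<circ> tK) i * (r \<circ> ?u \<circ> tK) i) (\<lambda>i. (l \<circ> ?u \<circ> tK') i * (r \<circ> ?u \<circ> tK') i)"
      by (rule lendq.quantum_system_coproduct[OF gcm dl[THEN conjunct2, THEN conjunct1] dr[THEN conjunct2, THEN conjunct1]])
        (use lr(4) in auto)
    then show "lendq.quantum_system Q ((\<lambda>g. h (\<delta> g)) \<circ> tE) ((\<lambda>g. h (\<delta> g)) \<circ> tF) ((\<lambda>g. h (\<delta> g)) \<circ> tK) ((\<lambda>g. h (\<delta> g)) \<circ> tK')"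
      unfolding lendq.quantum_system_def by (simp add: \<eta>)
    fix i assume i: "i \<in> verts Q"
    have m: "l a * r a * (l b * r b) = h \<one>\<^bsub>Tn\<^esub>" if "a \<in> carrier ?U" "b \<in> carrier ?U" "l a * l b = l \<one>\<^bsub>?U\<^esub>" "r a * r b = r \<one>\<^bsub>?U\<^esub>" for a b
    proof -
      have "l a * r a * (l b * r b) = l a * (r a * l b) * r b" by (simp add: mult.assoc)
      also have "\<dots> = (l a * l b) * (r a * r b)" unfolding lr(4)[OF that(2,1)] by (simp add: mult.assoc)
      finally show ?thesis using that one by simp
    qed
    show "h (\<delta> (tK i)) * h (\<delta> (tKinv i)) = h \<one>\<^bsub>Tn\<^esub>" "h (\<delta> (tKinv i)) * h (\<delta> (tK i)) = h \<one>\<^bsub>Tn\<^esub>"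
      "h (\<delta> (tK' i)) * h (\<delta> (tK'inv i)) = h \<one>\<^bsub>Tn\<^esub>" "h (\<delta> (tK'inv i)) * h (\<delta> (tK' i)) = h \<one>\<^bsub>Tn\<^esub>"
      unfolding \<eta>[OF i] using i dl dr by (auto intro!: m)
  qed
  from lendq.rep_of_Ut_data[OF this] obtain g where g: "lend.alg_rep ?U g" "\<forall>x\<in>Ut_gens Q. g (?u x) = h (\<delta> x)"
    "g \<one>\<^bsub>?U\<^esub> = h \<one>\<^bsub>Tn\<^esub>" "g ` carrier ?U \<subseteq> lend.lin (lend.word_rep (\<lambda>g. h (\<delta> g)) (h \<one>\<^bsub>Tn\<^esub>)) ` {f. Poly_Mapping.keys f \<subseteq> lists (Ut_gens Q)}"
    by (elim exE conjE) (rule that; assumption)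
  let ?H = "h ` carrier Tn"
  have H: "lend.subspace ?H"
  proof (rule lend.subspaceI)
    show "0 \<in> ?H" by (rule image_eqI[of _ _ "\<zero>\<^bsub>Tn\<^esub>"]) auto
    show "x + y \<in> ?H" if "x \<in> ?H" "y \<in> ?H" for x y
      using that by (auto simp: h.rep_add[symmetric] simp del: h.rep_add)
    show "lscale d x \<in> ?H" if "x \<in> ?H" for d x
      using that by (auto simp: h.rep_smult[symmetric] simp del: h.rep_smult)
  qed
  have word: "lend.word_rep (\<lambda>g. h (\<delta> g)) (h \<one>\<^bsub>Tn\<^esub>) w \<in> ?H" if "w \<in> lists (Ut_gens Q)" for w
    using that
  proof (induction w)
    case (Cons a w)
    then show ?case using \<delta> by (auto simp: h.rep_mult[symmetric] simp del: h.rep_mult)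
  qed auto
  have "g x \<in> ?H" if x: "x \<in> carrier ?U" for x
  proof -
    obtain f where f: "Poly_Mapping.keys f \<subseteq> lists (Ut_gens Q)" "g x = lend.lin (lend.word_rep (\<lambda>g. h (\<delta> g)) (h \<one>\<^bsub>Tn\<^esub>)) f"
      using subsetD[OF g(4) imageI[OF x]] by (elim imageE) (rule that; simp)
    show ?thesis unfolding f(2) lend.lin_def
      by (intro lend.subspace_sum[OF H] lend.subspace_scale[OF H] word) (rule subsetD[OF f(1)])
  qed
  then have gx: "h (inv_into (carrier Tn) h (g x)) = g x" "inv_into (carrier Tn) h (g x) \<in> carrier Tn" if "x \<in> carrier ?U" for x
    using that by (auto intro: f_inv_into_f inv_into_into)
  define \<Delta> where "\<Delta> x = inv_into (carrier Tn) h (g x)" for x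
  note \<Delta> = gx[folded \<Delta>_def]
  have eqI: "\<Delta> x = z" if "x \<in> carrier ?U" "z \<in> carrier Tn" "g x = h z" for x z
    using inj_onD[OF h(2), of "\<Delta> x" z] \<Delta> that by simp
  interpret g: represented_algebra lscale ?U g by unfold_locales (rule g)
  have "\<Delta> \<in> alg_hom ?U Tn"
    unfolding alg_hom_def
  proof (intro CollectI conjI ring_hom_memI allI ballI)
    fix x y d assume x: "x \<in> carrier ?U" and y: "y \<in> carrier ?U"
    show "\<Delta> (x \<otimes>\<^bsub>?U\<^esub> y) = \<Delta> x \<otimes>\<^bsub>Tn\<^esub> \<Delta> y" by (rule eqI) (use x y in \<open>simp_all add: \<Delta>\<close>)
    show "\<Delta> (x \<oplus>\<^bsub>?U\<^esub> y) = \<Delta> x \<oplus>\<^bsub>Tn\<^esub> \<Delta> y" by (rule eqI) (use x y in \<open>simp_all add: \<Delta>\<close>)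
  next
    show "\<Delta> (d \<odot>\<^bsub>?U\<^esub> x) = d \<odot>\<^bsub>Tn\<^esub> \<Delta> x" if "x \<in> carrier ?U" for d x
      by (rule eqI) (use that in \<open>simp_all add: \<Delta>\<close>)
    show "\<Delta> \<one>\<^bsub>?U\<^esub> = \<one>\<^bsub>Tn\<^esub>" by (rule eqI) (auto simp: g)
  qed (simp add: \<Delta>)
  moreover have "\<Delta> (?u x) = \<delta> x" if "x \<in> Ut_gens Q" for x
    by (rule eqI) (use that in \<open>auto simp: g \<delta>\<close>)
  ultimately have "is_comultiplication Q \<Delta>"
    unfolding is_comultiplication_def Let_def by (simp add: \<delta>_def)
  then show ?thesis by blast
qed

context ipair
begin

text \<open>
  The elements whose comultiplication lies in the subspace form a subalgebra, so it suffices to look at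
  generators. For \<open>B\<^sub>i\<close> the two terms with second factor \<open>K'\<^sub>i\<close> combine to \<open>B\<^sub>i \<otimes> K'\<^sub>i\<close>, and the first
  factors of the other terms are \<open>1\<close> and \<open>K\<^sub>\<tau>\<^sub>i K'\<^sub>i\<close>.
\<close>

theorem Uit_right_coideal:
  assumes "is_comultiplication Q \<Delta>"
  shows "right_coideal_subalgebra (Ut Q) \<Delta> (carrier R)"
proof -
  let ?U = "Ut Q" and ?u = "Ut_gen Q"
  interpret X: kalg_tensor ?U ?U by (simp add: kalg_tensor_def kalg_Ut)
  let ?T = "tensor_alg ?U ?U" and ?t = "pure_tensor ?U ?U" and ?S = "range T.evA"
  have hom: "\<Delta> \<in> alg_hom ?U ?T" and gen: "\<And>i. i \<in> V \<Longrightarrow>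
        \<Delta> (?u (tE i)) = ?t (?u (tE i)) \<one>\<^bsub>?U\<^esub> \<oplus>\<^bsub>?T\<^esub> ?t (?u (tK i)) (?u (tE i)) \<and>
        \<Delta> (?u (tF i)) = ?t \<one>\<^bsub>?U\<^esub> (?u (tF i)) \<oplus>\<^bsub>?T\<^esub> ?t (?u (tF i)) (?u (tK' i)) \<and>
        \<Delta> (?u (tK i)) = ?t (?u (tK i)) (?u (tK i)) \<and> \<Delta> (?u (tK' i)) = ?t (?u (tK' i)) (?u (tK' i))"
    using assms unfolding is_comultiplication_def Let_def by auto
  have h: "\<And>x. x \<in> carrier ?U \<Longrightarrow> \<Delta> x \<in> carrier ?T"
    "\<And>x y. x \<in> carrier ?U \<Longrightarrow> y \<in> carrier ?U \<Longrightarrow> \<Delta> (x \<otimes>\<^bsub>?U\<^esub> y) = \<Delta> x \<otimes>\<^bsub>?T\<^esub> \<Delta> y"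
    "\<And>x y. x \<in> carrier ?U \<Longrightarrow> y \<in> carrier ?U \<Longrightarrow> \<Delta> (x \<oplus>\<^bsub>?U\<^esub> y) = \<Delta> x \<oplus>\<^bsub>?T\<^esub> \<Delta> y"
    "\<Delta> \<one>\<^bsub>?U\<^esub> = \<one>\<^bsub>?T\<^esub>" "\<And>x d. x \<in> carrier ?U \<Longrightarrow> \<Delta> (d \<odot>\<^bsub>?U\<^esub> x) = d \<odot>\<^bsub>?T\<^esub> \<Delta> x"
    using hom unfolding alg_hom_def ring_hom_def by auto
  have S: "subring ?S ?U" using T.subalg_range_evA by (simp add: subalg_def)
  have SU: "?S \<subseteq> carrier ?U" by auto
  have D: "subring (X.D ?S) ?T" "\<And>d x. x \<in> X.D ?S \<Longrightarrow> d \<odot>\<^bsub>?T\<^esub> x \<in> X.D ?S"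
    using X.subalg_D[OF T.subalg_range_evA] by (auto simp: subalg_def)
  have pure: "?t x y \<in> X.D ?S" if "x \<in> ?S" "y \<in> carrier ?U" for x y
    using X.D_add_pure[OF SU X.D_zero that] that SU by auto
  define Y where "Y = {x \<in> carrier ?U. \<Delta> x \<in> X.D ?S}"
  have "subalg Y ?U"
    unfolding subalg_def
  proof (intro conjI T.subringI allI ballI)
    show "Y \<subseteq> carrier ?U" by (auto simp: Y_def)
    show "\<one>\<^bsub>?U\<^esub> \<in> Y" using subringE(3)[OF D(1)] by (simp add: Y_def h)
    show "x \<otimes>\<^bsub>?U\<^esub> y \<in> Y" "x \<oplus>\<^bsub>?U\<^esub> y \<in> Y" if "x \<in> Y" "y \<in> Y" for x y
      using that subringE(6,7)[OF D(1)] by (auto simp: Y_def h)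
    show s: "d \<odot>\<^bsub>?U\<^esub> x \<in> Y" if "x \<in> Y" for x d
      using that D(2) by (auto simp: Y_def h)
    show "\<ominus>\<^bsub>?U\<^esub> x \<in> Y" if "x \<in> Y" for x
      using s[OF that, of "- 1"] that by (simp add: Y_def T.smult_minus_1)
  qed
  moreover have "T.B i \<in> Y \<and> T.k i \<in> Y \<and> inv\<^bsub>?U\<^esub> (T.k i) \<in> Y" if i: "i \<in> V" for i
  proof -
    have ti: "\<tau> i \<in> V" using i T.tau_verts by simp
    let ?E = "?u (tE (\<tau> i))" and ?F = "?u (tF i)" and ?K = "?u (tK (\<tau> i))" and ?K' = "?u (tK' i)"
    have c: "?E \<in> carrier ?U" "?F \<in> carrier ?U" "?K \<in> carrier ?U" "?K' \<in> carrier ?U" using i ti by simp_all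
    have k: "?K \<otimes>\<^bsub>?U\<^esub> ?K' = T.k (\<tau> i)" unfolding T_gens(2)[OF ti] by (simp add: kti_def T.tau_tau)
    have B: "T.B i = ?F \<oplus>\<^bsub>?U\<^esub> ?E \<otimes>\<^bsub>?U\<^esub> ?K'" unfolding T_gens(1)[OF i] by (simp add: Bti_def)
    have kS: "T.k j \<in> ?S" "inv\<^bsub>?U\<^esub> (T.k j) \<in> ?S" if "j \<in> V" for j
    proof -
      have "T.k j = T.evA (Poly_Mapping.single ([], frag_of j) 1)" "inv\<^bsub>?U\<^esub> (T.k j) = T.evA (Poly_Mapping.single ([], - frag_of j) 1)"
        using that by (simp_all add: T.evA_torus T.tor(4) T.inv_k)
      then show "T.k j \<in> ?S" "inv\<^bsub>?U\<^esub> (T.k j) \<in> ?S" by blast+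
    qed
    have BS: "T.B i \<in> ?S" using T.evA_B[of i] by (metis rangeI)
    have "\<Delta> (T.B i) = (?t \<one>\<^bsub>?U\<^esub> ?F \<oplus>\<^bsub>?T\<^esub> ?t ?F ?K') \<oplus>\<^bsub>?T\<^esub> (?t ?E \<one>\<^bsub>?U\<^esub> \<oplus>\<^bsub>?T\<^esub> ?t ?K ?E) \<otimes>\<^bsub>?T\<^esub> ?t ?K' ?K'"
      unfolding B using c gen[OF i] gen[OF ti] by (simp add: h)
    also have "\<dots> = (?t \<one>\<^bsub>?U\<^esub> ?F \<oplus>\<^bsub>?T\<^esub> ?t ?F ?K') \<oplus>\<^bsub>?T\<^esub> (?t (?E \<otimes>\<^bsub>?U\<^esub> ?K') ?K' \<oplus>\<^bsub>?T\<^esub> ?t (T.k (\<tau> i)) (?E \<otimes>\<^bsub>?U\<^esub> ?K'))"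
      using c by (simp add: X.Tn.l_distr X.t_mult k)
    also have "\<dots> = ?t \<one>\<^bsub>?U\<^esub> ?F \<oplus>\<^bsub>?T\<^esub> (?t (T.B i) ?K' \<oplus>\<^bsub>?T\<^esub> ?t (T.k (\<tau> i)) (?E \<otimes>\<^bsub>?U\<^esub> ?K'))"
      unfolding B using c by (simp add: X.t_add_left X.Tn.a_assoc)
    also have "\<dots> \<in> X.D ?S"
      using c BS kS(1)[OF ti] subringE(3)[OF S] by (intro subringE(7)[OF D(1)] pure) auto
    finally have 1: "T.B i \<in> Y" by (simp add: Y_def)
    have ki: "T.k i = ?u (tK i) \<otimes>\<^bsub>?U\<^esub> ?u (tK' (\<tau> i))" unfolding T_gens(2)[OF i] by (simp add: kti_def)
    have dk: "\<Delta> (T.k i) = ?t (T.k i) (T.k i)"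
      unfolding ki using i ti gen[OF i] gen[OF ti] by (simp add: h X.t_mult)
    have 2: "T.k i \<in> Y" using dk pure[OF kS(1)[OF i], of "T.k i"] by (simp add: Y_def)
    note u = T.k_unit[OF i]
    let ?I = "inv\<^bsub>?U\<^esub> (T.k i)"
    have Ic: "?I \<in> carrier ?U" using u by simp
    have "\<Delta> ?I = ?t ?I ?I"
    proof (rule X.Tn.inv_unique)
      show "\<Delta> ?I \<otimes>\<^bsub>?T\<^esub> \<Delta> (T.k i) = \<one>\<^bsub>?T\<^esub>" using u Ic by (simp add: h(2)[symmetric] h(4))
      show "\<Delta> (T.k i) \<otimes>\<^bsub>?T\<^esub> ?t ?I ?I = \<one>\<^bsub>?T\<^esub>" unfolding dk X.t_one using u Ic by (simp add: X.t_mult)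
    qed (use Ic h in auto)
    then have "?I \<in> Y" using pure[OF kS(2)[OF i] Ic] Ic by (simp add: Y_def)
    then show ?thesis using 1 2 by blast
  qed
  ultimately have "range T.evA \<subseteq> Y" by (rule T.range_evA_minimal)
  then show ?thesis
    unfolding right_coideal_subalgebra_def R_simps(6) Y_def using T.subalg_range_evA by auto
qed

end

theorem proposition6p2:
  fixes Q :: "('i, 'a) pre_digraph" and \<tau> :: "'i \<Rightarrow> 'i"
    and \<sigma> :: "'i \<Rightarrow> rat poly fract" and J :: "'i set"
  assumes "fin_digraph Q" and "acyclic (arcs_ends Q)"
    and "\<tau> permutes verts Q" and "\<forall>i\<in>verts Q. \<tau> (\<tau> i) = i"
    and "\<forall>i\<in>verts Q. \<forall>j\<in>verts Q. cartan Q (\<tau> i) (\<tau> j) = cartan Q i j"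
    and "\<forall>i\<in>verts Q. \<sigma> i \<noteq> 0"
    and "\<forall>i\<in>verts Q. cartan Q i (\<tau> i) = 0 \<longrightarrow> \<sigma> i = \<sigma> (\<tau> i)"
    and "orbit_representatives \<tau> (verts Q) J"
  shows "(\<exists>\<phi> \<in> alg_iso (Uiq Q \<tau> J \<sigma>) (quot_alg (Uit Q \<tau>) (specialisation_ideal Q \<tau> \<sigma>)).
            (\<forall>i\<in>verts Q. \<phi> (Bi Q \<tau> \<sigma> i) = specialisation_ideal Q \<tau> \<sigma> +>\<^bsub>Uit Q \<tau>\<^esub> Bti Q \<tau> i) \<and>
            (\<forall>j\<in>verts Q - J.
               \<phi> (ki Q \<tau> j) =
                 specialisation_ideal Q \<tau> \<sigma> +>\<^bsub>Uit Q \<tau>\<^esub> (inverse (\<sigma> (\<tau> j)) \<odot>\<^bsub>Uit Q \<tau>\<^esub> kti Q \<tau> j) \<and>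
               \<phi> (inv\<^bsub>Uq Q\<^esub> (ki Q \<tau> j)) =
                 specialisation_ideal Q \<tau> \<sigma> +>\<^bsub>Uit Q \<tau>\<^esub> (inverse (\<sigma> j) \<odot>\<^bsub>Uit Q \<tau>\<^esub> kti Q \<tau> (\<tau> j))))
       \<and> (\<exists>\<Delta>. is_comultiplication Q \<Delta> \<and> right_coideal_subalgebra (Ut Q) \<Delta> (carrier (Uit Q \<tau>)))"
proof -
  have "satake_data Q \<tau> \<sigma>"
    using assms by (intro satake_data.intro) auto
  then interpret satake_data Q \<tau> \<sigma> .
  obtain P g where T: "iquantum (Ut Q) Q (\<lambda>i. frag_of (Inl i)) (\<lambda>i. frag_of (Inr i)) P \<tau> (\<lambda>_. 1)
    (zext Q (Ut Q) (\<lambda>i. Ut_gen Q (tE i))) (zext Q (Ut Q) (\<lambda>i. Ut_gen Q (tF i))) (zext Q (Ut Q) (\<lambda>i. Ut_gen Q (tK i)))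
    (zext Q (Ut Q) (\<lambda>i. Ut_gen Q (tK' i))) (\<lambda>i. Ut_gen Q (tKinv i)) (\<lambda>i. Ut_gen Q (tK'inv i)) g"
    using iquantum_Ut by blast
  obtain P' g' where S: "iquantum (Uq Q) Q (\<lambda>i. frag_of i) (\<lambda>i. - frag_of i) P' \<tau> \<sigma>
    (zext Q (Uq Q) (\<lambda>i. Uq_gen Q (qE i))) (zext Q (Uq Q) (\<lambda>i. Uq_gen Q (qF i))) (zext Q (Uq Q) (\<lambda>i. Uq_gen Q (qK i)))
    (zext Q (Uq Q) (\<lambda>i. Uq_gen Q (qKinv i))) (\<lambda>i. Uq_gen Q (qKinv i)) (\<lambda>i. Uq_gen Q (qK i)) g'"
    using iquantum_Uq by blast
  interpret ipair Q \<tau> \<sigma> P g P' g'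
    using satake_data_axioms T S by (rule ipair.intro)
  show ?thesis
    using specialisation_iso[OF assms(8)] comultiplication_ex[OF gcm_cartan[OF assms(1,2)]] Uit_right_coideal by blast
qed

end
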